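(* Assume $\gamma_T>0$, and let $k\ge1$, $k-1\le l=m\le k$. Let $z_h^0=0$ and for $\kappa=0,1,2,\dots$ let $(u_h^{\kappa+1},p_h^{\kappa+1},z_h^{\kappa+1})\in V_g^k\times D^l_{\tilde\psi}\times W^m$ be defined by $$s[(u_h^{\kappa+1},p_h^{\kappa+1}),(v_h,q_h)]+b(q_h,v_h,z_h^{\kappa+1})=0,$$ $$b(p_h^{\kappa+1},u_h^{\kappa+1},w_h)-s^*(z_h^{\kappa+1},w_h)=(f,w_h)_\Omega-s^*(z_h^\kappa,w_h)$$ for all $(v_h,q_h,w_h)\in V_0^k\times D_0^l\times W^m$, where $s^*(y,w)=\frac12(y,w)_\Omega$. Then, as $\kappa\to\infty$, $(u_h^\kappa,p_h^\kappa,z_h^\kappa)\to(u_h,p_h,z_h)$, where $(u_h,p_h,z_h)\in V_g^k\times D^l_{\tilde\psi}\times W^m$ is the solution of the system with $s^*\equiv0$: $$s[(u_h,p_h),(v_h,q_h)]+b(q_h,v_h,z_h)=0,\qquad b(p_h,u_h,w_h)=(f,w_h)_\Omega$$ for all $(v_h,q_h,w_h)\in V_0^k\times D_0^l\times W^m$.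
   Context: $\Omega\subset\mathbb R^d$, $d\in\{2,3\}$, is a convex polygonal/polyhedral domain with outward unit normal $\nu$; $\Sigma\subset\partial\Omega$; $A\in\mathbb R^{d\times d}$ is constant symmetric positive definite; $\mu\in\mathbb R$; $f\in L^2(\Omega)$, $g\in H^{3/2}(\Sigma)$, $\tilde\psi\in L^2(\Sigma)$ are given ($g$ the restriction to $\Sigma$ of a function in $H^2(\Omega)$). $(\cdot,\cdot)_\Omega$ and $\|\cdot\|_\Omega$ are the $L^2(\Omega)$ inner product and norm. $\mathcal T$ is a conforming, quasi-uniform mesh of $\Omega$ of shape regular simplices $K$ with mesh size $h$ (largest element diameter), fitted to $\Sigma$ so that $\Sigma$ is a union of boundary faces. Spaces: $X_h^k$ is the space of $L^2(\Omega)$ functions that are polynomials of degree $\le k$ on each $K$; $L_h^k=H^1(\Omega)\cap X_h^k$; $V_g^k=\{v_h\in L_h^k:v_h=g_h\text{ on }\Sigma\}$ with $g_h$ the nodal interpolant of $g$; $V_0^k=\{v_h\in L_h^k:v_h=0\text{ on }\Sigma\}$; $RT^l$ is the $H(\mathrm{div};\Omega)$-conforming Raviart–Thomas space, locally $\mathbb P_l(K)^d\oplus x\tilde{\mathbb P}_l(K)$ with $\tilde{\mathbb P}_l$ the homogeneous polynomials of degree $l$; $D^l_{\tilde\psi}=\{q_h\in RT^l:q_h\cdot\nu=\tilde\psi_h\text{ on }\Sigma\}$ with $\tilde\psi_h|_F$ the $L^2(F)$-projection of $\tilde\psi$ onto $\mathbb P_l(F)$ for each face $F\subset\Sigma$;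 $D_0^l=\{q_h\in RT^l:q_h\cdot\nu=0\text{ on }\Sigma\}$; $W^m=X_h^m$. Forms: $b(q,v,y)=(\nabla\cdot q+\mu v,y)_\Omega$; $s$ is the symmetric bilinear form with $s[(v,q),(v,q)]=\frac12\|A\nabla v-q\|_\Omega^2+\frac12\gamma_Th^{2k}\|\nabla v\|_\Omega^2$. The mesh (hence $h$) is fixed and convergence is in the finite-dimensional space.
   Formalization: Σ is assumed nonempty and strictly contained in ∂Ω; without this the solution of the system with s*≡0 may fail to exist or be unique (for Σ=∂Ω, μ=0, ψ̃=0, f=1 there is none; for Σ empty, μ=0, u_h is determined only up to constants). *)

theory Defs
  imports "HOL-Analysis.Analysis"
begin

section \<open>Lebesgue and Sobolev spaces\<close>

text \<open>Elements of \<open>L\<^sup>2\<close> are represented by functions on the whole space of which only the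
  almost-everywhere class on \<open>\<Omega>\<close> matters; the same definitions serve scalar and vector fields.\<close>

definition L2 :: "(real^'d) set \<Rightarrow> (real^'d \<Rightarrow> 'b::euclidean_space) set" where
  "L2 \<Omega> = {f. f \<in> borel_measurable (lebesgue_on \<Omega>) \<and>
               integrable (lebesgue_on \<Omega>) (\<lambda>x. (norm (f x))\<^sup>2)}"

definition l2_inner ::
  "(real^'d) set \<Rightarrow> (real^'d \<Rightarrow> 'b::euclidean_space) \<Rightarrow> (real^'d \<Rightarrow> 'b) \<Rightarrow> real" where
  "l2_inner \<Omega> f g = (LINT x|lebesgue_on \<Omega>. f x \<bullet> g x)"

definition l2_norm :: "(real^'d) set \<Rightarrow> (real^'d \<Rightarrow> 'b::euclidean_space) \<Rightarrow> real" where
  "l2_norm \<Omega> f = sqrt (l2_inner \<Omega> f f)"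

definition ae_eq :: "(real^'d) set \<Rightarrow> (real^'d \<Rightarrow> 'b) \<Rightarrow> (real^'d \<Rightarrow> 'b) \<Rightarrow> bool" where
  "ae_eq S f g \<longleftrightarrow> (AE x in lebesgue_on S. f x = g x)"

definition partial :: "'d \<Rightarrow> (real^'d \<Rightarrow> real) \<Rightarrow> real^'d \<Rightarrow> real" where
  "partial i \<phi> = (\<lambda>x. frechet_derivative \<phi> (at x) (axis i 1))"

primrec Ck :: "nat \<Rightarrow> (real^'d::finite \<Rightarrow> real) \<Rightarrow> bool" where
  "Ck 0 \<phi> \<longleftrightarrow> continuous_on UNIV \<phi>"
| "Ck (Suc n) \<phi> \<longleftrightarrow> (\<forall>x. \<phi> differentiable (at x)) \<and> (\<forall>i. Ck n (partial i \<phi>))"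

definition test_functions :: "(real^'d) set \<Rightarrow> (real^'d::finite \<Rightarrow> real) set" where
  "test_functions \<Omega> = {\<phi>. (\<forall>n. Ck n \<phi>) \<and> (\<exists>C. compact C \<and> C \<subseteq> \<Omega> \<and> (\<forall>x. x \<notin> C \<longrightarrow> \<phi> x = 0))}"

definition weak_partial ::
  "(real^'d::finite) set \<Rightarrow> 'd \<Rightarrow> (real^'d \<Rightarrow> real) \<Rightarrow> (real^'d \<Rightarrow> real) \<Rightarrow> bool" where
  "weak_partial \<Omega> i v w \<longleftrightarrow>
     (\<forall>\<phi>\<in>test_functions \<Omega>. l2_inner \<Omega> v (partial i \<phi>) = - l2_inner \<Omega> w \<phi>)"

definition H1 :: "(real^'d::finite) set \<Rightarrow> (real^'d \<Rightarrow> real) set" where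
  "H1 \<Omega> = {v \<in> L2 \<Omega>. \<forall>i. \<exists>w\<in>L2 \<Omega>. weak_partial \<Omega> i v w}"

definition H2 :: "(real^'d::finite) set \<Rightarrow> (real^'d \<Rightarrow> real) set" where
  "H2 \<Omega> = {v \<in> L2 \<Omega>. \<forall>i. \<exists>w\<in>H1 \<Omega>. weak_partial \<Omega> i v w}"

text \<open>Weak derivatives are unique only almost everywhere; a representative is chosen.\<close>

definition weak_grad :: "(real^'d::finite) set \<Rightarrow> (real^'d \<Rightarrow> real) \<Rightarrow> real^'d \<Rightarrow> real^'d" where
  "weak_grad \<Omega> v = (\<lambda>x. \<chi> i. (SOME w. w \<in> L2 \<Omega> \<and> weak_partial \<Omega> i v w) x)"

definition is_weak_div ::
  "(real^'d::finite) set \<Rightarrow> (real^'d \<Rightarrow> real^'d) \<Rightarrow> (real^'d \<Rightarrow> real) \<Rightarrow> bool" where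
  "is_weak_div \<Omega> q w \<longleftrightarrow>
     (\<forall>\<phi>\<in>test_functions \<Omega>. l2_inner \<Omega> q (\<lambda>x. \<chi> i. partial i \<phi> x) = - l2_inner \<Omega> w \<phi>)"

definition Hdiv :: "(real^'d::finite) set \<Rightarrow> (real^'d \<Rightarrow> real^'d) set" where
  "Hdiv \<Omega> = {q \<in> L2 \<Omega>. \<exists>w\<in>L2 \<Omega>. is_weak_div \<Omega> q w}"

definition weak_div :: "(real^'d::finite) set \<Rightarrow> (real^'d \<Rightarrow> real^'d) \<Rightarrow> real^'d \<Rightarrow> real" where
  "weak_div \<Omega> q = (SOME w. w \<in> L2 \<Omega> \<and> is_weak_div \<Omega> q w)"


section \<open>Domain and mesh\<close>

definition convex_polytopal_domain :: "(real^'d::finite) set \<Rightarrow> bool" where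
  "convex_polytopal_domain \<Omega> \<longleftrightarrow> \<Omega> \<noteq> {} \<and> open \<Omega> \<and> convex \<Omega> \<and> polytope (closure \<Omega>)"

text \<open>\<^const>\<open>triangulation\<close> says that the collection is finite and that any two elements meet in a
  common (possibly empty) face, i.e. that the mesh is conforming.\<close>

definition conforming_mesh :: "(real^'d::finite) set \<Rightarrow> (real^'d) set set \<Rightarrow> bool" where
  "conforming_mesh \<Omega> T \<longleftrightarrow>
     triangulation T \<and> (\<forall>K\<in>T. int CARD('d) simplex K) \<and> \<Union>T = closure \<Omega>"

definition mesh_size :: "(real^'d) set set \<Rightarrow> real" where
  "mesh_size T = Max (diameter ` T)"

definition inradius :: "(real^'d) set \<Rightarrow> real" where
  "inradius K = Sup {r. \<exists>x. cball x r \<subseteq> K}"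

definition shape_regular :: "real \<Rightarrow> (real^'d) set set \<Rightarrow> bool" where
  "shape_regular c T \<longleftrightarrow> (\<forall>K\<in>T. diameter K \<le> c * inradius K)"

definition quasi_uniform :: "real \<Rightarrow> (real^'d) set set \<Rightarrow> bool" where
  "quasi_uniform c T \<longleftrightarrow> (\<forall>K\<in>T. mesh_size T \<le> c * diameter K)"

definition boundary_faces :: "(real^'d::finite) set \<Rightarrow> (real^'d) set set \<Rightarrow> (real^'d) set set" where
  "boundary_faces \<Omega> T = {F. F \<subseteq> frontier \<Omega> \<and> (\<exists>K\<in>T. F facet_of K)}"

text \<open>The inclusion of \<open>\<Sigma>\<close> in the boundary is strict and \<open>\<Sigma>\<close> is nonempty, as in a Cauchy problem
  with data on part of the boundary.  Otherwise the limit system need not be uniquely solvable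
  (e.g. for \<open>\<mu> = 0\<close>: \<open>u\<close> is determined only up to constants if \<open>\<Sigma>\<close> is empty, \<open>z\<close> if \<open>\<Sigma>\<close> is the
  whole boundary).\<close>

definition fitted_boundary_part ::
  "(real^'d::finite) set \<Rightarrow> (real^'d) set set \<Rightarrow> (real^'d) set \<Rightarrow> bool" where
  "fitted_boundary_part \<Omega> T \<Sigma> \<longleftrightarrow>
     (\<exists>\<F>\<subseteq>boundary_faces \<Omega> T. \<Sigma> = \<Union>\<F>) \<and> \<Sigma> \<noteq> {} \<and> \<Sigma> \<subset> frontier \<Omega>"

definition unit_normal :: "(real^'d::finite) set \<Rightarrow> (real^'d) set \<Rightarrow> real^'d" where
  "unit_normal \<Omega> F = (THE n. norm n = 1 \<and> (\<forall>x\<in>F. \<forall>y\<in>\<Omega>. n \<bullet> (y - x) \<le> 0))"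


section \<open>Integration over faces\<close>

text \<open>Surface measure on a face \<open>F\<close> is the image of Lebesgue measure on the right prism of height \<open>1\<close>
  over \<open>F\<close> under orthogonal projection onto the hyperplane spanned by \<open>F\<close>; hence a function on \<open>F\<close> is
  square integrable iff its pullback to the prism is, and face integrals are prism integrals.\<close>

definition face_proj :: "(real^'d::finite) set \<Rightarrow> real^'d \<Rightarrow> real^'d" where
  "face_proj F = closest_point (affine hull F)"

definition face_prism :: "(real^'d::finite) set \<Rightarrow> (real^'d) set" where
  "face_prism F = {x. face_proj F x \<in> F \<and> dist x (face_proj F x) \<le> 1/2}"

definition L2_face :: "(real^'d::finite) set \<Rightarrow> (real^'d \<Rightarrow> real) set" where
  "L2_face F = {\<psi>. \<psi> \<circ> face_proj F \<in> L2 (face_prism F)}"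

definition face_inner :: "(real^'d::finite) set \<Rightarrow> (real^'d \<Rightarrow> real) \<Rightarrow> (real^'d \<Rightarrow> real) \<Rightarrow> real" where
  "face_inner F \<psi> r = l2_inner (face_prism F) (\<psi> \<circ> face_proj F) (r \<circ> face_proj F)"

definition L2_boundary_part ::
  "(real^'d::finite) set \<Rightarrow> (real^'d) set set \<Rightarrow> (real^'d) set \<Rightarrow> (real^'d \<Rightarrow> real) set" where
  "L2_boundary_part \<Omega> T \<Sigma> = {\<psi>. \<forall>F\<in>boundary_faces \<Omega> T. F \<subseteq> \<Sigma> \<longrightarrow> \<psi> \<in> L2_face F}"

text \<open>Traces on \<open>\<Sigma>\<close> of \<open>H\<^sup>2\<close> functions.  In dimensions two and three an \<open>H\<^sup>2\<close> function has a
  representative that is continuous up to the boundary, and its trace is the restriction of that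
  representative; this gives \<open>g\<close> the point values that nodal interpolation uses.\<close>

definition H32 :: "(real^'d::finite) set \<Rightarrow> (real^'d) set \<Rightarrow> (real^'d \<Rightarrow> real) set" where
  "H32 \<Omega> \<Sigma> = {g. \<exists>G\<in>H2 \<Omega>. continuous_on (closure \<Omega>) G \<and> (\<forall>x\<in>\<Sigma>. g x = G x)}"


section \<open>Finite element spaces\<close>

definition monomial :: "('d::finite \<Rightarrow> nat) \<Rightarrow> real^'d \<Rightarrow> real" where
  "monomial \<alpha> x = (\<Prod>i\<in>UNIV. (x $ i) ^ \<alpha> i)"

definition polys :: "nat \<Rightarrow> (real^'d::finite \<Rightarrow> real) set" where
  "polys k = {p. \<exists>c. \<forall>x. p x = (\<Sum>\<alpha> | (\<Sum>i\<in>UNIV. \<alpha> i) \<le> k. c \<alpha> * monomial \<alpha> x)}"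

definition hom_polys :: "nat \<Rightarrow> (real^'d::finite \<Rightarrow> real) set" where
  "hom_polys k = {p. \<exists>c. \<forall>x. p x = (\<Sum>\<alpha> | (\<Sum>i\<in>UNIV. \<alpha> i) = k. c \<alpha> * monomial \<alpha> x)}"

definition RT_polys :: "nat \<Rightarrow> (real^'d::finite \<Rightarrow> real^'d) set" where
  "RT_polys l = {q. \<exists>a b. (\<forall>i. (\<lambda>x. a x $ i) \<in> polys l) \<and> b \<in> hom_polys l \<and>
                          (\<forall>x. q x = a x + b x *\<^sub>R x)}"

definition Xh :: "(real^'d::finite) set \<Rightarrow> (real^'d) set set \<Rightarrow> nat \<Rightarrow> (real^'d \<Rightarrow> real) set" where
  "Xh \<Omega> T k = {v \<in> L2 \<Omega>. \<forall>K\<in>T. \<exists>P\<in>polys k. ae_eq K v P}"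

definition Lh :: "(real^'d::finite) set \<Rightarrow> (real^'d) set set \<Rightarrow> nat \<Rightarrow> (real^'d \<Rightarrow> real) set" where
  "Lh \<Omega> T k = H1 \<Omega> \<inter> Xh \<Omega> T k"

definition RTh :: "(real^'d::finite) set \<Rightarrow> (real^'d) set set \<Rightarrow> nat \<Rightarrow> (real^'d \<Rightarrow> real^'d) set" where
  "RTh \<Omega> T l = {q \<in> Hdiv \<Omega>. \<forall>K\<in>T. \<exists>Q\<in>RT_polys l. ae_eq K q Q}"

definition lagrange_nodes :: "nat \<Rightarrow> (real^'d::finite) set \<Rightarrow> (real^'d) set" where
  "lagrange_nodes k F =
     (let V = {v. v extreme_point_of F} in
      {\<Sum>v\<in>V. (real (\<alpha> v) / real k) *\<^sub>R v | \<alpha>. (\<Sum>v\<in>V. \<alpha> v) = k})"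

text \<open>Polynomials representing \<open>g\<^sub>h\<close> and \<open>\<psi>\<^sub>h\<close> on a face \<open>F\<close>.  As functions on \<open>F\<close> they are unique;
  only the irrelevant extension off \<open>F\<close> is a matter of choice.\<close>

definition nodal_interpolant :: "nat \<Rightarrow> (real^'d::finite \<Rightarrow> real) \<Rightarrow> (real^'d) set \<Rightarrow> real^'d \<Rightarrow> real" where
  "nodal_interpolant k g F = (SOME r. r \<in> polys k \<and> (\<forall>x\<in>lagrange_nodes k F. r x = g x))"

definition L2_projection :: "nat \<Rightarrow> (real^'d::finite \<Rightarrow> real) \<Rightarrow> (real^'d) set \<Rightarrow> real^'d \<Rightarrow> real" where
  "L2_projection l \<psi> F = (SOME r. r \<in> polys l \<and> (\<forall>p\<in>polys l. face_inner F r p = face_inner F \<psi> p))"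

text \<open>Boundary data are given face by face.  The trace of a discrete function on a face of an element
  is the restriction to the face of the polynomial with which the function agrees on the element.\<close>

definition Vh :: "(real^'d::finite) set \<Rightarrow> (real^'d) set set \<Rightarrow> nat \<Rightarrow> (real^'d) set \<Rightarrow>
    ((real^'d) set \<Rightarrow> real^'d \<Rightarrow> real) \<Rightarrow> (real^'d \<Rightarrow> real) set" where
  "Vh \<Omega> T k \<Sigma> gh = {v \<in> Lh \<Omega> T k. \<forall>K\<in>T. \<forall>F. F facet_of K \<and> F \<subseteq> \<Sigma> \<longrightarrow>
     (\<exists>P\<in>polys k. ae_eq K v P \<and> (\<forall>x\<in>F. P x = gh F x))}"

definition Dh :: "(real^'d::finite) set \<Rightarrow> (real^'d) set set \<Rightarrow> nat \<Rightarrow> (real^'d) set \<Rightarrow>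
    ((real^'d) set \<Rightarrow> real^'d \<Rightarrow> real) \<Rightarrow> (real^'d \<Rightarrow> real^'d) set" where
  "Dh \<Omega> T l \<Sigma> \<psi>h = {q \<in> RTh \<Omega> T l. \<forall>K\<in>T. \<forall>F. F facet_of K \<and> F \<subseteq> \<Sigma> \<longrightarrow>
     (\<exists>Q\<in>RT_polys l. ae_eq K q Q \<and> (\<forall>x\<in>F. Q x \<bullet> unit_normal \<Omega> F = \<psi>h F x))}"

abbreviation Vg :: "(real^'d::finite) set \<Rightarrow> (real^'d) set set \<Rightarrow> nat \<Rightarrow> (real^'d) set \<Rightarrow>
    (real^'d \<Rightarrow> real) \<Rightarrow> (real^'d \<Rightarrow> real) set" where
  "Vg \<Omega> T k \<Sigma> g \<equiv> Vh \<Omega> T k \<Sigma> (nodal_interpolant k g)"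

abbreviation V0 :: "(real^'d::finite) set \<Rightarrow> (real^'d) set set \<Rightarrow> nat \<Rightarrow> (real^'d) set \<Rightarrow>
    (real^'d \<Rightarrow> real) set" where
  "V0 \<Omega> T k \<Sigma> \<equiv> Vh \<Omega> T k \<Sigma> (\<lambda>F x. 0)"

abbreviation Dpsi :: "(real^'d::finite) set \<Rightarrow> (real^'d) set set \<Rightarrow> nat \<Rightarrow> (real^'d) set \<Rightarrow>
    (real^'d \<Rightarrow> real) \<Rightarrow> (real^'d \<Rightarrow> real^'d) set" where
  "Dpsi \<Omega> T l \<Sigma> \<psi> \<equiv> Dh \<Omega> T l \<Sigma> (L2_projection l \<psi>)"

abbreviation D0 :: "(real^'d::finite) set \<Rightarrow> (real^'d) set set \<Rightarrow> nat \<Rightarrow> (real^'d) set \<Rightarrow>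
    (real^'d \<Rightarrow> real^'d) set" where
  "D0 \<Omega> T l \<Sigma> \<equiv> Dh \<Omega> T l \<Sigma> (\<lambda>F x. 0)"

abbreviation Wh :: "(real^'d::finite) set \<Rightarrow> (real^'d) set set \<Rightarrow> nat \<Rightarrow> (real^'d \<Rightarrow> real) set" where
  "Wh \<Omega> T m \<equiv> Xh \<Omega> T m"


section \<open>Forms and discrete systems\<close>

definition b_form :: "(real^'d::finite) set \<Rightarrow> real \<Rightarrow>
    (real^'d \<Rightarrow> real^'d) \<Rightarrow> (real^'d \<Rightarrow> real) \<Rightarrow> (real^'d \<Rightarrow> real) \<Rightarrow> real" where
  "b_form \<Omega> \<mu> q v y = l2_inner \<Omega> (\<lambda>x. weak_div \<Omega> q x + \<mu> * v x) y"

text \<open>The polarization of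
  \<open>1/2 \<parallel>A \<nabla>v - q\<parallel>\<^sup>2 + 1/2 \<gamma> h\<^sup>2\<^sup>k \<parallel>\<nabla>v\<parallel>\<^sup>2\<close>, i.e. \<open>s_form \<dots> (v, q) (v, q)\<close> is this expression.\<close>

definition s_form :: "(real^'d::finite) set \<Rightarrow> real^'d^'d \<Rightarrow> real \<Rightarrow> real \<Rightarrow> nat \<Rightarrow>
    (real^'d \<Rightarrow> real) \<times> (real^'d \<Rightarrow> real^'d) \<Rightarrow> (real^'d \<Rightarrow> real) \<times> (real^'d \<Rightarrow> real^'d) \<Rightarrow> real" where
  "s_form \<Omega> A \<gamma> h k = (\<lambda>(u, p) (v, q).
     1/2 * l2_inner \<Omega> (\<lambda>x. A *v weak_grad \<Omega> u x - p x) (\<lambda>x. A *v weak_grad \<Omega> v x - q x)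
     + 1/2 * \<gamma> * h ^ (2 * k) * l2_inner \<Omega> (weak_grad \<Omega> u) (weak_grad \<Omega> v))"

definition sstar_form :: "(real^'d::finite) set \<Rightarrow> (real^'d \<Rightarrow> real) \<Rightarrow> (real^'d \<Rightarrow> real) \<Rightarrow> real" where
  "sstar_form \<Omega> y w = 1/2 * l2_inner \<Omega> y w"

text \<open>One step of the iteration, from the old multiplier \<open>z'\<close> to the new triple \<open>(u, p, z)\<close>.\<close>

definition iteration_step where
  "iteration_step \<Omega> T \<Sigma> A \<mu> \<gamma> k l m f g \<psi> z' u p z \<longleftrightarrow>
     u \<in> Vg \<Omega> T k \<Sigma> g \<and> p \<in> Dpsi \<Omega> T l \<Sigma> \<psi> \<and> z \<in> Wh \<Omega> T m \<and>
     (\<forall>v\<in>V0 \<Omega> T k \<Sigma>. \<forall>q\<in>D0 \<Omega> T l \<Sigma>. \<forall>w\<in>Wh \<Omega> T m.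
        s_form \<Omega> A \<gamma> (mesh_size T) k (u, p) (v, q) + b_form \<Omega> \<mu> q v z = 0 \<and>
        b_form \<Omega> \<mu> p u w - sstar_form \<Omega> z w = l2_inner \<Omega> f w - sstar_form \<Omega> z' w)"

definition limit_system where
  "limit_system \<Omega> T \<Sigma> A \<mu> \<gamma> k l m f g \<psi> u p z \<longleftrightarrow>
     u \<in> Vg \<Omega> T k \<Sigma> g \<and> p \<in> Dpsi \<Omega> T l \<Sigma> \<psi> \<and> z \<in> Wh \<Omega> T m \<and>
     (\<forall>v\<in>V0 \<Omega> T k \<Sigma>. \<forall>q\<in>D0 \<Omega> T l \<Sigma>. \<forall>w\<in>Wh \<Omega> T m.
        s_form \<Omega> A \<gamma> (mesh_size T) k (u, p) (v, q) + b_form \<Omega> \<mu> q v z = 0 \<and>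
        b_form \<Omega> \<mu> p u w = l2_inner \<Omega> f w)"

end

theory Submission
  imports Defs "HOL-Library.Function_Algebras"
begin

text \<open>Subtracting consecutive iterates and testing the first equation with the difference gives, for
  \<open>e\<^sub>\<kappa> = z\<^sub>\<kappa>\<^sub>+\<^sub>1 - z\<^sub>\<kappa>\<close>, the energy estimate \<open>s[d\<^sub>\<kappa>, d\<^sub>\<kappa>] + 1/4 \<parallel>e\<^sub>\<kappa>\<^sub>+\<^sub>1\<parallel>\<^sup>2 \<le> 1/4 \<parallel>e\<^sub>\<kappa>\<parallel>\<^sup>2\<close>, where \<open>d\<^sub>\<kappa>\<close> is the
  increment of \<open>(u, p)\<close>.  If \<open>s\<close> is definite on \<open>V\<^sub>0 \<times> D\<^sub>0\<close> and only \<open>z = 0\<close> is \<open>b\<close>-orthogonal to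
  \<open>V\<^sub>0 \<times> D\<^sub>0\<close>, then finite-dimensionality bounds \<open>e\<^sub>\<kappa>\<^sub>+\<^sub>1\<close> and \<open>d\<^sub>\<kappa>\<close> by \<open>s[d\<^sub>\<kappa>, d\<^sub>\<kappa>]\<close>, so the increments
  decay geometrically and the iterates converge to the unique solution of the limit system.

  Definiteness: \<open>s[(v, q), (v, q)] = 0\<close> makes the weak gradient of \<open>v\<close> vanish, so \<open>v\<close> is constant on the
  convex domain, and it is zero on \<open>\<Sigma>\<close>; then \<open>q = A \<nabla>v = 0\<close>.

  Orthogonality: on one element, normal-free Raviart-Thomas bubbles built from the gradient of \<open>z\<close> force
  \<open>z\<close> to be piecewise constant; lowest-order fields \<open>\<plusminus> (x - v)\<close>, scaled to have matching flux across a common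
  facet of two elements, force equal constants; and the field \<open>x - v\<close> on an element with a boundary
  facet outside \<open>\<Sigma>\<close> forces the constant to be zero.\<close>

text \<open>Elements are functions, not almost-everywhere classes, so each space contains all null
  functions and is finite-dimensional only modulo these. Norms are therefore seminorms, taken
  relative to sets of square-integrable functions, since the integral of a non-integrable square is
  0 and the triangle inequality fails beyond them.

  The bounds cannot hold on all triples, as the energy does not see the multiplier. They hold on the
  subspace \<open>Z\<close> of pairs that solve the homogeneous first equation, which contains every
  pair of increments. There zero energy annihilates \<open>s x\<close> by Cauchy-Schwarz and leaves
  only the \<open>b\<close>-term.

  Surface integrals are avoided. Every divergence identity rests on one fact: the derivative of a
  function along an edge of a simplex has integral zero over the simplex if the function vanishes on
  the two facets opposite to the ends of the edge. The test fields are combinations of edge vectors,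
  and their normal components enter only pointwise, in the boundary condition.\<close>

instantiation "fun" :: (type, real_vector) real_vector
begin

definition scaleR_fun :: "real \<Rightarrow> ('a \<Rightarrow> 'b) \<Rightarrow> 'a \<Rightarrow> 'b" where
  "scaleR_fun c f = (\<lambda>x. c *\<^sub>R f x)"

instance
  by intro_classes (simp_all add: scaleR_fun_def fun_eq_iff scaleR_add_right scaleR_add_left)

end

lemma scaleR_fun_apply [simp]: "(c *\<^sub>R f) x = c *\<^sub>R f x"
  by (simp add: scaleR_fun_def)

section \<open>Seminorms and completeness modulo null vectors\<close>

definition seminorm_on :: "'a::real_vector set \<Rightarrow> ('a \<Rightarrow> real) \<Rightarrow> bool" where
  "seminorm_on E g \<longleftrightarrow> (\<forall>x\<in>E. \<forall>y\<in>E. g (x + y) \<le> g x + g y) \<and> (\<forall>x\<in>E. \<forall>c. g (c *\<^sub>R x) = \<bar>c\<bar> * g x)"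

lemma seminorm_on_add: "seminorm_on E g \<Longrightarrow> x \<in> E \<Longrightarrow> y \<in> E \<Longrightarrow> g (x + y) \<le> g x + g y"
  by (simp add: seminorm_on_def)

lemma seminorm_on_scale: "seminorm_on E g \<Longrightarrow> x \<in> E \<Longrightarrow> g (c *\<^sub>R x) = \<bar>c\<bar> * g x"
  by (simp add: seminorm_on_def)

lemma seminorm_on_subset: "seminorm_on E g \<Longrightarrow> E' \<subseteq> E \<Longrightarrow> seminorm_on E' g"
  unfolding seminorm_on_def by blast

lemma seminorm_on_zero:
  assumes "seminorm_on E g" "subspace E" shows "g 0 = 0"
  using seminorm_on_scale[OF assms(1) subspace_0[OF assms(2)], of 0] by simp

lemma seminorm_on_minus:
  assumes "seminorm_on E g" "x \<in> E" shows "g (- x) = g x"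
  using seminorm_on_scale[OF assms, of "-1"] by simp

lemma seminorm_on_nonneg:
  assumes "seminorm_on E g" "subspace E" "x \<in> E" shows "0 \<le> g x"
proof -
  have "- x \<in> E" using assms by (simp add: subspace_neg)
  then have "g (x + - x) \<le> g x + g (- x)" using assms by (intro seminorm_on_add)
  then show ?thesis
    using seminorm_on_zero[OF assms(1,2)] seminorm_on_minus[OF assms(1,3)] by simp
qed

lemma seminorm_on_diff:
  assumes "seminorm_on E g" "subspace E" "x \<in> E" "y \<in> E" shows "g (x - y) \<le> g x + g y"
  using seminorm_on_add[OF assms(1,3), of "- y"] seminorm_on_minus[OF assms(1,4)] assms
  by (simp add: subspace_neg)

definition seminorm_Cauchy :: "('a::real_vector \<Rightarrow> real) \<Rightarrow> (nat \<Rightarrow> 'a) \<Rightarrow> bool" where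
  "seminorm_Cauchy g x \<longleftrightarrow> (\<forall>e>0. \<exists>M. \<forall>m\<ge>M. \<forall>n\<ge>M. g (x m - x n) < e)"

text \<open>A limit is determined only up to \<open>g\<close>-null vectors. Completeness is carried
  through the induction on the dimension together with the comparison of seminorms, because the
  minimizing sequence of the next step needs it.\<close>

definition seminorm_complete :: "'a::real_vector set \<Rightarrow> ('a \<Rightarrow> real) \<Rightarrow> bool" where
  "seminorm_complete E g \<longleftrightarrow>
     (\<forall>x. (\<forall>n. x n \<in> E) \<and> seminorm_Cauchy g x \<longrightarrow> (\<exists>y\<in>E. (\<lambda>n. g (x n - y)) \<longlonglongrightarrow> 0))"

lemma LIMSEQ_squeeze0:
  fixes f g :: "nat \<Rightarrow> real"
  assumes "g \<longlonglongrightarrow> 0" "\<And>n. 0 \<le> f n" "\<And>n. f n \<le> g n"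
  shows "f \<longlonglongrightarrow> 0"
  using real_tendsto_sandwich[of "\<lambda>_. 0" f sequentially g 0] assms by simp

text \<open>If \<open>b\<close> is at \<open>g\<close>-distance \<open>0\<close> from \<open>E\<^sub>0\<close>, a minimizing sequence in \<open>E\<^sub>0\<close> is Cauchy, and by
  completeness its limit corrects \<open>b\<close> to a \<open>g\<close>-null vector.\<close>

lemma seminorm_extension_cases:
  fixes E E0 :: "'a::real_vector set"
  assumes E: "subspace E" and E0: "subspace E0" "E0 \<subseteq> E" and b: "b \<in> E"
    and dec: "\<And>x. x \<in> E \<Longrightarrow> \<exists>c. x - c *\<^sub>R b \<in> E0"
    and g: "seminorm_on E g" and compl: "seminorm_complete E0 g"
  obtains b' where "b' \<in> E" "g b' = 0" "\<And>x. x \<in> E \<Longrightarrow> \<exists>c. x - c *\<^sub>R b' \<in> E0"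
  | d where "d > 0" "\<And>s c. s \<in> E0 \<Longrightarrow> d * \<bar>c\<bar> \<le> g (s + c *\<^sub>R b)"
\<comment> \<open>The two outcomes are a positive and a zero \<open>g\<close>-distance of
  \<open>b\<close> from the subspace \<open>E0\<close>.\<close>
proof (cases "\<exists>d>0. \<forall>s\<in>E0. d \<le> g (b + s)")
  case True
  then obtain d where d: "d > 0" "\<And>s. s \<in> E0 \<Longrightarrow> d \<le> g (b + s)" by blast
  have "d * \<bar>c\<bar> \<le> g (s + c *\<^sub>R b)" if s: "s \<in> E0" for s c
  proof (cases "c = 0")
    case True
    then show ?thesis using seminorm_on_nonneg[OF g E] s E0 by auto
  next
    case False
    have "(1/c) *\<^sub>R s \<in> E0" using s E0 by (simp add: subspace_scale)
    then have "d \<le> g (b + (1/c) *\<^sub>R s)" by (rule d)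
    moreover have "b + (1/c) *\<^sub>R s \<in> E"
      using E E0 b \<open>(1/c) *\<^sub>R s \<in> E0\<close> by (meson subsetD subspace_add)
    then have "g (c *\<^sub>R (b + (1/c) *\<^sub>R s)) = \<bar>c\<bar> * g (b + (1/c) *\<^sub>R s)"
      by (intro seminorm_on_scale[OF g])
    moreover have "c *\<^sub>R (b + (1/c) *\<^sub>R s) = s + c *\<^sub>R b"
      using False by (simp add: scaleR_add_right add.commute)
    ultimately show ?thesis
      by (metis abs_ge_zero mult.commute mult_left_mono)
  qed
  then show ?thesis using d that by blast
next
  case False
  then have "\<exists>s\<in>E0. g (b + s) < 1 / real (Suc n)" for n
    by (meson not_le of_nat_0_less_iff zero_less_Suc zero_less_divide_1_iff)
  then obtain s where s: "\<And>n. s n \<in> E0" "\<And>n. g (b + s n) < 1 / real (Suc n)" by metis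
  have bs: "b + s n \<in> E" for n using E E0 b s(1) by (meson subsetD subspace_add)
  have "seminorm_Cauchy g s"
    unfolding seminorm_Cauchy_def
  proof (intro allI impI)
    fix e :: real assume "e > 0"
    then obtain M where M: "1 / real (Suc M) < e / 2"
      using nat_approx_posE[of "e/2"] by (metis half_gt_zero)
    have "g (s m - s n) < e" if "m \<ge> M" "n \<ge> M" for m n
    proof -
      have "g (s m - s n) = g ((b + s m) - (b + s n))" by simp
      also have "\<dots> \<le> g (b + s m) + g (b + s n)" by (intro seminorm_on_diff[OF g E] bs)
      also have "\<dots> < 1 / real (Suc m) + 1 / real (Suc n)" by (intro add_strict_mono s)
      also have "\<dots> \<le> 1 / real (Suc M) + 1 / real (Suc M)"
        using that by (intro add_mono) (simp_all add: frac_le)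
      finally show ?thesis using M by simp
    qed
    then show "\<exists>M. \<forall>m\<ge>M. \<forall>n\<ge>M. g (s m - s n) < e" by blast
  qed
  then obtain y where y: "y \<in> E0" "(\<lambda>n. g (s n - y)) \<longlonglongrightarrow> 0"
    using compl s(1) unfolding seminorm_complete_def by blast
  have by_E: "b + y \<in> E" using E E0 b y by (meson subsetD subspace_add)
  have "g (b + y) \<le> g (b + s n) + g (s n - y)" for n
  proof -
    have "s n - y \<in> E" using E0 s(1) y(1) by (meson subsetD subspace_diff)
    then show ?thesis using seminorm_on_diff[OF g E bs[of n], of "s n - y"] by simp
  qed
  moreover have "(\<lambda>n. 1 / real (Suc n) + g (s n - y)) \<longlonglongrightarrow> 0 + 0"
    by (intro tendsto_add y LIMSEQ_Suc lim_1_over_n)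
  ultimately have "g (b + y) \<le> 0"
    by (intro LIMSEQ_le_const[where X = "\<lambda>n. 1 / real (Suc n) + g (s n - y)"])
      (auto intro!: exI[of _ 0] order.trans[OF _ add_right_mono[OF less_imp_le[OF s(2)]]] simp del: of_nat_Suc)
  then have "g (b + y) = 0" using seminorm_on_nonneg[OF g E by_E] by simp
  moreover have "\<exists>c. x - c *\<^sub>R (b + y) \<in> E0" if x: "x \<in> E" for x
  proof -
    obtain c where "x - c *\<^sub>R b \<in> E0" using dec[OF x] by blast
    then have "(x - c *\<^sub>R b) - c *\<^sub>R y \<in> E0" using E0 y by (simp add: subspace_diff subspace_scale)
    then show ?thesis by (metis diff_diff_eq scaleR_add_right)
  qed
  ultimately show ?thesis using that(1) by_E by blast
qed

text \<open>A subspace \<open>E\<close> of \<open>span B + N\<close> with \<open>B\<close> finite is finite-dimensional up to the elements of \<open>N\<close>, on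
  which the seminorms vanish.\<close>

theorem finite_dim_seminorms:
  fixes B E N :: "'a::real_vector set"
  assumes "finite B" "subspace N" "subspace E" "\<And>x. x \<in> E \<Longrightarrow> \<exists>y\<in>span B. x - y \<in> N"
    and "seminorm_on E g" and "\<And>x. x \<in> E \<Longrightarrow> x \<in> N \<Longrightarrow> g x = 0"
  shows "seminorm_complete E g \<and>
    (\<forall>f. seminorm_on E f \<longrightarrow> (\<forall>x\<in>E. g x = 0 \<longrightarrow> f x = 0) \<longrightarrow> (\<exists>C\<ge>0. \<forall>x\<in>E. f x \<le> C * g x))"
  using assms
proof (induction B arbitrary: E rule: finite_induct)
  case empty
  then have "E \<subseteq> N" by fastforce
  then have g0: "g x = 0" if "x \<in> E" for x using empty that by blast
  have "\<exists>y\<in>E. (\<lambda>n. g (x n - y)) \<longlonglongrightarrow> 0" if "\<forall>n. x n \<in> E" for x :: "nat \<Rightarrow> 'a"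
    using that g0 subspace_0[OF empty(2)] by (intro bexI[of _ 0]) auto
  then show ?case using g0 by (auto simp: seminorm_complete_def intro!: exI[of _ 0])
next
  case (insert b B)
  note N = \<open>subspace N\<close> and E = \<open>subspace E\<close> and g = \<open>seminorm_on E g\<close>
  \<comment> \<open>The part of \<open>E\<close> already spanned by \<open>B\<close> modulo
    \<open>N\<close>; one further vector at most is missing, and the induction hypothesis applies to
    it.\<close>
  define E0 where "E0 = {x\<in>E. \<exists>y\<in>span B. x - y \<in> N}"
  have E0_E: "E0 \<subseteq> E" by (auto simp: E0_def)
  have E0: "subspace E0"
  proof (rule subspaceI)
    show "0 \<in> E0" using N E subspace_0 span_zero by (force simp: E0_def)
  next
    fix x x' assume "x \<in> E0" "x' \<in> E0"
    then obtain y y' where *: "x \<in> E" "x' \<in> E" "y \<in> span B" "y' \<in> span B" "x - y \<in> N" "x' - y' \<in> N"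
      by (auto simp: E0_def)
    then have "(x - y) + (x' - y') \<in> N" using N by (intro subspace_add)
    then have "x + x' - (y + y') \<in> N" by (simp add: algebra_simps)
    moreover have "y + y' \<in> span B" "x + x' \<in> E" using * E by (auto intro: span_add subspace_add)
    ultimately show "x + x' \<in> E0" by (auto simp: E0_def)
  next
    fix c x assume "x \<in> E0"
    then obtain y where *: "x \<in> E" "y \<in> span B" "x - y \<in> N" by (auto simp: E0_def)
    then have "c *\<^sub>R (x - y) \<in> N" using N by (intro subspace_scale)
    then have "c *\<^sub>R x - c *\<^sub>R y \<in> N" by (simp add: algebra_simps)
    moreover have "c *\<^sub>R y \<in> span B" "c *\<^sub>R x \<in> E" using * E by (auto intro: span_scale subspace_scale)
    ultimately show "c *\<^sub>R x \<in> E0" by (auto simp: E0_def)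
  qed
  have IH: "seminorm_complete E0 g"
    "\<And>f. seminorm_on E0 f \<Longrightarrow> \<forall>x\<in>E0. g x = 0 \<longrightarrow> f x = 0 \<Longrightarrow> \<exists>C\<ge>0. \<forall>x\<in>E0. f x \<le> C * g x"
    using insert.IH[OF N E0] insert.prems E0_E seminorm_on_subset[OF g E0_E] by (auto simp: E0_def)
  show ?case
  proof (cases "E0 = E")
    case True
    then show ?thesis using IH by blast
  next
    case False
    then obtain b' where b': "b' \<in> E" "b' \<notin> E0" using E0_E by blast
    \<comment> \<open>\<open>c0\<close> is the coefficient of the new generator \<open>b\<close> in
      \<open>b'\<close>; it is nonzero because \<open>b'\<close> lies outside
      \<open>E0\<close>.\<close>
    obtain y c0 where y: "b' - y \<in> N" "y - c0 *\<^sub>R b \<in> span B"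
      using insert.prems(3)[OF b'(1)] span_breakdown_eq by blast
    have "c0 \<noteq> 0" using y b' by (auto simp: E0_def)
    have dec: "\<exists>c. x - c *\<^sub>R b' \<in> E0" if x: "x \<in> E" for x
    proof -
      obtain y' c where y': "x - y' \<in> N" "y' - c *\<^sub>R b \<in> span B"
        using insert.prems(3)[OF x] span_breakdown_eq by blast
      have "(x - y') - (c/c0) *\<^sub>R (b' - y) \<in> N" by (rule subspace_diff[OF N y'(1) subspace_scale[OF N y(1)]])
      then have "(x - (c/c0) *\<^sub>R b') - (y' - (c/c0) *\<^sub>R y) \<in> N" by (simp add: algebra_simps)
      moreover have "(y' - c *\<^sub>R b) - (c/c0) *\<^sub>R (y - c0 *\<^sub>R b) \<in> span B"
        by (rule span_diff[OF y'(2) span_scale[OF y(2)]])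
      then have "y' - (c/c0) *\<^sub>R y \<in> span B" using \<open>c0 \<noteq> 0\<close> by (simp add: algebra_simps)
      moreover have "x - (c/c0) *\<^sub>R b' \<in> E" using x b' E by (intro subspace_diff subspace_scale)
      ultimately show ?thesis by (auto simp: E0_def)
    qed
    \<comment> \<open>Shared by both cases of the dichotomy. The premises say that the coefficient
      of the extra vector, weighted by its \<open>g\<close>- or \<open>f\<close>-value, is
      controlled by \<open>g\<close>; everything else comes from \<open>E0\<close>.\<close>
    have compl: ?thesis
      if b: "b \<in> E" and dec: "\<And>x. x \<in> E \<Longrightarrow> \<exists>c. x - c *\<^sub>R b \<in> E0"
        and D: "D \<ge> 0" "\<And>s c. s \<in> E0 \<Longrightarrow> \<bar>c\<bar> * g b \<le> D * g (s + c *\<^sub>R b)"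
        and conv: "\<And>x c. seminorm_Cauchy g x \<Longrightarrow> (\<And>n. x n \<in> E) \<Longrightarrow> (\<And>n. x n - c n *\<^sub>R b \<in> E0)
           \<Longrightarrow> \<exists>c'. (\<lambda>n. \<bar>c n - c'\<bar> * g b) \<longlonglongrightarrow> 0"
        and fb: "\<And>f. seminorm_on E f \<Longrightarrow> \<forall>x\<in>E. g x = 0 \<longrightarrow> f x = 0 \<Longrightarrow>
            \<exists>D'\<ge>0. \<forall>s\<in>E0. \<forall>c. \<bar>c\<bar> * f b \<le> D' * g (s + c *\<^sub>R b)" for b D
    proof
      have gs: "g s \<le> (1 + D) * g (s + c *\<^sub>R b)" if s: "s \<in> E0" for s c
      proof -
        have "s \<in> E" "s + c *\<^sub>R b \<in> E" "c *\<^sub>R b \<in> E" using s b E0_E E by (auto intro: subspace_add subspace_scale)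
        then have "g s \<le> g (s + c *\<^sub>R b) + \<bar>c\<bar> * g b"
          using seminorm_on_diff[OF g E, of "s + c *\<^sub>R b" "c *\<^sub>R b"] seminorm_on_scale[OF g b, of c] by simp
        then show ?thesis using D(2)[OF s, of c] by (simp add: algebra_simps)
      qed
      show "seminorm_complete E g"
        unfolding seminorm_complete_def
      proof (intro allI impI, elim conjE)
        fix x assume x: "\<forall>n. x n \<in> E" "seminorm_Cauchy g x"
        have "\<forall>n. \<exists>c. x n - c *\<^sub>R b \<in> E0" using x dec by blast
        then obtain c where c: "\<And>n. x n - c n *\<^sub>R b \<in> E0" by metis
        define s where "s n = x n - c n *\<^sub>R b" for n
        have s: "s n \<in> E0" for n using c by (simp add: s_def)
        obtain c' where c': "(\<lambda>n. \<bar>c n - c'\<bar> * g b) \<longlonglongrightarrow> 0" using conv x c by blast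
        have "seminorm_Cauchy g s"
          unfolding seminorm_Cauchy_def
        proof (intro allI impI)
          fix e :: real assume "e > 0"
          then have "e / (1 + D) > 0" using D by simp
          then obtain M where M: "\<And>m n. m \<ge> M \<Longrightarrow> n \<ge> M \<Longrightarrow> g (x m - x n) < e / (1 + D)"
            using x(2) unfolding seminorm_Cauchy_def by meson
          have "g (s m - s n) < e" if "m \<ge> M" "n \<ge> M" for m n
          proof -
            have "s m - s n \<in> E0" using s E0 by (simp add: subspace_diff)
            then have "g (s m - s n) \<le> (1 + D) * g ((s m - s n) + (c m - c n) *\<^sub>R b)" by (rule gs)
            also have "(s m - s n) + (c m - c n) *\<^sub>R b = x m - x n" by (simp add: s_def algebra_simps)
            also have "(1 + D) * g (x m - x n) < (1 + D) * (e / (1 + D))"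
              using M[OF that] D by (intro mult_strict_left_mono) auto
            finally show ?thesis using D by simp
          qed
          then show "\<exists>M. \<forall>m\<ge>M. \<forall>n\<ge>M. g (s m - s n) < e" by blast
        qed
        then obtain y where y: "y \<in> E0" "(\<lambda>n. g (s n - y)) \<longlonglongrightarrow> 0"
          using IH(1) s unfolding seminorm_complete_def by blast
        have yE: "y + c' *\<^sub>R b \<in> E" using y E0_E b E by (auto intro: subspace_add subspace_scale)
        have "(\<lambda>n. g (x n - (y + c' *\<^sub>R b))) \<longlonglongrightarrow> 0"
        proof (rule LIMSEQ_squeeze0)
          show "(\<lambda>n. g (s n - y) + \<bar>c n - c'\<bar> * g b) \<longlonglongrightarrow> 0" using tendsto_add[OF y(2) c'] by simp
          fix n
          show "0 \<le> g (x n - (y + c' *\<^sub>R b))"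
            using x yE E by (intro seminorm_on_nonneg[OF g E] subspace_diff) auto
          have "g ((s n - y) + (c n - c') *\<^sub>R b) \<le> g (s n - y) + g ((c n - c') *\<^sub>R b)"
            using s y E0_E b E by (intro seminorm_on_add[OF g]) (auto intro: subspace_diff subspace_scale)
          then show "g (x n - (y + c' *\<^sub>R b)) \<le> g (s n - y) + \<bar>c n - c'\<bar> * g b"
            unfolding seminorm_on_scale[OF g b] by (simp add: s_def algebra_simps)
        qed
        then show "\<exists>y\<in>E. (\<lambda>n. g (x n - y)) \<longlonglongrightarrow> 0" using yE by blast
      qed
      show "\<forall>f. seminorm_on E f \<longrightarrow> (\<forall>x\<in>E. g x = 0 \<longrightarrow> f x = 0) \<longrightarrow> (\<exists>C\<ge>0. \<forall>x\<in>E. f x \<le> C * g x)"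
      proof (intro allI impI)
        fix f assume f: "seminorm_on E f" "\<forall>x\<in>E. g x = 0 \<longrightarrow> f x = 0"
        obtain D' where D': "D' \<ge> 0" "\<And>s c. s \<in> E0 \<Longrightarrow> \<bar>c\<bar> * f b \<le> D' * g (s + c *\<^sub>R b)"
          using fb[OF f] by blast
        obtain C where C: "C \<ge> 0" "\<And>s. s \<in> E0 \<Longrightarrow> f s \<le> C * g s"
          using IH(2)[OF seminorm_on_subset[OF f(1) E0_E]] f(2) E0_E by blast
        have "f x \<le> (C * (1 + D) + D') * g x" if x: "x \<in> E" for x
        proof -
          obtain c where c: "x - c *\<^sub>R b \<in> E0" using dec x by blast
          define s where "s = x - c *\<^sub>R b"
          have s: "s \<in> E0" "x = s + c *\<^sub>R b" using c by (auto simp: s_def)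
          have "f x \<le> f s + f (c *\<^sub>R b)"
            unfolding s(2) using s(1) E0_E b E by (intro seminorm_on_add[OF f(1)]) (auto intro: subspace_scale)
          also have "f (c *\<^sub>R b) = \<bar>c\<bar> * f b" by (rule seminorm_on_scale[OF f(1) b])
          also have "f s \<le> C * g s" by (rule C(2)[OF s(1)])
          also have "C * g s \<le> C * ((1 + D) * g x)"
            using gs[OF s(1), of c] s C by (intro mult_left_mono) auto
          also have "\<bar>c\<bar> * f b \<le> D' * g x" using D'(2)[OF s(1), of c] s by simp
          finally show ?thesis by (simp add: algebra_simps)
        qed
        moreover have "C * (1 + D) + D' \<ge> 0" using C D D' by simp
        ultimately show "\<exists>C\<ge>0. \<forall>x\<in>E. f x \<le> C * g x" by blast
      qed
    qed
    show ?thesis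
    proof (rule seminorm_extension_cases[OF E E0 E0_E b'(1) dec g IH(1)])
      \<comment> \<open>Zero distance: the extra vector may be taken null, so its coefficient,
        although uncontrolled, always carries the weight 0.\<close>
      fix b assume b: "b \<in> E" "g b = 0" "\<And>x. x \<in> E \<Longrightarrow> \<exists>c. x - c *\<^sub>R b \<in> E0"
      show ?thesis
      proof (rule compl[OF b(1,3), of 0])
        fix f assume "seminorm_on E f" "\<forall>x\<in>E. g x = 0 \<longrightarrow> f x = 0"
        then show "\<exists>D'\<ge>0. \<forall>s\<in>E0. \<forall>c. \<bar>c\<bar> * f b \<le> D' * g (s + c *\<^sub>R b)"
          using b by (intro exI[of _ 0]) auto
      qed (use b in auto)
    next
      fix d assume d: "d > 0" "\<And>s c. s \<in> E0 \<Longrightarrow> d * \<bar>c\<bar> \<le> g (s + c *\<^sub>R b')"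
      \<comment> \<open>Positive distance: \<open>d\<close> bounds the coefficient itself by the
        seminorm, hence the constant \<open>f b' / d\<close>.\<close>
      have bound: "\<exists>D\<ge>0. \<forall>s\<in>E0. \<forall>c. \<bar>c\<bar> * f b' \<le> D * g (s + c *\<^sub>R b')" if f: "seminorm_on E f" for f
      proof (intro exI[of _ "f b' / d"] conjI ballI allI)
        have "f b' \<ge> 0" by (rule seminorm_on_nonneg[OF f E b'(1)])
        then show "f b' / d \<ge> 0" using d by simp
        fix s c assume "s \<in> E0"
        then show "\<bar>c\<bar> * f b' \<le> f b' / d * g (s + c *\<^sub>R b')"
          using d(1) d(2)[of s c] \<open>f b' \<ge> 0\<close> mult_left_mono[OF d(2), of s "f b'" c] by (simp add: field_simps)
      qed
      obtain D where D: "D \<ge> 0" "\<And>s c. s \<in> E0 \<Longrightarrow> \<bar>c\<bar> * g b' \<le> D * g (s + c *\<^sub>R b')"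
        using bound[OF g] by blast
      show ?thesis
      proof (rule compl[OF b'(1) dec D])
        fix x c assume x: "seminorm_Cauchy g x" "\<And>n. x n \<in> E" and c: "\<And>n. x n - c n *\<^sub>R b' \<in> E0"
        have cb: "d * \<bar>c m - c n\<bar> \<le> g (x m - x n)" for m n
        proof -
          have "(x m - c m *\<^sub>R b') - (x n - c n *\<^sub>R b') \<in> E0" by (rule subspace_diff[OF E0 c c])
          from d(2)[OF this, of "c m - c n"] show ?thesis by (simp add: algebra_simps)
        qed
        have "Cauchy c"
          unfolding Cauchy_def dist_real_def
        proof (intro allI impI)
          fix e :: real assume "e > 0"
          then have "d * e > 0" using d by simp
          then obtain M where M: "\<And>m n. m \<ge> M \<Longrightarrow> n \<ge> M \<Longrightarrow> g (x m - x n) < d * e"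
            using x(1) unfolding seminorm_Cauchy_def by meson
          then have "\<bar>c m - c n\<bar> < e" if "m \<ge> M" "n \<ge> M" for m n
            using cb[of m n] M[OF that] d(1)
            by (metis le_less_trans mult_less_cancel_left_pos)
          then show "\<exists>M. \<forall>m\<ge>M. \<forall>n\<ge>M. \<bar>c m - c n\<bar> < e" by blast
        qed
        then obtain c' where "c \<longlonglongrightarrow> c'" by (auto simp: Cauchy_convergent_iff convergent_def)
        then have "(\<lambda>n. \<bar>c n - c'\<bar> * g b') \<longlonglongrightarrow> \<bar>c' - c'\<bar> * g b'" by (intro tendsto_intros)
        then show "\<exists>c'. (\<lambda>n. \<bar>c n - c'\<bar> * g b') \<longlonglongrightarrow> 0" by auto
      qed (assumption+, rule bound)
    qed
  qed
qed

section \<open>The iteration in an abstract saddle-point setting\<close>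

text \<open>Linearity is demanded in the first argument only; symmetry supplies the second.
  Positivity is not strict, since null functions have zero energy.\<close>

definition psd_form :: "'a::real_vector set \<Rightarrow> ('a \<Rightarrow> 'a \<Rightarrow> real) \<Rightarrow> bool" where
  "psd_form E s \<longleftrightarrow>
     (\<forall>x\<in>E. \<forall>y\<in>E. \<forall>z\<in>E. s (x + y) z = s x z + s y z) \<and>
     (\<forall>c. \<forall>x\<in>E. \<forall>z\<in>E. s (c *\<^sub>R x) z = c * s x z) \<and>
     (\<forall>x\<in>E. \<forall>y\<in>E. s x y = s y x) \<and> (\<forall>x\<in>E. 0 \<le> s x x)"

lemma psd_formD:
  assumes "psd_form E s" "x \<in> E" "y \<in> E"
  shows "z \<in> E \<Longrightarrow> s (x + y) z = s x z + s y z" "s (c *\<^sub>R x) y = c * s x y" "s x y = s y x" "0 \<le> s x x"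
  using assms unfolding psd_form_def by blast+

lemma psd_form_expand:
  assumes "psd_form E s" "subspace E" "x \<in> E" "y \<in> E"
  shows "s (x + c *\<^sub>R y) (x + c *\<^sub>R y) = s x x + 2 * c * s x y + c\<^sup>2 * s y y"
proof -
  note D = psd_formD[OF assms(1)]
  have cy: "c *\<^sub>R y \<in> E" "x + c *\<^sub>R y \<in> E" using assms by (auto intro: subspace_add subspace_scale)
  have 1: "s u (x + c *\<^sub>R y) = s u x + c * s u y" if "u \<in> E" for u
    using D(3)[OF that cy(2)] D(1)[OF assms(3) cy(1) that] D(2)[OF assms(4) that, of c]
      D(3)[OF assms(3) that] D(3)[OF assms(4) that] by simp
  have "s (x + c *\<^sub>R y) (x + c *\<^sub>R y) = s x (x + c *\<^sub>R y) + c * s y (x + c *\<^sub>R y)"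
    using D(1)[OF assms(3) cy(1) cy(2)] D(2)[OF assms(4) cy(2), of c] by simp
  also have "\<dots> = s x x + 2 * c * s x y + c\<^sup>2 * s y y"
    using 1[OF assms(3)] 1[OF assms(4)] D(3)[OF assms(3,4)] by (simp add: algebra_simps power2_eq_square)
  finally show ?thesis .
qed

lemma psd_form_Cauchy_Schwarz:
  assumes "psd_form E s" "subspace E" "x \<in> E" "y \<in> E"
  shows "(s x y)\<^sup>2 \<le> s x x * s y y"
proof -
  have q: "0 \<le> s x x + 2 * c * s x y + c\<^sup>2 * s y y" for c
  proof -
    have "x + c *\<^sub>R y \<in> E" using assms by (auto intro: subspace_add subspace_scale)
    then show ?thesis
      using psd_form_expand[OF assms, of c] psd_formD(4)[OF assms(1), of "x + c *\<^sub>R y"] by simp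
  qed
  show ?thesis
  proof (cases "s y y = 0")
    case True
    have "s x y = 0"
    proof (rule ccontr)
      assume "s x y \<noteq> 0"
      \<comment> \<open>The quadratic in \<open>c\<close> degenerates to an affine function, which
        takes the value -1 at this \<open>c\<close>.\<close>
      then show False using q[of "- (s x x + 1) / (2 * s x y)"] True by (simp add: field_simps)
    qed
    then show ?thesis using True by simp
  next
    case False
    then have "s y y > 0" using psd_formD(4)[OF assms(1,4,4)] by simp
    \<comment> \<open>The minimizer of the quadratic in \<open>c\<close>.\<close>
    then show ?thesis using q[of "- s x y / s y y"]
      by (simp add: field_simps power2_eq_square split: if_splits)
  qed
qed

lemma psd_form_diff:
  assumes "psd_form E s" "subspace E" "x \<in> E" "y \<in> E" "z \<in> E"
  shows "s (x - y) z = s x z - s y z"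
proof -
  have "- y \<in> E" using assms by (simp add: subspace_neg)
  then show ?thesis
    using psd_formD(1)[OF assms(1,3) \<open>- y \<in> E\<close> assms(5)] psd_formD(2)[OF assms(1,4,5), of "-1"] by simp
qed

lemma seminorm_on_sqrt_psd_form:
  assumes "psd_form E s" "subspace E"
  shows "seminorm_on E (\<lambda>x. sqrt (s x x))"
  unfolding seminorm_on_def
proof (intro conjI ballI allI)
  fix x y assume xy: "x \<in> E" "y \<in> E"
  have nn: "0 \<le> s x x" "0 \<le> s y y" using xy psd_formD(4)[OF assms(1)] by auto
  have "\<bar>s x y\<bar> \<le> sqrt (s x x * s y y)"
    using psd_form_Cauchy_Schwarz[OF assms xy] by (simp add: real_le_rsqrt)
  then have "s x y \<le> sqrt (s x x) * sqrt (s y y)" by (simp add: real_sqrt_mult)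
  then have "s (x + y) (x + y) \<le> (sqrt (s x x) + sqrt (s y y))\<^sup>2"
    using psd_form_expand[OF assms xy, of 1] nn by (simp add: power2_sum)
  then show "sqrt (s (x + y) (x + y)) \<le> sqrt (s x x) + sqrt (s y y)"
    using nn by (intro real_le_lsqrt) auto
next
  fix x c assume x: "x \<in> E"
  have "c *\<^sub>R x \<in> E" using x assms by (simp add: subspace_scale)
  then have "s (c *\<^sub>R x) (c *\<^sub>R x) = c\<^sup>2 * s x x"
    using psd_formD(2)[OF assms(1) x, of "c *\<^sub>R x" c] psd_formD(2)[OF assms(1) x x, of c]
      psd_formD(3)[OF assms(1) x, of "c *\<^sub>R x"] by (simp add: power2_eq_square)
  then show "sqrt (s (c *\<^sub>R x) (c *\<^sub>R x)) = \<bar>c\<bar> * sqrt (s x x)" by (simp add: real_sqrt_mult)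
qed

lemma seminorm_Cauchy_geometric:
  assumes g: "seminorm_on E g" "subspace E" and x: "\<And>n. x n \<in> E" and r: "0 \<le> r" "r < 1"
    and step: "\<And>n. g (x (Suc n) - x n) \<le> M * r ^ n"
  shows "seminorm_Cauchy g x"
proof -
  have "0 \<le> M" using step[of 0] seminorm_on_nonneg[OF g, of "x (Suc 0) - x 0"] x g(2)
    by (simp add: subspace_diff)
  have tail: "g (x (n + k) - x n) \<le> M * r ^ n / (1 - r)" for n k
  proof -
    have "g (x (n + k) - x n) \<le> M * (\<Sum>i\<in>{n..<n+k}. r ^ i)"
    proof (induction k)
      case 0
      then show ?case using seminorm_on_zero[OF g] by simp
    next
      case (Suc k)
      have "g ((x (Suc (n + k)) - x (n + k)) + (x (n + k) - x n)) \<le> g (x (Suc (n + k)) - x (n + k)) + g (x (n + k) - x n)"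
        using x g(2) by (intro seminorm_on_add[OF g(1)] subspace_diff)
      then show ?case using Suc step[of "n + k"] by (simp add: algebra_simps)
    qed
    also have "(\<Sum>i\<in>{n..<n+k}. r ^ i) = r ^ n * (\<Sum>i<k. r ^ i)"
    proof -
      have "(\<Sum>i\<in>{n..<n+k}. r ^ i) = (\<Sum>i\<in>{0..<k}. r ^ (i + n))"
        using sum.shift_bounds_nat_ivl[of "\<lambda>i. r ^ i" 0 n k] by (simp add: add.commute)
      then show ?thesis by (simp add: power_add sum_distrib_left lessThan_atLeast0 mult.commute)
    qed
    also have "(\<Sum>i<k. r ^ i) \<le> 1 / (1 - r)"
      using r by (simp add: sum_gp_strict divide_right_mono)
    finally show ?thesis using \<open>0 \<le> M\<close> r by (simp add: mult_left_mono)
  qed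
  have lim: "(\<lambda>n. M * r ^ n / (1 - r)) \<longlonglongrightarrow> M * 0 / (1 - r)"
    using r by (intro tendsto_intros LIMSEQ_realpow_zero) auto
  show ?thesis
    unfolding seminorm_Cauchy_def
  proof (intro allI impI)
    fix e :: real assume "e > 0"
    then have "eventually (\<lambda>n. M * r ^ n / (1 - r) < e) sequentially"
      using lim order_tendstoD(2) by fastforce
    then obtain K where K: "\<And>n. n \<ge> K \<Longrightarrow> M * r ^ n / (1 - r) < e" by (auto simp: eventually_sequentially)
    have *: "g (x m - x n) < e" if "n \<ge> K" "n \<le> m" for m n
      using tail[of n "m - n"] K[OF that(1)] that(2) by simp
    have "g (x m - x n) < e" if "m \<ge> K" "n \<ge> K" for m n
    proof (cases "n \<le> m")
      case True then show ?thesis using * that by blast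
    next
      case False
      then have "g (- (x n - x m)) < e"
        using *[of m n] that seminorm_on_minus[OF g(1), of "x n - x m"] x g(2) by (simp add: subspace_diff)
      then show ?thesis by simp
    qed
    then show "\<exists>M. \<forall>m\<ge>M. \<forall>n\<ge>M. g (x m - x n) < e" by blast
  qed
qed

text \<open>\<open>H\<close> is the ambient space of iterates with inhomogeneous boundary data,
  \<open>X\<close> the space of admissible variations and \<open>W\<close> that of multipliers.
  \<open>N\<close> serves as norm on \<open>X\<close> and \<open>a\<close> as inner product on
  \<open>W\<close>, both up to null vectors. The assumptions on \<open>B\<close> express that
  \<open>X \<times> W\<close> is finite-dimensional modulo null vectors.\<close>

locale saddle_point =
  fixes H X :: "'x::real_vector set" and W :: "'w::real_vector set"
    and s :: "'x \<Rightarrow> 'x \<Rightarrow> real" and b :: "'x \<Rightarrow> 'w \<Rightarrow> real" and a :: "'w \<Rightarrow> 'w \<Rightarrow> real"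
    and N :: "'x \<Rightarrow> real" and B :: "('x \<times> 'w) set"
  assumes H: "subspace H" and X: "subspace X" "X \<subseteq> H" and W: "subspace W"
    and s: "psd_form H s" and a: "psd_form W a"
    and b_add: "\<And>x y w. x \<in> H \<Longrightarrow> y \<in> H \<Longrightarrow> w \<in> W \<Longrightarrow> b (x + y) w = b x w + b y w"
    and b_scale: "\<And>c x w. x \<in> H \<Longrightarrow> w \<in> W \<Longrightarrow> b (c *\<^sub>R x) w = c * b x w"
    and b_add2: "\<And>x v w. x \<in> H \<Longrightarrow> v \<in> W \<Longrightarrow> w \<in> W \<Longrightarrow> b x (v + w) = b x v + b x w"
    and b_scale2: "\<And>c x w. x \<in> H \<Longrightarrow> w \<in> W \<Longrightarrow> b x (c *\<^sub>R w) = c * b x w"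
    and N: "seminorm_on X N"
    and s_null: "\<And>x. x \<in> X \<Longrightarrow> N x = 0 \<Longrightarrow> s x x = 0"
    and b_null: "\<And>x w. x \<in> X \<Longrightarrow> w \<in> W \<Longrightarrow> N x = 0 \<Longrightarrow> b x w = 0"
    and s_definite: "\<And>x. x \<in> X \<Longrightarrow> s x x = 0 \<Longrightarrow> N x = 0"
    and b_inf_sup: "\<And>w. w \<in> W \<Longrightarrow> (\<And>x. x \<in> X \<Longrightarrow> b x w = 0) \<Longrightarrow> a w w = 0"
    and B: "finite B"
      "\<And>x w. x \<in> X \<Longrightarrow> w \<in> W \<Longrightarrow> \<exists>x' w'. (x', w') \<in> span B \<and>
         x - x' \<in> X \<and> N (x - x') = 0 \<and> w - w' \<in> W \<and> a (w - w') (w - w') = 0"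
begin

definition null where "null = {(x, w). x \<in> X \<and> N x = 0 \<and> w \<in> W \<and> sqrt (a w w) = 0}"

text \<open>Differences of solutions of the first equation land here: the boundary data cancel,
  which puts the first component into \<open>X\<close>.\<close>

definition Z where "Z = {(x, w). x \<in> X \<and> w \<in> W \<and> (\<forall>y\<in>X. s x y + b y w = 0)}"

lemmas s_simps = psd_formD[OF s]
lemmas a_seminorm = seminorm_on_sqrt_psd_form[OF a W]
lemmas s_seminorm = seminorm_on_subset[OF seminorm_on_sqrt_psd_form[OF s H] X(2)]

lemma X_H: "x \<in> X \<Longrightarrow> x \<in> H" using X by blast

lemma b_diff: "x \<in> H \<Longrightarrow> y \<in> H \<Longrightarrow> w \<in> W \<Longrightarrow> b (x - y) w = b x w - b y w"
  using b_add[of x "- y" w] b_scale[of y w "-1"] H by (simp add: subspace_neg)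

lemma b_diff2: "x \<in> H \<Longrightarrow> v \<in> W \<Longrightarrow> w \<in> W \<Longrightarrow> b x (v - w) = b x v - b x w"
  using b_add2[of x v "- w"] b_scale2[of x w "-1"] W by (simp add: subspace_neg)

lemma subspace_null: "subspace null"
proof (rule subspaceI)
  show "0 \<in> null"
    using X W seminorm_on_zero[OF N X(1)] seminorm_on_zero[OF a_seminorm W]
    by (auto simp: null_def zero_prod_def subspace_0)
next
  fix p q assume "p \<in> null" "q \<in> null"
  then obtain x w y v where *: "p = (x, w)" "q = (y, v)" "x \<in> X" "y \<in> X" "w \<in> W" "v \<in> W"
    "N x = 0" "N y = 0" "sqrt (a w w) = 0" "sqrt (a v v) = 0" by (auto simp: null_def)
  then have "N (x + y) \<le> 0" "sqrt (a (w + v) (w + v)) \<le> 0" "x + y \<in> X" "w + v \<in> W"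
    using seminorm_on_add[OF N, of x y] seminorm_on_add[OF a_seminorm, of w v] X W
    by (auto intro: subspace_add)
  then show "p + q \<in> null"
    using seminorm_on_nonneg[OF N X(1), of "x + y"] seminorm_on_nonneg[OF a_seminorm W, of "w + v"] *
    by (auto simp: null_def)
next
  fix c p assume "p \<in> null"
  then obtain x w where *: "p = (x, w)" "x \<in> X" "w \<in> W" "N x = 0" "sqrt (a w w) = 0"
    by (auto simp: null_def)
  then show "c *\<^sub>R p \<in> null"
    using seminorm_on_scale[OF N *(2), of c] seminorm_on_scale[OF a_seminorm *(3), of c]
      subspace_scale[OF X(1) *(2)] subspace_scale[OF W *(3)]
    by (simp add: null_def del: real_sqrt_eq_0_iff)
qed

lemma finite_dim:
  assumes "subspace E" "E \<subseteq> X \<times> W" "seminorm_on E g" "\<And>p. p \<in> E \<Longrightarrow> p \<in> null \<Longrightarrow> g p = 0"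
  shows "seminorm_complete E g"
    "\<And>f. seminorm_on E f \<Longrightarrow> (\<And>p. p \<in> E \<Longrightarrow> g p = 0 \<Longrightarrow> f p = 0) \<Longrightarrow> \<exists>C\<ge>0. \<forall>p\<in>E. f p \<le> C * g p"
proof -
  have "\<exists>q\<in>span B. p - q \<in> null" if "p \<in> E" for p
  proof -
    from that assms(2) obtain x w where p: "p = (x, w)" "x \<in> X" "w \<in> W" by auto
    obtain x' w' where "(x', w') \<in> span B" "x - x' \<in> X" "N (x - x') = 0" "w - w' \<in> W" "a (w - w') (w - w') = 0"
      using B(2)[OF p(2,3)] by blast
    then show ?thesis using p by (intro bexI[of _ "(x', w')"]) (auto simp: null_def)
  qed
  from finite_dim_seminorms[OF B(1) subspace_null assms(1) this assms(3,4)]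
  show "seminorm_complete E g"
    "\<And>f. seminorm_on E f \<Longrightarrow> (\<And>p. p \<in> E \<Longrightarrow> g p = 0 \<Longrightarrow> f p = 0) \<Longrightarrow> \<exists>C\<ge>0. \<forall>p\<in>E. f p \<le> C * g p"
    by blast+
qed

lemma subspace_Z: "subspace Z"
proof (rule subspaceI)
  show "0 \<in> Z"
    using X W s_simps(2)[of 0 _ 0] b_scale2[of _ 0 0]
    by (auto simp: Z_def zero_prod_def subspace_0 subspace_0[OF H] X_H)
next
  fix p q assume "p \<in> Z" "q \<in> Z"
  then obtain x w y v where *: "p = (x, w)" "q = (y, v)" "x \<in> X" "y \<in> X" "w \<in> W" "v \<in> W"
    "\<And>u. u \<in> X \<Longrightarrow> s x u + b u w = 0" "\<And>u. u \<in> X \<Longrightarrow> s y u + b u v = 0" by (auto simp: Z_def)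
  have "s (x + y) u + b u (w + v) = 0" if "u \<in> X" for u
    using *(7,8)[OF that] s_simps(1)[OF X_H X_H X_H, OF *(3,4) that] b_add2[OF X_H[OF that] *(5,6)] by simp
  then show "p + q \<in> Z"
    using * subspace_add[OF X(1) *(3,4)] subspace_add[OF W *(5,6)] by (simp add: Z_def)
next
  fix c p assume "p \<in> Z"
  then obtain x w where *: "p = (x, w)" "x \<in> X" "w \<in> W"
    "\<And>u. u \<in> X \<Longrightarrow> s x u + b u w = 0" by (auto simp: Z_def)
  have "s (c *\<^sub>R x) u + b u (c *\<^sub>R w) = 0" if "u \<in> X" for u
  proof -
    have "s (c *\<^sub>R x) u + b u (c *\<^sub>R w) = c * (s x u + b u w)"
      using s_simps(2)[OF X_H X_H, OF *(2) that] b_scale2[OF X_H[OF that] *(3)] by (simp add: distrib_left)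
    then show ?thesis using *(4)[OF that] by simp
  qed
  then show "c *\<^sub>R p \<in> Z"
    using * subspace_scale[OF X(1) *(2)] subspace_scale[OF W *(3)] by (simp add: Z_def)
qed

lemma Z_XW: "Z \<subseteq> X \<times> W" by (auto simp: Z_def)

lemma seminorm_on_fst: "seminorm_on X f \<Longrightarrow> E \<subseteq> X \<times> W \<Longrightarrow> seminorm_on E (\<lambda>p. f (fst p))"
  by (simp add: seminorm_on_def subset_iff) (metis prod.collapse)

lemma seminorm_on_snd: "seminorm_on W f \<Longrightarrow> E \<subseteq> X \<times> W \<Longrightarrow> seminorm_on E (\<lambda>p. f (snd p))"
  by (simp add: seminorm_on_def subset_iff) (metis prod.collapse)

text \<open>By Cauchy-Schwarz, zero energy of \<open>x\<close> makes \<open>s x\<close> vanish on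
  \<open>X\<close>. The equation defining \<open>Z\<close> then leaves \<open>b y w = 0\<close> for
  all \<open>y\<close>, and the inf-sup assumption removes \<open>w\<close>.\<close>

lemma Z_definite:
  assumes "(x, w) \<in> Z" "s x x = 0" shows "N x = 0" "a w w = 0"
proof -
  have Z: "x \<in> X" "w \<in> W" "\<And>y. y \<in> X \<Longrightarrow> s x y + b y w = 0" using assms by (auto simp: Z_def)
  show "N x = 0" using Z assms(2) s_definite by blast
  have "s x y = 0" if "y \<in> X" for y
    using psd_form_Cauchy_Schwarz[OF s H X_H X_H, of x y] Z(1) that assms(2) by simp
  then show "a w w = 0" using Z by (intro b_inf_sup) auto
qed

text \<open>A quantitative inf-sup condition obtained from the qualitative one: on \<open>Z\<close>
  the energy seminorm has no kernel beyond null vectors, so finite-dimensionality lets it dominate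
  the seminorms of both components.\<close>

lemma Z_bound: "\<exists>C>0. \<forall>(x, w)\<in>Z. N x \<le> C * sqrt (s x x) \<and> sqrt (a w w) \<le> C * sqrt (s x x)"
proof -
  note sZ = seminorm_on_fst[OF s_seminorm Z_XW]
  have s0: "sqrt (s (fst p) (fst p)) = 0" if "p \<in> null" for p
    using that s_null by (auto simp: null_def)
  have 1: "N (fst p) = 0 \<and> sqrt (a (snd p) (snd p)) = 0" if "p \<in> Z" "sqrt (s (fst p) (fst p)) = 0" for p
    using Z_definite[of "fst p" "snd p"] that by simp
  obtain C1 where C1: "C1 \<ge> 0" "\<forall>p\<in>Z. N (fst p) \<le> C1 * sqrt (s (fst p) (fst p))"
    using finite_dim(2)[OF subspace_Z Z_XW sZ s0 seminorm_on_fst[OF N Z_XW]] 1 by blast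
  obtain C2 where C2: "C2 \<ge> 0" "\<forall>p\<in>Z. sqrt (a (snd p) (snd p)) \<le> C2 * sqrt (s (fst p) (fst p))"
    using finite_dim(2)[OF subspace_Z Z_XW sZ s0 seminorm_on_snd[OF a_seminorm Z_XW]] 1 by blast
  show ?thesis
  \<comment> \<open>The summand 1 only makes the common constant positive.\<close>
  proof (intro exI[of _ "C1 + C2 + 1"] conjI ballI, simp add: C1 C2 add_nonneg_pos)
    fix p assume "p \<in> Z"
    then obtain x w where p: "p = (x, w)" "x \<in> X" by (auto simp: Z_def)
    have "0 \<le> sqrt (s x x)" using s_simps(4)[OF X_H X_H, OF p(2) p(2)] by simp
    then have "0 \<le> C1 * sqrt (s x x)" "0 \<le> C2 * sqrt (s x x)" using C1 C2 by auto
    moreover have "N x \<le> C1 * sqrt (s x x)" "sqrt (a w w) \<le> C2 * sqrt (s x x)" using C1(2) C2(2) \<open>p \<in> Z\<close> p by force+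
    ultimately show "case p of (x, w) \<Rightarrow> N x \<le> (C1 + C2 + 1) * sqrt (s x x) \<and> sqrt (a w w) \<le> (C1 + C2 + 1) * sqrt (s x x)"
      using \<open>0 \<le> sqrt (s x x)\<close> unfolding p prod.case distrib_right by (intro conjI; linarith)
  qed
qed

text \<open>Continuity of \<open>b\<close> in its first argument is again a comparison of seminorms;
  pairing \<open>X\<close> with the zero multiplier lets \<open>finite_dim\<close> be reused. The
  constant may depend on \<open>w\<close>, as only limits for a fixed \<open>w\<close> are
  taken.\<close>

lemma b_bound:
  assumes w: "w \<in> W" shows "\<exists>C\<ge>0. \<forall>x\<in>X. \<bar>b x w\<bar> \<le> C * N x"
proof -
  let ?E = "X \<times> {0}"
  have E: "subspace ?E" "?E \<subseteq> X \<times> W"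
    using X W by (auto simp: subspace_def zero_prod_def)
  have "seminorm_on X (\<lambda>x. \<bar>b x w\<bar>)"
    unfolding seminorm_on_def using w by (auto simp: b_add b_scale X_H abs_mult)
  from finite_dim(2)[OF E seminorm_on_fst[OF N E(2)] _ seminorm_on_fst[OF this E(2)]]
  show ?thesis using b_null w by (auto simp: null_def)
qed

text \<open>The indices are staggered: \<open>x n\<close> belongs with \<open>z (Suc n)\<close>, the
  multiplier computed in the same step, while \<open>z n\<close> enters only as the old multiplier
  on the right-hand side. The uniqueness clause is modulo null vectors.\<close>

theorem iteration:
  fixes F :: "'w \<Rightarrow> real" and x :: "nat \<Rightarrow> 'x" and z :: "nat \<Rightarrow> 'w"
  assumes xH: "\<And>n. x n \<in> H" and xX: "\<And>n. x n - x 0 \<in> X" and zW: "\<And>n. z n \<in> W"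
    and eq1: "\<And>n y. y \<in> X \<Longrightarrow> s (x n) y + b y (z (Suc n)) = 0"
    and eq2: "\<And>n w. w \<in> W \<Longrightarrow> b (x n) w - 1/2 * a (z (Suc n)) w = F w - 1/2 * a (z n) w"
  obtains x' z' where "x' - x 0 \<in> X" "z' \<in> W"
    "\<And>y. y \<in> X \<Longrightarrow> s x' y + b y z' = 0" "\<And>w. w \<in> W \<Longrightarrow> b x' w = F w"
    "\<And>x'' z''. x'' - x 0 \<in> X \<Longrightarrow> z'' \<in> W \<Longrightarrow> (\<And>y. y \<in> X \<Longrightarrow> s x'' y + b y z'' = 0) \<Longrightarrow>
        (\<And>w. w \<in> W \<Longrightarrow> b x'' w = F w) \<Longrightarrow> N (x'' - x') = 0 \<and> a (z'' - z') (z'' - z') = 0"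
    "(\<lambda>n. N (x n - x')) \<longlonglongrightarrow> 0" "(\<lambda>n. sqrt (a (z n - z') (z n - z'))) \<longlonglongrightarrow> 0"
proof -
  obtain C where C: "C > 0" "\<And>x w. (x, w) \<in> Z \<Longrightarrow> N x \<le> C * sqrt (s x x)"
    "\<And>x w. (x, w) \<in> Z \<Longrightarrow> sqrt (a w w) \<le> C * sqrt (s x x)"
    using Z_bound by fast
  define e where "e n = z (Suc n) - z n" for n
  define d where "d n = x (Suc n) - x n" for n
  have eW: "e n \<in> W" for n using zW W by (simp add: e_def subspace_diff)
  have dX: "d n \<in> X" for n
    using subspace_diff[OF X(1) xX[of "Suc n"] xX[of n]] by (simp add: d_def)
  have de: "(d n, e (Suc n)) \<in> Z" for n
  proof -
    have "s (d n) v + b v (e (Suc n)) = 0" if "v \<in> X" for v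
      using eq1[OF that, of n] eq1[OF that, of "Suc n"] psd_form_diff[OF s H xH xH X_H[OF that], of "Suc n" n]
        b_diff2[OF X_H[OF that] zW zW, of "Suc (Suc n)" "Suc n"] by (simp add: d_def e_def)
    then show ?thesis using dX eW by (simp add: Z_def)
  qed
  \<comment> \<open>The difference of the second equations is tested with the new multiplier
    increment, that of the first equations with \<open>d n\<close>, and the \<open>b\<close>-terms
    cancel. The mixed term is absorbed by the nonnegative square of the difference of two successive
    multiplier increments.\<close>
  have energy: "s (d n) (d n) + 1/4 * a (e (Suc n)) (e (Suc n)) \<le> 1/4 * a (e n) (e n)" for n
  proof -
    let ?e = "e (Suc n)"
    have "b (d n) ?e = 1/2 * a ?e ?e - 1/2 * a (e n) ?e"
      using eq2[OF eW[of "Suc n"], of n] eq2[OF eW[of "Suc n"], of "Suc n"]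
        b_diff[OF xH xH eW, of "Suc n" n "Suc n"]
        psd_form_diff[OF a W zW zW eW, of "Suc n" n "Suc n"] psd_form_diff[OF a W zW zW eW, of "Suc (Suc n)" "Suc n" "Suc n"]
      unfolding d_def e_def[symmetric] by linarith
    moreover have "s (d n) (d n) + b (d n) ?e = 0" using de[of n] dX by (auto simp: Z_def)
    moreover have "0 \<le> a (e n) (e n) - 2 * a (e n) ?e + a ?e ?e"
      using psd_form_expand[OF a W eW[of n] eW[of "Suc n"], of "-1"]
        psd_formD(4)[OF a, of "e n + (-1) *\<^sub>R ?e" ?e] eW W
      by (simp add: subspace_diff)
    ultimately show ?thesis by simp
  qed
  \<comment> \<open>From \<open>energy\<close> and the bound of the squared multiplier increment by
    \<open>C\<^sup>2\<close> times the energy, \<open>(1 + 4 / C\<^sup>2)\<close> times the new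
    squared increment is at most the old one; \<open>r\<close> is the square root of the resulting
    factor.\<close>
  define r where "r = sqrt (1 / (1 + 4 / C\<^sup>2))"
  have "1 / (1 + 4 / C\<^sup>2) < 1" using C(1) by (simp add: divide_less_eq add_pos_pos)
  then have r: "0 \<le> r" "r < 1" using C by (auto simp: r_def)
  have a_nonneg: "0 \<le> a w w" if "w \<in> W" for w using psd_formD(4)[OF a that that] .
  have decay: "sqrt (a (e (Suc n)) (e (Suc n))) \<le> r * sqrt (a (e n) (e n))" for n
  proof -
    have "(sqrt (a (e (Suc n)) (e (Suc n))))\<^sup>2 \<le> (C * sqrt (s (d n) (d n)))\<^sup>2"
      using C(3)[OF de] a_nonneg[OF eW] by (intro power_mono) auto
    then have "a (e (Suc n)) (e (Suc n)) / C\<^sup>2 \<le> s (d n) (d n)"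
      using C(1) a_nonneg[OF eW] s_simps(4)[OF X_H X_H, OF dX dX] by (simp add: power_mult_distrib field_simps)
    then have "(1 + 4 / C\<^sup>2) * a (e (Suc n)) (e (Suc n)) \<le> a (e n) (e n)"
      using energy[of n] by (simp add: algebra_simps)
    then have "a (e (Suc n)) (e (Suc n)) \<le> 1 / (1 + 4 / C\<^sup>2) * a (e n) (e n)"
      using C(1) by (simp add: field_simps add_pos_pos)
    then show ?thesis unfolding r_def by (metis real_sqrt_le_mono real_sqrt_mult)
  qed
  define M where "M = sqrt (a (e 0) (e 0))"
  have M: "0 \<le> M" using a_nonneg[OF eW] by (simp add: M_def)
  have e_geo: "sqrt (a (e n) (e n)) \<le> M * r ^ n" for n
  proof (induction n)
    case (Suc n)
    have "r * sqrt (a (e n) (e n)) \<le> r * (M * r ^ n)" using Suc r by (intro mult_left_mono)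
    then show ?case using decay[of n] by (simp add: algebra_simps)
  qed (simp add: M_def)
  \<comment> \<open>The factor 1/2 is the square root of the 1/4 in \<open>energy\<close>.\<close>
  have d_geo: "N (d n) \<le> C / 2 * M * r ^ n" for n
  proof -
    have "s (d n) (d n) \<le> 1/4 * a (e n) (e n)" using energy[of n] a_nonneg[OF eW[of "Suc n"]] by simp
    then have "sqrt (s (d n) (d n)) \<le> sqrt (1/4 * a (e n) (e n))" by (rule real_sqrt_le_mono)
    also have "\<dots> = 1/2 * sqrt (a (e n) (e n))" by (simp add: real_sqrt_mult real_sqrt_divide)
    also have "\<dots> \<le> 1/2 * (M * r ^ n)" using e_geo by simp
    finally have "C * sqrt (s (d n) (d n)) \<le> C * (1/2 * (M * r ^ n))" using C(1) by (intro mult_left_mono) auto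
    then show ?thesis using C(2)[OF de, of n] by simp
  qed
  define g where "g p = N (fst p) + sqrt (a (snd p) (snd p))" for p
  have g: "seminorm_on Z g"
  proof -
    have 1: "seminorm_on Z (\<lambda>p. N (fst p))" "seminorm_on Z (\<lambda>p. sqrt (a (snd p) (snd p)))"
      using seminorm_on_fst[OF N Z_XW] seminorm_on_snd[OF a_seminorm Z_XW] by auto
    show ?thesis
      unfolding seminorm_on_def
    proof (intro conjI ballI allI)
      fix p q assume "p \<in> Z" "q \<in> Z"
      then show "g (p + q) \<le> g p + g q"
        using seminorm_on_add[OF 1(1), of p q] seminorm_on_add[OF 1(2), of p q] unfolding g_def by linarith
    next
      fix p c assume "p \<in> Z"
      then show "g (c *\<^sub>R p) = \<bar>c\<bar> * g p"
        using seminorm_on_scale[OF 1(1), of p c] seminorm_on_scale[OF 1(2), of p c]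
        unfolding g_def distrib_left by linarith
    qed
  qed
  \<comment> \<open>Subtracting the first pair moves the affine sequence into \<open>Z\<close>,
    where a single application of completeness yields the limits of both components.\<close>
  define y where "y n = (x n - x 0, z (Suc n) - z (Suc 0))" for n
  have y: "y n \<in> Z" for n
  proof -
    have "s (x n - x 0) v + b v (z (Suc n) - z (Suc 0)) = 0" if "v \<in> X" for v
      using eq1[OF that, of n] eq1[OF that, of 0] psd_form_diff[OF s H xH xH X_H[OF that], of n 0]
        b_diff2[OF X_H[OF that] zW zW, of "Suc n" "Suc 0"] by simp
    then show ?thesis using xX subspace_diff[OF W zW zW] by (simp add: Z_def y_def)
  qed
  have "seminorm_Cauchy g y"
  proof (rule seminorm_Cauchy_geometric[OF g subspace_Z y r])
    fix n
    have "y (Suc n) - y n = (d n, e (Suc n))" by (simp add: y_def d_def e_def)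
    then have "g (y (Suc n) - y n) = N (d n) + sqrt (a (e (Suc n)) (e (Suc n)))" by (simp add: g_def)
    also have "\<dots> \<le> C / 2 * M * r ^ n + M * r ^ Suc n" by (intro add_mono d_geo e_geo)
    also have "\<dots> = (C / 2 * M + M * r) * r ^ n" by (simp add: algebra_simps)
    finally show "g (y (Suc n) - y n) \<le> (C / 2 * M + M * r) * r ^ n" .
  qed
  moreover have "seminorm_complete Z g"
    using finite_dim(1)[OF subspace_Z Z_XW g] by (auto simp: g_def null_def)
  ultimately obtain p where p: "p \<in> Z" "(\<lambda>n. g (y n - p)) \<longlonglongrightarrow> 0"
    using y unfolding seminorm_complete_def by blast
  obtain x\<^sub>l z\<^sub>l where pl: "p = (x\<^sub>l, z\<^sub>l)" by fastforce
  define x' where "x' = x 0 + x\<^sub>l"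
  define z' where "z' = z (Suc 0) + z\<^sub>l"
  have l: "x\<^sub>l \<in> X" "z\<^sub>l \<in> W" "\<And>v. v \<in> X \<Longrightarrow> s x\<^sub>l v + b v z\<^sub>l = 0" using p pl by (auto simp: Z_def)
  have x'X: "x' - x 0 \<in> X" using l by (simp add: x'_def)
  have x'H: "x' \<in> H" unfolding x'_def by (rule subspace_add[OF H xH X_H[OF l(1)]])
  have z'W: "z' \<in> W" unfolding z'_def by (rule subspace_add[OF W zW l(2)])
  have N0: "0 \<le> N (x n - x')" and xx': "x n - x' \<in> X" for n
  proof -
    show "x n - x' \<in> X" using subspace_diff[OF X(1) xX[of n] l(1)] by (simp add: x'_def diff_diff_eq)
    then show "0 \<le> N (x n - x')" by (rule seminorm_on_nonneg[OF N X(1)])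
  qed
  have gy: "g (y n - p) = N (x n - x') + sqrt (a (z (Suc n) - z') (z (Suc n) - z'))" for n
    by (simp add: g_def y_def pl x'_def z'_def algebra_simps)
  have zz': "z n - z' \<in> W" for n using zW z'W W by (simp add: subspace_diff)
  have limN: "(\<lambda>n. N (x n - x')) \<longlonglongrightarrow> 0"
    by (rule LIMSEQ_squeeze0[OF p(2)]) (use N0 zz' a_nonneg in \<open>auto simp: gy\<close>)
  have "(\<lambda>n. sqrt (a (z (Suc n) - z') (z (Suc n) - z'))) \<longlonglongrightarrow> 0"
    by (rule LIMSEQ_squeeze0[OF p(2)]) (use N0 zz' a_nonneg in \<open>auto simp: gy\<close>)
  then have lima: "(\<lambda>n. sqrt (a (z n - z') (z n - z'))) \<longlonglongrightarrow> 0"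
    by (rule LIMSEQ_imp_Suc)
  have sol1: "s x' v + b v z' = 0" if "v \<in> X" for v
    using l(3)[OF that] eq1[OF that, of 0] s_simps(1)[OF xH[of 0] X_H[OF l(1)] X_H[OF that]]
      b_add2[OF X_H[OF that] zW[of "Suc 0"] l(2)] by (simp add: x'_def z'_def)
  \<comment> \<open>In the limit the stabilization disappears: it contributes half of
    \<open>a (e n) w\<close>, which decays geometrically with the multiplier increments.\<close>
  have sol2: "b x' w = F w" if w: "w \<in> W" for w
  proof -
    have "(\<lambda>n. \<bar>b (x n - x') w\<bar>) \<longlonglongrightarrow> 0"
    proof -
      obtain D where D: "\<And>v. v \<in> X \<Longrightarrow> \<bar>b v w\<bar> \<le> D * N v" using b_bound[OF w] by blast
      show ?thesis
        by (rule LIMSEQ_squeeze0[where g = "\<lambda>n. D * N (x n - x')"])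
          (use D xx' tendsto_mult_right_zero[OF limN] in auto)
    qed
    then have 1: "(\<lambda>n. b (x n - x') w) \<longlonglongrightarrow> 0" by (simp add: tendsto_rabs_zero_iff)
    have "(\<lambda>n. \<bar>a (e n) w\<bar>) \<longlonglongrightarrow> 0"
    proof (rule LIMSEQ_squeeze0)
      show "(\<lambda>n. M * r ^ n * sqrt (a w w)) \<longlonglongrightarrow> 0"
        using r by (intro tendsto_mult_left_zero tendsto_mult_right_zero LIMSEQ_realpow_zero) auto
      fix n
      have "\<bar>a (e n) w\<bar> \<le> sqrt (a (e n) (e n)) * sqrt (a w w)"
        using psd_form_Cauchy_Schwarz[OF a W eW w, of n]
        by (metis real_sqrt_abs real_sqrt_le_mono real_sqrt_mult)
      also have "\<dots> \<le> M * r ^ n * sqrt (a w w)" using e_geo a_nonneg[OF w] by (intro mult_right_mono) auto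
      finally show "\<bar>a (e n) w\<bar> \<le> M * r ^ n * sqrt (a w w)" .
    qed simp
    then have 2: "(\<lambda>n. a (e n) w) \<longlonglongrightarrow> 0" by (simp add: tendsto_rabs_zero_iff)
    have "F w + 1/2 * a (e n) w - b (x n - x') w = b x' w" for n
      using eq2[OF w, of n] psd_form_diff[OF a W zW zW w, of "Suc n" n] b_diff[OF xH x'H w, of n]
      by (simp add: e_def algebra_simps)
    moreover have "(\<lambda>n. F w + 1/2 * a (e n) w - b (x n - x') w) \<longlonglongrightarrow> F w + 1/2 * 0 - 0"
      by (intro tendsto_intros 1 2)
    ultimately show ?thesis by (simp add: LIMSEQ_const_iff)
  qed
  have unique: "N (x'' - x') = 0 \<and> a (z'' - z') (z'' - z') = 0"
    if x'': "x'' - x 0 \<in> X" and z'': "z'' \<in> W" and "\<And>v. v \<in> X \<Longrightarrow> s x'' v + b v z'' = 0"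
      and "\<And>w. w \<in> W \<Longrightarrow> b x'' w = F w" for x'' z''
  proof -
    have H'': "x'' \<in> H" using subspace_add[OF H X_H[OF x''] xH[of 0]] by simp
    have X'': "x'' - x' \<in> X" using subspace_diff[OF X(1) x'' x'X] by simp
    have W'': "z'' - z' \<in> W" using z'' z'W W by (simp add: subspace_diff)
    have "s (x'' - x') v + b v (z'' - z') = 0" if "v \<in> X" for v
      using that(1) \<open>\<And>v. v \<in> X \<Longrightarrow> s x'' v + b v z'' = 0\<close>[OF that] sol1[OF that]
        psd_form_diff[OF s H H'' x'H X_H[OF that]] b_diff2[OF X_H[OF that] z'' z'W] by simp
    then have "(x'' - x', z'' - z') \<in> Z" using X'' W'' by (simp add: Z_def)
    \<comment> \<open>The second equations have the same right-hand side, so the difference has zero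
      \<open>b\<close>-term and hence zero energy; \<open>Z_definite\<close> then applies.\<close>
    moreover have "b (x'' - x') (z'' - z') = 0"
      using b_diff[OF H'' x'H W''] that(4)[OF W''] sol2[OF W''] by simp
    then have "s (x'' - x') (x'' - x') = 0" using calculation X'' by (auto simp: Z_def)
    ultimately show ?thesis using Z_definite by blast
  qed
  show thesis by (rule that[OF x'X z'W sol1 sol2 unique limN lima])
qed

end

section \<open>Smooth bump functions\<close>

text \<open>All polynomials \<open>p\<close> are admitted to make the family closed under differentiation.\<close>

definition flat :: "real poly \<Rightarrow> real \<Rightarrow> real" where
  "flat p t = (if t > 0 then poly p (1 / t) * exp (- (1 / t)) else 0)"

text \<open>With \<open>s = 1 / t\<close> one has d/dt = - s^2 d/ds, and differentiating
  \<open>poly p s * exp (- s)\<close> in \<open>s\<close> produces \<open>pderiv p - p\<close> in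
  front of the exponential.\<close>

definition flat_deriv :: "real poly \<Rightarrow> real poly" where
  "flat_deriv p = [:0, 0, 1:] * (p - pderiv p)"

lemma poly_exp_minus_tendsto_0: "((\<lambda>s. poly p s * exp (- s)) \<longlongrightarrow> (0::real)) at_top"
proof -
  have "((\<lambda>s. \<Sum>i\<le>degree p. coeff p i * (s ^ i * exp (- s))) \<longlongrightarrow> (\<Sum>i\<le>degree p. coeff p i * 0)) at_top"
  proof (intro tendsto_sum tendsto_mult_left)
    fix i
    show "((\<lambda>s::real. s ^ i * exp (- s)) \<longlongrightarrow> 0) at_top"
      using tendsto_power_div_exp_0[of i] by (simp add: exp_minus field_simps)
  qed
  then show ?thesis by (simp add: poly_altdef sum_distrib_right mult.assoc)
qed

lemma flat_has_real_derivative: "(flat p has_real_derivative flat (flat_deriv p) t) (at t)"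
proof -
  consider "t > 0" | "t < 0" | "t = 0" by linarith
  then show ?thesis
  proof cases
    case 1
    have "((\<lambda>t. poly p (1 / t) * exp (- (1 / t))) has_real_derivative
        poly (pderiv p) (1 / t) * (- 1 / t\<^sup>2) * exp (- (1 / t)) + poly p (1 / t) * (exp (- (1 / t)) * (1 / t\<^sup>2))) (at t)"
      using 1 by (auto intro!: derivative_eq_intros DERIV_chain2[OF poly_DERIV] simp: power2_eq_square)
    also have "poly (pderiv p) (1 / t) * (- 1 / t\<^sup>2) * exp (- (1 / t)) + poly p (1 / t) * (exp (- (1 / t)) * (1 / t\<^sup>2))
      = flat (flat_deriv p) t"
      using 1 by (simp add: flat_def flat_deriv_def power2_eq_square algebra_simps)
    finally show ?thesis
      by (rule has_field_derivative_transform_within[where d = t]) (use 1 in \<open>auto simp: flat_def dist_real_def\<close>)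
  next
    case 2
    have "((\<lambda>t. 0) has_real_derivative flat (flat_deriv p) t) (at t)" using 2 by (simp add: flat_def)
    then show ?thesis
      by (rule has_field_derivative_transform_within[where d = "- t"]) (use 2 in \<open>auto simp: flat_def dist_real_def\<close>)
  next
    case 3
    have "((\<lambda>h. flat p h / h) \<longlongrightarrow> 0) (at_right 0)"
    proof -
      have "filterlim (\<lambda>h::real. 1 / h) at_top (at_right 0)"
        using filterlim_inverse_at_top_right by (simp add: inverse_eq_divide)
      \<comment> \<open>The difference quotient at 0 from the right is
        \<open>s * poly p s * exp (- s)\<close> with \<open>s = 1 / h\<close>, hence the polynomial
        \<open>[:0, 1:] * p\<close>.\<close>
      from filterlim_compose[OF poly_exp_minus_tendsto_0[of "[:0, 1:] * p"] this]
      show ?thesis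
        by (rule Lim_transform_eventually) (auto simp: flat_def eventually_at_filter intro!: always_eventually)
    qed
    moreover have "((\<lambda>h. flat p h / h) \<longlongrightarrow> 0) (at_left 0)"
      by (rule Lim_transform_eventually[OF tendsto_const]) (auto simp: flat_def eventually_at_filter)
    ultimately have "((\<lambda>h. flat p h / h) \<longlongrightarrow> 0) (at 0)" by (simp add: filterlim_split_at_real)
    then show ?thesis using 3 by (simp add: DERIV_def flat_def)
  qed
qed

text \<open>A class closed under partial derivatives consists of smooth functions by induction on
  the order, so no higher derivative ever has to be computed.\<close>

inductive_set bump_algebra :: "(real^'d::finite \<Rightarrow> real) set" where
  const: "(\<lambda>x. c) \<in> bump_algebra"
| flat: "(\<lambda>x. flat p (a * x $ i + b)) \<in> bump_algebra"
| add: "f \<in> bump_algebra \<Longrightarrow> g \<in> bump_algebra \<Longrightarrow> (\<lambda>x. f x + g x) \<in> bump_algebra"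
| mult: "f \<in> bump_algebra \<Longrightarrow> g \<in> bump_algebra \<Longrightarrow> (\<lambda>x. f x * g x) \<in> bump_algebra"

lemma partial_eqI: "(f has_derivative f') (at x) \<Longrightarrow> partial i f x = f' (axis i 1)"
  by (simp add: partial_def frechet_derivative_at[symmetric])

lemma bump_algebra_deriv:
  fixes f :: "real^'d::finite \<Rightarrow> real"
  assumes "f \<in> bump_algebra"
  shows "(\<forall>x. f differentiable (at x)) \<and> (\<forall>i. partial i f \<in> bump_algebra)"
  using assms
proof induction
  case (const c)
  have "partial i (\<lambda>x. c) = (\<lambda>x::real^'d. 0)" for i by (intro ext partial_eqI) simp
  then show ?case using bump_algebra.const by simp
next
  case (flat p a j b)
  have D: "((\<lambda>x::real^'d. flat p (a * x $ j + b)) has_derivative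
      (\<lambda>h. flat (flat_deriv p) (a * x $ j + b) * (a * h $ j))) (at x)" for x
  proof -
    have "((\<lambda>x::real^'d. a * x $ j + b) has_derivative (\<lambda>h. a * h $ j)) (at x)"
      by (auto intro!: derivative_eq_intros bounded_linear_imp_has_derivative bounded_linear_vec_nth)
    from has_derivative_compose[OF this flat_has_real_derivative[of p, unfolded has_field_derivative_def]]
    show ?thesis by simp
  qed
  have "partial i (\<lambda>x::real^'d. flat p (a * x $ j + b))
      = (\<lambda>x. flat (flat_deriv p) (a * x $ j + b) * (a * axis i 1 $ j))" for i
    by (intro ext partial_eqI) (rule D)
  then have "partial i (\<lambda>x::real^'d. flat p (a * x $ j + b)) \<in> bump_algebra" for i
    using bump_algebra.mult[OF bump_algebra.flat bump_algebra.const, of "flat_deriv p" a j b "a * axis i 1 $ j"] by simp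
  then show ?case using D by (auto simp: differentiable_def)
next
  case (add f g)
  then have D: "(f has_derivative frechet_derivative f (at x)) (at x)" "(g has_derivative frechet_derivative g (at x)) (at x)" for x
    by (auto simp: frechet_derivative_works)
  have "partial i (\<lambda>x. f x + g x) = (\<lambda>x. partial i f x + partial i g x)" for i
    unfolding partial_def[of i f] partial_def[of i g] by (intro ext partial_eqI) (intro derivative_intros D)
  then show ?case using add by (auto intro: bump_algebra.add)
next
  case (mult f g)
  then have D: "(f has_derivative frechet_derivative f (at x)) (at x)" "(g has_derivative frechet_derivative g (at x)) (at x)" for x
    by (auto simp: frechet_derivative_works)
  have "partial i (\<lambda>x. f x * g x) = (\<lambda>x. f x * partial i g x + partial i f x * g x)" for i
    unfolding partial_def[of i f] partial_def[of i g] by (intro ext partial_eqI) (intro derivative_intros D)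
  moreover have "(\<lambda>x. f x * partial i g x + partial i f x * g x) \<in> bump_algebra" for i
    using mult by (intro bump_algebra.add bump_algebra.mult) auto
  moreover have "(\<lambda>x. f x * g x) differentiable at x" for x
    using mult by (intro differentiable_mult) auto
  ultimately show ?case by simp
qed

lemma bump_algebra_Ck: "f \<in> bump_algebra \<Longrightarrow> Ck n f"
proof (induction n arbitrary: f)
  case 0
  then show ?case
    using bump_algebra_deriv[of f] by (auto intro!: differentiable_imp_continuous_on simp: differentiable_on_def)
next
  case (Suc n)
  then show ?case using bump_algebra_deriv[of f] by auto
qed

lemma bump_algebra_prod:
  "finite I \<Longrightarrow> (\<And>i. i \<in> I \<Longrightarrow> f i \<in> bump_algebra) \<Longrightarrow> (\<lambda>x. \<Prod>i\<in>I. f i x) \<in> bump_algebra"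
  by (induction I rule: finite_induct) (auto intro: bump_algebra.const bump_algebra.mult)

text \<open>The parameter \<open>n\<close> controls the steepness: for fixed \<open>n > 0\<close>
  this is a smooth function positive exactly on the open box, and for growing \<open>n\<close> it
  tends to the indicator of that box.\<close>

definition bump :: "real \<Rightarrow> real^'d::finite \<Rightarrow> real^'d \<Rightarrow> real^'d \<Rightarrow> real" where
  "bump n a b x = (\<Prod>i\<in>UNIV. flat 1 (n * (x $ i - a $ i)) * flat 1 (n * (b $ i - x $ i)))"

lemma bump_in_bump_algebra: "bump n a b \<in> bump_algebra"
proof -
  have 1: "(\<lambda>x. flat 1 (n * (x $ i - a $ i)) * flat 1 (n * (b $ i - x $ i))) \<in> bump_algebra" for i
    using bump_algebra.mult[OF bump_algebra.flat[of 1 n i "- n * a $ i"] bump_algebra.flat[of 1 "- n" i "n * b $ i"]]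
    by (simp add: algebra_simps)
  show ?thesis
    using bump_algebra_prod[OF finite, of UNIV "\<lambda>i x. flat 1 (n * (x $ i - a $ i)) * flat 1 (n * (b $ i - x $ i))"] 1
    by (simp add: bump_def[abs_def])
qed

lemma bump_Ck: "Ck k (bump n a b)"
  by (rule bump_algebra_Ck[OF bump_in_bump_algebra])

lemma flat_1_bounds: "0 \<le> flat 1 t" "flat 1 t \<le> 1" "t \<le> 0 \<Longrightarrow> flat 1 t = 0" "t > 0 \<Longrightarrow> flat 1 t > 0"
  by (auto simp: flat_def)

lemma bump_bounds: "0 \<le> bump n a b x" "bump n a b x \<le> 1"
  unfolding bump_def by (auto intro!: prod_nonneg prod_le_1 mult_le_one mult_nonneg_nonneg flat_1_bounds)

lemma bump_zero: "n > 0 \<Longrightarrow> x \<notin> box a b \<Longrightarrow> bump n a b x = 0"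
proof -
  assume n: "n > 0" and x: "x \<notin> box a b"
  obtain i where "x $ i \<le> a $ i \<or> b $ i \<le> x $ i"
    using x unfolding mem_box_cart by (meson not_le)
  then have "n * (x $ i - a $ i) \<le> 0 \<or> n * (b $ i - x $ i) \<le> 0" using n by (auto intro!: mult_nonneg_nonpos)
  then have "flat 1 (n * (x $ i - a $ i)) * flat 1 (n * (b $ i - x $ i)) = 0" using flat_1_bounds(3) by auto
  then show ?thesis unfolding bump_def by (intro prod_zero) auto
qed

lemma bump_pos: "n > 0 \<Longrightarrow> x \<in> box a b \<Longrightarrow> bump n a b x > 0"
  unfolding bump_def by (auto simp: mem_box_cart intro!: prod_pos mult_pos_pos flat_1_bounds)

lemma bump_tendsto: "(\<lambda>n. bump (real (Suc n)) a b x) \<longlonglongrightarrow> indicator (box a b) x"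
proof (cases "x \<in> box a b")
  case True
  have 1: "(\<lambda>n. flat 1 (real (Suc n) * t)) \<longlonglongrightarrow> 1" if "t > 0" for t
  proof -
    have "(\<lambda>n. exp (- (1 / real (Suc n) * (1 / t)))) \<longlonglongrightarrow> exp (- (0 * (1 / t)))"
      by (intro tendsto_intros LIMSEQ_Suc lim_1_over_n)
    moreover have "flat 1 (real (Suc n) * t) = exp (- (1 / real (Suc n) * (1 / t)))" for n
      using that by (simp add: flat_def del: of_nat_Suc)
    ultimately show ?thesis by simp
  qed
  have "(\<lambda>n. bump (real (Suc n)) a b x) \<longlonglongrightarrow> (\<Prod>i\<in>(UNIV::'a set). 1 * 1)"
    unfolding bump_def using True by (intro tendsto_prod tendsto_mult 1) (auto simp: mem_box_cart)
  then show ?thesis using True by simp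
next
  case False
  then show ?thesis by (simp add: bump_zero)
qed

lemma bump_translate: "bump n (a + v) (b + v) x = bump n a b (x - v)"
  by (simp add: bump_def algebra_simps)

lemma bump_test_function: "n > 0 \<Longrightarrow> cbox a b \<subseteq> \<Omega> \<Longrightarrow> bump n a b \<in> test_functions \<Omega>"
  unfolding test_functions_def
  using box_subset_cbox[of a b] by (auto intro!: bump_Ck exI[of _ "cbox a b"] bump_zero)

lemma test_function_differentiable:
  assumes "\<phi> \<in> test_functions \<Omega>"
  shows "\<phi> differentiable (at x)" "continuous_on UNIV \<phi>" "continuous_on UNIV (partial i \<phi>)"
proof -
  have *: "Ck (Suc 0) \<phi>" "Ck 0 \<phi>" using assms unfolding test_functions_def by blast+
  then show "\<phi> differentiable (at x)" "continuous_on UNIV \<phi>" "continuous_on UNIV (partial i \<phi>)" by auto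
qed

lemma test_function_support:
  assumes "\<phi> \<in> test_functions \<Omega>"
  obtains C where "compact C" "C \<subseteq> \<Omega>" "\<And>x. x \<notin> C \<Longrightarrow> \<phi> x = 0" "\<And>x i. x \<notin> C \<Longrightarrow> partial i \<phi> x = 0"
proof -
  obtain C where C: "compact C" "C \<subseteq> \<Omega>" "\<And>x. x \<notin> C \<Longrightarrow> \<phi> x = 0"
    using assms by (auto simp: test_functions_def)
  have "partial i \<phi> x = 0" if "x \<notin> C" for x i
  proof -
    have "open (- C)" using C by (simp add: compact_imp_closed open_Compl)
    have "(\<phi> has_derivative (\<lambda>h. 0)) (at x)"
      by (rule has_derivative_transform_within_open[of "\<lambda>_. 0", OF _ \<open>open (- C)\<close>]) (use that C in auto)
    then show ?thesis by (simp add: partial_eqI)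
  qed
  then show ?thesis using that C by blast
qed

lemma has_derivative_partial:
  assumes "\<phi> differentiable (at (x::real^'d::finite))"
  shows "(\<phi> has_derivative (\<lambda>h. \<Sum>i\<in>UNIV. h $ i * partial i \<phi> x)) (at x)"
proof -
  have D: "(\<phi> has_derivative frechet_derivative \<phi> (at x)) (at x)"
    using assms by (simp add: frechet_derivative_works)
  have "frechet_derivative \<phi> (at x) h = (\<Sum>i\<in>UNIV. h $ i * partial i \<phi> x)" for h
  proof -
    have lin: "linear (frechet_derivative \<phi> (at x))" using D by (rule has_derivative_linear)
    have "frechet_derivative \<phi> (at x) h = frechet_derivative \<phi> (at x) (\<Sum>i\<in>UNIV. h $ i *\<^sub>R axis i 1)"
      by (simp add: basis_expansion scalar_mult_eq_scaleR[symmetric])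
    also have "\<dots> = (\<Sum>i\<in>UNIV. h $ i * partial i \<phi> x)"
      by (simp add: linear_sum[OF lin] linear_cmul[OF lin] partial_def)
    finally show ?thesis .
  qed
  then have "frechet_derivative \<phi> (at x) = (\<lambda>h. \<Sum>i\<in>UNIV. h $ i * partial i \<phi> x)" by blast
  then show ?thesis using D by simp
qed

section \<open>Square-integrable functions and weak derivatives\<close>

lemma ae_eq_lebesgue:
  "S \<in> sets lebesgue \<Longrightarrow> ae_eq S f g \<longleftrightarrow> (AE x in lebesgue. x \<in> S \<longrightarrow> f x = g x)"
  by (simp add: ae_eq_def AE_restrict_space_iff)

lemma ae_eq_refl [simp]: "ae_eq S f f"
  by (simp add: ae_eq_def)

lemma ae_eq_trans: assumes "ae_eq S f g" "ae_eq S g h" shows "ae_eq S f h"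
  using assms unfolding ae_eq_def by eventually_elim simp

lemma ae_eq_add: assumes "ae_eq S f g" "ae_eq S f' g'" shows "ae_eq S (f + f') (g + g')"
  using assms unfolding ae_eq_def by eventually_elim simp

lemma ae_eq_scaleR: "ae_eq S f g \<Longrightarrow> ae_eq S (c *\<^sub>R f) (c *\<^sub>R (g :: _ \<Rightarrow> 'b::real_vector))"
  unfolding ae_eq_def by (elim eventually_mono) simp

lemma L2D: "f \<in> L2 S \<Longrightarrow> f \<in> borel_measurable (lebesgue_on S)"
  "f \<in> L2 S \<Longrightarrow> integrable (lebesgue_on S) (\<lambda>x. (norm (f x))\<^sup>2)"
  by (auto simp: L2_def)

lemma L2_integrable_inner:
  assumes "f \<in> L2 S" "g \<in> L2 S" shows "integrable (lebesgue_on S) (\<lambda>x. f x \<bullet> g x)"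
proof (rule Bochner_Integration.integrable_bound)
  show "integrable (lebesgue_on S) (\<lambda>x. (norm (f x))\<^sup>2 + (norm (g x))\<^sup>2)"
    using assms by (intro Bochner_Integration.integrable_add L2D)
  show "(\<lambda>x. f x \<bullet> g x) \<in> borel_measurable (lebesgue_on S)"
    using assms by (intro borel_measurable_inner L2D)
  have "\<bar>f x \<bullet> g x\<bar> \<le> (norm (f x))\<^sup>2 + (norm (g x))\<^sup>2" for x
  proof -
    have "\<bar>f x \<bullet> g x\<bar> \<le> norm (f x) * norm (g x)" by (rule Cauchy_Schwarz_ineq2)
    also have "\<dots> \<le> (norm (f x))\<^sup>2 + (norm (g x))\<^sup>2"
      using sum_squares_bound[of "norm (f x)" "norm (g x)"]
        mult_nonneg_nonneg[OF norm_ge_zero norm_ge_zero, of "f x" "g x"] by linarith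
    finally show ?thesis .
  qed
  then show "AE x in lebesgue_on S. norm (f x \<bullet> g x) \<le> norm ((norm (f x))\<^sup>2 + (norm (g x))\<^sup>2)"
    by (simp add: abs_of_nonneg)
qed

lemma L2_add: assumes "f \<in> L2 S" "g \<in> L2 S" shows "f + g \<in> L2 S"
proof -
  have "integrable (lebesgue_on S) (\<lambda>x. (norm (f x))\<^sup>2 + 2 * (f x \<bullet> g x) + (norm (g x))\<^sup>2)"
    using assms by (intro Bochner_Integration.integrable_add integrable_mult_right L2D L2_integrable_inner)
  moreover have "(norm (f x + g x))\<^sup>2 = (norm (f x))\<^sup>2 + 2 * (f x \<bullet> g x) + (norm (g x))\<^sup>2" for x
    by (simp add: power2_norm_eq_inner inner_add inner_commute)
  moreover have "f + g \<in> borel_measurable (lebesgue_on S)"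
    unfolding plus_fun_def using assms by (intro borel_measurable_add L2D)
  ultimately show ?thesis by (simp add: L2_def)
qed

lemma L2_scale: "f \<in> L2 S \<Longrightarrow> c *\<^sub>R f \<in> L2 S"
  by (auto simp: L2_def power_mult_distrib scaleR_fun_def intro!: borel_measurable_scaleR)

lemma subspace_L2: "subspace (L2 S)"
  by (intro subspaceI L2_add L2_scale) (simp add: L2_def zero_fun_def)

lemma L2_linear_image:
  assumes "bounded_linear h" "f \<in> L2 S" shows "(\<lambda>x. h (f x)) \<in> L2 S"
proof -
  obtain K where K: "\<And>x. norm (h x) \<le> norm x * K" using bounded_linear.bounded[OF assms(1)] by blast
  have m: "(\<lambda>x. h (f x)) \<in> borel_measurable (lebesgue_on S)"
    using L2D(1)[OF assms(2)] borel_measurable_continuous_onI[OF linear_continuous_on[OF assms(1)]]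
    by (rule measurable_compose)
  have "integrable (lebesgue_on S) (\<lambda>x. (norm (h (f x)))\<^sup>2)"
  proof (rule Bochner_Integration.integrable_bound)
    show "integrable (lebesgue_on S) (\<lambda>x. K\<^sup>2 * (norm (f x))\<^sup>2)"
      using assms by (intro integrable_mult_right L2D)
    have "(norm (h (f x)))\<^sup>2 \<le> K\<^sup>2 * (norm (f x))\<^sup>2" for x
      using power_mono[OF K[of "f x"], of 2] by (simp add: power_mult_distrib mult.commute)
    then show "AE x in lebesgue_on S. norm ((norm (h (f x)))\<^sup>2) \<le> norm (K\<^sup>2 * (norm (f x))\<^sup>2)" by simp
    show "(\<lambda>x. (norm (h (f x)))\<^sup>2) \<in> borel_measurable (lebesgue_on S)"
      using m by measurable
  qed
  then show ?thesis using m by (simp add: L2_def)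
qed

lemma L2_bounded:
  assumes "S \<in> lmeasurable" "f \<in> borel_measurable (lebesgue_on S)" "\<And>x. x \<in> S \<Longrightarrow> norm (f x) \<le> C"
  shows "f \<in> L2 S"
proof -
  have "(norm (f x))\<^sup>2 \<le> C\<^sup>2" if "x \<in> S" for x using assms(3)[OF that] by (intro power_mono) auto
  then have "integrable (lebesgue_on S) (\<lambda>x. (norm (f x))\<^sup>2)"
    using assms by (intro finite_measure.integrable_const_bound[OF finite_measure_lebesgue_on, where B = "C\<^sup>2"]
        AE_I2 borel_measurable_power borel_measurable_norm) simp_all
  then show ?thesis using assms(2) by (simp add: L2_def)
qed

lemma L2_components:
  fixes f :: "real^'d::finite \<Rightarrow> real^'n::finite"
  shows "f \<in> L2 S \<longleftrightarrow> (\<forall>i. (\<lambda>x. f x $ i) \<in> L2 S)"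
proof
  assume "f \<in> L2 S"
  then show "\<forall>i. (\<lambda>x. f x $ i) \<in> L2 S"
    using L2_linear_image[OF bounded_linear_vec_nth] by blast
next
  assume *: "\<forall>i. (\<lambda>x. f x $ i) \<in> L2 S"
  then have m: "f \<in> borel_measurable (lebesgue_on S)"
    by (subst borel_measurable_euclidean_space) (auto simp: Basis_vec_def inner_axis L2_def)
  have "integrable (lebesgue_on S) (\<lambda>x. \<Sum>i\<in>UNIV. (norm (f x $ i))\<^sup>2)"
    using * by (intro Bochner_Integration.integrable_sum) (auto simp: L2_def)
  moreover have "(\<Sum>i\<in>UNIV. (norm (f x $ i))\<^sup>2) = (norm (f x))\<^sup>2" for x
    by (simp only: power2_norm_eq_inner inner_vec_def)
  ultimately show "f \<in> L2 S" using m by (simp add: L2_def)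
qed

lemma l2_inner_add: "f \<in> L2 S \<Longrightarrow> g \<in> L2 S \<Longrightarrow> h \<in> L2 S \<Longrightarrow> l2_inner S (f + g) h = l2_inner S f h + l2_inner S g h"
  by (simp add: l2_inner_def inner_add_left L2_integrable_inner)

lemma l2_inner_commute: "l2_inner S f g = l2_inner S g f"
  by (simp add: l2_inner_def inner_commute)

lemma l2_inner_scale: "l2_inner S (c *\<^sub>R f) h = c * l2_inner S f h"
  by (simp add: l2_inner_def)

lemma psd_form_l2_inner: "psd_form (L2 S) (l2_inner S)"
  unfolding psd_form_def
proof (intro conjI ballI allI)
  show "l2_inner S x y = l2_inner S y x" for x y :: "_ \<Rightarrow> 'b" by (rule l2_inner_commute)
  show "0 \<le> l2_inner S x x" for x :: "_ \<Rightarrow> 'b" by (simp add: l2_inner_def)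
qed (simp_all add: l2_inner_add l2_inner_scale)

lemma l2_inner_ae_cong:
  assumes "ae_eq S f f'" "ae_eq S g g'" "f \<in> L2 S" "f' \<in> L2 S" "g \<in> L2 S" "g' \<in> L2 S"
  shows "l2_inner S f g = l2_inner S f' g'"
  unfolding l2_inner_def
proof (rule Bochner_Integration.integral_cong_AE)
  show "AE x in lebesgue_on S. f x \<bullet> g x = f' x \<bullet> g' x"
    using assms(1,2) unfolding ae_eq_def by eventually_elim simp
qed (use assms in \<open>auto intro: borel_measurable_inner L2D\<close>)

lemma l2_inner_self_eq_0:
  assumes "f \<in> L2 S" shows "l2_inner S f f = 0 \<longleftrightarrow> ae_eq S f 0"
  unfolding l2_inner_def ae_eq_def
  by (subst integral_nonneg_eq_0_iff_AE) (auto simp: L2_integrable_inner assms)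

lemma l2_norm_eq_0: "f \<in> L2 S \<Longrightarrow> l2_norm S f = 0 \<longleftrightarrow> ae_eq S f 0"
  by (simp add: l2_norm_def l2_inner_self_eq_0)

lemma seminorm_on_l2_norm: "seminorm_on (L2 S) (l2_norm S)"
  using seminorm_on_sqrt_psd_form[OF psd_form_l2_inner subspace_L2, of S] by (simp add: l2_norm_def[abs_def])

lemma continuous_compact_support_bounded:
  fixes f :: "'a::euclidean_space \<Rightarrow> real"
  assumes "continuous_on UNIV f" "compact C" "\<And>x. x \<notin> C \<Longrightarrow> f x = 0"
  obtains B where "\<And>x. \<bar>f x\<bar> \<le> B"
proof -
  have "bounded (f ` C)" using assms by (intro compact_imp_bounded compact_continuous_image continuous_on_subset[OF assms(1)]) auto
  then obtain B where "B > 0" "\<And>x. x \<in> C \<Longrightarrow> \<bar>f x\<bar> \<le> B" by (auto simp: bounded_pos)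
  then have "\<bar>f x\<bar> \<le> B" for x using assms(3)[of x] by (cases "x \<in> C") auto
  then show ?thesis using that by blast
qed

lemma borel_measurable_lebesgue_on_continuous:
  "continuous_on UNIV f \<Longrightarrow> f \<in> borel_measurable (lebesgue_on S)"
  by (intro measurable_restrict_space1 measurable_completion) (simp add: borel_measurable_continuous_onI)

lemma test_function_bounded:
  assumes "\<phi> \<in> test_functions \<Omega>"
  obtains B where "\<And>x. \<bar>\<phi> x\<bar> \<le> B" "\<And>x i. \<bar>partial i \<phi> x\<bar> \<le> B"
proof -
  obtain C where C: "compact C" "\<And>x. x \<notin> C \<Longrightarrow> \<phi> x = 0" "\<And>x i. x \<notin> C \<Longrightarrow> partial i \<phi> x = 0"
    using test_function_support[OF assms] by metis
  obtain B0 where B0: "\<And>x. \<bar>\<phi> x\<bar> \<le> B0"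
    using continuous_compact_support_bounded[OF test_function_differentiable(2)[OF assms] C(1,2)] by blast
  have "\<exists>B. \<forall>x. \<bar>partial i \<phi> x\<bar> \<le> B" for i
    using continuous_compact_support_bounded[OF test_function_differentiable(3)[OF assms] C(1) C(3)] by metis
  then obtain B1 where B1: "\<And>i x. \<bar>partial i \<phi> x\<bar> \<le> B1 i" by metis
  have "B1 i \<ge> 0" for i using order.trans[OF abs_ge_zero B1] .
  then have "\<bar>partial i \<phi> x\<bar> \<le> \<bar>B0\<bar> + (\<Sum>i\<in>UNIV. B1 i)" for i x
    using order.trans[OF B1[of i x], of "\<Sum>i\<in>UNIV. B1 i"] member_le_sum[of i UNIV B1] by simp
  moreover have "\<bar>\<phi> x\<bar> \<le> \<bar>B0\<bar> + (\<Sum>i\<in>UNIV. B1 i)" for x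
    using B0[of x] sum_nonneg[of UNIV B1] \<open>\<And>i. B1 i \<ge> 0\<close> by (smt (verit))
  ultimately show ?thesis using that by blast
qed

lemma test_function_L2:
  assumes "\<phi> \<in> test_functions \<Omega>" "S \<in> lmeasurable"
  shows "\<phi> \<in> L2 S" "partial i \<phi> \<in> L2 S" "(\<lambda>x. \<chi> i. partial i \<phi> x) \<in> L2 S"
proof -
  obtain B where B: "\<And>x. \<bar>\<phi> x\<bar> \<le> B" "\<And>x i. \<bar>partial i \<phi> x\<bar> \<le> B"
    using test_function_bounded[OF assms(1)] by blast
  note t = test_function_differentiable[OF assms(1)]
  show 1: "\<phi> \<in> L2 S" "partial i \<phi> \<in> L2 S" for i
    using B t assms(2) by (auto intro!: L2_bounded[where C = B] borel_measurable_lebesgue_on_continuous)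
  show "(\<lambda>x. \<chi> i. partial i \<phi> x) \<in> L2 S" using 1(2) by (simp add: L2_components)
qed

text \<open>Open boxes form an intersection-stable generator of the Borel sets, so a Dynkin argument
  spreads the vanishing of integrals to all Borel sets; the total integral is what complements need.
  A function with vanishing integral over every Borel set is null.\<close>

lemma integral_zero_boxes_imp_AE:
  fixes f :: "'a::euclidean_space \<Rightarrow> real"
  assumes f: "integrable lebesgue f" and box: "\<And>a b. (LINT x|lebesgue. indicator (box a b) x * f x) = 0"
    and "(LINT x|lebesgue. f x) = 0"
  shows "AE x in lebesgue. f x = 0"
proof -
  \<comment> \<open>A Borel representative is needed because the boxes generate only the Borel sets,
    not all Lebesgue measurable ones.\<close>
  obtain g where g: "g \<in> borel_measurable lborel" and fg: "AE x in lborel. f x = g x"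
    using completion_ex_borel_measurable_real[OF borel_measurable_integrable[OF f]] by blast
  have fg': "AE x in lebesgue. f x = g x" using fg by (rule AE_completion)
  have g_leb: "g \<in> borel_measurable lebesgue" using g by (rule measurable_completion)
  have "integrable lebesgue g"
    by (rule integrable_cong_AE_imp[OF f g_leb]) (use fg' in eventually_elim, simp)
  then have gi: "integrable lborel g" using g by (simp add: integrable_completion)
  have int_eq: "(LINT x:A|lborel. g x) = (LINT x|lebesgue. indicator A x * f x)" if A: "A \<in> sets borel" for A
  proof -
    have "(LINT x:A|lborel. g x) = (LINT x|lebesgue. indicator A x * g x)"
      unfolding set_lebesgue_integral_def using A g by (subst integral_completion) auto
    also have "\<dots> = (LINT x|lebesgue. indicator A x * f x)"
    proof (rule Bochner_Integration.integral_cong_AE)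
      show "AE x in lebesgue. indicator A x * g x = indicator A x * f x"
        using fg' by (elim eventually_mono) simp
      have "A \<in> sets lebesgue" using A by auto
      then show "(\<lambda>x. indicator A x * g x) \<in> borel_measurable lebesgue" "(\<lambda>x. indicator A x * f x) \<in> borel_measurable lebesgue"
        using g_leb borel_measurable_integrable[OF f] by (auto intro!: borel_measurable_times)
    qed
    finally show ?thesis .
  qed
  have zero: "(LINT x:A|lborel. g x) = 0" if "A \<in> sets borel" for A
  proof -
    have si: "set_integrable lborel B g" if "B \<in> sets borel" for B
      unfolding set_integrable_def using integrable_mult_indicator[OF _ gi, of B] that by simp
    have "Int_stable (range (\<lambda>(a, b). box a b :: 'a set))"
      by (auto simp: Int_stable_def box_Int_box)
    moreover have "range (\<lambda>(a, b). box a b :: 'a set) \<subseteq> Pow UNIV" by simp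
    moreover have "A \<in> sigma_sets UNIV (range (\<lambda>(a, b). box a b :: 'a set))"
      using that by (simp add: borel_eq_box)
    ultimately show ?thesis
    proof (induction rule: sigma_sets_induct_disjoint)
      fix A :: "'a set" assume "A \<in> range (\<lambda>(a, b). box a b)"
      then show "(LINT x:A|lborel. g x) = 0" using box int_eq by auto
    next
      show "(LINT x:{}|lborel. g x) = 0" by (simp add: set_lebesgue_integral_def)
    next
      fix A :: "'a set" assume A: "A \<in> sigma_sets UNIV (range (\<lambda>(a, b). box a b))" "(LINT x:A|lborel. g x) = 0"
      then have A': "A \<in> sets borel" by (simp add: borel_eq_box)
      have "(LINT x:UNIV|lborel. g x) = (LINT x:A|lborel. g x) + (LINT x:(UNIV - A)|lborel. g x)"
        using set_integral_Un[of A "UNIV - A" lborel g] A' si[of A] si[of "UNIV - A"] by simp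
      moreover have "(LINT x:UNIV|lborel. g x) = 0" using int_eq[of UNIV] assms(3) by simp
      ultimately show "(LINT x:(UNIV - A)|lborel. g x) = 0" using A by simp
    next
      fix A :: "nat \<Rightarrow> 'a set"
      assume A: "disjoint_family A" "range A \<subseteq> sigma_sets UNIV (range (\<lambda>(a, b). box a b))"
        "\<And>i. (LINT x:A i|lborel. g x) = 0"
      then have A': "A i \<in> sets borel" for i by (auto simp: borel_eq_box)
      then have "(LINT x:(\<Union>i. A i)|lborel. g x) = (\<Sum>i. (LINT x:A i|lborel. g x))"
        using A(1) by (intro lebesgue_integral_countable_add si) (auto simp: disjoint_family_on_def)
      then show "(LINT x:\<Union> (range A)|lborel. g x) = 0" using A(3) by simp
    qed
  qed
  have "AE x in lborel. g x = 0" by (rule sigma_finite_measure.density_zero[OF sigma_finite_lborel gi]) (use zero in simp)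
  then have "AE x in lebesgue. g x = 0" by (rule AE_completion)
  then show ?thesis using fg' by eventually_elim simp
qed

text \<open>Bumps converge to indicators of boxes, so dominated convergence turns the hypothesis
  into vanishing integrals over boxes. The argument is run inside closed boxes contained in
  \<Omega>, where \<open>w\<close> is integrable even if \<Omega> is unbounded, and countably many
  of them cover \<Omega>.\<close>

lemma fundamental_lemma:
  fixes w :: "real^'d::finite \<Rightarrow> real"
  assumes "open \<Omega>" and w: "w \<in> L2 \<Omega>" and test: "\<And>\<phi>. \<phi> \<in> test_functions \<Omega> \<Longrightarrow> l2_inner \<Omega> w \<phi> = 0"
  shows "ae_eq \<Omega> w 0"
proof -
  have \<Omega>: "\<Omega> \<in> sets lebesgue" using assms(1) by (simp add: borel_open)
  have wm: "w \<in> borel_measurable (lebesgue_on \<Omega>)" using w by (rule L2D)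
  have box_zero: "AE x in lebesgue. x \<in> cbox c d \<longrightarrow> w x = 0" if cd: "cbox c d \<subseteq> \<Omega>" for c d
  proof -
    have one: "(indicator (cbox c d) :: _ \<Rightarrow> real) \<in> L2 \<Omega>"
    proof -
      have m: "(indicator (cbox c d) :: _ \<Rightarrow> real) \<in> borel_measurable (lebesgue_on \<Omega>)"
        by (intro measurable_restrict_space1 borel_measurable_indicator) auto
      have "integrable (lebesgue_on \<Omega>) (indicator (cbox c d) :: _ \<Rightarrow> real)"
        using \<Omega> cd by (subst integrable_restrict_space) (auto simp: indicator_inter_arith[symmetric] inf.absorb2 lmeasurable_iff_integrable[symmetric])
      moreover have "(\<lambda>x. (norm (indicator (cbox c d) x :: real))\<^sup>2) = indicator (cbox c d)"
        by (auto simp: indicator_def)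
      ultimately show ?thesis using m by (simp add: L2_def)
    qed
    then have wQ: "integrable (lebesgue_on \<Omega>) (\<lambda>x. w x * indicator (cbox c d) x)"
      using L2_integrable_inner[OF w] by simp
    have sub: "(LINT x|lebesgue_on \<Omega>. w x * indicator (box a b) x) = 0" if ab: "cbox a b \<subseteq> cbox c d" for a b
    proof -
      have "(\<lambda>n. LINT x|lebesgue_on \<Omega>. w x * bump (real (Suc n)) a b x) \<longlonglongrightarrow> (LINT x|lebesgue_on \<Omega>. w x * indicator (box a b) x)"
      proof (rule integral_dominated_convergence[where w = "\<lambda>x. \<bar>w x * indicator (cbox c d) x\<bar>"])
        show "AE x in lebesgue_on \<Omega>. norm (w x * bump (real (Suc n)) a b x) \<le> \<bar>w x * indicator (cbox c d) x\<bar>" for n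
        proof (rule AE_I2)
          fix x
          have "bump (real (Suc n)) a b x \<le> indicator (cbox c d) x"
            using bump_bounds(2)[of "real (Suc n)" a b x] bump_zero[of "real (Suc n)" x a b] ab box_subset_cbox[of a b]
            by (cases "x \<in> box a b") (auto simp: indicator_def)
          then show "norm (w x * bump (real (Suc n)) a b x) \<le> \<bar>w x * indicator (cbox c d) x\<bar>"
            using bump_bounds(1)[of "real (Suc n)" a b x] by (simp add: abs_mult mult_left_mono)
        qed
        show "AE x in lebesgue_on \<Omega>. (\<lambda>n. w x * bump (real (Suc n)) a b x) \<longlonglongrightarrow> w x * indicator (box a b) x"
          by (intro AE_I2 tendsto_mult_left bump_tendsto)
        show "(\<lambda>x. w x * bump (real (Suc n)) a b x) \<in> borel_measurable (lebesgue_on \<Omega>)" for n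
        proof -
          have "bump (real (Suc n)) a b \<in> test_functions UNIV" by (rule bump_test_function) auto
          from test_function_differentiable(2)[OF this] show ?thesis
            by (intro borel_measurable_times wm borel_measurable_lebesgue_on_continuous)
        qed
        show "(\<lambda>x. w x * indicator (box a b) x) \<in> borel_measurable (lebesgue_on \<Omega>)"
          by (intro borel_measurable_times wm measurable_restrict_space1 borel_measurable_indicator) auto
      qed (use wQ in auto)
      moreover have "(LINT x|lebesgue_on \<Omega>. w x * bump (real (Suc n)) a b x) = 0" for n
        using test[OF bump_test_function[of "real (Suc n)" a b \<Omega>]] ab cd by (auto simp: l2_inner_def)
      ultimately show ?thesis by (simp add: LIMSEQ_const_iff)
    qed
    \<comment> \<open>\<open>w\<close> cut off to one open box. Any other box meets it in a box
      again, whose closure stays in \<open>cbox c d\<close>.\<close>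
    define f where "f x = indicator \<Omega> x * (w x * indicator (box c d) x)" for x
    have leb: "(LINT x|lebesgue_on \<Omega>. h x) = (LINT x|lebesgue. indicator \<Omega> x * h x)" for h :: "_ \<Rightarrow> real"
      using \<Omega> by (simp add: integral_restrict_space)
    have "integrable (lebesgue_on \<Omega>) (\<lambda>x. indicator (box c d) x *\<^sub>R (w x * indicator (cbox c d) x))"
    proof (intro integrable_mult_indicator wQ)
      have "box c d \<subseteq> \<Omega>" using cd box_subset_cbox[of c d] by blast
      then show "box c d \<in> sets (lebesgue_on \<Omega>)" using \<Omega> by (simp add: sets_restrict_space_iff)
    qed
    then have "integrable (lebesgue_on \<Omega>) (\<lambda>x. w x * indicator (box c d) x)"
      by (rule back_subst[of "integrable _"]) (use box_subset_cbox in \<open>auto simp: indicator_def fun_eq_iff\<close>)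
    then have fi: "integrable lebesgue f" using \<Omega> by (simp add: integrable_restrict_space f_def[abs_def])
    have "AE x in lebesgue. f x = 0"
    proof (rule integral_zero_boxes_imp_AE[OF fi])
      show "(LINT x|lebesgue. f x) = 0" using sub[of c d] by (simp add: leb f_def)
      fix a b :: "real^'d"
      obtain a' b' where *: "box a b \<inter> box c d = box a' b'" by (auto simp: box_Int_box)
      have "(LINT x|lebesgue_on \<Omega>. w x * indicator (box a' b') x) = 0"
      proof (cases "box a' b' = {}")
        case False
        have "box a' b' \<subseteq> cbox c d" using * box_subset_cbox[of c d] by blast
        then have "cbox a' b' \<subseteq> cbox c d" using False closure_box[OF False] by (metis closed_cbox closure_minimal)
        then show ?thesis by (rule sub)
      qed simp
      then show "(LINT x|lebesgue. indicator (box a b) x * f x) = 0"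
        unfolding leb *[symmetric] by (simp add: f_def indicator_inter_arith mult_ac)
    qed
    \<comment> \<open>The cut-off function says nothing about the faces of the box, but these are
      null.\<close>
    moreover have "AE x in lebesgue. x \<notin> cbox c d - box c d"
      by (rule AE_not_in) (use negligible_frontier_interval[of c d] in \<open>simp add: negligible_iff_null_sets\<close>)
    ultimately show ?thesis by eventually_elim (use cd in \<open>auto simp: f_def indicator_def\<close>)
  qed
  obtain D where D: "D \<subseteq> Pow \<Omega>" "countable D" "\<And>Q. Q \<in> D \<Longrightarrow> \<exists>a b. Q = cbox a b" "\<Union>D = \<Omega>"
    using open_countable_Union_open_cbox[OF assms(1)] by metis
  have "AE x in lebesgue. \<forall>Q\<in>D. x \<in> Q \<longrightarrow> w x = 0"
    unfolding AE_ball_countable[OF D(2)] using D(1,3) box_zero by fastforce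
  then show ?thesis unfolding ae_eq_lebesgue[OF \<Omega>] using D(4) by (elim eventually_mono) auto
qed

lemma l2_inner_diff:
  "f \<in> L2 S \<Longrightarrow> g \<in> L2 S \<Longrightarrow> h \<in> L2 S \<Longrightarrow> l2_inner S (f - g) h = l2_inner S f h - l2_inner S g h"
  by (rule psd_form_diff[OF psd_form_l2_inner subspace_L2])

section \<open>Uniqueness and linearity of weak derivatives, almost everywhere\<close>

lemma weak_partial_unique:
  assumes "open \<Omega>" "bounded \<Omega>" "w \<in> L2 \<Omega>" "w' \<in> L2 \<Omega>" "weak_partial \<Omega> i v w" "weak_partial \<Omega> i v w'"
  shows "ae_eq \<Omega> w w'"
proof -
  have "ae_eq \<Omega> (w - w') 0"
  proof (rule fundamental_lemma[OF assms(1)])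
    show "w - w' \<in> L2 \<Omega>" using assms subspace_diff[OF subspace_L2] by blast
    fix \<phi> assume *: "\<phi> \<in> test_functions \<Omega>"
    have "\<Omega> \<in> lmeasurable" using assms by (simp add: lmeasurable_open)
    then show "l2_inner \<Omega> (w - w') \<phi> = 0"
      using * assms l2_inner_diff[OF assms(3,4) test_function_L2(1)[OF *]] by (simp add: weak_partial_def)
  qed
  then show ?thesis unfolding ae_eq_def by (elim eventually_mono) simp
qed

lemma weak_div_unique':
  assumes "open \<Omega>" "bounded \<Omega>" "w \<in> L2 \<Omega>" "w' \<in> L2 \<Omega>" "is_weak_div \<Omega> q w" "is_weak_div \<Omega> q w'"
  shows "ae_eq \<Omega> w w'"
proof -
  have "ae_eq \<Omega> (w - w') 0"
  proof (rule fundamental_lemma[OF assms(1)])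
    show "w - w' \<in> L2 \<Omega>" using assms subspace_diff[OF subspace_L2] by blast
    fix \<phi> assume *: "\<phi> \<in> test_functions \<Omega>"
    have "\<Omega> \<in> lmeasurable" using assms by (simp add: lmeasurable_open)
    then show "l2_inner \<Omega> (w - w') \<phi> = 0"
      using * assms l2_inner_diff[OF assms(3,4) test_function_L2(1)[OF *]] by (simp add: is_weak_div_def)
  qed
  then show ?thesis unfolding ae_eq_def by (elim eventually_mono) simp
qed

lemma weak_div:
  assumes "q \<in> Hdiv \<Omega>" shows "weak_div \<Omega> q \<in> L2 \<Omega>" "is_weak_div \<Omega> q (weak_div \<Omega> q)"
  using assms someI_ex[of "\<lambda>w. w \<in> L2 \<Omega> \<and> is_weak_div \<Omega> q w"] by (auto simp: Hdiv_def weak_div_def)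

lemma weak_div_unique:
  assumes "open \<Omega>" "bounded \<Omega>" "q \<in> L2 \<Omega>" "w \<in> L2 \<Omega>" "is_weak_div \<Omega> q w"
  shows "ae_eq \<Omega> (weak_div \<Omega> q) w" "q \<in> Hdiv \<Omega>"
proof -
  show "q \<in> Hdiv \<Omega>" using assms by (auto simp: Hdiv_def)
  then show "ae_eq \<Omega> (weak_div \<Omega> q) w" using weak_div_unique'[OF assms(1,2) _ assms(4) _ assms(5)] weak_div by blast
qed

lemma weak_grad:
  assumes "u \<in> H1 \<Omega>"
  shows "weak_grad \<Omega> u \<in> L2 \<Omega>" "weak_partial \<Omega> i u (\<lambda>x. weak_grad \<Omega> u x $ i)"
proof -
  have 1: "(SOME w. w \<in> L2 \<Omega> \<and> weak_partial \<Omega> i u w) \<in> L2 \<Omega> \<and> weak_partial \<Omega> i u (SOME w. w \<in> L2 \<Omega> \<and> weak_partial \<Omega> i u w)" for i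
    using assms someI_ex[of "\<lambda>w. w \<in> L2 \<Omega> \<and> weak_partial \<Omega> i u w"] by (auto simp: H1_def)
  then show "weak_grad \<Omega> u \<in> L2 \<Omega>" by (auto simp: L2_components weak_grad_def)
  show "weak_partial \<Omega> i u (\<lambda>x. weak_grad \<Omega> u x $ i)" using 1[of i] by (simp add: weak_grad_def)
qed

lemma weak_grad_unique:
  assumes "open \<Omega>" "bounded \<Omega>" "u \<in> L2 \<Omega>" "G \<in> L2 \<Omega>" "\<And>i. weak_partial \<Omega> i u (\<lambda>x. G x $ i)"
  shows "ae_eq \<Omega> (weak_grad \<Omega> u) G" "u \<in> H1 \<Omega>"
proof -
  have G: "(\<lambda>x. G x $ i) \<in> L2 \<Omega>" for i using assms(4) by (simp add: L2_components)
  then show u: "u \<in> H1 \<Omega>" using assms by (auto simp: H1_def)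
  have "ae_eq \<Omega> (\<lambda>x. weak_grad \<Omega> u x $ i) (\<lambda>x. G x $ i)" for i
    using weak_partial_unique[OF assms(1,2) _ G weak_grad(2)[OF u] assms(5)] weak_grad(1)[OF u] by (simp add: L2_components)
  then have "AE x in lebesgue_on \<Omega>. \<forall>i\<in>UNIV. weak_grad \<Omega> u x $ i = G x $ i"
    unfolding ae_eq_def by (intro AE_finite_allI) auto
  then show "ae_eq \<Omega> (weak_grad \<Omega> u) G"
    unfolding ae_eq_def by (elim eventually_mono) (simp add: vec_eq_iff)
qed

context
  fixes \<Omega> :: "(real^'d::finite) set"
  assumes \<Omega>: "open \<Omega>" "bounded \<Omega>"
begin

lemma \<Omega>_lmeasurable: "\<Omega> \<in> lmeasurable"
  using \<Omega> by (simp add: lmeasurable_open)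

lemmas l2_inner_add_test = l2_inner_add[OF _ _ test_function_L2(1)[OF _ \<Omega>_lmeasurable]]
  l2_inner_add[OF _ _ test_function_L2(2)[OF _ \<Omega>_lmeasurable]]
  l2_inner_add[OF _ _ test_function_L2(3)[OF _ \<Omega>_lmeasurable]]

lemma weak_grad_add:
  assumes "u \<in> H1 \<Omega>" "v \<in> H1 \<Omega>"
  shows "ae_eq \<Omega> (weak_grad \<Omega> (u + v)) (weak_grad \<Omega> u + weak_grad \<Omega> v)" "u + v \<in> H1 \<Omega>"
proof -
  have L: "u \<in> L2 \<Omega>" "v \<in> L2 \<Omega>" using assms by (auto simp: H1_def)
  have C: "(\<lambda>x. weak_grad \<Omega> u x $ i) \<in> L2 \<Omega>" "(\<lambda>x. weak_grad \<Omega> v x $ i) \<in> L2 \<Omega>" for i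
    using weak_grad(1)[OF assms(1)] weak_grad(1)[OF assms(2)] by (auto simp: L2_components)
  have "weak_partial \<Omega> i (u + v) ((\<lambda>x. weak_grad \<Omega> u x $ i) + (\<lambda>x. weak_grad \<Omega> v x $ i))" for i
    using weak_grad(2)[OF assms(1), of i] weak_grad(2)[OF assms(2), of i]
    by (simp add: weak_partial_def l2_inner_add_test L C)
  then have "weak_partial \<Omega> i (u + v) (\<lambda>x. (weak_grad \<Omega> u + weak_grad \<Omega> v) x $ i)" for i
    by (simp add: plus_fun_def)
  note * = weak_grad_unique[OF \<Omega> L2_add[OF L] L2_add[OF weak_grad(1)[OF assms(1)] weak_grad(1)[OF assms(2)]] this]
  show "ae_eq \<Omega> (weak_grad \<Omega> (u + v)) (weak_grad \<Omega> u + weak_grad \<Omega> v)" "u + v \<in> H1 \<Omega>" by (rule *)+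
qed

lemma weak_grad_scale:
  assumes "u \<in> H1 \<Omega>"
  shows "ae_eq \<Omega> (weak_grad \<Omega> (c *\<^sub>R u)) (c *\<^sub>R weak_grad \<Omega> u)" "c *\<^sub>R u \<in> H1 \<Omega>"
proof -
  have "weak_partial \<Omega> i (c *\<^sub>R u) (c *\<^sub>R (\<lambda>x. weak_grad \<Omega> u x $ i))" for i
    using weak_grad(2)[OF assms(1), of i] by (simp add: weak_partial_def l2_inner_scale)
  then have "weak_partial \<Omega> i (c *\<^sub>R u) (\<lambda>x. (c *\<^sub>R weak_grad \<Omega> u) x $ i)" for i
    by (simp add: scaleR_fun_def)
  moreover have "u \<in> L2 \<Omega>" using assms by (simp add: H1_def)
  ultimately have * : "ae_eq \<Omega> (weak_grad \<Omega> (c *\<^sub>R u)) (c *\<^sub>R weak_grad \<Omega> u) \<and> c *\<^sub>R u \<in> H1 \<Omega>"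
    using weak_grad_unique[OF \<Omega> L2_scale L2_scale[OF weak_grad(1)[OF assms(1)]], of u c c] by blast
  then show "ae_eq \<Omega> (weak_grad \<Omega> (c *\<^sub>R u)) (c *\<^sub>R weak_grad \<Omega> u)" "c *\<^sub>R u \<in> H1 \<Omega>" by auto
qed

lemma weak_div_add:
  assumes "p \<in> Hdiv \<Omega>" "q \<in> Hdiv \<Omega>"
  shows "ae_eq \<Omega> (weak_div \<Omega> (p + q)) (weak_div \<Omega> p + weak_div \<Omega> q)" "p + q \<in> Hdiv \<Omega>"
proof -
  have L: "p \<in> L2 \<Omega>" "q \<in> L2 \<Omega>" using assms by (auto simp: Hdiv_def)
  have "is_weak_div \<Omega> (p + q) (weak_div \<Omega> p + weak_div \<Omega> q)"
    using weak_div[OF assms(1)] weak_div[OF assms(2)]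
    by (simp add: is_weak_div_def l2_inner_add_test L)
  from weak_div_unique[OF \<Omega> _ _ this]
  show "ae_eq \<Omega> (weak_div \<Omega> (p + q)) (weak_div \<Omega> p + weak_div \<Omega> q)" "p + q \<in> Hdiv \<Omega>"
    using L weak_div(1)[OF assms(1)] weak_div(1)[OF assms(2)] by (auto intro: L2_add)
qed

lemma weak_div_scale:
  assumes "q \<in> Hdiv \<Omega>"
  shows "ae_eq \<Omega> (weak_div \<Omega> (c *\<^sub>R q)) (c *\<^sub>R weak_div \<Omega> q)" "c *\<^sub>R q \<in> Hdiv \<Omega>"
proof -
  have "is_weak_div \<Omega> (c *\<^sub>R q) (c *\<^sub>R weak_div \<Omega> q)"
    using weak_div[OF assms(1)] by (simp add: is_weak_div_def l2_inner_scale)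
  from weak_div_unique[OF \<Omega> _ _ this]
  show "ae_eq \<Omega> (weak_div \<Omega> (c *\<^sub>R q)) (c *\<^sub>R weak_div \<Omega> q)" "c *\<^sub>R q \<in> Hdiv \<Omega>"
    using assms weak_div(1)[OF assms(1)] by (auto intro: L2_scale simp: Hdiv_def)
qed

text \<open>Null functions have to be members of the discrete spaces: the difference between a
  discrete function and its representative in a finite span is one of them.\<close>

lemma ae_zero_imp_H1:
  assumes "u \<in> L2 \<Omega>" "ae_eq \<Omega> u 0"
  shows "u \<in> H1 \<Omega>" "ae_eq \<Omega> (weak_grad \<Omega> u) 0"
proof -
  have "weak_partial \<Omega> i u (\<lambda>x. (0 :: _ \<Rightarrow> real^'d) x $ i)" for i
  proof -
    have "l2_inner \<Omega> u (partial i \<phi>) = 0" if "\<phi> \<in> test_functions \<Omega>" for \<phi>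
      using l2_inner_ae_cong[OF assms(2) ae_eq_refl assms(1) subspace_0[OF subspace_L2]] 
        test_function_L2(2)[OF that \<Omega>_lmeasurable] by (simp add: l2_inner_def)
    then show ?thesis by (simp add: weak_partial_def l2_inner_def)
  qed
  note * = weak_grad_unique[OF \<Omega> assms(1) subspace_0[OF subspace_L2] this]
  show "u \<in> H1 \<Omega>" "ae_eq \<Omega> (weak_grad \<Omega> u) 0" by (rule *)+
qed

lemma ae_zero_imp_Hdiv:
  assumes "q \<in> L2 \<Omega>" "ae_eq \<Omega> q 0"
  shows "q \<in> Hdiv \<Omega>" "ae_eq \<Omega> (weak_div \<Omega> q) 0"
proof -
  have "is_weak_div \<Omega> q 0"
  proof -
    have "l2_inner \<Omega> q (\<lambda>x. \<chi> i. partial i \<phi> x) = 0" if "\<phi> \<in> test_functions \<Omega>" for \<phi>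
      using l2_inner_ae_cong[OF assms(2) ae_eq_refl assms(1) subspace_0[OF subspace_L2]] 
        test_function_L2(3)[OF that \<Omega>_lmeasurable] by (simp add: l2_inner_def)
    then show ?thesis by (simp add: is_weak_div_def l2_inner_def)
  qed
  from weak_div_unique[OF \<Omega> assms(1) subspace_0[OF subspace_L2] this]
  show "q \<in> Hdiv \<Omega>" "ae_eq \<Omega> (weak_div \<Omega> q) 0" by auto
qed

end

section \<open>Functions with vanishing weak gradient\<close>

lemma integral_lborel_shift:
  fixes f :: "'a::euclidean_space \<Rightarrow> real"
  assumes "f \<in> borel_measurable borel"
  shows "(LINT x|lborel. f (x + t)) = (LINT x|lborel. f x)"
proof -
  have "(LINT x|lborel. f x) = (LINT x|distr lborel borel ((+) t). f x)" by (simp add: lborel_distr_plus)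
  also have "\<dots> = (LINT x|lborel. f (t + x))" using assms by (subst integral_distr) auto
  finally show ?thesis by (simp add: add.commute)
qed

lemma has_real_derivative_along:
  assumes "(f has_derivative D) (at (x + t *\<^sub>R e))"
  shows "((\<lambda>t. f (x + t *\<^sub>R e)) has_real_derivative D e) (at t)"
proof -
  have "((\<lambda>t. x + t *\<^sub>R e) has_derivative (\<lambda>h. h *\<^sub>R e)) (at t)" by (auto intro!: derivative_eq_intros)
  from has_derivative_compose[OF this assms]
  have "((\<lambda>t. f (x + t *\<^sub>R e)) has_derivative (\<lambda>h. D (h *\<^sub>R e))) (at t)" .
  moreover have "D (h *\<^sub>R e) = D e * h" for h
    using linear_cmul[OF has_derivative_linear[OF assms]] by simp
  ultimately show ?thesis by (simp add: has_field_derivative_def)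
qed

lemma has_derivative_at_0_sequence:
  assumes "(g has_real_derivative d) (at (0::real))" "X \<longlonglongrightarrow> 0" "\<And>n. X n \<noteq> 0"
  shows "(\<lambda>n. (g (X n) - g 0) / X n) \<longlonglongrightarrow> d"
proof -
  have "((\<lambda>h. (g h - g 0) / h) \<longlongrightarrow> d) (at 0)" using assms(1) by (simp add: DERIV_def)
  moreover have "filterlim X (at 0) sequentially" using assms(2,3) by (auto simp: filterlim_at)
  ultimately show ?thesis by (rule filterlim_compose)
qed

context
  fixes \<Omega> :: "(real^'d::finite) set" and v :: "real^'d \<Rightarrow> real"
  assumes \<Omega>: "open \<Omega>" "bounded \<Omega>" and v: "v \<in> L2 \<Omega>"
    and zero_grad: "\<And>\<phi> i. \<phi> \<in> test_functions \<Omega> \<Longrightarrow> l2_inner \<Omega> v (partial i \<phi>) = 0"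
begin

text \<open>The derivative in \<open>t\<close> of the pairing with the bump translated by
  \<open>t *\<^sub>R e\<close> is minus the pairing with its derivative along \<open>e\<close>, a
  combination of partial derivatives of a test function, and hence zero. Local averages of
  \<open>v\<close> are thus the same at both ends.\<close>

lemma l2_inner_bump_translate:
  assumes box: "\<And>t. 0 \<le> t \<Longrightarrow> t \<le> 1 \<Longrightarrow> cbox (a + t *\<^sub>R e) (b + t *\<^sub>R e) \<subseteq> \<Omega>"
  shows "l2_inner \<Omega> v (bump 1 a b) = l2_inner \<Omega> v (bump 1 (a + e) (b + e))"
proof -
  let ?\<phi> = "bump 1 a b"
  define \<psi> where "\<psi> x = (\<Sum>i\<in>UNIV. e $ i * partial i ?\<phi> x)" for x
  define F where "F t = l2_inner \<Omega> v (bump 1 (a + t *\<^sub>R e) (b + t *\<^sub>R e))" for t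
  have \<phi>: "?\<phi> \<in> test_functions UNIV" by (rule bump_test_function) auto
  obtain B where B: "\<And>x. \<bar>?\<phi> x\<bar> \<le> B" "\<And>x i. \<bar>partial i ?\<phi> x\<bar> \<le> B"
    using test_function_bounded[OF \<phi>] by blast
  \<comment> \<open>A Lipschitz constant of the bump along \<open>e\<close>; it dominates the
    difference quotients.\<close>
  define L where "L = (\<Sum>i\<in>UNIV. \<bar>e $ i\<bar> * B)"
  have \<psi>_L: "\<bar>\<psi> x\<bar> \<le> L" for x
    unfolding \<psi>_def L_def by (rule order.trans[OF sum_abs]) (auto intro!: sum_mono mult_left_mono B simp: abs_mult)
  have D: "(?\<phi> has_derivative (\<lambda>h. \<Sum>i\<in>UNIV. h $ i * partial i ?\<phi> x)) (at x)" for x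
    by (rule has_derivative_partial[OF test_function_differentiable(1)[OF \<phi>]])
  have along: "((\<lambda>s. ?\<phi> (x + s *\<^sub>R e)) has_real_derivative \<psi> (x + s *\<^sub>R e)) (at s)" for x s
    using has_real_derivative_along[OF D] by (simp add: \<psi>_def)
  have lip: "\<bar>?\<phi> (x + s *\<^sub>R e) - ?\<phi> x\<bar> \<le> L * \<bar>s\<bar>" for x s
    using field_differentiable_bound[OF convex_UNIV, of "\<lambda>s. ?\<phi> (x + s *\<^sub>R e)" "\<lambda>s. \<psi> (x + s *\<^sub>R e)" L 0 s]
      along \<psi>_L by (simp add: dist_norm norm_minus_commute abs_minus_commute)
  have vi: "integrable (lebesgue_on \<Omega>) v"
  proof -
    have "(\<lambda>x. 1::real) \<in> L2 \<Omega>"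
      using \<Omega> by (intro L2_bounded[where C = 1] lmeasurable_open) auto
    from L2_integrable_inner[OF v this] show ?thesis by simp
  qed
  have shift_cont: "continuous_on UNIV (\<lambda>x. f (x - s))" if "continuous_on UNIV f" for f :: "real^'d \<Rightarrow> real" and s
  proof -
    have "continuous_on UNIV (\<lambda>x. x - s)" by (intro continuous_intros)
    from continuous_on_compose2[OF that this] show ?thesis by simp
  qed
  have F': "(F has_real_derivative 0) (at t within {0..1})" if t: "0 \<le> t" "t \<le> 1" for t
  proof -
    have "((\<lambda>h. (F (t + h) - F t) / h) \<longlongrightarrow> (LINT x|lebesgue_on \<Omega>. v x * - \<psi> (x - t *\<^sub>R e))) (at 0)"
      unfolding tendsto_at_iff_sequentially
    proof (intro allI impI)
      fix X :: "nat \<Rightarrow> real" assume X: "\<forall>n. X n \<in> UNIV - {0}" "X \<longlonglongrightarrow> 0"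
      have meas: "(\<lambda>x. v x * ?\<phi> (x - s)) \<in> borel_measurable (lebesgue_on \<Omega>)" for s
        by (intro borel_measurable_times L2D(1)[OF v] borel_measurable_lebesgue_on_continuous
            shift_cont test_function_differentiable(2)[OF \<phi>])
      have int: "integrable (lebesgue_on \<Omega>) (\<lambda>x. v x * ?\<phi> (x - s))" for s
      proof (rule Bochner_Integration.integrable_bound[OF integrable_mult_right[OF vi, of B] meas])
        show "AE x in lebesgue_on \<Omega>. norm (v x * ?\<phi> (x - s)) \<le> norm (B * v x)"
          using B(1) order.trans[OF abs_ge_zero B(1)] 
          by (auto intro!: AE_I2 simp: abs_mult mult.commute[of B] mult_left_mono)
      qed
      have quot: "(F (t + X n) - F t) / X n = (LINT x|lebesgue_on \<Omega>. v x * ((?\<phi> (x - (t + X n) *\<^sub>R e) - ?\<phi> (x - t *\<^sub>R e)) / X n))" for n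
      proof -
        have "F s = (LINT x|lebesgue_on \<Omega>. v x * ?\<phi> (x - s *\<^sub>R e))" for s
          by (simp add: F_def l2_inner_def bump_translate)
        then have "F (t + X n) - F t = (LINT x|lebesgue_on \<Omega>. v x * ?\<phi> (x - (t + X n) *\<^sub>R e) - v x * ?\<phi> (x - t *\<^sub>R e))"
          using int by simp
        then have "(F (t + X n) - F t) / X n = (LINT x|lebesgue_on \<Omega>. (v x * ?\<phi> (x - (t + X n) *\<^sub>R e) - v x * ?\<phi> (x - t *\<^sub>R e)) / X n)"
          by simp
        then show ?thesis by (simp add: right_diff_distrib)
      qed
      have "(\<lambda>n. LINT x|lebesgue_on \<Omega>. v x * ((?\<phi> (x - (t + X n) *\<^sub>R e) - ?\<phi> (x - t *\<^sub>R e)) / X n))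
        \<longlonglongrightarrow> (LINT x|lebesgue_on \<Omega>. v x * - \<psi> (x - t *\<^sub>R e))"
      proof (rule integral_dominated_convergence[where w = "\<lambda>x. L * \<bar>v x\<bar>"])
        have "continuous_on UNIV \<psi>"
          unfolding \<psi>_def using test_function_differentiable(3)[OF \<phi>] by (intro continuous_intros)
        then show "(\<lambda>x. v x * - \<psi> (x - t *\<^sub>R e)) \<in> borel_measurable (lebesgue_on \<Omega>)"
          by (intro borel_measurable_times L2D(1)[OF v] borel_measurable_lebesgue_on_continuous
              continuous_on_minus shift_cont)
        show "(\<lambda>x. v x * ((?\<phi> (x - (t + X n) *\<^sub>R e) - ?\<phi> (x - t *\<^sub>R e)) / X n)) \<in> borel_measurable (lebesgue_on \<Omega>)" for n
        proof -
          have "(\<lambda>x. (v x * ?\<phi> (x - (t + X n) *\<^sub>R e) - v x * ?\<phi> (x - t *\<^sub>R e)) / X n) \<in> borel_measurable (lebesgue_on \<Omega>)"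
            by (intro borel_measurable_divide borel_measurable_diff borel_measurable_const meas)
          then show ?thesis by (simp add: right_diff_distrib)
        qed
        show "integrable (lebesgue_on \<Omega>) (\<lambda>x. L * \<bar>v x\<bar>)" using vi by simp
        show "AE x in lebesgue_on \<Omega>. norm (v x * ((?\<phi> (x - (t + X n) *\<^sub>R e) - ?\<phi> (x - t *\<^sub>R e)) / X n)) \<le> L * \<bar>v x\<bar>" for n
        proof (rule AE_I2)
          fix x
          have "\<bar>?\<phi> (x - (t + X n) *\<^sub>R e) - ?\<phi> (x - t *\<^sub>R e)\<bar> \<le> L * \<bar>X n\<bar>"
            using lip[of "x - t *\<^sub>R e" "- X n"] by (simp add: algebra_simps)
          then have "\<bar>(?\<phi> (x - (t + X n) *\<^sub>R e) - ?\<phi> (x - t *\<^sub>R e)) / X n\<bar> \<le> L"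
            using X(1) by (simp add: field_simps abs_divide)
          from mult_left_mono[OF this abs_ge_zero[of "v x"]]
          show "norm (v x * ((?\<phi> (x - (t + X n) *\<^sub>R e) - ?\<phi> (x - t *\<^sub>R e)) / X n)) \<le> L * \<bar>v x\<bar>"
            by (simp only: real_norm_def abs_mult mult.commute[of L])
        qed
        show "AE x in lebesgue_on \<Omega>. (\<lambda>n. v x * ((?\<phi> (x - (t + X n) *\<^sub>R e) - ?\<phi> (x - t *\<^sub>R e)) / X n)) \<longlonglongrightarrow> v x * - \<psi> (x - t *\<^sub>R e)"
        proof (intro AE_I2 tendsto_mult_left)
          fix x
          \<comment> \<open>Moving the bump forward moves its argument
            \<open>x - t *\<^sub>R e\<close> backward, hence the sequence
            \<open>- X n\<close>.\<close>
          have X': "(\<lambda>n. - X n) \<longlonglongrightarrow> 0" "\<And>n. - X n \<noteq> 0" using X tendsto_minus[OF X(2)] by auto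
          from has_derivative_at_0_sequence[OF _ X', of "\<lambda>s. ?\<phi> ((x - t *\<^sub>R e) + s *\<^sub>R e)" "\<psi> (x - t *\<^sub>R e)"]
          have "(\<lambda>n. (?\<phi> ((x - t *\<^sub>R e) + (- X n) *\<^sub>R e) - ?\<phi> (x - t *\<^sub>R e)) / (- X n)) \<longlonglongrightarrow> \<psi> (x - t *\<^sub>R e)"
            using along[of "x - t *\<^sub>R e" 0] by simp
          from tendsto_minus[OF this]
          show "(\<lambda>n. (?\<phi> (x - (t + X n) *\<^sub>R e) - ?\<phi> (x - t *\<^sub>R e)) / X n) \<longlonglongrightarrow> - \<psi> (x - t *\<^sub>R e)"
            by (simp add: algebra_simps)
        qed
      qed
      then show "((\<lambda>h. (F (t + h) - F t) / h) \<circ> X) \<longlonglongrightarrow> (LINT x|lebesgue_on \<Omega>. v x * - \<psi> (x - t *\<^sub>R e))"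
        by (simp add: o_def quot)
    qed
    moreover have "(LINT x|lebesgue_on \<Omega>. v x * - \<psi> (x - t *\<^sub>R e)) = 0"
    proof -
      let ?\<phi>t = "bump 1 (a + t *\<^sub>R e) (b + t *\<^sub>R e)"
      have \<phi>t: "?\<phi>t \<in> test_functions \<Omega>" by (rule bump_test_function) (use box t in auto)
      have eq: "partial i ?\<phi>t x = partial i ?\<phi> (x - t *\<^sub>R e)" for i x
      proof -
        have "((\<lambda>x. x - t *\<^sub>R e) has_derivative (\<lambda>h. h)) (at x)" by (auto intro!: derivative_eq_intros)
        from has_derivative_compose[OF this D]
        have "(?\<phi>t has_derivative (\<lambda>h. \<Sum>i\<in>UNIV. h $ i * partial i ?\<phi> (x - t *\<^sub>R e))) (at x)"
          by (simp add: bump_translate[abs_def])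
        from partial_eqI[OF this, of i] show ?thesis
          by (simp add: axis_def if_distrib[of "\<lambda>c. c * _"] cong: if_cong)
      qed
      have "(LINT x|lebesgue_on \<Omega>. v x * - \<psi> (x - t *\<^sub>R e)) = (LINT x|lebesgue_on \<Omega>. (\<Sum>i\<in>UNIV. - e $ i * (v x * partial i ?\<phi>t x)))"
        by (simp add: \<psi>_def eq sum_distrib_left sum_negf mult_ac)
      also have "\<dots> = (\<Sum>i\<in>UNIV. LINT x|lebesgue_on \<Omega>. - e $ i * (v x * partial i ?\<phi>t x))"
        using L2_integrable_inner[OF v test_function_L2(2)[OF \<phi>t lmeasurable_open[OF \<Omega>(2,1)]]]
        by (intro Bochner_Integration.integral_sum integrable_mult_right) simp
      also have "\<dots> = 0"
        using zero_grad[OF \<phi>t] by (simp add: l2_inner_def)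
      finally show ?thesis .
    qed
    ultimately have "(F has_real_derivative 0) (at t)" by (simp add: DERIV_def)
    then show ?thesis by (rule has_field_derivative_at_within)
  qed
  obtain c where "\<And>t. t \<in> {0..1} \<Longrightarrow> F t = c"
    using has_field_derivative_zero_constant[of "{0..1}" F] F' by auto
  then have "F 0 = F 1" by simp
  then show ?thesis by (simp add: F_def)
qed

text \<open>If the values at the two points were strictly ordered, two levels between them would
  separate the averages of \<open>v\<close> against a bump at \<open>x\<close> and against its
  translate at \<open>x'\<close>, which are equal. One inequality suffices, as the roles of the
  points can be exchanged.\<close>

lemma zero_grad_le:
  assumes conv: "convex \<Omega>" and U: "open U" "U \<subseteq> \<Omega>" "x \<in> U" "ae_eq U v P" "isCont P x"
    and U': "open U'" "U' \<subseteq> \<Omega>" "x' \<in> U'" "ae_eq U' v P'" "isCont P' x'"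
  shows "P' x' \<le> P x"
proof (rule ccontr)
  assume "\<not> P' x' \<le> P x"
  then obtain m m' where m: "P x < m" "m < m'" "m' < P' x'" by (meson dense not_le)
  have "\<forall>\<^sub>F z in at x. P z < m" "\<forall>\<^sub>F z in at x'. m' < P' z"
    using U(5) U'(5) m order_tendstoD[of P "P x" "at x"] order_tendstoD[of P' "P' x'" "at x'"] by (auto simp: isCont_def)
  then obtain r1 r2 where r12: "r1 > 0" "r2 > 0" "\<And>z. z \<noteq> x \<Longrightarrow> dist z x < r1 \<Longrightarrow> P z < m" "\<And>z. z \<noteq> x' \<Longrightarrow> dist z x' < r2 \<Longrightarrow> m' < P' z"
    unfolding eventually_at by (metis UNIV_I)
  obtain r3 r4 where r34: "r3 > 0" "r4 > 0" "ball x r3 \<subseteq> U" "ball x' r4 \<subseteq> U'"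
    using U(1,3) U'(1,3) by (meson open_contains_ball)
  define r where "r = min (min r1 r2) (min r3 r4)"
  have r: "r > 0" "\<And>z. dist z x < r \<Longrightarrow> P z < m \<and> z \<in> U" "\<And>z. dist z x' < r \<Longrightarrow> m' < P' z \<and> z \<in> U'"
    using r12 r34 m by (auto simp: r_def subset_iff dist_commute) (metis dist_commute)+
  \<comment> \<open>The Euclidean norm is at most the sum of the \<open>CARD('d)\<close>
    coordinates, so a box of this half-width lies within distance r/2 of its centre.\<close>
  define \<delta> where "\<delta> = r / (2 * real CARD('d))"
  have \<delta>: "\<delta> > 0" using r(1) by (simp add: \<delta>_def)
  define a where "a = (\<chi> i. x $ i - \<delta>)"
  define b where "b = (\<chi> i. x $ i + \<delta>)"
  define e where "e = x' - x"
  have near: "dist z x < r" if "z \<in> cbox a b" for z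
  proof -
    have "norm (z - x) \<le> (\<Sum>i\<in>UNIV. \<bar>(z - x) $ i\<bar>)" by (rule norm_le_l1_cart)
    also have "\<dots> \<le> (\<Sum>i\<in>(UNIV::'d set). \<delta>)"
      using that by (intro sum_mono) (auto simp: mem_box_cart a_def b_def abs_le_iff algebra_simps)
    also have "\<dots> < r" using r(1) by (simp add: \<delta>_def)
    finally show ?thesis by (simp add: dist_norm)
  qed
  have shift: "z \<in> cbox (a + t *\<^sub>R e) (b + t *\<^sub>R e) \<longleftrightarrow> z - t *\<^sub>R e \<in> cbox a b" for z t
    by (simp add: mem_box_cart algebra_simps)
  have near': "dist z x' < r" if "z \<in> cbox (a + e) (b + e)" for z
    using near[of "z - e"] shift[of z 1] that by (simp add: dist_norm e_def algebra_simps)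
  \<comment> \<open>Convexity of \<Omega> enters here: a point of an intermediate box lies on the
    segment between its two translates in the end boxes.\<close>
  have box: "cbox (a + t *\<^sub>R e) (b + t *\<^sub>R e) \<subseteq> \<Omega>" if t: "0 \<le> t" "t \<le> 1" for t
  proof
    fix z assume "z \<in> cbox (a + t *\<^sub>R e) (b + t *\<^sub>R e)"
    then have 1: "z - t *\<^sub>R e \<in> cbox a b" by (simp add: shift)
    then have "z - t *\<^sub>R e \<in> \<Omega>" using near r U(2) by blast
    moreover have "z - t *\<^sub>R e + e \<in> cbox (a + e) (b + e)" using 1 shift[of "z - t *\<^sub>R e + e" 1] by simp
    then have "z - t *\<^sub>R e + e \<in> \<Omega>" using near' r U'(2) by blast
    ultimately have "(1 - t) *\<^sub>R (z - t *\<^sub>R e) + t *\<^sub>R (z - t *\<^sub>R e + e) \<in> \<Omega>"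
      using conv t by (intro convexD_alt) auto
    then show "z \<in> \<Omega>" by (simp add: algebra_simps)
  qed
  have ab: "cbox a b \<subseteq> \<Omega>" "cbox (a + e) (b + e) \<subseteq> \<Omega>" using box[of 0] box[of 1] by auto
  have lm: "\<Omega> \<in> lmeasurable" and sl: "\<Omega> \<in> sets lebesgue" using \<Omega> by (auto simp: lmeasurable_open borel_open)
  have t1: "bump 1 a b \<in> test_functions \<Omega>" "bump 1 (a + e) (b + e) \<in> test_functions \<Omega>"
    using ab by (auto intro: bump_test_function)
  have one: "(\<lambda>x. c::real) \<in> L2 \<Omega>" for c
    using lm by (intro L2_bounded[where C = "\<bar>c\<bar>"]) auto
  have int1: "integrable (lebesgue_on \<Omega>) (bump 1 a b)" "integrable (lebesgue_on \<Omega>) (bump 1 (a + e) (b + e))"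
    using L2_integrable_inner[OF one[of 1] test_function_L2(1)[OF t1(1) lm]]
      L2_integrable_inner[OF one[of 1] test_function_L2(1)[OF t1(2) lm]] by simp_all
  have intv: "integrable (lebesgue_on \<Omega>) (\<lambda>x. v x * bump 1 a b x)" "integrable (lebesgue_on \<Omega>) (\<lambda>x. v x * bump 1 (a + e) (b + e) x)"
    using L2_integrable_inner[OF v test_function_L2(1)[OF t1(1) lm]]
      L2_integrable_inner[OF v test_function_L2(1)[OF t1(2) lm]] by simp_all
  have ae: "AE x in lebesgue_on \<Omega>. x \<in> U \<longrightarrow> v x = P x" "AE x in lebesgue_on \<Omega>. x \<in> U' \<longrightarrow> v x = P' x"
    using U(1,4) U'(1,4) sl by (auto simp: ae_eq_lebesgue borel_open AE_restrict_space_iff)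
  have le: "(LINT x|lebesgue_on \<Omega>. v x * bump 1 a b x) \<le> (LINT x|lebesgue_on \<Omega>. m * bump 1 a b x)"
  proof (rule integral_mono_AE[OF intv(1)])
    show "AE x in lebesgue_on \<Omega>. v x * bump 1 a b x \<le> m * bump 1 a b x"
      using ae(1)
    proof eventually_elim
      case (elim z)
      show ?case
      proof (cases "z \<in> box a b")
        case True
        then have "z \<in> cbox a b" using box_subset_cbox by blast
        then have "v z \<le> m" using near[of z] r(2)[of z] elim by simp
        then show ?thesis by (intro mult_right_mono bump_bounds)
      qed (simp add: bump_zero)
    qed
  qed (use int1 in simp)
  have ge: "(LINT x|lebesgue_on \<Omega>. m' * bump 1 (a + e) (b + e) x) \<le> (LINT x|lebesgue_on \<Omega>. v x * bump 1 (a + e) (b + e) x)"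
  proof (rule integral_mono_AE[OF _ intv(2)])
    show "AE x in lebesgue_on \<Omega>. m' * bump 1 (a + e) (b + e) x \<le> v x * bump 1 (a + e) (b + e) x"
      using ae(2)
    proof eventually_elim
      case (elim z)
      show ?case
      proof (cases "z \<in> box (a + e) (b + e)")
        case True
        then have "z \<in> cbox (a + e) (b + e)" using box_subset_cbox by blast
        then have "m' \<le> v z" using near'[of z] r(3)[of z] elim by simp
        then show ?thesis by (intro mult_right_mono bump_bounds)
      qed (simp add: bump_zero)
    qed
  qed (use int1 in simp)
  have leb: "(LINT x|lebesgue_on \<Omega>. \<phi> x) = (LINT x|lborel. \<phi> x)" if "\<phi> \<in> test_functions \<Omega>" for \<phi> :: "real^'d \<Rightarrow> real"
  proof -
    from test_function_support[OF that] obtain C where C: "C \<subseteq> \<Omega>" "\<And>x. x \<notin> C \<Longrightarrow> \<phi> x = 0" by metis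
    have "(LINT x|lebesgue_on \<Omega>. \<phi> x) = (LINT x|lebesgue. indicator \<Omega> x *\<^sub>R \<phi> x)"
      using sl by (simp add: integral_restrict_space)
    also have "(\<lambda>x. indicator \<Omega> x *\<^sub>R \<phi> x) = \<phi>" using C by (force simp: indicator_def fun_eq_iff)
    also have "(LINT x|lebesgue. \<phi> x) = (LINT x|lborel. \<phi> x)"
      using borel_measurable_continuous_onI[OF test_function_differentiable(2)[OF that]] by (intro integral_completion) simp
    finally show ?thesis .
  qed
  have same: "(LINT x|lebesgue_on \<Omega>. bump 1 (a + e) (b + e) x) = (LINT x|lebesgue_on \<Omega>. bump 1 a b x)"
    unfolding leb[OF t1(1)] leb[OF t1(2)]
    using integral_lborel_shift[OF borel_measurable_continuous_onI[OF test_function_differentiable(2)[OF t1(1)]], of "- e"]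
    by (simp add: bump_translate[abs_def])
  have "l2_inner \<Omega> v (bump 1 a b) = l2_inner \<Omega> v (bump 1 (a + e) (b + e))"
    by (rule l2_inner_bump_translate[OF box])
  then have "m' * (LINT x|lebesgue_on \<Omega>. bump 1 a b x) \<le> m * (LINT x|lebesgue_on \<Omega>. bump 1 a b x)"
    using le ge same by (simp add: l2_inner_def)
  moreover have "(LINT x|lebesgue_on \<Omega>. bump 1 a b x) > 0"
  proof -
    have "(LINT x|lebesgue_on \<Omega>. bump 1 a b x) \<noteq> 0"
    proof
      assume "(LINT x|lebesgue_on \<Omega>. bump 1 a b x) = 0"
      then have "AE x in lebesgue_on \<Omega>. bump 1 a b x = 0"
        using integral_nonneg_eq_0_iff_AE[OF int1(1) AE_I2[OF bump_bounds(1)]] by simp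
      then have "AE x in lebesgue. x \<in> \<Omega> \<longrightarrow> bump 1 a b x = 0" using sl by (simp add: AE_restrict_space_iff)
      then have "AE x in lebesgue. x \<notin> box a b"
        by eventually_elim (use bump_pos[of 1 _ a b] ab box_subset_cbox[of a b] in \<open>force\<close>)
      then have "negligible (box a b)" by (simp add: negligible_iff_null_sets AE_iff_null_sets)
      moreover have "x \<in> box a b" using \<delta> by (simp add: mem_box_cart a_def b_def)
      ultimately show False using open_not_negligible[OF open_box] by blast
    qed
    moreover have "(LINT x|lebesgue_on \<Omega>. bump 1 a b x) \<ge> 0" by (simp add: bump_bounds)
    ultimately show ?thesis by simp
  qed
  ultimately show False using m(2) by simp
qed

end

lemma zero_weak_grad_pieces_eq:
  assumes "open \<Omega>" "bounded \<Omega>" "convex \<Omega>" "v \<in> L2 \<Omega>"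
    and "\<And>\<phi> i. \<phi> \<in> test_functions \<Omega> \<Longrightarrow> l2_inner \<Omega> v (partial i \<phi>) = 0"
    and "open U" "U \<subseteq> \<Omega>" "x \<in> U" "ae_eq U v P" "isCont P x"
    and "open U'" "U' \<subseteq> \<Omega>" "x' \<in> U'" "ae_eq U' v P'" "isCont P' x'"
  shows "P x = P' x'"
  using zero_grad_le[OF assms(1,2,4,5,3) assms(6-10) assms(11-15)]
    zero_grad_le[OF assms(1,2,4,5,3) assms(11-15) assms(6-10)] by simp

section \<open>Polynomials\<close>

lemma finite_multi_indices [simp]: "finite {\<alpha> :: 'd::finite \<Rightarrow> nat. (\<Sum>i\<in>UNIV. \<alpha> i) \<le> k}"
proof (rule finite_subset)
  show "{\<alpha> :: 'd \<Rightarrow> nat. (\<Sum>i\<in>UNIV. \<alpha> i) \<le> k} \<subseteq> {\<alpha>. \<forall>i. (i \<in> UNIV \<longrightarrow> \<alpha> i \<in> {..k}) \<and> (i \<notin> UNIV \<longrightarrow> \<alpha> i = 0)}"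
  proof
    fix \<alpha> :: "'d \<Rightarrow> nat" assume "\<alpha> \<in> {\<alpha>. (\<Sum>i\<in>UNIV. \<alpha> i) \<le> k}"
    moreover have "\<alpha> i \<le> (\<Sum>i\<in>UNIV. \<alpha> i)" for i by (rule member_le_sum) auto
    ultimately have "\<alpha> i \<le> k" for i using le_trans by blast
    then show "\<alpha> \<in> {\<alpha>. \<forall>i. (i \<in> UNIV \<longrightarrow> \<alpha> i \<in> {..k}) \<and> (i \<notin> UNIV \<longrightarrow> \<alpha> i = 0)}" by simp
  qed
  show "finite {\<alpha> :: 'd \<Rightarrow> nat. \<forall>i. (i \<in> UNIV \<longrightarrow> \<alpha> i \<in> {..k}) \<and> (i \<notin> UNIV \<longrightarrow> \<alpha> i = 0)}"
    by (rule finite_set_of_finite_funs) auto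
qed

lemma finite_multi_indices_eq [simp]: "finite {\<alpha> :: 'd::finite \<Rightarrow> nat. (\<Sum>i\<in>UNIV. \<alpha> i) = k}"
  by (rule finite_subset[OF _ finite_multi_indices[of k]]) auto

lemma polys_alt: "polys k = {\<lambda>x. \<Sum>\<alpha> | (\<Sum>i\<in>UNIV. \<alpha> i) \<le> k. c \<alpha> * monomial \<alpha> x | c. True}"
  by (auto simp: polys_def fun_eq_iff)

lemma subspace_polys: "subspace (polys k :: (real^'d::finite \<Rightarrow> real) set)"
proof (rule subspaceI)
  show "0 \<in> (polys k :: (real^'d \<Rightarrow> real) set)" unfolding polys_def by (auto intro!: exI[of _ "\<lambda>_. 0"])
next
  fix p q :: "real^'d \<Rightarrow> real" assume "p \<in> polys k" "q \<in> polys k"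
  then obtain c d where "p = (\<lambda>x. \<Sum>\<alpha> | (\<Sum>i\<in>UNIV. \<alpha> i) \<le> k. c \<alpha> * monomial \<alpha> x)"
    "q = (\<lambda>x. \<Sum>\<alpha> | (\<Sum>i\<in>UNIV. \<alpha> i) \<le> k. d \<alpha> * monomial \<alpha> x)" unfolding polys_alt by auto
  then show "p + q \<in> polys k" unfolding polys_def
    by (auto intro!: exI[of _ "\<lambda>\<alpha>. c \<alpha> + d \<alpha>"] simp: sum.distrib algebra_simps)
next
  fix r and p :: "real^'d \<Rightarrow> real" assume "p \<in> polys k"
  then obtain c where "p = (\<lambda>x. \<Sum>\<alpha> | (\<Sum>i\<in>UNIV. \<alpha> i) \<le> k. c \<alpha> * monomial \<alpha> x)" unfolding polys_alt by auto
  then show "r *\<^sub>R p \<in> polys k" unfolding polys_def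
    by (auto intro!: exI[of _ "\<lambda>\<alpha>. r * c \<alpha>"] simp: sum_distrib_left algebra_simps)
qed

lemma polys_add: "p \<in> polys k \<Longrightarrow> q \<in> polys k \<Longrightarrow> (\<lambda>x. p x + q x) \<in> polys k"
  using subspace_add[OF subspace_polys] by (auto simp: plus_fun_def)

lemma polys_scale: "p \<in> polys k \<Longrightarrow> (\<lambda>x. c * p x) \<in> polys k"
  using subspace_scale[OF subspace_polys, of p k c] by (simp add: scaleR_fun_def)

lemma polys_zero: "(\<lambda>x. 0) \<in> polys k"
  using subspace_0[OF subspace_polys] by (simp add: zero_fun_def)

lemma polys_sum: "(\<And>i. i \<in> I \<Longrightarrow> p i \<in> polys k) \<Longrightarrow> (\<lambda>x. \<Sum>i\<in>I. p i x) \<in> polys k"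
  by (induction I rule: infinite_finite_induct) (auto intro: polys_add polys_zero)

lemma monomial_polys: "(\<Sum>i\<in>UNIV. \<alpha> i) \<le> k \<Longrightarrow> monomial \<alpha> \<in> polys k"
  unfolding polys_def
  by (auto intro!: exI[of _ "\<lambda>\<beta>. if \<beta> = \<alpha> then 1 else 0"] simp: if_distrib[of "\<lambda>c. c * _"] sum.delta cong: if_cong)

lemma polys_induct [consumes 1, case_names zero add monomial]:
  assumes p: "p \<in> polys k" and "P (\<lambda>x. 0)" "\<And>f g. P f \<Longrightarrow> P g \<Longrightarrow> P (\<lambda>x. f x + g x)"
    and mon: "\<And>c \<alpha>. (\<Sum>i\<in>UNIV. \<alpha> i) \<le> k \<Longrightarrow> P (\<lambda>x. c * monomial \<alpha> x)"
  shows "P p"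
proof -
  obtain c where p: "p = (\<lambda>x. \<Sum>\<alpha> | (\<Sum>i\<in>UNIV. \<alpha> i) \<le> k. c \<alpha> * monomial \<alpha> x)" using p unfolding polys_alt by auto
  have "P (\<lambda>x. \<Sum>\<alpha>\<in>A. c \<alpha> * monomial \<alpha> x)" if "finite A" "A \<subseteq> {\<alpha>. (\<Sum>i\<in>UNIV. \<alpha> i) \<le> k}" for A
    using that by (induction A rule: finite_induct) (auto intro!: assms)
  then show ?thesis using p by auto
qed

lemma polys_mono: assumes "k \<le> k'" "p \<in> polys k" shows "p \<in> polys k'"
  using assms(2)
proof (induction rule: polys_induct)
  case (monomial c \<alpha>)
  then show ?case using assms(1) by (intro polys_scale monomial_polys) auto
qed (auto intro: polys_zero polys_add)

lemma monomial_mult: "monomial \<alpha> x * monomial \<beta> x = monomial (\<lambda>i. \<alpha> i + \<beta> i) x"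
  by (simp add: monomial_def power_add prod.distrib)

lemma polys_mult:
  assumes "p \<in> polys k" "q \<in> polys l" shows "(\<lambda>x. p x * q x) \<in> polys (k + l)"
  using assms(1)
proof (induction rule: polys_induct)
  case (monomial c \<alpha>)
  show ?case using assms(2)
  proof (induction rule: polys_induct)
    case (monomial d \<beta>)
    have "(\<lambda>x. (c * d) * monomial (\<lambda>i. \<alpha> i + \<beta> i) x) \<in> polys (k + l)"
      using monomial \<open>sum \<alpha> UNIV \<le> k\<close> by (intro polys_scale monomial_polys) (simp add: sum.distrib)
    then show ?case by (simp add: monomial_mult[symmetric] mult_ac)
  qed (auto simp: distrib_left intro: polys_zero polys_add)
qed (auto simp: distrib_right intro: polys_zero polys_add)

lemma polys_const: "(\<lambda>x. c) \<in> polys k"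
  using polys_scale[OF monomial_polys[of "\<lambda>i. 0" k], of c] by (simp add: monomial_def)

lemma polys_nth: "(\<lambda>x. x $ i) \<in> polys 1"
proof -
  have "monomial (\<lambda>j. if j = i then 1 else 0) = (\<lambda>x. x $ i)"
    by (simp add: monomial_def fun_eq_iff if_distrib[of "\<lambda>n. _ ^ n"] prod.delta cong: if_cong)
  then show ?thesis using monomial_polys[of "\<lambda>j. if j = i then 1 else 0" 1] by simp
qed

lemma polys_inner: "(\<lambda>x. a \<bullet> x + b) \<in> polys 1"
  unfolding inner_vec_def inner_real_def by (intro polys_add polys_sum polys_scale polys_nth polys_const)

lemma polys_0: "p \<in> polys 0 \<Longrightarrow> \<exists>c. p = (\<lambda>x. c)"
proof (induction rule: polys_induct)
  case (monomial c \<alpha>)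
  then show ?case by (auto simp: monomial_def)
qed auto

text \<open>The clause for degree 0 is not redundant: subtraction on naturals is truncated, so the
  degree bound alone would not say that the derivative of a constant vanishes, and the product with
  a coordinate in the next step would have too high a degree.\<close>

lemma monomial_has_derivative:
  "\<exists>D. (\<forall>x. (monomial \<alpha> has_derivative (\<lambda>h. \<Sum>i\<in>UNIV. h $ i * D i x)) (at x)) \<and>
       (\<forall>i. D i \<in> polys ((\<Sum>i\<in>UNIV. \<alpha> i) - 1)) \<and> ((\<Sum>i\<in>UNIV. \<alpha> i) = 0 \<longrightarrow> D = (\<lambda>i x. 0))"
proof (induction "\<Sum>i\<in>UNIV. \<alpha> i" arbitrary: \<alpha>)
  case 0
  have "\<alpha> i = 0" for i using 0 sum_eq_0_iff[of UNIV \<alpha>] by (metis UNIV_I finite)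
  then have "monomial \<alpha> = (\<lambda>x. 1)" by (simp add: monomial_def fun_eq_iff)
  then show ?case by (intro exI[of _ "\<lambda>i x. 0"]) (simp add: polys_zero)
next
  case (Suc n)
  obtain j where j: "\<alpha> j \<noteq> 0" using Suc.hyps(2) by (metis nat.simps(3) sum.neutral)
  \<comment> \<open>One factor of the coordinate \<open>j\<close> is split off, so that the product
    rule applies.\<close>
  define \<beta> where "\<beta> = \<alpha>(j := \<alpha> j - 1)"
  have \<alpha>: "\<alpha> i = (if i = j then 1 else 0) + \<beta> i" for i using j by (simp add: \<beta>_def)
  have sum: "(\<Sum>i\<in>UNIV. \<alpha> i) = Suc (\<Sum>i\<in>UNIV. \<beta> i)"
    using \<alpha> by (simp add: sum.distrib)
  then have n: "n = (\<Sum>i\<in>UNIV. \<beta> i)" using Suc.hyps(2) by simp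
  have mon: "monomial \<alpha> = (\<lambda>x. x $ j * monomial \<beta> x)"
  proof -
    have "monomial \<alpha> x = monomial (\<lambda>i. if i = j then 1 else 0) x * monomial \<beta> x" for x :: "real^'a"
      unfolding monomial_mult by (simp only: monomial_def \<alpha>)
    moreover have "monomial (\<lambda>i. if i = j then 1 else 0) x = x $ j" for x :: "real^'a"
      by (simp add: monomial_def if_distrib[of "\<lambda>n. _ ^ n"] prod.delta cong: if_cong)
    ultimately show ?thesis by (simp add: fun_eq_iff)
  qed
  obtain D where D': "(\<forall>x. (monomial \<beta> has_derivative (\<lambda>h. \<Sum>i\<in>UNIV. h $ i * D i x)) (at x)) \<and>
      (\<forall>i. D i \<in> polys (n - 1)) \<and> (n = 0 \<longrightarrow> D = (\<lambda>i x. 0))"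
    using Suc.hyps(1)[OF n] unfolding n[symmetric] by (rule exE)
  note D = D'[THEN conjunct1, rule_format] D'[THEN conjunct2, THEN conjunct1, rule_format]
    D'[THEN conjunct2, THEN conjunct2]
  define D' where "D' i x = (if i = j then 1 else 0) * monomial \<beta> x + x $ j * D i x" for i x
  have "(monomial \<alpha> has_derivative (\<lambda>h. \<Sum>i\<in>UNIV. h $ i * D' i x)) (at x)" for x
  proof -
    have eq: "(\<lambda>h. x $ j * (\<Sum>i\<in>UNIV. h $ i * D i x) + h $ j * monomial \<beta> x) = (\<lambda>h. \<Sum>i\<in>UNIV. h $ i * D' i x)"
    proof
      fix h :: "real^'a"
      have "(\<Sum>i\<in>UNIV. h $ i * ((if i = j then 1 else 0) * monomial \<beta> x)) = h $ j * monomial \<beta> x"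
        by (simp add: if_distrib[of "\<lambda>c. _ * c"] if_distrib[of "\<lambda>c. c * _"] cong: if_cong)
      then show "x $ j * (\<Sum>i\<in>UNIV. h $ i * D i x) + h $ j * monomial \<beta> x = (\<Sum>i\<in>UNIV. h $ i * D' i x)"
        unfolding D'_def distrib_left sum.distrib by (simp add: sum_distrib_left mult.left_commute)
    qed
    show ?thesis
      unfolding mon eq[symmetric]
      by (rule has_derivative_mult[OF bounded_linear_imp_has_derivative[OF bounded_linear_vec_nth] D(1)])
  qed
  moreover have "D' i \<in> polys n" for i
  proof -
    have "monomial \<beta> \<in> polys n" using n by (intro monomial_polys) simp
    moreover have "(\<lambda>x. x $ j * D i x) \<in> polys n"
    proof (cases "n = 0")
      case True
      then show ?thesis using D(3) by (auto intro: polys_zero)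
    next
      case False
      then show ?thesis using polys_mult[OF polys_nth[of j] D(2)[of i]] by simp
    qed
    ultimately show ?thesis unfolding D'_def[abs_def] by (intro polys_add polys_scale)
  qed
  moreover have "(\<Sum>i\<in>UNIV. \<alpha> i) - 1 = n" "(\<Sum>i\<in>UNIV. \<alpha> i) \<noteq> 0" using sum n by simp_all
  ultimately show ?case by (intro exI[of _ D']) (simp del: sum_eq_0_iff)
qed

lemma polys_has_derivative:
  assumes "p \<in> polys k"
  obtains D where "\<And>x. (p has_derivative (\<lambda>h. \<Sum>i\<in>UNIV. h $ i * D i x)) (at x)"
    "\<And>i. D i \<in> polys (k - 1)" "k = 0 \<Longrightarrow> D = (\<lambda>i x. 0)"
proof -
  have "\<exists>D. (\<forall>x. (p has_derivative (\<lambda>h. \<Sum>i\<in>UNIV. h $ i * D i x)) (at x)) \<and> (\<forall>i. D i \<in> polys (k - 1)) \<and> (k = 0 \<longrightarrow> D = (\<lambda>i x. 0))"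
    using assms
  proof (induction rule: polys_induct)
    case zero
    show ?case by (intro exI[of _ "\<lambda>i x. 0"]) (auto intro: polys_zero)
  next
    case (add f g)
    then obtain D E where *: "\<forall>x. (f has_derivative (\<lambda>h. \<Sum>i\<in>UNIV. h $ i * D i x)) (at x)"
      "\<forall>x. (g has_derivative (\<lambda>h. \<Sum>i\<in>UNIV. h $ i * E i x)) (at x)"
      "\<forall>i. D i \<in> polys (k - 1)" "\<forall>i. E i \<in> polys (k - 1)" "k = 0 \<longrightarrow> D = (\<lambda>i x. 0)" "k = 0 \<longrightarrow> E = (\<lambda>i x. 0)" by (elim exE conjE) (rule that)
    have "((\<lambda>x. f x + g x) has_derivative (\<lambda>h. \<Sum>i\<in>UNIV. h $ i * (D i x + E i x))) (at x)" for x
      using has_derivative_add[OF *(1)[rule_format] *(2)[rule_format]] by (simp add: distrib_left sum.distrib)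
    then show ?case using * by (intro exI[of _ "\<lambda>i x. D i x + E i x"]) (auto intro: polys_add)
  next
    case (monomial c \<alpha>)
    obtain D where D': "(\<forall>x. (monomial \<alpha> has_derivative (\<lambda>h. \<Sum>i\<in>UNIV. h $ i * D i x)) (at x)) \<and>
      (\<forall>i. D i \<in> polys ((\<Sum>i\<in>UNIV. \<alpha> i) - 1)) \<and> ((\<Sum>i\<in>UNIV. \<alpha> i) = 0 \<longrightarrow> D = (\<lambda>i x. 0))"
      using monomial_has_derivative by (rule exE)
    note D = D'[THEN conjunct1, rule_format] D'[THEN conjunct2, THEN conjunct1, rule_format]
      D'[THEN conjunct2, THEN conjunct2]
    have "((\<lambda>x. c * monomial \<alpha> x) has_derivative (\<lambda>h. \<Sum>i\<in>UNIV. h $ i * (c * D i x))) (at x)" for x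
      using has_derivative_mult_right[OF D(1), of c] by (simp add: sum_distrib_left mult_ac)
    moreover have "(\<lambda>x. c * D i x) \<in> polys (k - 1)" for i
      by (intro polys_scale polys_mono[OF _ D(2)]) (use monomial in simp)
    ultimately show ?case using monomial D(3) by (intro exI[of _ "\<lambda>i x. c * D i x"]) auto
  qed
  then show ?thesis
  proof (elim exE conjE)
    fix D assume D: "\<forall>x. (p has_derivative (\<lambda>h. \<Sum>i\<in>UNIV. h $ i * D i x)) (at x)"
      "\<forall>i. D i \<in> polys (k - 1)" "k = 0 \<longrightarrow> D = (\<lambda>i x. 0)"
    show ?thesis by (rule that[OF D(1)[rule_format] D(2)[rule_format] D(3)[rule_format]])
  qed
qed

lemma polys_continuous: "p \<in> polys k \<Longrightarrow> continuous_on S p"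
proof (induction rule: polys_induct)
  case (monomial c \<alpha>)
  show ?case unfolding monomial_def[abs_def] by (intro continuous_intros)
qed (auto intro: continuous_intros)

text \<open>Isolates the part of top degree, since the enrichment in \<open>RT_polys\<close> admits
  only homogeneous factors.\<close>

lemma polys_split:
  assumes "p \<in> polys (Suc k)" obtains r b where "r \<in> polys k" "b \<in> hom_polys (Suc k)" "p = (\<lambda>x. r x + b x)"
proof -
  obtain c where p: "p = (\<lambda>x. \<Sum>\<alpha> | (\<Sum>i\<in>UNIV. \<alpha> i) \<le> Suc k. c \<alpha> * monomial \<alpha> x)" using assms unfolding polys_alt by auto
  have set: "{\<alpha>::'a \<Rightarrow> nat. (\<Sum>i\<in>UNIV. \<alpha> i) \<le> Suc k} = {\<alpha>. (\<Sum>i\<in>UNIV. \<alpha> i) \<le> k} \<union> {\<alpha>. (\<Sum>i\<in>UNIV. \<alpha> i) = Suc k}" by auto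
  show ?thesis
  proof (rule that)
    show "(\<lambda>x. \<Sum>\<alpha> | (\<Sum>i\<in>UNIV. \<alpha> i) \<le> k. c \<alpha> * monomial \<alpha> x) \<in> polys k" by (auto simp: polys_def)
    show "(\<lambda>x. \<Sum>\<alpha> | (\<Sum>i\<in>UNIV. \<alpha> i) = Suc k. c \<alpha> * monomial \<alpha> x) \<in> hom_polys (Suc k)" by (auto simp: hom_polys_def)
    show "p = (\<lambda>x. (\<Sum>\<alpha> | (\<Sum>i\<in>UNIV. \<alpha> i) \<le> k. c \<alpha> * monomial \<alpha> x) + (\<Sum>\<alpha> | (\<Sum>i\<in>UNIV. \<alpha> i) = Suc k. c \<alpha> * monomial \<alpha> x))"
      unfolding p set by (intro ext sum.union_disjoint) auto
  qed
qed

lemma hom_polys_subset: "b \<in> hom_polys k \<Longrightarrow> b \<in> polys k"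
proof -
  assume "b \<in> hom_polys k"
  then obtain c where b: "b = (\<lambda>x. \<Sum>\<alpha> | (\<Sum>i\<in>UNIV. \<alpha> i) = k. c \<alpha> * monomial \<alpha> x)" by (auto simp: hom_polys_def fun_eq_iff)
  show ?thesis unfolding b by (intro polys_sum polys_scale monomial_polys) auto
qed

lemma hom_polys_0: "(\<lambda>x. c) \<in> hom_polys 0"
proof -
  have "{\<alpha> :: 'a \<Rightarrow> nat. (\<Sum>i\<in>UNIV. \<alpha> i) = 0} = {\<lambda>_. 0}" by auto
  then show ?thesis unfolding hom_polys_def by (simp add: monomial_def) (rule exI[of _ "\<lambda>_. c"], simp)
qed

lemma subspace_hom_polys: "subspace (hom_polys k :: (real^'d::finite \<Rightarrow> real) set)"
proof (rule subspaceI)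
  show "0 \<in> (hom_polys k :: (real^'d \<Rightarrow> real) set)" unfolding hom_polys_def by (auto intro!: exI[of _ "\<lambda>_. 0"])
next
  fix p q :: "real^'d \<Rightarrow> real" assume "p \<in> hom_polys k" "q \<in> hom_polys k"
  then obtain c d where "\<forall>x. p x = (\<Sum>\<alpha> | (\<Sum>i\<in>UNIV. \<alpha> i) = k. c \<alpha> * monomial \<alpha> x)"
    "\<forall>x. q x = (\<Sum>\<alpha> | (\<Sum>i\<in>UNIV. \<alpha> i) = k. d \<alpha> * monomial \<alpha> x)" by (auto simp: hom_polys_def)
  then show "p + q \<in> hom_polys k" unfolding hom_polys_def
    by (auto intro!: exI[of _ "\<lambda>\<alpha>. c \<alpha> + d \<alpha>"] simp: sum.distrib algebra_simps)
next
  fix r and p :: "real^'d \<Rightarrow> real" assume "p \<in> hom_polys k"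
  then obtain c where "\<forall>x. p x = (\<Sum>\<alpha> | (\<Sum>i\<in>UNIV. \<alpha> i) = k. c \<alpha> * monomial \<alpha> x)" by (auto simp: hom_polys_def)
  then show "r *\<^sub>R p \<in> hom_polys k" unfolding hom_polys_def
    by (auto intro!: exI[of _ "\<lambda>\<alpha>. r * c \<alpha>"] simp: sum_distrib_left algebra_simps)
qed

section \<open>Raviart-Thomas polynomials\<close>

lemma RT_polysI:
  "(\<And>i. (\<lambda>x. a x $ i) \<in> polys l) \<Longrightarrow> b \<in> hom_polys l \<Longrightarrow> (\<And>x. q x = a x + b x *\<^sub>R x) \<Longrightarrow> q \<in> RT_polys l"
  unfolding RT_polys_def by (rule CollectI, rule exI[of _ a], rule exI[of _ b]) simp

lemma RT_polysE:
  assumes "q \<in> RT_polys l"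
  obtains a b where "\<forall>i. (\<lambda>x. a x $ i) \<in> polys l" "b \<in> hom_polys l" "\<forall>x. q x = a x + b x *\<^sub>R x"
proof -
  have "\<exists>a b. (\<forall>i. (\<lambda>x. a x $ i) \<in> polys l) \<and> b \<in> hom_polys l \<and> (\<forall>x. q x = a x + b x *\<^sub>R x)"
    using assms unfolding RT_polys_def by (rule CollectD)
  then show ?thesis by (elim exE conjE) (rule that)
qed

lemma subspace_RT_polys: "subspace (RT_polys l :: (real^'d::finite \<Rightarrow> real^'d) set)"
proof (rule subspaceI)
  show "0 \<in> (RT_polys l :: (real^'d \<Rightarrow> real^'d) set)"
    by (rule RT_polysI[where a = "\<lambda>x. 0" and b = 0]) (simp_all add: polys_zero subspace_0 subspace_hom_polys)
next
  fix p q :: "real^'d \<Rightarrow> real^'d" assume pq: "p \<in> RT_polys l" "q \<in> RT_polys l"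
  obtain a b where p: "\<forall>i. (\<lambda>x. a x $ i) \<in> polys l" "b \<in> hom_polys l" "\<forall>x. p x = a x + b x *\<^sub>R x"
    by (rule RT_polysE[OF pq(1)]) (rule that)
  obtain a' b' where q: "\<forall>i. (\<lambda>x. a' x $ i) \<in> polys l" "b' \<in> hom_polys l" "\<forall>x. q x = a' x + b' x *\<^sub>R x"
    by (rule RT_polysE[OF pq(2)]) (rule that)
  note * = p[rule_format] q[rule_format]
  show "p + q \<in> RT_polys l"
    by (rule RT_polysI[where a = "\<lambda>x. a x + a' x" and b = "b + b'"])
      (simp_all add: * polys_add subspace_add subspace_hom_polys scaleR_add_left)
next
  fix r and p :: "real^'d \<Rightarrow> real^'d" assume "p \<in> RT_polys l"
  then obtain a b where p: "\<forall>i. (\<lambda>x. a x $ i) \<in> polys l" "b \<in> hom_polys l" "\<forall>x. p x = a x + b x *\<^sub>R x"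
    by (rule RT_polysE) (rule that)
  note * = p[rule_format]
  show "r *\<^sub>R p \<in> RT_polys l"
    by (rule RT_polysI[where a = "\<lambda>x. r *\<^sub>R a x" and b = "r *\<^sub>R b"])
      (simp_all add: * polys_scale subspace_scale subspace_hom_polys scaleR_add_right)
qed

lemma RT_polys_components: assumes "q \<in> RT_polys l" shows "(\<lambda>x. q x $ i) \<in> polys (Suc l)"
proof -
  obtain a b where q: "\<forall>i. (\<lambda>x. a x $ i) \<in> polys l" "b \<in> hom_polys l" "\<forall>x. q x = a x + b x *\<^sub>R x"
    by (rule RT_polysE[OF assms]) (rule that)
  note * = q[rule_format]
  have "(\<lambda>x. b x * x $ i) \<in> polys (l + 1)" by (intro polys_mult hom_polys_subset * polys_nth)
  moreover have "(\<lambda>x. a x $ i) \<in> polys (Suc l)" using polys_mono[OF _ *(1)] by simp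
  ultimately show ?thesis by (simp add: *(3) polys_add)
qed

text \<open>For \<open>l = 0\<close> the multiple of \<open>x\<close> must come from the homogeneous
  enrichment; for larger \<open>l\<close> the whole field is already a vector polynomial of degree
  \<open>l\<close>.\<close>

lemma RT_polys_affine: "(\<lambda>x. c *\<^sub>R (x - v)) \<in> RT_polys l"
proof (cases l)
  case 0
  show ?thesis
    by (rule RT_polysI[where a = "\<lambda>x. - (c *\<^sub>R v)" and b = "\<lambda>x. c"])
      (simp_all add: 0 hom_polys_0 polys_const scaleR_diff_right)
next
  case (Suc n)
  have "(\<lambda>x. c * x $ i + - (c * v $ i)) \<in> polys l" for i
    using Suc by (intro polys_add polys_scale polys_const polys_mono[OF _ polys_nth]) simp
  then show ?thesis
    by (intro RT_polysI[where a = "\<lambda>x. c *\<^sub>R (x - v)" and b = 0])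
      (simp_all add: algebra_simps subspace_0 subspace_hom_polys)
qed

section \<open>Linear images of Lebesgue measure\<close>

text \<open>Uniqueness of Haar measure, by evaluating \<open>\<integral>\<integral> 1\<^sub>A(x) 1\<^sub>U(x + y) d\<nu>(y) dx\<close> in both orders.  The
  library's change of variables formula for linear maps asks for a well-ordered index type.\<close>

lemma translation_invariant_measure:
  fixes \<nu> :: "'a::euclidean_space measure"
  assumes sf: "sigma_finite_measure \<nu>" and sets [measurable_cong, simp]: "sets \<nu> = sets borel"
    and inv: "\<And>a. distr \<nu> borel ((+) a) = \<nu>"
    and A [measurable]: "A \<in> sets borel" and U [measurable]: "U \<in> sets borel"
  shows "emeasure lborel A * emeasure \<nu> U = emeasure lborel U * emeasure \<nu> (uminus -` A)"
proof -
  interpret P: pair_sigma_finite lborel \<nu>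
    using sf sigma_finite_lborel by (simp add: pair_sigma_finite_def)
  have space: "space \<nu> = UNIV" using sets_eq_imp_space_eq[OF sets] by simp
  have shift: "(\<integral>\<^sup>+y. h (a + y) \<partial>\<nu>) = (\<integral>\<^sup>+y. h y \<partial>\<nu>)" if [measurable]: "h \<in> borel_measurable borel" for h :: "'a \<Rightarrow> ennreal" and a
  proof -
    have "(\<integral>\<^sup>+y. h y \<partial>\<nu>) = (\<integral>\<^sup>+y. h y \<partial>distr \<nu> borel ((+) a))" by (simp add: inv)
    also have "\<dots> = (\<integral>\<^sup>+y. h (a + y) \<partial>\<nu>)" by (subst nn_integral_distr) auto
    finally show ?thesis by simp
  qed
  have shiftL: "(\<integral>\<^sup>+x. h (a + x) \<partial>lborel) = (\<integral>\<^sup>+x. h x \<partial>lborel)" if [measurable]: "h \<in> borel_measurable borel" for h :: "'a \<Rightarrow> ennreal" and a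
  proof -
    have "(\<integral>\<^sup>+x. h x \<partial>lborel) = (\<integral>\<^sup>+x. h x \<partial>distr lborel borel ((+) a))" by (simp add: lborel_distr_plus)
    also have "\<dots> = (\<integral>\<^sup>+x. h (a + x) \<partial>lborel)" by (subst nn_integral_distr) auto
    finally show ?thesis by simp
  qed
  have "emeasure lborel A * emeasure \<nu> U = (\<integral>\<^sup>+x. indicator A x * emeasure \<nu> U \<partial>lborel)"
    by (simp add: nn_integral_multc)
  also have "\<dots> = (\<integral>\<^sup>+x. \<integral>\<^sup>+y. indicator A x * indicator U (x + y) \<partial>\<nu> \<partial>lborel)"
    using shift[of "indicator U"] by (simp add: nn_integral_cmult)
  also have "\<dots> = (\<integral>\<^sup>+y. \<integral>\<^sup>+x. indicator A x * indicator U (x + y) \<partial>lborel \<partial>\<nu>)"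
    by (subst P.Fubini') auto
  also have "\<dots> = (\<integral>\<^sup>+y. \<integral>\<^sup>+x. indicator A (x - y) * indicator U x \<partial>lborel \<partial>\<nu>)"
  proof (rule nn_integral_cong)
    fix y
    show "(\<integral>\<^sup>+x. indicator A x * indicator U (x + y) \<partial>lborel) = (\<integral>\<^sup>+x. indicator A (x - y) * indicator U x \<partial>lborel)"
      using shiftL[of "\<lambda>x. indicator A (x - y) * indicator U x" y] by (simp add: add.commute)
  qed
  also have "\<dots> = (\<integral>\<^sup>+x. \<integral>\<^sup>+y. indicator A (x - y) * indicator U x \<partial>\<nu> \<partial>lborel)"
    by (subst P.Fubini') auto
  also have "\<dots> = (\<integral>\<^sup>+x. indicator U x * emeasure \<nu> (uminus -` A) \<partial>lborel)"
  proof (rule nn_integral_cong)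
    fix x
    \<comment> \<open>Translating \<open>y\<close> by \<open>x\<close> turns \<open>x - y\<close>
      into \<open>- y\<close> and decouples the variables; this is the origin of the reflection of
      \<open>A\<close>.\<close>
    have "(\<integral>\<^sup>+y. indicator A (x - y) \<partial>\<nu>) = (\<integral>\<^sup>+y. indicator A (- y) \<partial>\<nu>)"
      using shift[of "\<lambda>y. indicator A (x - y)" x] by simp
    also have "\<dots> = (\<integral>\<^sup>+y. indicator (uminus -` A) y \<partial>\<nu>)" by (simp add: indicator_def)
    also have "\<dots> = emeasure \<nu> (uminus -` A)"
      using measurable_sets[of uminus "borel :: 'a measure" borel A] by (intro nn_integral_indicator) simp
    finally show "(\<integral>\<^sup>+y. indicator A (x - y) * indicator U x \<partial>\<nu>) = indicator U x * emeasure \<nu> (uminus -` A)"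
      by (simp add: nn_integral_multc mult.commute[of "emeasure _ _"])
  qed
  also have "\<dots> = emeasure lborel U * emeasure \<nu> (uminus -` A)" by (simp add: nn_integral_multc)
  finally show ?thesis .
qed

text \<open>The image of Lebesgue measure under \<open>T\<close> is again translation invariant,
  hence a multiple of it. The factor is left unspecified, because it is later compared with a ratio
  of volumes and no determinant is required.\<close>

lemma lborel_linear_image:
  fixes T :: "'a::euclidean_space \<Rightarrow> 'a"
  assumes T: "linear T" "bij T"
  obtains c where "c > 0" "\<And>f. f \<in> borel_measurable borel \<Longrightarrow> (LINT x|lborel. f (T x)) = c * (LINT x|lborel. f x :: real)"
proof -
  define S where "S = inv T"
  have S: "linear S" unfolding S_def by (rule inj_linear_imp_inv_linear) (use T in \<open>simp_all add: bij_is_inj\<close>)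
  have TS [simp]: "T (S x) = x" "S (T x) = x" for x
    using T by (simp_all add: S_def bij_def surj_f_inv_f)
  have cont: "continuous_on UNIV T" "continuous_on UNIV S"
    using T S by (auto intro: linear_continuous_on simp: linear_conv_bounded_linear)
  have [measurable]: "T \<in> borel_measurable borel" "S \<in> borel_measurable borel"
    using cont by (auto intro: borel_measurable_continuous_onI)
  define \<nu> where "\<nu> = distr lborel borel T"
  have [simp]: "sets \<nu> = sets borel" by (simp add: \<nu>_def)
  have inv: "distr \<nu> borel ((+) a) = \<nu>" for a
  proof -
    have "distr \<nu> borel ((+) a) = distr lborel borel ((+) a \<circ> T)" unfolding \<nu>_def by (subst distr_distr) auto
    also have "(+) a \<circ> T = T \<circ> (+) (S a)" using T by (auto simp: fun_eq_iff linear_add)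
    also have "distr lborel borel \<dots> = distr (distr lborel borel ((+) (S a))) borel T" by (subst distr_distr) auto
    also have "\<dots> = \<nu>" by (simp add: \<nu>_def lborel_distr_plus)
    finally show ?thesis .
  qed
  have sf: "sigma_finite_measure \<nu>"
  proof (rule sigma_finite_measure_distr)
    have "distr \<nu> lborel S = distr lborel lborel (S \<circ> T)" unfolding \<nu>_def by (subst distr_distr) auto
    also have "S \<circ> T = (\<lambda>x. x)" by auto
    finally show "sigma_finite_measure (distr \<nu> lborel S)" by (simp add: distr_id2 sigma_finite_lborel)
  qed (simp add: \<nu>_def)
  \<comment> \<open>A reference set of positive finite measure under both measures; it fixes the
    factor \<open>c\<close>.\<close>
  define U :: "'a set" where "U = cball 0 1"
  have \<nu>U: "emeasure \<nu> U = emeasure lborel (S ` U)"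
  proof -
    have "T -` U = S ` U" by (auto simp: image_iff) (metis TS(2))
    then show ?thesis unfolding \<nu>_def U_def by (subst emeasure_distr) auto
  qed
  have SU: "compact (S ` U)" unfolding U_def
    using cont(2) by (intro compact_continuous_image) (auto intro: continuous_on_subset)
  have fin: "emeasure \<nu> U < \<infinity>" "emeasure lborel U < \<infinity>"
    unfolding \<nu>U using emeasure_compact_finite[OF SU] emeasure_compact_finite[OF compact_cball[of 0 1]]
    by (simp_all add: U_def)
  have pos: "emeasure lborel V > 0" if V: "V \<in> sets borel" "open W" "W \<noteq> {}" "W \<subseteq> V" for V W :: "'a set"
  proof (rule ccontr)
    assume "\<not> emeasure lborel V > 0"
    then have "V \<in> null_sets lborel" using V by (simp add: null_setsI)
    then have "negligible V" by (simp add: negligible_iff_null_sets null_sets_completionI)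
    then show False using V negligible_subset open_not_negligible by blast
  qed
  have pos1: "emeasure lborel U > 0" by (rule pos[of _ "ball 0 1"]) (auto simp: U_def)
  have pos2: "emeasure \<nu> U > 0" unfolding \<nu>U
  proof (rule pos[of _ "T -` ball 0 1"])
    show "open (T -` ball 0 1)" using cont(1) by (simp add: open_vimage)
    have "0 \<in> T -` ball 0 1" using linear_0[OF T(1)] by simp
    then show "T -` ball 0 1 \<noteq> {}" by blast
    show "T -` ball 0 1 \<subseteq> S ` U" by (auto simp: U_def image_iff) (metis TS(2) dist_norm less_imp_le mem_cball_0 norm_minus_cancel diff_0)
    show "S ` U \<in> sets borel" using SU by (simp add: compact_imp_closed)
  qed
  define c where "c = measure \<nu> U / measure lborel U"
  have cpos: "c > 0" using pos1 pos2 fin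
    by (auto simp: c_def measure_def enn2real_positive_iff intro!: divide_pos_pos)
  have eq: "emeasure \<nu> A = ennreal c * emeasure lborel A" if A: "A \<in> sets borel" for A
  proof -
    have mA: "uminus -` A \<in> sets borel" using measurable_sets[of uminus "borel :: 'a measure" borel A] A by simp
    \<comment> \<open>The same identity with Lebesgue measure in place of \<nu> shows its invariance
      under reflection, which then removes the reflection from the identity for \<nu>.\<close>
    have "emeasure lborel (uminus -` A) * emeasure lborel U = emeasure lborel U * emeasure lborel A"
      using translation_invariant_measure[OF sigma_finite_lborel _ lborel_distr_plus mA, of U] by (simp add: U_def vimage_def)
    then have "emeasure lborel U * emeasure lborel (uminus -` A) = emeasure lborel U * emeasure lborel A"
      by (simp only: mult.commute[of "emeasure lborel U" "emeasure lborel (uminus -` A)"])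
    then have "emeasure lborel (uminus -` A) = emeasure lborel A"
      using pos1 fin by (auto simp: ennreal_mult_cancel_left)
    moreover have "emeasure lborel (uminus -` A) * emeasure \<nu> U = emeasure lborel U * emeasure \<nu> A"
      using translation_invariant_measure[OF sf _ inv mA, of U] by (simp add: U_def vimage_def)
    ultimately have "emeasure lborel U * emeasure \<nu> A = emeasure lborel U * (ennreal c * emeasure lborel A)"
    proof -
      assume *: "emeasure lborel (uminus -` A) = emeasure lborel A" "emeasure lborel (uminus -` A) * emeasure \<nu> U = emeasure lborel U * emeasure \<nu> A"
      have "emeasure lborel U * ennreal c = emeasure \<nu> U"
      proof -
        have "emeasure lborel U = ennreal (measure lborel U)" "emeasure \<nu> U = ennreal (measure \<nu> U)"
          using fin by (auto simp: emeasure_eq_ennreal_measure less_top)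
        moreover have "measure lborel U > 0" using pos1 fin by (simp add: measure_def enn2real_positive_iff)
        ultimately show ?thesis using cpos by (simp add: c_def ennreal_mult[symmetric])
      qed
      then show ?thesis using * by (simp add: mult.assoc[symmetric] mult.commute)
    qed
    then show ?thesis using pos1 fin by (auto simp: ennreal_mult_cancel_left)
  qed
  have dens: "\<nu> = density lborel (\<lambda>_. ennreal c)"
    by (rule measure_eqI) (auto simp: eq emeasure_density nn_integral_cmult_indicator)
  show ?thesis
  proof (rule that[OF cpos])
    fix f :: "'a \<Rightarrow> real" assume [measurable]: "f \<in> borel_measurable borel"
    have "(LINT x|lborel. f (T x)) = (LINT x|\<nu>. f x)" unfolding \<nu>_def by (subst integral_distr) auto
    also have "\<dots> = c * (LINT x|lborel. f x)" unfolding dens using cpos by (subst integral_density) auto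
    finally show "(LINT x|lborel. f (T x)) = c * (LINT x|lborel. f x)" .
  qed
qed

section \<open>Barycentric coordinates and integration by parts on a simplex\<close>

locale full_simplex =
  fixes C :: "(real^'d::finite) set"
  assumes indep: "\<not> affine_dependent C" and card: "card C = Suc CARD('d)"
begin

abbreviation K where "K \<equiv> convex hull C"

lemma finite_C [simp]: "finite C"
  using indep by (rule aff_independent_finite)

text \<open>The gradient of the barycentric coordinate of \<open>v\<close>, pinned down by that
  coordinate falling from 1 at \<open>v\<close> to 0 at every other vertex.\<close>

definition bgrad :: "real^'d \<Rightarrow> real^'d" where
  "bgrad v = (SOME a. \<forall>w\<in>C - {v}. a \<bullet> (w - v) = -1)"

definition bary :: "real^'d \<Rightarrow> real^'d \<Rightarrow> real" where
  "bary v x = 1 + bgrad v \<bullet> (x - v)"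

text \<open>The other vertices span a hyperplane that misses \<open>v\<close> by affine
  independence; a suitable multiple of its normal has the required values.\<close>

lemma bgrad: assumes v: "v \<in> C" and w: "w \<in> C" "w \<noteq> v" shows "bgrad v \<bullet> (w - v) = -1"
proof -
  have "\<not> affine_dependent (C - {v})" using indep affine_independent_Diff by blast
  then have "aff_dim (C - {v}) = int CARD('d) - 1"
    using aff_dim_affine_independent[of "C - {v}"] v card by (simp add: card_Diff_singleton)
  then obtain a b where ab: "a \<noteq> 0" "affine hull (C - {v}) = {x. a \<bullet> x = b}"
    using aff_dim_eq_hyperplane[of "C - {v}"] by auto
  have "v \<notin> affine hull (C - {v})" using indep v by (auto simp: affine_dependent_def)
  then have ne: "a \<bullet> v \<noteq> b" using ab by simp
  have "\<forall>w\<in>C - {v}. (1 / (a \<bullet> v - b)) *\<^sub>R a \<bullet> (w - v) = -1"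
  proof
    fix w assume "w \<in> C - {v}"
    then have "a \<bullet> w = b" using ab(2) hull_inc[of w "C - {v}" affine] by blast
    then have "(1 / (a \<bullet> v - b)) *\<^sub>R a \<bullet> (w - v) = (1 / (a \<bullet> v - b)) * (- (a \<bullet> v - b))"
      by (simp add: inner_diff_right diff_divide_distrib)
    also have "\<dots> = -1" using ne by (simp add: divide_eq_eq)
    finally show "(1 / (a \<bullet> v - b)) *\<^sub>R a \<bullet> (w - v) = -1" .
  qed
  then have "\<forall>w\<in>C - {v}. bgrad v \<bullet> (w - v) = -1" unfolding bgrad_def by (rule someI)
  then show ?thesis using w by blast
qed

lemma bary_vertex: "v \<in> C \<Longrightarrow> w \<in> C \<Longrightarrow> bary v w = (if w = v then 1 else 0)"
  using bgrad by (simp add: bary_def)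

lemma bary_affine: "bary v (x + t *\<^sub>R e) = bary v x + t * (bgrad v \<bullet> e)"
  by (simp add: bary_def algebra_simps)

lemma bary_sum:
  assumes "v \<in> C" "(\<Sum>w\<in>C. u w) = 1" shows "bary v (\<Sum>w\<in>C. u w *\<^sub>R w) = u v"
proof -
  have "bary v (\<Sum>w\<in>C. u w *\<^sub>R w) = (\<Sum>w\<in>C. u w) + bgrad v \<bullet> ((\<Sum>w\<in>C. u w *\<^sub>R w) - (\<Sum>w\<in>C. u w) *\<^sub>R v)"
    using assms by (simp add: bary_def)
  also have "\<dots> = (\<Sum>w\<in>C. u w * bary v w)"
    by (simp add: bary_def inner_diff_right inner_sum_right sum_distrib_left scaleR_sum_left algebra_simps sum.distrib sum_subtractf)
  also have "\<dots> = (\<Sum>w\<in>C. if w = v then u w else 0)"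
    using assms(1) by (intro sum.cong) (auto simp: bary_vertex)
  also have "\<dots> = u v" using assms(1) by simp
  finally show ?thesis .
qed

lemma affine_hull_C: "affine hull C = UNIV"
proof -
  have "aff_dim C = int DIM(real^'d)" using aff_dim_affine_independent[OF indep] card by simp
  then show ?thesis by (simp only: aff_dim_eq_full)
qed

lemma bary_expand: "(\<Sum>v\<in>C. bary v x) = 1" "(\<Sum>v\<in>C. bary v x *\<^sub>R v) = x"
proof -
  have "x \<in> affine hull C" by (simp add: affine_hull_C)
  then obtain u where u: "(\<Sum>w\<in>C. u w) = 1" "(\<Sum>w\<in>C. u w *\<^sub>R w) = x"
    by (auto simp: affine_hull_finite)
  then have "bary v x = u v" if "v \<in> C" for v using bary_sum[OF that u(1)] by simp
  then show "(\<Sum>v\<in>C. bary v x) = 1" "(\<Sum>v\<in>C. bary v x *\<^sub>R v) = x" using u by simp_all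
qed

text \<open>Moving along an edge changes only the coordinates of its two ends, at rates 1 and -1.
  This is why the edges are the convenient directions of integration.\<close>

lemma bgrad_diff:
  assumes "v \<in> C" "i \<in> C" "j \<in> C"
  shows "bgrad v \<bullet> (i - j) = (if i = v then 1 else 0) - (if j = v then 1 else 0)"
proof -
  have "bary v i = bary v j + bgrad v \<bullet> (i - j)" by (simp add: bary_def algebra_simps)
  then show ?thesis using assms by (simp add: bary_vertex)
qed

lemma K_bary: "K = {x. \<forall>v\<in>C. 0 \<le> bary v x}"
proof (intro equalityI subsetI)
  fix x assume "x \<in> K"
  then obtain u where u: "\<forall>w\<in>C. 0 \<le> u w" "(\<Sum>w\<in>C. u w) = 1" "(\<Sum>w\<in>C. u w *\<^sub>R w) = x"
    by (auto simp: convex_hull_finite)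
  then show "x \<in> {x. \<forall>v\<in>C. 0 \<le> bary v x}" using bary_sum by force
next
  fix x assume "x \<in> {x. \<forall>v\<in>C. 0 \<le> bary v x}"
  then show "x \<in> K" unfolding convex_hull_finite[OF finite_C]
    using bary_expand[of x] by (intro CollectI exI[of _ "\<lambda>v. bary v x"]) auto
qed

lemma facet_bary: assumes "v \<in> C" shows "convex hull (C - {v}) = {x \<in> K. bary v x = 0}"
proof (intro equalityI subsetI)
  fix x assume x: "x \<in> convex hull (C - {v})"
  then obtain u where u: "(\<Sum>w\<in>C - {v}. u w) = 1" "(\<Sum>w\<in>C - {v}. u w *\<^sub>R w) = x"
    by (auto simp: convex_hull_finite)
  define u' where "u' w = (if w = v then 0 else u w)" for w
  have "(\<Sum>w\<in>C. u' w) = 1" "(\<Sum>w\<in>C. u' w *\<^sub>R w) = x"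
    using u assms by (simp_all add: sum.remove[of C v] u'_def)
  then have "bary v x = 0" using bary_sum[OF assms, of u'] by (simp add: u'_def)
  moreover have "x \<in> K" using x hull_mono[of "C - {v}" C convex] by blast
  ultimately show "x \<in> {x \<in> K. bary v x = 0}" by simp
next
  fix x assume x: "x \<in> {x \<in> K. bary v x = 0}"
  show "x \<in> convex hull (C - {v})"
    unfolding convex_hull_finite[OF finite_Diff[OF finite_C]]
    using x bary_expand[of x] assms
    by (intro CollectI exI[of _ "\<lambda>w. bary w x"]) (auto simp: K_bary sum.remove[of C v])
qed

lemma continuous_bary: "continuous_on S (bary v)"
  unfolding bary_def[abs_def] by (intro continuous_intros)

lemma compact_K: "compact K"
  by (simp add: finite_imp_compact compact_convex_hull)

lemma K_borel: "K \<in> sets borel" and K_lebesgue: "K \<in> sets lebesgue" and K_lmeasurable: "K \<in> lmeasurable"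
  using compact_K by (auto simp: compact_imp_closed lmeasurable_compact)

lemma open_pos: "open {x. \<forall>v\<in>C. 0 < bary v x}"
proof -
  have "open (\<Inter>v\<in>C. {x. 0 < bary v x})"
    by (intro open_INT finite_C ballI open_Collect_less continuous_on_const continuous_bary)
  then show ?thesis by (simp add: INTER_eq)
qed

lemma pos_interior: "{x. \<forall>v\<in>C. 0 < bary v x} \<subseteq> interior K"
  by (rule interior_maximal[OF _ open_pos]) (auto simp: K_bary less_imp_le)

lemma C_nonempty: "C \<noteq> {}"
  using card by auto

lemma interior_nonempty: "interior K \<noteq> {}"
proof -
  define x where "x = (\<Sum>w\<in>C. (1 / real (card C)) *\<^sub>R w)"
  have "bary v x = 1 / real (card C)" if "v \<in> C" for v
    unfolding x_def using C_nonempty by (intro bary_sum that) simp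
  then have "x \<in> {x. \<forall>v\<in>C. 0 < bary v x}" using card by simp
  then show ?thesis using pos_interior by blast
qed

text \<open>If the coordinate were zero, a small step in the direction from \<open>v\<close> to
  another vertex would make it negative while staying in the simplex.\<close>

lemma interior_pos: "x \<in> interior K \<Longrightarrow> v \<in> C \<Longrightarrow> 0 < bary v x"
proof (rule ccontr)
  assume x: "x \<in> interior K" and v: "v \<in> C" and "\<not> 0 < bary v x"
  then have b0: "bary v x = 0" using interior_subset by (fastforce simp: K_bary)
  obtain w where w: "w \<in> C" "w \<noteq> v"
    using card v by (metis card_1_singletonE card_Suc_eq is_singletonI' is_singleton_altdef One_nat_def card_eq_0_iff finite nat.simps(3) C_nonempty Suc_inject zero_neq_one UNIV_not_empty)
  obtain e where e: "e > 0" "ball x e \<subseteq> K" using x by (auto simp: mem_interior)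
  \<comment> \<open>Half of the admissible radius; the summand 1 keeps the denominator positive
    without a case distinction.\<close>
  define t where "t = e / (2 * (1 + norm (w - v)))"
  have pos: "1 + norm (w - v) > 0" by (simp add: add_pos_nonneg)
  then have t: "t > 0" using e by (simp add: t_def)
  have "t * norm (w - v) < e"
  proof -
    have "t * norm (w - v) \<le> t * (1 + norm (w - v))" using t by (intro mult_left_mono) auto
    also have "\<dots> = e / 2"
    proof -
      have "e / (2 * N) * N = e / 2" if "N > 0" for N :: real using that by simp
      from this[OF pos] show ?thesis by (simp only: t_def)
    qed
    also have "\<dots> < e" using e by simp
    finally show ?thesis .
  qed
  then have "x + t *\<^sub>R (w - v) \<in> K" using e t by (intro subsetD[OF e(2)]) (simp add: dist_norm)
  then have "0 \<le> bary v (x + t *\<^sub>R (w - v))" using v by (simp add: K_bary)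
  then show False using b0 t bgrad[OF v w] by (simp add: bary_affine)
qed

lemma closure_interior: "closure (interior K) = K"
  using convex_closure_interior[OF convex_convex_hull interior_nonempty] compact_K by (simp add: compact_imp_closed)

lemma measure_pos: "measure lebesgue K > 0"
proof -
  have "\<not> negligible K"
    using interior_nonempty open_not_negligible[OF open_interior] negligible_subset interior_subset by metis
  then have "measure lebesgue K \<noteq> 0" using K_lmeasurable negligible_iff_measure0 by blast
  then show ?thesis using measure_nonneg[of lebesgue K] by linarith
qed

lemma integral_K:
  fixes f :: "real^'d \<Rightarrow> real"
  assumes "continuous_on K f"
  shows "(LINT x|lebesgue_on K. f x) = (LINT x|lborel. indicator K x * f x)" "integrable (lebesgue_on K) f"
proof -
  have m: "(\<lambda>x. indicator K x * f x) \<in> borel_measurable borel"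
    using borel_measurable_continuous_on_indicator[OF K_borel assms] by simp
  have i: "integrable lborel (\<lambda>x. indicator K x * f x)"
    using borel_integrable_compact[OF compact_K assms] by (simp add: indicator_def if_distrib cong: if_cong)
  then show "integrable (lebesgue_on K) f"
    using K_lebesgue m by (simp add: integrable_restrict_space integrable_completion)
  show "(LINT x|lebesgue_on K. f x) = (LINT x|lborel. indicator K x * f x)"
    using K_lebesgue m by (simp add: integral_restrict_space integral_completion)
qed

section \<open>Integration by parts along the edges of a simplex\<close>

text \<open>Lines in direction \<open>i - j\<close> enter the simplex through the facet opposite
  \<open>i\<close> and leave it through the one opposite \<open>j\<close>, and \<psi> vanishes on
  both. So its extension by zero is Lipschitz in this direction, and its difference quotients, which
  have integral 0 by translation invariance, converge dominatedly to the derivative.\<close>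

lemma integral_along_edge_eq_0:
  fixes \<psi> :: "real^'d \<Rightarrow> real"
  assumes ij: "i \<in> C" "j \<in> C" "i \<noteq> j"
    and D: "\<And>x. (\<psi> has_derivative D x) (at x)" and cont: "continuous_on K (\<lambda>x. D x (i - j))"
    and zero: "\<And>x. x \<in> K \<Longrightarrow> bary i x = 0 \<or> bary j x = 0 \<Longrightarrow> \<psi> x = 0"
  shows "(LINT x|lebesgue_on K. D x (i - j)) = 0"
proof -
  define e where "e = i - j"
  define G where "G x = indicator K x * \<psi> x" for x
  have bi: "bgrad i \<bullet> e = 1" "bgrad j \<bullet> e = -1" and bo: "\<And>v. v \<in> C \<Longrightarrow> v \<noteq> i \<Longrightarrow> v \<noteq> j \<Longrightarrow> bgrad v \<bullet> e = 0"
    using ij bgrad_diff by (auto simp: e_def)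
  have "bounded ((\<lambda>x. D x e) ` K)"
    using cont compact_K by (intro compact_imp_bounded compact_continuous_image) (simp_all add: e_def)
  then obtain M where M: "M > 0" "\<And>x. x \<in> K \<Longrightarrow> \<bar>D x e\<bar> \<le> M" by (auto simp: bounded_pos)
  have c\<psi>: "continuous_on S \<psi>" for S
    using D has_derivative_continuous by (metis continuous_at_imp_continuous_on)
  have segment: "\<bar>\<psi> (x + t *\<^sub>R e) - \<psi> x\<bar> \<le> M * t" if "x \<in> K" "x + t *\<^sub>R e \<in> K" "0 \<le> t" for x t
  proof -
    have inK: "x + s *\<^sub>R e \<in> K" if s: "s \<in> {0..t}" for s
    proof (cases "t = 0")
      case False
      have "(1 - s/t) *\<^sub>R x + (s/t) *\<^sub>R (x + t *\<^sub>R e) \<in> K"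
        using s False \<open>x \<in> K\<close> \<open>x + t *\<^sub>R e \<in> K\<close> by (intro convexD_alt[OF convex_convex_hull]) auto
      then show ?thesis using False by (simp add: algebra_simps)
    qed (use s \<open>x \<in> K\<close> in auto)
    have "norm (\<psi> (x + t *\<^sub>R e) - \<psi> (x + 0 *\<^sub>R e)) \<le> M * norm (t - 0)"
    proof (rule field_differentiable_bound[of "{0..t}" "\<lambda>s. \<psi> (x + s *\<^sub>R e)" "\<lambda>s. D (x + s *\<^sub>R e) e"])
      show "((\<lambda>s. \<psi> (x + s *\<^sub>R e)) has_field_derivative D (x + s *\<^sub>R e) e) (at s within {0..t})" for s
        by (rule has_field_derivative_at_within[OF has_real_derivative_along[OF D]])
    qed (use M inK \<open>0 \<le> t\<close> in auto)
    then show ?thesis using \<open>0 \<le> t\<close> by simp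
  qed
  \<comment> \<open>If only one end of the segment is in the simplex, the segment is cut at the
    boundary point it passes; \<psi> is zero there, and the remaining piece is shorter.\<close>
  have lip: "\<bar>G (x + t *\<^sub>R e) - G x\<bar> \<le> M * t" if t: "0 \<le> t" for x t
  proof -
    consider "x \<in> K" "x + t *\<^sub>R e \<in> K" | "x \<in> K" "x + t *\<^sub>R e \<notin> K" | "x \<notin> K" "x + t *\<^sub>R e \<in> K" | "x \<notin> K" "x + t *\<^sub>R e \<notin> K"
      by blast
    then show ?thesis
    proof cases
      case 1
      then show ?thesis using segment[OF 1 t] by (simp add: G_def)
    next
      case 2
      have x: "0 \<le> bary v x" if "v \<in> C" for v using 2 that by (simp add: K_bary)
      \<comment> \<open>Along \<open>e\<close> only the coordinate of \<open>j\<close> decreases, so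
        this is the one that turns negative; it reaches zero after the time \<open>bary j x\<close>,
        at the exit point \<open>?y\<close>.\<close>
      obtain v where v: "v \<in> C" "bary v (x + t *\<^sub>R e) < 0" using 2(2) by (auto simp: K_bary not_le)
      then have "v = j" using x[OF v(1)] bo[OF v(1)] bi t by (cases "v = i"; cases "v = j") (auto simp: bary_affine)
      then have s: "0 \<le> bary j x" "bary j x < t" using v x[OF ij(2)] bi by (auto simp: bary_affine)
      let ?y = "x + bary j x *\<^sub>R e"
      have y0: "bary j ?y = 0" using bi by (simp add: bary_affine)
      have yK: "?y \<in> K" unfolding K_bary
      proof (intro CollectI ballI)
        fix w assume w: "w \<in> C"
        show "0 \<le> bary w ?y"
          using x[OF w] s bi bo[OF w] y0 by (cases "w = i"; cases "w = j") (auto simp: bary_affine)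
      qed
      have "\<bar>\<psi> ?y - \<psi> x\<bar> \<le> M * bary j x" by (rule segment[OF 2(1) yK s(1)])
      then have "\<bar>\<psi> x\<bar> \<le> M * bary j x" using zero[OF yK] y0 by simp
      also have "\<dots> \<le> M * t" using M s by simp
      finally show ?thesis using 2 by (simp add: G_def)
    next
      case 3
      let ?z = "x + t *\<^sub>R e"
      have z: "0 \<le> bary v ?z" if "v \<in> C" for v using 3 that by (simp add: K_bary)
      \<comment> \<open>The mirror image: traced back from \<open>?z\<close>, the coordinate of
        \<open>i\<close> decreases and gives the entry point.\<close>
      obtain v where v: "v \<in> C" "bary v x < 0" using 3(1) by (auto simp: K_bary not_le)
      then have "v = i" using z[OF v(1)] bo[OF v(1)] bi t by (cases "v = i"; cases "v = j") (auto simp: bary_affine)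
      then have s: "0 \<le> bary i ?z" "bary i ?z < t" using v z[OF ij(1)] bi by (auto simp: bary_affine)
      let ?y = "?z + (- bary i ?z) *\<^sub>R e"
      have y0: "bary i ?y = 0"
      proof -
        have "bary i ?y = bary i ?z + (- bary i ?z) * (bgrad i \<bullet> e)" by (rule bary_affine)
        also have "\<dots> = 0" unfolding bi by simp
        finally show ?thesis .
      qed
      have yK: "?y \<in> K" unfolding K_bary
      proof (intro CollectI ballI)
        fix w assume w: "w \<in> C"
        show "0 \<le> bary w ?y"
        proof (cases "w = i")
          case False
          have "bary w ?y = bary w ?z + (- bary i ?z) * (bgrad w \<bullet> e)" by (rule bary_affine)
          then show ?thesis using False z[OF w] s bi bo[OF w] by (cases "w = j") auto
        next
          case True
          show ?thesis unfolding True y0 by simp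
        qed
      qed
      have "\<bar>\<psi> (?y + bary i ?z *\<^sub>R e) - \<psi> ?y\<bar> \<le> M * bary i ?z"
        by (rule segment[OF yK _ s(1)]) (use 3 in simp)
      then have "\<bar>\<psi> ?z\<bar> \<le> M * bary i ?z" using zero[OF yK] y0 by simp
      also have "\<dots> \<le> M * t" using M s by simp
      finally show ?thesis using 3 by (simp add: G_def)
    next
      case 4
      then show ?thesis using M t by (simp add: G_def)
    qed
  qed
  have Gm: "G \<in> borel_measurable borel"
    using borel_measurable_continuous_on_indicator[OF K_borel c\<psi>[of K]] by (simp add: G_def[abs_def])
  have Gi: "integrable lborel G"
    using borel_integrable_compact[OF compact_K c\<psi>[of K]] by (simp add: G_def[abs_def] indicator_def if_distrib cong: if_cong)
  define t where "t n = 1 / real (Suc n)" for n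
  have t: "0 < t n" "t n \<le> 1" for n by (simp_all add: t_def)
  have t0: "t \<longlonglongrightarrow> 0" unfolding t_def by (intro LIMSEQ_Suc lim_1_over_n)
  obtain R where R: "\<And>x. x \<in> K \<Longrightarrow> norm x \<le> R" using compact_imp_bounded[OF compact_K] by (auto simp: bounded_iff)
  have Gshift: "integrable lborel (\<lambda>x. G (x + t n *\<^sub>R e))" "(LINT x|lborel. G (x + t n *\<^sub>R e)) = (LINT x|lborel. G x)" for n
  proof -
    have "integrable (distr lborel borel ((+) (t n *\<^sub>R e))) G" using Gi by (simp add: lborel_distr_plus)
    then have "integrable lborel (\<lambda>x. G (t n *\<^sub>R e + x))" using Gm by (subst (asm) integrable_distr_eq) auto
    then show "integrable lborel (\<lambda>x. G (x + t n *\<^sub>R e))" by (simp add: add.commute)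
    show "(LINT x|lborel. G (x + t n *\<^sub>R e)) = (LINT x|lborel. G x)" by (rule integral_lborel_shift[OF Gm])
  qed
  have q0: "(LINT x|lborel. (G (x + t n *\<^sub>R e) - G x) / t n) = 0" for n
    using Gshift[of n] Gi by simp
  have "(\<lambda>n. LINT x|lborel. (G (x + t n *\<^sub>R e) - G x) / t n) \<longlonglongrightarrow> (LINT x|lborel. indicator K x * D x e)"
  proof (rule integral_dominated_convergence[where w = "\<lambda>x. M * indicator (cball 0 (R + norm e)) x"])
    show "(\<lambda>x. indicator K x * D x e) \<in> borel_measurable lborel"
      using borel_measurable_continuous_on_indicator[OF K_borel cont] by (simp add: e_def)
    show "(\<lambda>x. (G (x + t n *\<^sub>R e) - G x) / t n) \<in> borel_measurable lborel" for n
      using Gm by measurable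
    show "integrable lborel (\<lambda>x. M * indicator (cball 0 (R + norm e)) x :: real)"
      \<comment> \<open>As the step lengths are at most 1, all quotients vanish outside this one
        ball, which makes the constant bound integrable.\<close>
      using emeasure_compact_finite[OF compact_cball[of 0 "R + norm e"]]
      by (intro integrable_mult_right integrable_real_indicator) simp_all
    show "AE x in lborel. norm ((G (x + t n *\<^sub>R e) - G x) / t n) \<le> M * indicator (cball 0 (R + norm e)) x" for n
    proof (rule AE_I2)
      fix x
      show "norm ((G (x + t n *\<^sub>R e) - G x) / t n) \<le> M * indicator (cball 0 (R + norm e)) x"
      proof (cases "x \<in> cball 0 (R + norm e)")
        case True
        then show ?thesis using lip[of "t n" x] t[of n] by (simp add: field_simps)
      next
        case False
        have "x \<notin> K" using False R[of x] norm_ge_zero[of e] by (auto simp del: norm_ge_zero)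
        moreover have "x + t n *\<^sub>R e \<notin> K"
        proof
          assume "x + t n *\<^sub>R e \<in> K"
          have "norm x \<le> norm (x + t n *\<^sub>R e) + norm (t n *\<^sub>R e)" by (metis add_diff_cancel_right' norm_triangle_ineq4)
          also have "\<dots> \<le> R + norm e"
            using R[OF \<open>x + t n *\<^sub>R e \<in> K\<close>] t[of n] by (intro add_mono) (auto simp: mult_left_le_one_le)
          finally show False using False by simp
        qed
        ultimately show ?thesis using False by (simp add: G_def)
      qed
    qed
    \<comment> \<open>Pointwise convergence is checked off this null set: at interior points the
      quotient is eventually that of \<psi>, at exterior points it is eventually 0.\<close>
    have "AE x in lborel. x \<notin> frontier K"
    proof -
      have "negligible (frontier K)" by (intro negligible_convex_frontier convex_convex_hull)
      then have "AE x in lebesgue. x \<notin> frontier K" by (intro AE_not_in) (simp add: negligible_iff_null_sets)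
      then show ?thesis by (subst (asm) AE_completion_iff) auto
    qed
    then show "AE x in lborel. (\<lambda>n. (G (x + t n *\<^sub>R e) - G x) / t n) \<longlonglongrightarrow> indicator K x * D x e"
    proof eventually_elim
      case (elim x)
      have lim: "(\<lambda>n. x + t n *\<^sub>R e) \<longlonglongrightarrow> x" using t0 by (auto intro!: tendsto_eq_intros)
      show ?case
      proof (cases "x \<in> K")
        case True
        then have xi: "x \<in> interior K" using elim compact_K by (simp add: frontier_def compact_imp_closed)
        have "\<forall>\<^sub>F n in sequentially. x + t n *\<^sub>R e \<in> interior K"
          using lim xi by (intro topological_tendstoD) auto
        then have ev: "\<forall>\<^sub>F n in sequentially. (\<psi> (x + t n *\<^sub>R e) - \<psi> x) / t n = (G (x + t n *\<^sub>R e) - G x) / t n"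
          by eventually_elim (use True interior_subset[of K] in \<open>auto simp: G_def\<close>)
        have "(\<lambda>n. (\<psi> (x + t n *\<^sub>R e) - \<psi> (x + 0 *\<^sub>R e)) / t n) \<longlonglongrightarrow> D x e"
        proof (rule has_derivative_at_0_sequence[OF _ t0])
          show "((\<lambda>s. \<psi> (x + s *\<^sub>R e)) has_real_derivative D x e) (at 0)"
            using has_real_derivative_along[of \<psi> "D x" x 0 e] D by simp
          show "t n \<noteq> 0" for n using t(1)[of n] by simp
        qed
        then show ?thesis using True Lim_transform_eventually[OF _ ev] by simp
      next
        case False
        then have "\<forall>\<^sub>F n in sequentially. x + t n *\<^sub>R e \<in> - K"
          using lim compact_K by (intro topological_tendstoD) (auto simp: compact_imp_closed)
        then have "\<forall>\<^sub>F n in sequentially. (G (x + t n *\<^sub>R e) - G x) / t n = 0"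
          by eventually_elim (use False in \<open>auto simp: G_def\<close>)
        then have "(\<lambda>n. (G (x + t n *\<^sub>R e) - G x) / t n) \<longlonglongrightarrow> 0" by (rule tendsto_eventually)
        then show ?thesis using False by simp
      qed
    qed
  qed
  then have "(LINT x|lborel. indicator K x * D x e) = 0" unfolding q0 by (simp add: LIMSEQ_const_iff)
  then show ?thesis using integral_K(1)[OF cont] by (simp add: e_def)
qed

text \<open>The integrand is the divergence of \<psi> times the cone field \<open>x - v0\<close>.
  This field is tangential on the facets through \<open>v0\<close>, and \<psi> vanishes on the
  remaining one. In terms of edges, each product \<open>bary v x * \<psi> x\<close> vanishes on the
  facets opposite to \<open>v\<close> and to \<open>v0\<close>.\<close>

lemma integral_cone_field_eq_0:
  assumes v0: "v0 \<in> C" and D: "\<And>x. (\<psi> has_derivative (\<lambda>h. G x \<bullet> h)) (at x)" and cont: "continuous_on UNIV G"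
    and zero: "\<And>x. x \<in> K \<Longrightarrow> bary v0 x = 0 \<Longrightarrow> \<psi> x = 0"
  shows "(LINT x|lebesgue_on K. real CARD('d) * \<psi> x + G x \<bullet> (x - v0)) = 0"
proof -
  have c\<psi>: "continuous_on S \<psi>" for S
    using D has_derivative_continuous by (metis continuous_at_imp_continuous_on)
  have cG: "continuous_on S G" for S using cont by (rule continuous_on_subset) simp
  have each: "(LINT x|lebesgue_on K. \<psi> x + bary v x * (G x \<bullet> (v - v0))) = 0"
    "integrable (lebesgue_on K) (\<lambda>x. \<psi> x + bary v x * (G x \<bullet> (v - v0)))" if v: "v \<in> C - {v0}" for v
  proof -
    have b1: "bgrad v \<bullet> (v - v0) = 1" using bgrad_diff[of v v v0] v v0 by auto
    have Db: "(bary v has_derivative (\<lambda>h. bgrad v \<bullet> h)) (at x)" for x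
      unfolding bary_def[abs_def] by (auto intro!: derivative_eq_intros)
    have D': "((\<lambda>x. bary v x * \<psi> x) has_derivative (\<lambda>h. bary v x * (G x \<bullet> h) + (bgrad v \<bullet> h) * \<psi> x)) (at x)" for x
      by (rule has_derivative_mult[OF Db D])
    have ct: "continuous_on K (\<lambda>x. bary v x * (G x \<bullet> (v - v0)) + (bgrad v \<bullet> (v - v0)) * \<psi> x)"
      by (intro continuous_intros continuous_bary cG c\<psi>)
    have "(LINT x|lebesgue_on K. bary v x * (G x \<bullet> (v - v0)) + (bgrad v \<bullet> (v - v0)) * \<psi> x) = 0"
      by (rule integral_along_edge_eq_0[OF _ v0 _ D' ct]) (use v zero in auto)
    then show "(LINT x|lebesgue_on K. \<psi> x + bary v x * (G x \<bullet> (v - v0))) = 0" by (simp add: b1 add.commute)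
    show "integrable (lebesgue_on K) (\<lambda>x. \<psi> x + bary v x * (G x \<bullet> (v - v0)))"
      by (intro integral_K continuous_intros continuous_bary cG c\<psi>)
  qed
  \<comment> \<open>The cone field is expanded in the edges at \<open>v0\<close>; each of the
    \<open>CARD('d)\<close> edges contributes one copy of \<psi>, which accounts for the
    factor.\<close>
  have "real CARD('d) * \<psi> x + G x \<bullet> (x - v0) = (\<Sum>v\<in>C - {v0}. \<psi> x + bary v x * (G x \<bullet> (v - v0)))" for x
  proof -
    have "x - v0 = (\<Sum>v\<in>C. bary v x *\<^sub>R v) - (\<Sum>v\<in>C. bary v x) *\<^sub>R v0" by (simp add: bary_expand)
    also have "\<dots> = (\<Sum>v\<in>C. bary v x *\<^sub>R (v - v0))" by (simp add: scaleR_sum_left sum_subtractf algebra_simps)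
    also have "\<dots> = (\<Sum>v\<in>C - {v0}. bary v x *\<^sub>R (v - v0))" using v0 by (simp add: sum.remove[of C v0])
    finally have "G x \<bullet> (x - v0) = (\<Sum>v\<in>C - {v0}. bary v x * (G x \<bullet> (v - v0)))"
      by (simp add: inner_sum_right)
    moreover have "card (C - {v0}) = CARD('d)" using v0 card by simp
    ultimately show ?thesis by (simp add: sum.distrib)
  qed
  then show ?thesis using each by (simp add: Bochner_Integration.integral_sum)
qed

text \<open>The covariance matrix of the barycentric weights at \<open>x\<close>, applied to \<open>g x\<close>.\<close>

definition bubble :: "(real^'d \<Rightarrow> real^'d) \<Rightarrow> real^'d \<Rightarrow> real^'d" where
  "bubble g x = (\<Sum>i\<in>C. bary i x *\<^sub>R ((i \<bullet> g x) *\<^sub>R i)) - (x \<bullet> g x) *\<^sub>R x"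

text \<open>The usual expression of a covariance by differences of independent copies. It shows what
  the defining formula hides: the field consists of edge vectors with weights that vanish on the
  facets opposite to both ends.\<close>

lemma bubble_pairs:
  "bubble g x = (1/2) *\<^sub>R (\<Sum>i\<in>C. \<Sum>j\<in>C. (bary i x * bary j x * ((i - j) \<bullet> g x)) *\<^sub>R (i - j))"
proof -
  let ?b = "\<lambda>i. bary i x"
  have 1: "(\<Sum>i\<in>C. \<Sum>j\<in>C. (?b i * ?b j * (i \<bullet> g x)) *\<^sub>R i) = (\<Sum>i\<in>C. ?b i *\<^sub>R ((i \<bullet> g x) *\<^sub>R i))"
  proof (rule sum.cong[OF refl])
    fix i
    have "(\<Sum>j\<in>C. ?b i * ?b j * (i \<bullet> g x)) = ?b i * (i \<bullet> g x) * (\<Sum>j\<in>C. ?b j)"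
      by (simp add: sum_distrib_left mult_ac)
    then show "(\<Sum>j\<in>C. (?b i * ?b j * (i \<bullet> g x)) *\<^sub>R i) = ?b i *\<^sub>R ((i \<bullet> g x) *\<^sub>R i)"
      unfolding scaleR_sum_left[symmetric] by (simp add: bary_expand)
  qed
  have 2: "(\<Sum>i\<in>C. \<Sum>j\<in>C. (?b i * ?b j * (i \<bullet> g x)) *\<^sub>R j) = (x \<bullet> g x) *\<^sub>R x"
  proof -
    have "(\<Sum>i\<in>C. \<Sum>j\<in>C. (?b i * ?b j * (i \<bullet> g x)) *\<^sub>R j) = (\<Sum>i\<in>C. (?b i * (i \<bullet> g x)) *\<^sub>R (\<Sum>j\<in>C. ?b j *\<^sub>R j))"
      by (simp add: scaleR_sum_right mult_ac)
    also have "\<dots> = (\<Sum>i\<in>C. ?b i * (i \<bullet> g x)) *\<^sub>R x" by (simp only: bary_expand(2) scaleR_sum_left)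
    also have "(\<Sum>i\<in>C. ?b i * (i \<bullet> g x)) = (\<Sum>i\<in>C. ?b i *\<^sub>R i) \<bullet> g x"
      by (simp only: inner_sum_left inner_scaleR_left)
    finally show ?thesis by (simp only: bary_expand(2))
  qed
  have 3: "(\<Sum>i\<in>C. \<Sum>j\<in>C. (?b i * ?b j * (j \<bullet> g x)) *\<^sub>R j) = (\<Sum>i\<in>C. ?b i *\<^sub>R ((i \<bullet> g x) *\<^sub>R i))"
    using 1 by (subst sum.swap) (simp add: mult.commute)
  have 4: "(\<Sum>i\<in>C. \<Sum>j\<in>C. (?b i * ?b j * (j \<bullet> g x)) *\<^sub>R i) = (x \<bullet> g x) *\<^sub>R x"
    using 2 by (subst sum.swap) (simp add: mult.commute)
  have "(?b i * ?b j * ((i - j) \<bullet> g x)) *\<^sub>R (i - j) = (?b i * ?b j * (i \<bullet> g x)) *\<^sub>R i - (?b i * ?b j * (i \<bullet> g x)) *\<^sub>R j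
      - (?b i * ?b j * (j \<bullet> g x)) *\<^sub>R i + (?b i * ?b j * (j \<bullet> g x)) *\<^sub>R j" for i j
    by (simp add: algebra_simps)
  then have "(\<Sum>i\<in>C. \<Sum>j\<in>C. (?b i * ?b j * ((i - j) \<bullet> g x)) *\<^sub>R (i - j)) = 2 *\<^sub>R bubble g x"
    by (simp add: sum.distrib sum_subtractf 1 2 3 4 bubble_def scaleR_2)
  then show ?thesis by simp
qed

lemma bubble_inner:
  "bubble g x \<bullet> h = 1/2 * (\<Sum>i\<in>C. \<Sum>j\<in>C. bary i x * bary j x * ((i - j) \<bullet> g x) * ((i - j) \<bullet> h))"
  by (simp add: bubble_pairs inner_sum_left)

text \<open>On the facet opposite \<open>u\<close> every pair containing \<open>u\<close> has weight
  zero, and the edges of the remaining pairs are tangential.\<close>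

lemma bubble_normal:
  assumes u: "u \<in> C" "bary u x = 0" and n: "\<And>v w. v \<in> C - {u} \<Longrightarrow> w \<in> C - {u} \<Longrightarrow> n \<bullet> (v - w) = 0"
  shows "bubble g x \<bullet> n = 0"
proof -
  have "bary i x * bary j x * ((i - j) \<bullet> g x) * ((i - j) \<bullet> n) = 0" if "i \<in> C" "j \<in> C" for i j
    using n[of i j] u that by (cases "i = u"; cases "j = u") (auto simp: inner_commute)
  then have "(\<Sum>i\<in>C. \<Sum>j\<in>C. bary i x * bary j x * ((i - j) \<bullet> g x) * ((i - j) \<bullet> n)) = 0"
    by (intro sum.neutral ballI)
  then show ?thesis unfolding bubble_inner by simp
qed

text \<open>The first sum has degree one more than \<open>g\<close>. Only the second term exceeds
  this, and its excess is a homogeneous polynomial times \<open>x\<close>, which is exactly the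
  Raviart-Thomas enrichment.\<close>

lemma bubble_RT:
  assumes g: "\<And>i. (\<lambda>x. g x $ i) \<in> polys l"
  shows "bubble g \<in> RT_polys (Suc l)"
proof -
  have vg: "(\<lambda>x. v \<bullet> g x) \<in> polys l" for v
    unfolding inner_vec_def by (auto intro!: polys_sum polys_scale g)
  have "(\<lambda>x. x \<bullet> g x) \<in> polys (Suc l)"
    unfolding inner_vec_def using polys_mult[OF polys_nth g] by (auto intro!: polys_sum)
  then obtain r b where rb: "r \<in> polys l" "b \<in> hom_polys (Suc l)" "(\<lambda>x. x \<bullet> g x) = (\<lambda>x. r x + b x)"
    by (rule polys_split)
  define a where "a x = (\<Sum>i\<in>C. bary i x *\<^sub>R ((i \<bullet> g x) *\<^sub>R i)) - r x *\<^sub>R x" for x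
  have "(\<lambda>x. a x $ j) \<in> polys (Suc l)" for j
  proof -
    have b1: "bary i \<in> polys 1" for i
      using polys_inner[of "bgrad i" "1 - bgrad i \<bullet> i"] by (simp add: bary_def[abs_def] algebra_simps)
    have "(\<lambda>x. (i $ j) * (bary i x * (i \<bullet> g x))) \<in> polys (Suc l)" for i
      using polys_mult[OF b1 vg] by (intro polys_scale) simp
    moreover have "(\<lambda>x. (-1) * (x $ j * r x)) \<in> polys (Suc l)"
      using polys_mult[OF polys_nth rb(1)] by (intro polys_scale) simp
    ultimately have "(\<lambda>x. (\<Sum>i\<in>C. (i $ j) * (bary i x * (i \<bullet> g x))) + (-1) * (x $ j * r x)) \<in> polys (Suc l)"
      by (intro polys_add polys_sum)
    then show ?thesis by (simp add: a_def mult_ac)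
  qed
  moreover have "bubble g x = a x + (- b x) *\<^sub>R x" for x
    using fun_cong[OF rb(3), of x] by (simp add: bubble_def a_def algebra_simps)
  moreover have "(\<lambda>x. - b x) \<in> hom_polys (Suc l)"
    using subspace_neg[OF subspace_hom_polys rb(2)] by (simp add: fun_Compl_def)
  ultimately show ?thesis unfolding RT_polys_def by blast
qed

text \<open>Each pair contributes a scalar weight \<theta> times an edge, and \<theta> vanishes on
  the two facets that the edge formula asks for, so \<psi> is unrestricted on the boundary. The
  witness \<open>w\<close> must not depend on \<psi>, since it becomes the weak divergence.\<close>

lemma bubble_integration_by_parts:
  assumes Dg: "\<And>x. (g has_derivative g' x) (at x)" and cg': "\<And>h. continuous_on UNIV (\<lambda>x. g' x h)"
  obtains w where "continuous_on UNIV w"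
    "\<And>(\<psi> :: real^'d \<Rightarrow> real) (G :: real^'d \<Rightarrow> real^'d). (\<And>x. (\<psi> has_derivative (\<lambda>h. G x \<bullet> h)) (at x)) \<Longrightarrow> continuous_on UNIV G \<Longrightarrow>
       (LINT x|lebesgue_on K. bubble g x \<bullet> G x) = - (LINT x|lebesgue_on K. w x * \<psi> x)"
proof -
  have cg: "continuous_on S g" for S
    using Dg has_derivative_continuous by (metis continuous_at_imp_continuous_on)
  define \<theta> where "\<theta> i j x = bary i x * bary j x * ((i - j) \<bullet> g x)" for i j x
  define \<theta>' where "\<theta>' i j x h = bary i x * bary j x * ((i - j) \<bullet> g' x h) + (bary i x * (bgrad j \<bullet> h) + (bgrad i \<bullet> h) * bary j x) * ((i - j) \<bullet> g x)" for i j x h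
  \<comment> \<open>The divergence of the field: the derivative of each weight along its own
    edge.\<close>
  define w where "w x = 1/2 * (\<Sum>i\<in>C. \<Sum>j\<in>C. \<theta>' i j x (i - j))" for x
  have c\<theta>: "continuous_on S (\<theta> i j)" for i j S
    unfolding \<theta>_def[abs_def] by (intro continuous_intros continuous_bary cg)
  have c\<theta>': "continuous_on S (\<lambda>x. \<theta>' i j x h)" for i j h S
    unfolding \<theta>'_def[abs_def] by (intro continuous_intros continuous_bary cg continuous_on_subset[OF cg']) simp
  have D\<theta>: "(\<theta> i j has_derivative \<theta>' i j x) (at x)" for i j x
  proof -
    have Db: "(bary v has_derivative (\<lambda>h. bgrad v \<bullet> h)) (at x)" for v x
      unfolding bary_def[abs_def] by (auto intro!: derivative_eq_intros)
    have "((\<lambda>x. (i - j) \<bullet> g x) has_derivative (\<lambda>h. (i - j) \<bullet> g' x h)) (at x)"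
      by (intro has_derivative_inner_right Dg)
    from has_derivative_mult[OF has_derivative_mult[OF Db Db] this]
    show ?thesis unfolding \<theta>_def[abs_def] \<theta>'_def[abs_def] .
  qed
  show ?thesis
  proof (rule that)
    show "continuous_on UNIV w" unfolding w_def[abs_def] by (intro continuous_intros c\<theta>')
    fix \<psi> :: "real^'d \<Rightarrow> real" and G :: "real^'d \<Rightarrow> real^'d" assume D: "\<And>x. (\<psi> has_derivative (\<lambda>h. G x \<bullet> h)) (at x)" and cG': "continuous_on UNIV G"
    have c\<psi>: "continuous_on S \<psi>" for S
      using D has_derivative_continuous by (metis continuous_at_imp_continuous_on)
    have cG: "continuous_on S G" for S using cG' by (rule continuous_on_subset) simp
    define I where "I i j x = \<theta> i j x * (G x \<bullet> (i - j)) + \<theta>' i j x (i - j) * \<psi> x" for i j x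
    have cI: "continuous_on S (I i j)" for i j S
      unfolding I_def[abs_def] by (intro continuous_intros c\<theta> c\<theta>' c\<psi> cG)
    have I0: "(LINT x|lebesgue_on K. I i j x) = 0" if "i \<in> C" "j \<in> C" for i j
    proof (cases "i = j")
      case True
      have "\<theta>' j j x 0 = 0" for x
        using linear_0[OF has_derivative_linear[OF D\<theta>]] .
      then show ?thesis using True by (simp add: I_def)
    next
      case False
      have "((\<lambda>x. \<theta> i j x * \<psi> x) has_derivative (\<lambda>h. \<theta> i j x * (G x \<bullet> h) + \<theta>' i j x h * \<psi> x)) (at x)" for x
        by (rule has_derivative_mult[OF D\<theta> D])
      from integral_along_edge_eq_0[OF that False this]
      show ?thesis using cI[of K i j] by (auto simp: I_def[abs_def] \<theta>_def)
    qed
    have "(LINT x|lebesgue_on K. bubble g x \<bullet> G x + w x * \<psi> x) = (LINT x|lebesgue_on K. 1/2 * (\<Sum>i\<in>C. \<Sum>j\<in>C. I i j x))"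
    proof -
      have "bubble g x \<bullet> G x = 1/2 * (\<Sum>i\<in>C. \<Sum>j\<in>C. \<theta> i j x * (G x \<bullet> (i - j)))" for x
        unfolding bubble_inner \<theta>_def by (simp add: inner_commute)
      moreover have "w x * \<psi> x = 1/2 * (\<Sum>i\<in>C. \<Sum>j\<in>C. \<theta>' i j x (i - j) * \<psi> x)" for x
        unfolding w_def by (simp add: sum_distrib_right)
      ultimately show ?thesis unfolding I_def sum.distrib distrib_left by presburger
    qed
    also have "\<dots> = 1/2 * (\<Sum>i\<in>C. \<Sum>j\<in>C. LINT x|lebesgue_on K. I i j x)"
      using integral_K(2)[OF cI] by (simp add: Bochner_Integration.integral_sum)
    also have "\<dots> = 0" using I0 by simp
    finally have "(LINT x|lebesgue_on K. bubble g x \<bullet> G x + w x * \<psi> x) = 0" .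
    moreover have "integrable (lebesgue_on K) (\<lambda>x. bubble g x \<bullet> G x)"
      unfolding bubble_def by (intro integral_K continuous_intros continuous_bary cG cg)
    moreover have "integrable (lebesgue_on K) (\<lambda>x. w x * \<psi> x)"
      unfolding w_def by (intro integral_K continuous_intros c\<theta>' c\<psi>)
    ultimately show "(LINT x|lebesgue_on K. bubble g x \<bullet> G x) = - (LINT x|lebesgue_on K. w x * \<psi> x)" by simp
  qed
qed

text \<open>By the pair formula the integrand is a sum of squares of
  \<open>(i - j) \<bullet> g x\<close> with nonnegative weights, which are positive in the interior.
  It vanishes everywhere there by continuity, and the edges span the space.\<close>

lemma bubble_vanishing_gradient:
  assumes cg: "continuous_on UNIV g" and zero: "(LINT x|lebesgue_on K. bubble g x \<bullet> g x) = 0" and x: "x \<in> interior K"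
  shows "g x = 0"
proof -
  have c: "continuous_on S (\<lambda>x. bubble g x \<bullet> g x)" for S
    unfolding bubble_def[abs_def] by (intro continuous_intros continuous_bary continuous_on_subset[OF cg]) auto
  have nn: "0 \<le> bubble g y \<bullet> g y" if "y \<in> K" for y
  proof -
    have "0 \<le> bary i y * bary j y * ((i - j) \<bullet> g y) * ((i - j) \<bullet> g y)" if "i \<in> C" "j \<in> C" for i j
    proof -
      have "0 \<le> bary i y" "0 \<le> bary j y" using \<open>y \<in> K\<close> that by (auto simp: K_bary)
      then show ?thesis by (simp add: mult.assoc)
    qed
    then show ?thesis unfolding bubble_inner by (simp add: sum_nonneg)
  qed
  have "AE y in lebesgue_on K. bubble g y \<bullet> g y = 0"
  proof -
    have "AE y in lebesgue_on K. 0 \<le> bubble g y \<bullet> g y" by (rule AE_I2) (use nn in simp)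
    then show ?thesis using zero integral_nonneg_eq_0_iff_AE[OF integral_K(2)[OF c]] by blast
  qed
  then have ae: "AE y in lebesgue. y \<in> K \<longrightarrow> bubble g y \<bullet> g y = 0"
    using K_lebesgue by (simp add: AE_restrict_space_iff)
  have "bubble g x \<bullet> g x = 0"
  proof (rule ccontr)
    assume "bubble g x \<bullet> g x \<noteq> 0"
    define S where "S = {y \<in> interior K. bubble g y \<bullet> g y \<noteq> 0}"
    have "open S"
    proof -
      have "open {y. bubble g y \<bullet> g y \<noteq> 0}" by (intro open_Collect_neq c continuous_on_const)
      then show ?thesis unfolding S_def by (simp add: Collect_conj_eq open_Int)
    qed
    moreover have "x \<in> S" using x \<open>bubble g x \<bullet> g x \<noteq> 0\<close> by (simp add: S_def)
    moreover have "AE y in lebesgue. y \<notin> S"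
      using ae by eventually_elim (use interior_subset in \<open>auto simp: S_def\<close>)
    then have "negligible S" using \<open>open S\<close> by (simp add: negligible_iff_null_sets AE_iff_null_sets borel_open)
    ultimately show False using open_not_negligible by blast
  qed
  define t where "t i j = bary i x * bary j x * ((i - j) \<bullet> g x) * ((i - j) \<bullet> g x)" for i j
  from \<open>bubble g x \<bullet> g x = 0\<close> have s: "(\<Sum>i\<in>C. \<Sum>j\<in>C. t i j) = 0"
    unfolding bubble_inner t_def by simp
  have t0: "0 \<le> t i j" if "i \<in> C" "j \<in> C" for i j
    using interior_pos[OF x that(1)] interior_pos[OF x that(2)] by (simp add: t_def mult.assoc)
  have "(\<Sum>j\<in>C. t i j) = 0" if "i \<in> C" for i
    using s that sum_nonneg_eq_0_iff[of C "\<lambda>i. \<Sum>j\<in>C. t i j"] t0 by (simp add: sum_nonneg)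
  then have "t i j = 0" if "i \<in> C" "j \<in> C" for i j
    using that sum_nonneg_eq_0_iff[of C "t i"] t0 by simp
  then have orth: "(i - j) \<bullet> g x = 0" if "i \<in> C" "j \<in> C" for i j
    using interior_pos[OF x that(1)] interior_pos[OF x that(2)] \<open>\<And>i j. i \<in> C \<Longrightarrow> j \<in> C \<Longrightarrow> t i j = 0\<close>[OF that]
    by (simp add: t_def)
  obtain j where j: "j \<in> C" using C_nonempty by blast
  \<comment> \<open>Comparing the barycentric expansions of \<open>j + g x\<close> and of
    \<open>j\<close> writes \<open>g x\<close> itself as a combination of edges at
    \<open>j\<close>.\<close>
  have "g x = (\<Sum>i\<in>C. bary i (j + g x) *\<^sub>R i) - (\<Sum>i\<in>C. bary i (j + g x)) *\<^sub>R j" by (simp add: bary_expand)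
  also have "\<dots> = (\<Sum>i\<in>C. bary i (j + g x) *\<^sub>R (i - j))" by (simp add: scaleR_sum_left sum_subtractf algebra_simps)
  finally have "g x \<bullet> g x = (\<Sum>i\<in>C. bary i (j + g x) *\<^sub>R (i - j)) \<bullet> g x" by (rule arg_cong[where f = "\<lambda>y. y \<bullet> g x"])
  also have "\<dots> = (\<Sum>i\<in>C. bary i (j + g x) * ((i - j) \<bullet> g x))" by (simp only: inner_sum_left inner_scaleR_left)
  also have "\<dots> = 0" using orth j by simp
  finally show ?thesis by simp
qed

end

text \<open>Both cone fields have the same normal flux density through the common facet: the affine map
  that fixes the facet and moves \<open>v\<close> to \<open>v'\<close> carries one into the other.\<close>

lemma two_simplices_flux:
  fixes S :: "(real^'d::finite) set"
  assumes C: "full_simplex (insert v S)" and C': "full_simplex (insert v' S)" and v: "v \<notin> S" "v' \<notin> S"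
    and D: "\<And>x. (\<phi> has_derivative (\<lambda>h. G x \<bullet> h)) (at x)" and cG: "continuous_on UNIV G"
  shows "(LINT x|lebesgue_on (convex hull (insert v S)). real CARD('d) * \<phi> x + G x \<bullet> (x - v)) / measure lebesgue (convex hull (insert v S))
    = (LINT x|lebesgue_on (convex hull (insert v' S)). real CARD('d) * \<phi> x + G x \<bullet> (x - v')) / measure lebesgue (convex hull (insert v' S))"
proof -
  interpret A: full_simplex "insert v S" by fact
  interpret B: full_simplex "insert v' S" by fact
  have [simp]: "finite S" using A.finite_C by simp
  define L where "L h = h + (A.bgrad v \<bullet> h) *\<^sub>R (v' - v)" for h
  define L' where "L' h = h + (B.bgrad v' \<bullet> h) *\<^sub>R (v - v')" for h
  \<comment> \<open>The affine map with linear part \<open>L\<close> that replaces \<open>v\<close>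
    by \<open>v'\<close> and keeps all barycentric weights.\<close>
  define \<Phi> where "\<Phi> x = x + A.bary v x *\<^sub>R (v' - v)" for x
  have linL: "linear L" "linear L'"
    by (auto intro!: linearI simp: L_def L'_def inner_add_right algebra_simps)
  have \<Phi>_expand: "\<Phi> x = (\<Sum>w\<in>insert v' S. (if w = v' then A.bary v x else A.bary w x) *\<^sub>R w)"
    and \<Phi>_sum: "(\<Sum>w\<in>insert v' S. (if w = v' then A.bary v x else A.bary w x)) = 1" for x
  proof -
    have S: "(\<Sum>w\<in>S. (if w = v' then A.bary v x else A.bary w x) *\<^sub>R w) = (\<Sum>w\<in>S. A.bary w x *\<^sub>R w)"
      "(\<Sum>w\<in>S. (if w = v' then A.bary v x else A.bary w x)) = (\<Sum>w\<in>S. A.bary w x)"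
      using v by (auto intro!: sum.cong)
    show "\<Phi> x = (\<Sum>w\<in>insert v' S. (if w = v' then A.bary v x else A.bary w x) *\<^sub>R w)"
      using A.bary_expand(2)[of x] v S by (simp add: \<Phi>_def algebra_simps)
    show "(\<Sum>w\<in>insert v' S. (if w = v' then A.bary v x else A.bary w x)) = 1"
      using A.bary_expand(1)[of x] v S by simp
  qed
  have bary\<Phi>: "B.bary v' (\<Phi> x) = A.bary v x" "w \<in> S \<Longrightarrow> B.bary w (\<Phi> x) = A.bary w x" for x w
  proof -
    show "B.bary v' (\<Phi> x) = A.bary v x"
      unfolding \<Phi>_expand by (subst B.bary_sum) (use \<Phi>_sum in auto)
    show "B.bary w (\<Phi> x) = A.bary w x" if "w \<in> S"
      unfolding \<Phi>_expand by (subst B.bary_sum) (use \<Phi>_sum that v in auto)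
  qed
  have \<Phi>K: "\<Phi> x \<in> B.K \<longleftrightarrow> x \<in> A.K" for x
    unfolding A.K_bary B.K_bary using bary\<Phi> by auto
  have \<Phi>L: "\<Phi> x = L x + \<Phi> 0" for x
    by (simp add: \<Phi>_def L_def A.bary_def algebra_simps)
  have inj: "inj L"
  proof (rule linear_injective_0[THEN iffD2, OF linL(1), rule_format])
    fix h assume h: "L h = 0"
    then have 1: "h = - (A.bgrad v \<bullet> h) *\<^sub>R (v' - v)" by (simp add: L_def add_eq_0_iff2)
    have "\<Phi> h = \<Phi> 0" using h \<Phi>L[of h] by simp
    then have "A.bary v h = A.bary v 0" using bary\<Phi>(1) by metis
    then have "A.bgrad v \<bullet> h = 0" by (simp add: A.bary_def algebra_simps)
    then show "h = 0" using 1 by simp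
  qed
  then have "bij L" using linL(1) linear_injective_imp_surjective by (auto simp: bij_def)
  then obtain c where c: "c > 0" "\<And>f. f \<in> borel_measurable borel \<Longrightarrow> (LINT x|lborel. f (L x)) = c * (LINT x|lborel. f x :: real)"
    using lborel_linear_image[OF linL(1)] by blast
  have change: "(LINT x|lebesgue_on A.K. f (\<Phi> x)) = c * (LINT x|lebesgue_on B.K. f x)" if f: "continuous_on UNIV f" for f :: "real^'d \<Rightarrow> real"
  proof -
    have cf: "continuous_on A.K (\<lambda>x. f (\<Phi> x))"
      unfolding \<Phi>_def by (intro continuous_on_compose2[OF f] continuous_intros A.continuous_bary) auto
    have m: "(\<lambda>y. indicator B.K y * f y) \<in> borel_measurable borel"
      using borel_measurable_continuous_on_indicator[OF B.K_borel continuous_on_subset[OF f]] by simp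
    have "(LINT x|lebesgue_on A.K. f (\<Phi> x)) = (LINT x|lborel. indicator A.K x * f (\<Phi> x))"
      by (rule A.integral_K(1)[OF cf])
    also have "\<dots> = (LINT x|lborel. (\<lambda>y. indicator B.K (y + \<Phi> 0) * f (y + \<Phi> 0)) (L x))"
      using \<Phi>K by (simp add: indicator_def \<Phi>L[symmetric])
    also have "\<dots> = c * (LINT y|lborel. indicator B.K (y + \<Phi> 0) * f (y + \<Phi> 0))"
    proof (rule c(2))
      show "(\<lambda>y. indicator B.K (y + \<Phi> 0) * f (y + \<Phi> 0)) \<in> borel_measurable borel"
        using measurable_compose[OF _ m, of "\<lambda>y. y + \<Phi> 0" borel] by simp
    qed
    also have "(LINT y|lborel. indicator B.K (y + \<Phi> 0) * f (y + \<Phi> 0)) = (LINT y|lborel. indicator B.K y * f y)"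
      by (rule integral_lborel_shift[OF m])
    also have "\<dots> = (LINT x|lebesgue_on B.K. f x)"
      using B.integral_K(1)[OF continuous_on_subset[OF f]] by simp
    finally show ?thesis .
  qed
  \<comment> \<open>For the constant function 1 the change of variables identifies \<open>c\<close>
    as the ratio of the two volumes, hence the normalization by volume in the claim.\<close>
  have vol: "measure lebesgue A.K = c * measure lebesgue B.K"
    using change[of "\<lambda>x. 1"] A.K_lmeasurable B.K_lmeasurable by (simp add: measure_restrict_space)
  have c\<phi>: "continuous_on S \<phi>" for S
    using D has_derivative_continuous by (metis continuous_at_imp_continuous_on)
  have cG': "continuous_on S G" for S using cG by (rule continuous_on_subset) simp
  \<comment> \<open>The gradient of the composition of \<phi> with \<Phi>: the transpose of
    \<open>L\<close> applied to \<open>G (\<Phi> x)\<close>.\<close>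
  define G\<Phi> where "G\<Phi> x = G (\<Phi> x) + (G (\<Phi> x) \<bullet> (v' - v)) *\<^sub>R A.bgrad v" for x
  have c\<Phi>: "continuous_on S \<Phi>" for S unfolding \<Phi>_def[abs_def] by (intro continuous_intros A.continuous_bary)
  have cGc: "continuous_on S (\<lambda>x. G (\<Phi> x))" "continuous_on S (\<lambda>x. \<phi> (\<Phi> x))" for S
    by (rule continuous_on_compose2[OF cG'[of UNIV] c\<Phi>] continuous_on_compose2[OF c\<phi>[of UNIV] c\<Phi>]; simp)+
  have cG\<Phi>: "continuous_on S G\<Phi>" for S unfolding G\<Phi>_def[abs_def] by (intro continuous_intros cGc)
  have D\<Phi>: "((\<lambda>x. \<phi> (\<Phi> x)) has_derivative (\<lambda>h. G\<Phi> x \<bullet> h)) (at x)" for x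
  proof -
    have "(\<Phi> has_derivative L) (at x)" unfolding \<Phi>_def[abs_def] L_def[abs_def] A.bary_def[abs_def]
      by (auto intro!: derivative_eq_intros simp: algebra_simps)
    from has_derivative_compose[OF this D]
    show ?thesis by (simp add: G\<Phi>_def L_def[abs_def] inner_add_right inner_add_left algebra_simps inner_commute)
  qed
  \<comment> \<open>\<phi> need not vanish on the common facet, but its difference to the
    composition with \<Phi> does, because \<Phi> fixes that facet; the cone formula applies to this
    difference.\<close>
  have "(LINT x|lebesgue_on A.K. real CARD('d) * (\<phi> (\<Phi> x) - \<phi> x) + (G\<Phi> x - G x) \<bullet> (x - v)) = 0"
  proof (rule A.integral_cone_field_eq_0)
    show "((\<lambda>x. \<phi> (\<Phi> x) - \<phi> x) has_derivative (\<lambda>h. (G\<Phi> x - G x) \<bullet> h)) (at x)" for x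
      using has_derivative_diff[OF D\<Phi> D] by (simp add: inner_diff_left)
    show "continuous_on UNIV (\<lambda>x. G\<Phi> x - G x)" by (intro continuous_intros cG\<Phi> cG)
  qed (simp_all add: \<Phi>_def)
  moreover have "real CARD('d) * (\<phi> (\<Phi> x) - \<phi> x) + (G\<Phi> x - G x) \<bullet> (x - v)
    = (real CARD('d) * \<phi> (\<Phi> x) + G\<Phi> x \<bullet> (x - v)) - (real CARD('d) * \<phi> x + G x \<bullet> (x - v))" for x
    by (simp add: algebra_simps)
  moreover have "integrable (lebesgue_on A.K) (\<lambda>x. real CARD('d) * \<phi> (\<Phi> x) + G\<Phi> x \<bullet> (x - v))"
    "integrable (lebesgue_on A.K) (\<lambda>x. real CARD('d) * \<phi> x + G x \<bullet> (x - v))"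
    by (intro A.integral_K continuous_intros cGc cG\<Phi> c\<phi> cG')+
  ultimately have "(LINT x|lebesgue_on A.K. real CARD('d) * \<phi> x + G x \<bullet> (x - v)) = (LINT x|lebesgue_on A.K. real CARD('d) * \<phi> (\<Phi> x) + G\<Phi> x \<bullet> (x - v))"
    by simp
  also have "\<dots> = (LINT x|lebesgue_on A.K. (\<lambda>y. real CARD('d) * \<phi> y + G y \<bullet> (y - v')) (\<Phi> x))"
  proof -
    \<comment> \<open>\<open>L\<close> maps \<open>x - v\<close> to \<open>\<Phi> x - v'\<close>, so
      one cone field is carried into the other.\<close>
    have "G\<Phi> x \<bullet> (x - v) = G (\<Phi> x) \<bullet> (\<Phi> x - v')" for x
    proof -
      have "A.bgrad v \<bullet> (x - v) = A.bary v x - 1" by (simp add: A.bary_def)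
      then have "G\<Phi> x \<bullet> (x - v) = G (\<Phi> x) \<bullet> (x - v) + (G (\<Phi> x) \<bullet> (v' - v)) * (A.bary v x - 1)"
        by (simp add: G\<Phi>_def inner_add_left)
      also have "\<dots> = G (\<Phi> x) \<bullet> (\<Phi> x - v')" by (simp add: \<Phi>_def algebra_simps)
      finally show ?thesis .
    qed
    then show ?thesis by simp
  qed
  also have "\<dots> = c * (LINT x|lebesgue_on B.K. real CARD('d) * \<phi> x + G x \<bullet> (x - v'))"
    by (rule change) (intro continuous_intros c\<phi> cG)
  finally show ?thesis using c(1) by (simp add: vol)
qed

section \<open>Geometry of the mesh\<close>

text \<open>Any vector \<open>h\<close> is the sum of the vertices with weights
  \<open>bgrad i \<bullet> h\<close>, which add up to zero. Measured from a vertex of the facet,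
  only the weight of \<open>u\<close> survives in \<open>n \<bullet> h\<close>.\<close>

lemma (in full_simplex) normal_multiple:
  assumes u: "u \<in> C" and n: "\<And>v w. v \<in> C - {u} \<Longrightarrow> w \<in> C - {u} \<Longrightarrow> n \<bullet> (v - w) = 0"
  obtains c where "n = c *\<^sub>R bgrad u"
proof -
  have "card (C - {u}) = CARD('d)" using u card by simp
  then have "C - {u} \<noteq> {}" by (intro notI) simp
  then obtain v where v: "v \<in> C - {u}" by blast
  have "n \<bullet> h = (n \<bullet> (u - v)) * (bgrad u \<bullet> h)" for h
  proof -
    have d: "bgrad i \<bullet> h = bary i (v + h) - bary i v" for i by (simp add: bary_def algebra_simps)
    have "h = (\<Sum>i\<in>C. bary i (v + h) *\<^sub>R i) - (\<Sum>i\<in>C. bary i v *\<^sub>R i)" by (simp add: bary_expand)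
    also have "\<dots> = (\<Sum>i\<in>C. (bgrad i \<bullet> h) *\<^sub>R i)" by (simp add: d scaleR_diff_left sum_subtractf)
    finally have "n \<bullet> h = n \<bullet> (\<Sum>i\<in>C. (bgrad i \<bullet> h) *\<^sub>R i)" by (rule arg_cong[where f = "(\<bullet>) n"])
    also have "\<dots> = (\<Sum>i\<in>C. (bgrad i \<bullet> h) * (n \<bullet> i))" by (simp add: inner_sum_right)
    also have "\<dots> = (\<Sum>i\<in>C. (bgrad i \<bullet> h) * (n \<bullet> (i - v)))"
    proof -
      have "(\<Sum>i\<in>C. bgrad i \<bullet> h) = 0" by (simp add: d sum_subtractf bary_expand)
      then have "(\<Sum>i\<in>C. (bgrad i \<bullet> h) * (n \<bullet> v)) = 0" by (simp flip: sum_distrib_right)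
      then show ?thesis by (simp add: inner_diff_right right_diff_distrib sum_subtractf)
    qed
    also have "\<dots> = (\<Sum>i\<in>C. if i = u then (bgrad u \<bullet> h) * (n \<bullet> (u - v)) else 0)"
      using n v by (intro sum.cong) auto
    also have "\<dots> = (n \<bullet> (u - v)) * (bgrad u \<bullet> h)" using u by simp
    finally show ?thesis .
  qed
  then have "\<forall>h. n \<bullet> h = ((n \<bullet> (u - v)) *\<^sub>R bgrad u) \<bullet> h" unfolding inner_scaleR_left by (rule allI)
  then have "n = (n \<bullet> (u - v)) *\<^sub>R bgrad u" by (rule iffD1[OF vector_eq_rdot])
  then show ?thesis by (rule that)
qed

lemma negligible_aff_dim_lt:
  assumes "aff_dim S < int DIM('a::euclidean_space)" shows "negligible (affine hull S :: 'a set)"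
proof -
  have "interior (affine hull S) = {}"
    using aff_dim_nonempty_interior[of "affine hull S"] assms by auto
  then show ?thesis using negligible_convex_interior affine_imp_convex[OF affine_affine_hull] by blast
qed

text \<open>Removing a closed set of lower dimension from a nonempty relatively open set leaves a
  nonempty relatively open set, so the members can be removed one at a time.\<close>

lemma openin_not_subset_lower_dim:
  fixes S :: "'a::euclidean_space set"
  assumes "finite \<G>" "\<And>G. G \<in> \<G> \<Longrightarrow> closed G" "\<And>G. G \<in> \<G> \<Longrightarrow> aff_dim G < aff_dim S"
    and "openin (top_of_set (affine hull S)) U" "U \<noteq> {}"
  shows "\<not> U \<subseteq> \<Union>\<G>"
  using assms
proof (induction \<G> arbitrary: U rule: finite_induct)
  case (insert G \<G>)
  have aff: "affine hull U = affine hull S"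
    by (rule affine_hull_openin[OF insert.prems(3,4)])
  have dim: "aff_dim G < aff_dim U" using insert.prems(2)[of G] aff by (metis aff_dim_affine_hull insertI1)
  have "closure (U - G) = closure U"
    using dim insert.prems(3) aff by (intro dense_complement_openin_affine_hull) auto
  then have "U - G \<noteq> {}" using insert.prems(4) by (metis closure_empty closure_eq_empty)
  moreover have "openin (top_of_set (affine hull S)) (U - G)"
    unfolding Diff_eq using insert.prems(1)[of G] insert.prems(3)
    by (intro openin_Int_open) auto
  ultimately show ?case using insert.IH[of "U - G"] insert.prems by blast
qed auto

section \<open>Elements, adjacency and boundary facets of the mesh\<close>

locale mesh =
  fixes \<Omega> :: "(real^'d::finite) set" and T :: "(real^'d) set set"
  assumes domain: "convex_polytopal_domain \<Omega>" and mesh: "conforming_mesh \<Omega> T"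
begin

lemma \<Omega>_open: "open \<Omega>" and \<Omega>_convex: "convex \<Omega>" and \<Omega>_nonempty: "\<Omega> \<noteq> {}"
  and closure_polytope: "polytope (closure \<Omega>)"
  using domain by (auto simp: convex_polytopal_domain_def)

lemma \<Omega>_bounded: "bounded \<Omega>"
  using polytope_imp_bounded[OF closure_polytope] bounded_subset closure_subset by blast

lemma \<Omega>_meas: "\<Omega> \<in> lmeasurable" and \<Omega>_sets: "\<Omega> \<in> sets lebesgue"
  using \<Omega>_open \<Omega>_bounded by (auto simp: lmeasurable_open borel_open)

lemma interior_closure_\<Omega>: "interior (closure \<Omega>) = \<Omega>"
  using convex_interior_closure[OF \<Omega>_convex] \<Omega>_open by (simp add: interior_open)

lemma AE_not_frontier: "AE x in lebesgue. x \<notin> frontier \<Omega>"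
  by (rule AE_not_in) (use negligible_convex_frontier[OF \<Omega>_convex] in \<open>simp add: negligible_iff_null_sets\<close>)

lemma finite_T: "finite T" and Union_T: "\<Union>T = closure \<Omega>"
  using mesh by (auto simp: conforming_mesh_def triangulation_def)

lemma T_subset: "K \<in> T \<Longrightarrow> K \<subseteq> closure \<Omega>"
  using Union_T by blast

lemma T_simplex:
  assumes "K \<in> T" obtains C where "full_simplex C" "K = convex hull C"
proof -
  have "int CARD('d) simplex K" using mesh assms by (auto simp: conforming_mesh_def)
  then obtain C where "\<not> affine_dependent C" "int (card C) = int CARD('d) + 1" "K = convex hull C"
    by (auto simp: simplex_def)
  then show ?thesis by (intro that[of C]) (auto simp: full_simplex_def)
qed

lemma T_props:
  assumes "K \<in> T"
  shows "convex K" "compact K" "closed K" "interior K \<noteq> {}" "K \<in> sets lebesgue" "K \<in> lmeasurable"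
    "aff_dim K = int CARD('d)" "closure (interior K) = K" "interior K \<subseteq> \<Omega>"
proof -
  obtain C where C: "full_simplex C" "K = convex hull C" using T_simplex[OF assms] by blast
  interpret full_simplex C by fact
  show "convex K" "compact K" "closed K" "interior K \<noteq> {}" "K \<in> sets lebesgue" "K \<in> lmeasurable" "closure (interior K) = K"
    using C(2) compact_K interior_nonempty K_lebesgue K_lmeasurable closure_interior by (auto simp: compact_imp_closed)
  show "aff_dim K = int CARD('d)"
    using aff_dim_nonempty_interior[of K] \<open>interior K \<noteq> {}\<close> by simp
  show "interior K \<subseteq> \<Omega>" using interior_mono[OF T_subset[OF assms]] interior_closure_\<Omega> by simp
qed

lemma T_Int_face: "K \<in> T \<Longrightarrow> K' \<in> T \<Longrightarrow> K \<inter> K' face_of K"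
  using mesh by (auto simp: conforming_mesh_def triangulation_def)

lemma T_Int_aff_dim:
  assumes "K \<in> T" "K' \<in> T" "K \<noteq> K'" shows "aff_dim (K \<inter> K') < int CARD('d)"
proof (cases "K \<inter> K' = K")
  case True
  then have "K face_of K'" using T_Int_face[OF assms(2,1)] by (simp add: Int_commute)
  then have "aff_dim K < aff_dim K'" using T_props[OF assms(2)] assms(3) by (intro face_of_aff_dim_lt) auto
  then show ?thesis using assms T_props by simp
next
  case False
  then have "aff_dim (K \<inter> K') < aff_dim K"
    using T_props[OF assms(1)] T_Int_face[OF assms(1,2)] by (intro face_of_aff_dim_lt) auto
  then show ?thesis using assms T_props by simp
qed

lemma T_Int_negligible:
  assumes "K \<in> T" "K' \<in> T" "K \<noteq> K'" shows "negligible (K \<inter> K')"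
proof -
  have "aff_dim (K \<inter> K') < int DIM(real^'d)" using T_Int_aff_dim[OF assms] by simp
  from negligible_subset[OF negligible_aff_dim_lt[OF this] hull_subset] show ?thesis .
qed

lemma AE_T_Int:
  assumes "K \<in> T" "K' \<in> T" "K \<noteq> K'" shows "AE x in lebesgue. \<not> (x \<in> K \<and> x \<in> K')"
  using AE_not_in[of "K \<inter> K'" lebesgue] T_Int_negligible[OF assms] by (simp add: negligible_iff_null_sets)

lemma ae_eq_mesh: "ae_eq \<Omega> v w \<longleftrightarrow> (\<forall>K\<in>T. ae_eq K v w)"
proof
  assume "ae_eq \<Omega> v w"
  then have "AE x in lebesgue. x \<in> \<Omega> \<longrightarrow> v x = w x" by (simp add: ae_eq_lebesgue \<Omega>_sets)
  then have *: "AE x in lebesgue. x \<in> closure \<Omega> \<longrightarrow> v x = w x"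
    using AE_not_frontier by eventually_elim (auto simp: frontier_def interior_open[OF \<Omega>_open])
  show "\<forall>K\<in>T. ae_eq K v w"
  proof
    fix K assume "K \<in> T"
    then show "ae_eq K v w" unfolding ae_eq_lebesgue[OF T_props(5)[OF \<open>K \<in> T\<close>]]
      using * T_subset by (elim eventually_mono) blast
  qed
next
  assume "\<forall>K\<in>T. ae_eq K v w"
  then have "AE x in lebesgue. \<forall>K\<in>T. x \<in> K \<longrightarrow> v x = w x"
    using T_props(5) by (subst AE_finite_all[OF finite_T]) (simp add: ae_eq_lebesgue)
  then show "ae_eq \<Omega> v w" unfolding ae_eq_lebesgue[OF \<Omega>_sets]
    using Union_T closure_subset by (elim eventually_mono) blast
qed

text \<open>An element lies in the closure of \<Omega> and may touch the frontier, so restriction to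
  \<Omega> loses a null set.\<close>

lemma integral_indicator_K:
  fixes f :: "real^'d \<Rightarrow> real"
  assumes K: "K \<in> T" and f: "f \<in> borel_measurable (lebesgue_on K)"
  shows "(LINT x|lebesgue_on \<Omega>. indicator K x * f x) = (LINT x|lebesgue_on K. f x)"
    "integrable (lebesgue_on K) f \<Longrightarrow> integrable (lebesgue_on \<Omega>) (\<lambda>x. indicator K x * f x)"
proof -
  have fK: "(\<lambda>x. indicator K x * f x) \<in> borel_measurable lebesgue"
    using f T_props(5)[OF K] borel_measurable_restrict_space_iff[of K lebesgue f] by simp
  have f\<Omega>: "(\<lambda>x. indicator \<Omega> x * (indicator K x * f x)) \<in> borel_measurable lebesgue"
    using fK \<Omega>_sets by simp
  have ae: "AE x in lebesgue. indicator \<Omega> x * (indicator K x * f x) = indicator K x * f x"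
    using AE_not_frontier
  proof eventually_elim
    case (elim x)
    have "x \<in> K \<Longrightarrow> x \<in> \<Omega>" using elim T_subset[OF K] by (auto simp: frontier_def interior_open[OF \<Omega>_open])
    then show ?case by (auto simp: indicator_def)
  qed
  show "(LINT x|lebesgue_on \<Omega>. indicator K x * f x) = (LINT x|lebesgue_on K. f x)"
    using Bochner_Integration.integral_cong_AE[OF f\<Omega> fK ae] \<Omega>_sets T_props(5)[OF K]
    by (simp add: integral_restrict_space)
  show "integrable (lebesgue_on \<Omega>) (\<lambda>x. indicator K x * f x)" if "integrable (lebesgue_on K) f"
    using that integrable_cong_AE[OF f\<Omega> fK ae] \<Omega>_sets T_props(5)[OF K]
    by (simp add: integrable_restrict_space)
qed

text \<open>The last conjunct prevents the common facet from being part of \<Sigma>, so that flux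
  through it is not constrained by the boundary condition.\<close>

definition adjacent :: "(real^'d) set \<Rightarrow> (real^'d) set \<Rightarrow> bool" where
  "adjacent K K' \<longleftrightarrow> K \<noteq> K' \<and> aff_dim (K \<inter> K') = int CARD('d) - 1 \<and> K \<inter> K' \<inter> \<Omega> \<noteq> {}"

text \<open>A segment in general position between two elements avoids all intersections of codimension
  two, so it passes from element to element through facets.\<close>

lemma mesh_connected:
  assumes S: "S \<subseteq> T" "S \<noteq> {}" and closed: "\<And>K K'. K \<in> S \<Longrightarrow> K' \<in> T \<Longrightarrow> adjacent K K' \<Longrightarrow> K' \<in> S"
  shows "S = T"
proof (rule ccontr)
  assume "S \<noteq> T"
  then obtain K0 K1 where K: "K0 \<in> S" "K1 \<in> T" "K1 \<notin> S" using S by blast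
  then have K0: "K0 \<in> T" using S by blast
  define L where "L = {K \<inter> K' | K K'. K \<in> T \<and> K' \<in> T \<and> aff_dim (K \<inter> K') \<le> int CARD('d) - 2}"
  have finL: "finite L"
    by (rule finite_subset[of _ "(\<lambda>(K, K'). K \<inter> K') ` (T \<times> T)"]) (auto simp: L_def finite_T)
  have neg1: "negligible (\<Union>L)"
  proof (rule negligible_Union[OF finL])
    fix A assume "A \<in> L"
    then have "aff_dim A < int DIM(real^'d)" by (auto simp: L_def)
    from negligible_subset[OF negligible_aff_dim_lt[OF this] hull_subset] show "negligible A" .
  qed
  have pick: "\<exists>x\<in>interior K'. x \<notin> A" if "K' \<in> T" "negligible A" for K' A
  proof -
    have "\<not> interior K' \<subseteq> A"
      using that T_props(4) open_not_negligible[OF open_interior, of K'] negligible_subset by blast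
    then show ?thesis by blast
  qed
  obtain y where y: "y \<in> interior K1" "y \<notin> \<Union>L" using pick[OF K(2) neg1] by blast
  \<comment> \<open>Joining \<open>y\<close> to a set of codimension at least two raises its
    dimension by at most one, so these hulls are still null and \<open>x\<close> can be chosen off
    them.\<close>
  have neg2: "negligible (\<Union>((\<lambda>A. affine hull (insert y A)) ` L))"
  proof (rule negligible_Union, simp add: finL)
    fix B assume "B \<in> (\<lambda>A. affine hull (insert y A)) ` L"
    then obtain A where A: "A \<in> L" "B = affine hull (insert y A)" by blast
    have "aff_dim (insert y A) \<le> aff_dim A + 1" by (simp add: aff_dim_insert)
    also have "\<dots> < int DIM(real^'d)" using A(1) by (auto simp: L_def)
    finally show "negligible B" unfolding A(2) by (rule negligible_aff_dim_lt)
  qed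
  obtain x where x: "x \<in> interior K0" "x \<notin> \<Union>((\<lambda>A. affine hull (insert y A)) ` L)" using pick[OF K0 neg2] by blast
  have seg_\<Omega>: "closed_segment x y \<subseteq> \<Omega>"
    using x y T_props(9)[OF K0] T_props(9)[OF K(2)] by (intro closed_segment_subset \<Omega>_convex) auto
  \<comment> \<open>A point of the segment other than \<open>y\<close> that lies in \<open>A\<close>
    would put \<open>x\<close> on the line through it and \<open>y\<close>, hence into an excluded
    hull.\<close>
  have avoid: "z \<notin> A" if z: "z \<in> closed_segment x y" and A: "A \<in> L" for z A
  proof
    assume zA: "z \<in> A"
    obtain t where t: "0 \<le> t" "t \<le> 1" "z = (1 - t) *\<^sub>R x + t *\<^sub>R y" using z by (auto simp: in_segment)
    show False
    proof (cases "t = 1")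
      case True
      then show ?thesis using t zA y A by auto
    next
      case False
      have "x = (1 / (1 - t)) *\<^sub>R z + (- t / (1 - t)) *\<^sub>R y"
        using False by (simp add: t(3) algebra_simps divide_simps flip: scaleR_add_left scaleR_diff_left)
      moreover have "1 / (1 - t) + - t / (1 - t) = 1" using False by (simp add: field_simps)
      ultimately have "x \<in> affine hull (insert y A)"
        using mem_affine[OF affine_affine_hull, of z "insert y A" y] zA
        by (metis hull_inc insertCI)
      then show ?thesis using x(2) A by blast
    qed
  qed
  let ?A = "\<Union>S" and ?B = "\<Union>(T - S)"
  have cl: "closed ?A" "closed ?B"
    using finite_T S T_props(3) by (auto intro!: closed_Union finite_subset[of _ T])
  have "closed_segment x y \<subseteq> ?A \<union> ?B" using seg_\<Omega> closure_subset[of \<Omega>] Union_T by blast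
  moreover have "?A \<inter> closed_segment x y \<noteq> {}" using x(1) K(1) interior_subset[of K0] by auto
  moreover have "?B \<inter> closed_segment x y \<noteq> {}" using y(1) K interior_subset[of K1] by auto
  \<comment> \<open>The connected segment is covered by two closed sets and meets both, so they meet
    on it.\<close>
  ultimately have "?A \<inter> ?B \<inter> closed_segment x y \<noteq> {}"
    using connected_closedD[OF connected_segment[of x y] _ _ cl] by blast
  then obtain z K K' where z: "z \<in> closed_segment x y" "z \<in> K" "z \<in> K'" "K \<in> S" "K' \<in> T" "K' \<notin> S" by blast
  have KT: "K \<in> T" "K \<noteq> K'" using z S by auto
  have "aff_dim (K \<inter> K') < int CARD('d)" by (rule T_Int_aff_dim[OF KT(1) z(5) KT(2)])
  moreover have "\<not> aff_dim (K \<inter> K') \<le> int CARD('d) - 2"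
    using avoid[OF z(1), of "K \<inter> K'"] z KT by (auto simp: L_def)
  ultimately have "adjacent K K'" using z KT seg_\<Omega> by (auto simp: adjacent_def)
  then show False using closed[OF z(4,5)] z(6) by blast
qed

text \<open>Either element describes the common face by vertices of its own. The two descriptions
  coincide because the vertices of a simplex are its extreme points.\<close>

lemma adjacent_simplices:
  assumes K: "K \<in> T" "K' \<in> T" "adjacent K K'"
  obtains S v v' where "full_simplex (insert v S)" "full_simplex (insert v' S)" "v \<notin> S" "v' \<notin> S"
    "K = convex hull (insert v S)" "K' = convex hull (insert v' S)" "K \<inter> K' = convex hull S"
proof -
  have *: "\<exists>S v. full_simplex (insert v S) \<and> v \<notin> S \<and> K = convex hull (insert v S) \<and> K \<inter> K' = convex hull S"
    if K: "K \<in> T" "K' \<in> T" "aff_dim (K \<inter> K') = int CARD('d) - 1" for K K'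
  proof -
    obtain C where C: "full_simplex C" "K = convex hull C" using T_simplex[OF K(1)] by blast
    interpret full_simplex C by fact
    obtain S where S: "S \<subseteq> C" "K \<inter> K' = convex hull S"
      using T_Int_face[OF K(1,2)] face_of_convex_hull_affine_independent[OF indep] C(2) by auto
    have "\<not> affine_dependent S" using S indep affine_dependent_subset by blast
    then have "card S = CARD('d)"
      using K(3) S(2) aff_dim_affine_independent[of S] by (simp add: aff_dim_convex_hull)
    then have "card (C - S) = 1" using S card card_Diff_subset[of S C] finite_subset[OF S(1)] by simp
    then obtain v where "C - S = {v}" by (rule card_1_singletonE)
    then have "C = insert v S" "v \<notin> S" using S by auto
    then show ?thesis using C S by blast
  qed
  have d: "aff_dim (K \<inter> K') = int CARD('d) - 1" using K(3) by (simp add: adjacent_def)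
  obtain S v where S: "full_simplex (insert v S)" "v \<notin> S" "K = convex hull (insert v S)" "K \<inter> K' = convex hull S"
    using *[OF K(1,2) d] by blast
  obtain S' v' where S': "full_simplex (insert v' S')" "v' \<notin> S'" "K' = convex hull (insert v' S')" "K' \<inter> K = convex hull S'"
    using *[OF K(2,1)] d by (auto simp: Int_commute)
  have "\<not> affine_dependent S" "\<not> affine_dependent S'"
    using S(1) S'(1) affine_dependent_subset unfolding full_simplex_def by blast+
  then have "S = {x. x extreme_point_of (convex hull S)}" "S' = {x. x extreme_point_of (convex hull S')}"
    using extreme_point_of_convex_hull_affine_independent[of S] extreme_point_of_convex_hull_affine_independent[of S'] by auto
  moreover have "convex hull S = convex hull S'" using S(4) S'(4) by (simp add: Int_commute)
  ultimately have "S' = S" by simp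
  then show ?thesis using S S' that by blast
qed

lemma closed_boundary_faces: "F \<in> boundary_faces \<Omega> T \<Longrightarrow> closed F"
proof -
  assume "F \<in> boundary_faces \<Omega> T"
  then obtain K where "K \<in> T" "F facet_of K" by (auto simp: boundary_faces_def)
  then show ?thesis using face_of_imp_closed[OF T_props(1,3) facet_of_imp_face_of] by blast
qed

lemma finite_boundary_faces: "finite (boundary_faces \<Omega> T)"
proof -
  have "finite (\<Union>K\<in>T. {F. F facet_of K})"
  proof (intro finite_UN_I finite_T)
    fix K assume "K \<in> T"
    then obtain C where "full_simplex C" "K = convex hull C" using T_simplex by blast
    then show "finite {F. F facet_of K}"
      by (intro finite_polytope_facets) (auto simp: polytope_def intro!: exI[of _ C] full_simplex.finite_C)
  qed
  then show ?thesis by (rule rev_finite_subset) (auto simp: boundary_faces_def)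
qed

text \<open>A frontier point lies on a facet of the polytope. If no boundary face contained it, a
  relatively open piece of that facet would avoid all boundary faces; but the elements cut the facet
  into finitely many pieces, and those of full dimension are boundary faces.\<close>

lemma frontier_boundary_faces: "frontier \<Omega> \<subseteq> \<Union>(boundary_faces \<Omega> T)"
proof
  fix x assume x: "x \<in> frontier \<Omega>"
  show "x \<in> \<Union>(boundary_faces \<Omega> T)"
  proof (rule ccontr)
    assume nx: "x \<notin> \<Union>(boundary_faces \<Omega> T)"
    have "closed (\<Union>(boundary_faces \<Omega> T))"
      by (intro closed_Union finite_boundary_faces ballI closed_boundary_faces)
    then obtain e where e: "e > 0" "ball x e \<inter> \<Union>(boundary_faces \<Omega> T) = {}"
    proof -
      assume *: "\<And>e. e > 0 \<Longrightarrow> ball x e \<inter> \<Union>(boundary_faces \<Omega> T) = {} \<Longrightarrow> thesis"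
      have "open (- \<Union>(boundary_faces \<Omega> T))" using \<open>closed (\<Union>(boundary_faces \<Omega> T))\<close> by (rule open_Compl)
      moreover have "x \<in> - \<Union>(boundary_faces \<Omega> T)" using nx by simp
      ultimately obtain e where "e > 0" "ball x e \<subseteq> - \<Union>(boundary_faces \<Omega> T)" by (rule openE)
      then show thesis using * by blast
    qed
    have poly: "polyhedron (closure \<Omega>)" using closure_polytope by (rule polytope_imp_polyhedron)
    have dimc: "aff_dim (closure \<Omega>) = int CARD('d)"
      using aff_dim_nonempty_interior[of "closure \<Omega>"] interior_closure_\<Omega> \<Omega>_nonempty by simp
    have "rel_frontier (closure \<Omega>) = frontier \<Omega>"
      using interior_closure_\<Omega> \<Omega>_nonempty rel_interior_nonempty_interior[of "closure \<Omega>"]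
      by (simp add: rel_frontier_def frontier_def interior_open[OF \<Omega>_open])
    then obtain \<Phi> where \<Phi>: "\<Phi> facet_of closure \<Omega>" "x \<in> \<Phi>"
      using rel_frontier_of_polyhedron[OF poly] x by auto
    have \<Phi>_front: "\<Phi> \<subseteq> frontier \<Omega>"
      using rel_frontier_of_polyhedron[OF poly] \<Phi>(1) \<open>rel_frontier (closure \<Omega>) = frontier \<Omega>\<close> by blast
    have \<Phi>_face: "\<Phi> face_of closure \<Omega>" using \<Phi>(1) by (rule facet_of_imp_face_of)
    have \<Phi>_conv: "convex \<Phi>" using \<Phi>_face by (rule face_of_imp_convex)
    have \<Phi>_closed: "closed \<Phi>" using \<Phi>_face \<Omega>_convex by (metis closed_closure convex_closure face_of_imp_closed)
    have \<Phi>_dim: "aff_dim \<Phi> = int CARD('d) - 1" using \<Phi>(1) dimc by (simp add: facet_of_def)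
    define U where "U = rel_interior \<Phi> \<inter> ball x e"
    have "x \<in> closure (rel_interior \<Phi>)"
      using \<Phi>(2) convex_closure_rel_interior[OF \<Phi>_conv] closure_subset by blast
    then obtain y where "y \<in> rel_interior \<Phi>" "dist y x < e" using e(1) by (auto simp: closure_approachable)
    then have "U \<noteq> {}" by (auto simp: U_def dist_commute)
    have Uopen: "openin (top_of_set (affine hull \<Phi>)) U"
      unfolding U_def by (intro openin_Int_open openin_rel_interior open_ball)
    \<comment> \<open>The pieces of too low dimension; they cannot cover \<open>U\<close>, so some
      point of \<open>U\<close> lies only in full-dimensional pieces.\<close>
    define \<G> where "\<G> = {G \<in> (\<lambda>K. \<Phi> \<inter> K) ` T. aff_dim G < aff_dim \<Phi>}"
    have "\<not> U \<subseteq> \<Union>\<G>"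
    proof (rule openin_not_subset_lower_dim[OF _ _ _ Uopen \<open>U \<noteq> {}\<close>])
      show "finite \<G>" using finite_T by (simp add: \<G>_def)
      show "closed G" if "G \<in> \<G>" for G using that \<Phi>_closed T_props(3) by (auto simp: \<G>_def)
      show "aff_dim G < aff_dim \<Phi>" if "G \<in> \<G>" for G using that by (simp add: \<G>_def)
    qed
    then obtain w where w: "w \<in> U" "w \<notin> \<Union>\<G>" by blast
    have w\<Phi>: "w \<in> \<Phi>" using w(1) rel_interior_subset[of \<Phi>] by (auto simp: U_def)
    then have "w \<in> closure \<Omega>" using \<Phi>_face face_of_imp_subset by blast
    then obtain K where K: "K \<in> T" "w \<in> K" using Union_T by blast
    have face: "\<Phi> \<inter> K face_of K"
      using face_of_slice[OF \<Phi>_face T_props(1)[OF K(1)]] T_subset[OF K(1)] by (simp add: inf.absorb2)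
    have "\<not> aff_dim (\<Phi> \<inter> K) < aff_dim \<Phi>" using w(2) w\<Phi> K by (auto simp: \<G>_def)
    moreover have "aff_dim (\<Phi> \<inter> K) \<le> aff_dim \<Phi>" by (simp add: aff_dim_subset)
    ultimately have "\<Phi> \<inter> K facet_of K"
      using face w\<Phi> K \<Phi>_dim T_props(7)[OF K(1)] by (auto simp: facet_of_def)
    then have "\<Phi> \<inter> K \<in> boundary_faces \<Omega> T" using K(1) \<Phi>_front by (auto simp: boundary_faces_def)
    then show False using e(2) w(1) w\<Phi> K(2) by (auto simp: U_def)
  qed
qed

lemma free_boundary_face:
  assumes "fitted_boundary_part \<Omega> T \<Sigma>"
  obtains K F where "K \<in> T" "F facet_of K" "F \<subseteq> frontier \<Omega>" "\<not> F \<subseteq> \<Sigma>"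
proof -
  have "\<Sigma> \<subset> frontier \<Omega>" using assms by (simp add: fitted_boundary_part_def)
  then obtain x where "x \<in> frontier \<Omega>" "x \<notin> \<Sigma>" by blast
  then obtain F where "F \<in> boundary_faces \<Omega> T" "x \<in> F" using frontier_boundary_faces by blast
  then show ?thesis using that \<open>x \<notin> \<Sigma>\<close> by (auto simp: boundary_faces_def)
qed

lemma facet_simplex:
  assumes "full_simplex C" "F facet_of convex hull C"
  obtains u where "u \<in> C" "F = convex hull (C - {u})"
  using facet_of_convex_hull_affine_independent[of C F] assms by (auto simp: full_simplex_def)

text \<open>The normal is defined by a definite description over the whole domain, so both existence
  and uniqueness are due. Convexity of \<Omega> is what makes the facet normal of one element a
  normal of all of \<Omega>.\<close>

lemma unit_normal_multiple:
  assumes C: "full_simplex C" and K: "convex hull C \<in> T" and u: "u \<in> C"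
    and F: "F = convex hull (C - {u})" "F \<subseteq> frontier \<Omega>"
  obtains c where "unit_normal \<Omega> F = c *\<^sub>R full_simplex.bgrad C u"
proof -
  interpret full_simplex C by fact
  have CF: "v \<in> F" if "v \<in> C - {u}" for v using that F(1) by (simp add: hull_inc)
  have Fcl: "F \<subseteq> closure \<Omega>" using F(2) by (auto simp: frontier_def)
  have cardF: "card (C - {u}) = CARD('d)" using u card by simp
  have neC: "C - {u} \<noteq> {}" using cardF by (intro notI) simp
  obtain y0 where y0: "y0 \<in> interior K" using interior_nonempty by blast
  then have y0\<Omega>: "y0 \<in> \<Omega>" using T_props(9)[OF K] by blast
  have bF: "bary u x = 0" if "x \<in> F" for x using that F(1) facet_bary[OF u] by simp
  have by0: "bgrad u \<bullet> (y0 - x) > 0" if "x \<in> F" for x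
  proof -
    have "bgrad u \<bullet> (y0 - x) = bary u y0 - bary u x" by (simp add: bary_def algebra_simps)
    then show ?thesis using bF[OF that] interior_pos[OF y0 u] by simp
  qed
  define n0 where "n0 = - (1 / norm (bgrad u)) *\<^sub>R bgrad u"
  have bne: "bgrad u \<noteq> 0" using by0 neC CF by fastforce
  let ?P = "\<lambda>n. norm n = 1 \<and> (\<forall>x\<in>F. \<forall>y\<in>\<Omega>. n \<bullet> (y - x) \<le> 0)"
  \<comment> \<open>The inequality extends to the closure, which contains the facet; used in both
    orders for two vertices it becomes orthogonality. An interior point of the element then fixes
    the sign.\<close>
  have uniq: "n = n0" if n: "?P n" for n
  proof -
    have ncl: "n \<bullet> (y - x) \<le> 0" if "x \<in> F" "y \<in> closure \<Omega>" for x y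
    proof -
      have "closed {y. n \<bullet> (y - x) \<le> 0}" by (intro closed_Collect_le continuous_intros)
      moreover have "\<Omega> \<subseteq> {y. n \<bullet> (y - x) \<le> 0}" using n that by blast
      ultimately show ?thesis using closure_minimal that(2) by blast
    qed
    have "n \<bullet> (v - w) = 0" if "v \<in> C - {u}" "w \<in> C - {u}" for v w
      using ncl[OF CF[OF that(1)] subsetD[OF Fcl CF[OF that(2)]]] ncl[OF CF[OF that(2)] subsetD[OF Fcl CF[OF that(1)]]]
      by (simp add: inner_diff_right)
    then obtain c where c: "n = c *\<^sub>R bgrad u" using normal_multiple[OF u] by blast
    obtain x where x: "x \<in> F" using neC CF by blast
    have "c * (bgrad u \<bullet> (y0 - x)) \<le> 0" using n x y0\<Omega> c by fastforce
    then have "c \<le> 0" using by0[OF x] by (simp add: mult_le_0_iff)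
    moreover have "\<bar>c\<bar> * norm (bgrad u) = 1" using n c by simp
    ultimately have "c = - (1 / norm (bgrad u))" using bne by (simp add: field_simps abs_if split: if_splits)
    then show ?thesis using c by (simp add: n0_def)
  qed
  have "?P n0"
  proof
    show "norm n0 = 1" using bne by (simp add: n0_def)
    \<comment> \<open>The centroid of the facet. A supporting functional that is minimal at an
      average of vertices is minimal at each of them, so the hyperplane contains the entire
      facet.\<close>
    define x0 where "x0 = (\<Sum>v\<in>C - {u}. (1 / real CARD('d)) *\<^sub>R v)"
    have x0F: "x0 \<in> F" unfolding F(1) x0_def convex_hull_finite[OF finite_Diff[OF finite_C]]
      using cardF by (intro CollectI exI[of _ "\<lambda>_. 1 / real CARD('d)"]) simp
    have "x0 \<notin> rel_interior \<Omega>"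
      using x0F F(2) \<Omega>_open by (auto simp: frontier_def interior_open rel_interior_open)
    then obtain a where a: "a \<noteq> 0" "\<And>y. y \<in> closure \<Omega> \<Longrightarrow> a \<bullet> x0 \<le> a \<bullet> y"
      using supporting_hyperplane_relative_frontier[OF \<Omega>_convex] subsetD[OF Fcl x0F] by metis
    have av: "a \<bullet> v = a \<bullet> x0" if v: "v \<in> C - {u}" for v
    proof -
      have le: "0 \<le> a \<bullet> w - a \<bullet> x0" if "w \<in> C - {u}" for w using a(2)[OF subsetD[OF Fcl CF[OF that]]] by simp
      have "(\<Sum>w\<in>C - {u}. a \<bullet> w - a \<bullet> x0) = real CARD('d) * (a \<bullet> x0) - real CARD('d) * (a \<bullet> x0)"
      proof -
        have "a \<bullet> x0 = (\<Sum>w\<in>C - {u}. a \<bullet> w) / real CARD('d)"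
          by (simp add: x0_def inner_sum_right sum_divide_distrib)
        then have "(\<Sum>w\<in>C - {u}. a \<bullet> w) = real CARD('d) * (a \<bullet> x0)" by simp
        then show ?thesis using cardF by (simp add: sum_subtractf)
      qed
      then have "(\<Sum>w\<in>C - {u}. a \<bullet> w - a \<bullet> x0) = 0" by simp
      from iffD1[OF sum_nonneg_eq_0_iff[OF finite_Diff[OF finite_C] le] this] v
      have "a \<bullet> v - a \<bullet> x0 = 0" by (rule bspec)
      then show ?thesis by simp
    qed
    have "a \<bullet> (v - w) = 0" if "v \<in> C - {u}" "w \<in> C - {u}" for v w
      unfolding inner_diff_right av[OF that(1)] av[OF that(2)] by simp
    then obtain c where c: "a = c *\<^sub>R bgrad u" by (rule normal_multiple[OF u])
    have "0 \<le> a \<bullet> (y0 - x0)" using a(2)[of y0] y0\<Omega> closure_subset by (force simp: inner_diff_right)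
    then have "0 \<le> c" using by0[OF x0F] c by (simp add: zero_le_mult_iff)
    then have "c > 0" using a(1) c by (cases "c = 0") auto
    show "\<forall>x\<in>F. \<forall>y\<in>\<Omega>. n0 \<bullet> (y - x) \<le> 0"
    proof (intro ballI)
      fix x y assume x: "x \<in> F" and y: "y \<in> \<Omega>"
      have "0 \<le> a \<bullet> (y - x0)" using a(2)[of y] y closure_subset by (force simp: inner_diff_right)
      then have "0 \<le> bgrad u \<bullet> (y - x0)" using \<open>c > 0\<close> c by (simp add: zero_le_mult_iff)
      also have "bgrad u \<bullet> (y - x0) = bgrad u \<bullet> (y - x)"
      proof -
        have "bary u x0 = bary u x" using bF x x0F by simp
        then show ?thesis by (simp add: bary_def algebra_simps)
      qed
      finally show "n0 \<bullet> (y - x) \<le> 0" by (simp add: n0_def)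
    qed
  qed
  then have "unit_normal \<Omega> F = n0"
    unfolding unit_normal_def by (rule the_equality) (rule uniq)
  then show ?thesis using that[of "- (1 / norm (bgrad u))"] by (simp add: n0_def)
qed

end

section \<open>The finite element spaces\<close>

lemma l2_inner_cong:
  "f \<in> L2 S \<Longrightarrow> f' \<in> L2 S \<Longrightarrow> g \<in> L2 S \<Longrightarrow> ae_eq S f f' \<Longrightarrow> l2_inner S f g = l2_inner S f' g"
  by (rule l2_inner_ae_cong) auto

lemma ae_eq_diff_0:
  fixes f g :: "_ \<Rightarrow> 'b::real_vector"
  shows "ae_eq S (f - g) 0 \<longleftrightarrow> ae_eq S f g"
  by (simp add: ae_eq_def)

lemma gradient_has_derivative:
  assumes "\<phi> \<in> test_functions \<Omega>"
  shows "(\<phi> has_derivative (\<lambda>h. (\<chi> i. partial i \<phi> x) \<bullet> h)) (at x)"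
    "continuous_on UNIV (\<lambda>x. \<chi> i. partial i \<phi> x)"
proof -
  have "(\<lambda>h. (\<chi> i. partial i \<phi> x) \<bullet> h) = (\<lambda>h. \<Sum>i\<in>UNIV. h $ i * partial i \<phi> x)"
    by (simp add: inner_vec_def mult.commute)
  then show "(\<phi> has_derivative (\<lambda>h. (\<chi> i. partial i \<phi> x) \<bullet> h)) (at x)"
    using has_derivative_partial[OF test_function_differentiable(1)[OF assms]] by simp
  show "continuous_on UNIV (\<lambda>x. \<chi> i. partial i \<phi> x)"
    by (intro continuous_on_vec_lambda test_function_differentiable(3)[OF assms])
qed

lemma has_derivative_vec_lambda:
  fixes f :: "'n::finite \<Rightarrow> real^'d::finite \<Rightarrow> real"
  assumes "\<And>i. (f i has_derivative f' i) (at x)"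
  shows "((\<lambda>x. \<chi> i. f i x) has_derivative (\<lambda>h. \<chi> i. f' i h)) (at x)"
  by (subst has_derivative_componentwise_within) (auto simp: Basis_vec_def inner_axis assms)

lemma polys_gradient:
  assumes "P \<in> polys k"
  shows "\<exists>D. (\<forall>x. (P has_derivative (\<lambda>h. \<Sum>i\<in>UNIV. h $ i * D i x)) (at x)) \<and> (\<forall>i. D i \<in> polys (k - 1))"
proof (rule polys_has_derivative[OF assms])
  fix D assume D: "\<And>x. (P has_derivative (\<lambda>h. \<Sum>i\<in>UNIV. h $ i * D i x)) (at x)" "\<And>i. D i \<in> polys (k - 1)"
  show ?thesis by (intro exI[of _ D] conjI allI D)
qed

context mesh
begin

lemma test_zero_off: "\<phi> \<in> test_functions \<Omega> \<Longrightarrow> x \<notin> \<Omega> \<Longrightarrow> \<phi> x = 0"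
  by (auto simp: test_functions_def)

lemma piece_L2:
  fixes P :: "real^'d \<Rightarrow> 'b::euclidean_space"
  assumes "K \<in> T" "continuous_on UNIV P"
  shows "(\<lambda>x. indicator K x *\<^sub>R P x) \<in> L2 \<Omega>"
proof -
  have "bounded (P ` K)"
    using T_props(2)[OF assms(1)] assms(2) by (intro compact_imp_bounded compact_continuous_image) (auto intro: continuous_on_subset)
  then obtain B where B: "B > 0" "\<And>x. x \<in> K \<Longrightarrow> norm (P x) \<le> B" by (auto simp: bounded_pos)
  have "(\<lambda>x. indicator K x *\<^sub>R P x) \<in> borel_measurable borel"
    using T_props(3)[OF assms(1)] continuous_on_subset[OF assms(2)]
    by (intro borel_measurable_continuous_on_indicator) auto
  then have "(\<lambda>x. indicator K x *\<^sub>R P x) \<in> borel_measurable (lebesgue_on \<Omega>)"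
    by (intro measurable_restrict_space1 measurable_completion) simp
  then show ?thesis
    by (intro L2_bounded[where C = B] \<Omega>_meas) (use B in \<open>auto simp: indicator_def\<close>)
qed

lemma l2_inner_piece:
  fixes P Q :: "real^'d \<Rightarrow> 'b::euclidean_space"
  assumes "K \<in> T" "continuous_on UNIV P" "continuous_on UNIV Q"
  shows "l2_inner \<Omega> (\<lambda>x. indicator K x *\<^sub>R P x) Q = (LINT x|lebesgue_on K. P x \<bullet> Q x)"
  unfolding l2_inner_def inner_scaleR_left
  by (rule integral_indicator_K[OF assms(1)])
    (intro borel_measurable_lebesgue_on_continuous continuous_on_inner assms)

lemma l2_inner_piece_ae:
  fixes P Q z :: "real^'d \<Rightarrow> real"
  assumes "K \<in> T" "continuous_on UNIV P" "continuous_on UNIV Q" "z \<in> L2 \<Omega>" "ae_eq K z Q"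
  shows "l2_inner \<Omega> (\<lambda>x. indicator K x * P x) z = (LINT x|lebesgue_on K. P x * Q x)"
proof -
  have PK: "(\<lambda>x. indicator K x * P x) \<in> L2 \<Omega>" "(\<lambda>x. indicator K x * Q x) \<in> L2 \<Omega>"
    using piece_L2[OF assms(1,2)] piece_L2[OF assms(1,3)] by simp_all
  have "l2_inner \<Omega> (\<lambda>x. indicator K x * P x) z = l2_inner \<Omega> (\<lambda>x. indicator K x * P x) (\<lambda>x. indicator K x * Q x)"
    unfolding l2_inner_def
  proof (rule Bochner_Integration.integral_cong_AE)
    have "AE x in lebesgue. x \<in> K \<longrightarrow> z x = Q x" using assms(5) T_props(5)[OF assms(1)] by (simp add: ae_eq_lebesgue)
    then show "AE x in lebesgue_on \<Omega>. (indicator K x * P x) \<bullet> z x = (indicator K x * P x) \<bullet> (indicator K x * Q x)"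
      unfolding AE_restrict_space_iff[of \<Omega> lebesgue, simplified, OF \<Omega>_sets]
      by eventually_elim (auto simp: indicator_def)
  qed (intro borel_measurable_inner L2D(1)[OF PK(1)] L2D(1)[OF PK(2)] L2D(1)[OF assms(4)])+
  also have "\<dots> = (LINT x|lebesgue_on \<Omega>. indicator K x * (P x * Q x))"
    unfolding l2_inner_def by (intro Bochner_Integration.integral_cong) (auto simp: indicator_def)
  also have "\<dots> = (LINT x|lebesgue_on K. P x * Q x)"
    by (rule integral_indicator_K[OF assms(1)])
      (intro borel_measurable_lebesgue_on_continuous continuous_on_mult assms)
  finally show ?thesis .
qed

lemma ae_eq_off:
  assumes "K \<in> T" "K'' \<in> T" "K'' \<noteq> K" "\<And>x. x \<notin> K \<Longrightarrow> f x = g x" shows "ae_eq K'' f g"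
  unfolding ae_eq_lebesgue[OF T_props(5)[OF assms(2)]]
  using AE_T_Int[OF assms(2,1,3)] by eventually_elim (use assms(4) in auto)

lemma ae_eq_indicator: "K \<in> T \<Longrightarrow> ae_eq K (\<lambda>x. indicator K x *\<^sub>R P x) (P :: _ \<Rightarrow> 'b::euclidean_space)"
  unfolding ae_eq_lebesgue[OF T_props(5)] by simp

lemma interior_of_piece:
  fixes v :: "real^'d \<Rightarrow> real"
  assumes "K \<in> T" "ae_eq K v P" shows "ae_eq (interior K) v P"
  using assms interior_subset[of K]
  by (auto simp: ae_eq_lebesgue T_props borel_open elim!: eventually_mono)

lemma Xh_piece: "v \<in> Xh \<Omega> T k \<Longrightarrow> K \<in> T \<Longrightarrow> \<exists>P\<in>polys k. ae_eq K v P"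
  by (simp add: Xh_def)

lemma Xh_add: assumes "u \<in> Xh \<Omega> T k" "v \<in> Xh \<Omega> T k" shows "u + v \<in> Xh \<Omega> T k"
  unfolding Xh_def
proof (intro CollectI conjI ballI)
  show "u + v \<in> L2 \<Omega>" using assms by (auto simp: Xh_def intro: L2_add)
  fix K assume "K \<in> T"
  then obtain P Q where "P \<in> polys k" "ae_eq K u P" "Q \<in> polys k" "ae_eq K v Q" using assms Xh_piece by metis
  then show "\<exists>P\<in>polys k. ae_eq K (u + v) P"
    using ae_eq_add[of K u P v Q] subspace_add[OF subspace_polys, of P k Q] by blast
qed

lemma Xh_scale: assumes "u \<in> Xh \<Omega> T k" shows "c *\<^sub>R u \<in> Xh \<Omega> T k"
  unfolding Xh_def
proof (intro CollectI conjI ballI)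
  show "c *\<^sub>R u \<in> L2 \<Omega>" using assms by (auto simp: Xh_def intro: L2_scale)
  fix K assume "K \<in> T"
  then obtain P where "P \<in> polys k" "ae_eq K u P" using assms Xh_piece by metis
  then show "\<exists>P\<in>polys k. ae_eq K (c *\<^sub>R u) P"
    using ae_eq_scaleR[of K u P c] subspace_scale[OF subspace_polys, of P k c] by blast
qed

lemma Xh_null: assumes "u \<in> L2 \<Omega>" "ae_eq \<Omega> u 0" shows "u \<in> Xh \<Omega> T k"
  using assms subspace_0[OF subspace_polys] ae_eq_mesh[of u 0] unfolding Xh_def by blast

lemma zero_L2: "0 \<in> L2 \<Omega>"
  by (rule subspace_0[OF subspace_L2])

lemma subspace_Xh: "subspace (Xh \<Omega> T k)"
  by (rule subspaceI) (simp_all add: Xh_add Xh_scale Xh_null zero_L2)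

lemma subspace_Lh: "subspace (Lh \<Omega> T k)"
proof (rule subspaceI)
  show "0 \<in> Lh \<Omega> T k"
    using ae_zero_imp_H1[OF \<Omega>_open \<Omega>_bounded zero_L2] subspace_0[OF subspace_Xh] by (simp add: Lh_def)
next
  fix u v assume "u \<in> Lh \<Omega> T k" "v \<in> Lh \<Omega> T k"
  then show "u + v \<in> Lh \<Omega> T k"
    using weak_grad_add(2)[OF \<Omega>_open \<Omega>_bounded] Xh_add by (simp add: Lh_def)
next
  fix c u assume "u \<in> Lh \<Omega> T k"
  then show "c *\<^sub>R u \<in> Lh \<Omega> T k"
    using weak_grad_scale(2)[OF \<Omega>_open \<Omega>_bounded] Xh_scale by (simp add: Lh_def)
qed

lemma subspace_RTh: "subspace (RTh \<Omega> T l)"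
proof (rule subspaceI)
  show "0 \<in> RTh \<Omega> T l"
    using ae_zero_imp_Hdiv(1)[OF \<Omega>_open \<Omega>_bounded zero_L2] subspace_0[OF subspace_RT_polys] ae_eq_refl
    unfolding RTh_def by blast
next
  fix p q assume pq: "p \<in> RTh \<Omega> T l" "q \<in> RTh \<Omega> T l"
  show "p + q \<in> RTh \<Omega> T l"
    unfolding RTh_def
  proof (intro CollectI conjI ballI)
    show "p + q \<in> Hdiv \<Omega>" using pq weak_div_add(2)[OF \<Omega>_open \<Omega>_bounded] by (simp add: RTh_def)
    fix K assume "K \<in> T"
    then obtain P Q where "P \<in> RT_polys l" "ae_eq K p P" "Q \<in> RT_polys l" "ae_eq K q Q" using pq unfolding RTh_def by blast
    then show "\<exists>Q\<in>RT_polys l. ae_eq K (p + q) Q"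
      using ae_eq_add[of K p P q Q] subspace_add[OF subspace_RT_polys, of P l Q] by blast
  qed
next
  fix c p assume p: "p \<in> RTh \<Omega> T l"
  show "c *\<^sub>R p \<in> RTh \<Omega> T l"
    unfolding RTh_def
  proof (intro CollectI conjI ballI)
    show "c *\<^sub>R p \<in> Hdiv \<Omega>" using p weak_div_scale(2)[OF \<Omega>_open \<Omega>_bounded] by (simp add: RTh_def)
    fix K assume "K \<in> T"
    then obtain P where "P \<in> RT_polys l" "ae_eq K p P" using p unfolding RTh_def by blast
    then show "\<exists>Q\<in>RT_polys l. ae_eq K (c *\<^sub>R p) Q"
      using ae_eq_scaleR[of K p P c] subspace_scale[OF subspace_RT_polys, of P l c] by blast
  qed
qed

text \<open>The boundary data vary with the function, so one statement covers the linear structure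
  of the homogeneous space, differences of two functions with equal data, and the addition of a
  variation.\<close>

lemma Vh_lincomb:
  assumes "u \<in> Vh \<Omega> T k \<Sigma> g" "v \<in> Vh \<Omega> T k \<Sigma> g'" "\<And>F x. g'' F x = g F x + c * g' F x"
  shows "u + c *\<^sub>R v \<in> Vh \<Omega> T k \<Sigma> g''"
  unfolding Vh_def
proof (intro CollectI conjI ballI allI impI)
  show "u + c *\<^sub>R v \<in> Lh \<Omega> T k"
    using assms(1,2) by (auto simp: Vh_def intro: subspace_add[OF subspace_Lh] subspace_scale[OF subspace_Lh])
  fix K F assume K: "K \<in> T" "F facet_of K \<and> F \<subseteq> \<Sigma>"
  obtain P where P: "P \<in> polys k" "ae_eq K u P" "\<forall>x\<in>F. P x = g F x" using assms(1) K unfolding Vh_def by blast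
  obtain Q where Q: "Q \<in> polys k" "ae_eq K v Q" "\<forall>x\<in>F. Q x = g' F x" using assms(2) K unfolding Vh_def by blast
  show "\<exists>P\<in>polys k. ae_eq K (u + c *\<^sub>R v) P \<and> (\<forall>x\<in>F. P x = g'' F x)"
  proof (intro bexI conjI)
    show "ae_eq K (u + c *\<^sub>R v) (P + c *\<^sub>R Q)" using P Q by (intro ae_eq_add ae_eq_scaleR)
    show "P + c *\<^sub>R Q \<in> polys k" using P Q by (intro subspace_add[OF subspace_polys] subspace_scale[OF subspace_polys])
    show "\<forall>x\<in>F. (P + c *\<^sub>R Q) x = g'' F x" using P Q assms(3) by simp
  qed
qed

lemma V0_null: assumes "u \<in> L2 \<Omega>" "ae_eq \<Omega> u 0" shows "u \<in> V0 \<Omega> T k \<Sigma>"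
proof -
  have "u \<in> Lh \<Omega> T k" using assms ae_zero_imp_H1(1)[OF \<Omega>_open \<Omega>_bounded] Xh_null by (simp add: Lh_def)
  moreover have "ae_eq K u 0" if "K \<in> T" for K using assms ae_eq_mesh[of u 0] that by blast
  ultimately show ?thesis unfolding Vh_def using subspace_0[OF subspace_polys] by fastforce
qed

lemma subspace_V0: "subspace (V0 \<Omega> T k \<Sigma>)"
proof (rule subspaceI)
  show 0: "0 \<in> V0 \<Omega> T k \<Sigma>" by (rule V0_null) (auto intro: zero_L2)
  show "u + v \<in> V0 \<Omega> T k \<Sigma>" if "u \<in> V0 \<Omega> T k \<Sigma>" "v \<in> V0 \<Omega> T k \<Sigma>" for u v
    using Vh_lincomb[OF that, of "\<lambda>F x. 0" 1] by simp
  show "c *\<^sub>R u \<in> V0 \<Omega> T k \<Sigma>" if "u \<in> V0 \<Omega> T k \<Sigma>" for c u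
    using Vh_lincomb[OF 0 that, of "\<lambda>F x. 0" c] by simp
qed

lemma Dh_lincomb:
  assumes "p \<in> Dh \<Omega> T l \<Sigma> g" "q \<in> Dh \<Omega> T l \<Sigma> g'" "\<And>F x. g'' F x = g F x + c * g' F x"
  shows "p + c *\<^sub>R q \<in> Dh \<Omega> T l \<Sigma> g''"
  unfolding Dh_def
proof (intro CollectI conjI ballI allI impI)
  show "p + c *\<^sub>R q \<in> RTh \<Omega> T l"
    using assms(1,2) by (auto simp: Dh_def intro: subspace_add[OF subspace_RTh] subspace_scale[OF subspace_RTh])
  fix K F assume K: "K \<in> T" "F facet_of K \<and> F \<subseteq> \<Sigma>"
  obtain P where P: "P \<in> RT_polys l" "ae_eq K p P" "\<forall>x\<in>F. P x \<bullet> unit_normal \<Omega> F = g F x" using assms(1) K unfolding Dh_def by blast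
  obtain Q where Q: "Q \<in> RT_polys l" "ae_eq K q Q" "\<forall>x\<in>F. Q x \<bullet> unit_normal \<Omega> F = g' F x" using assms(2) K unfolding Dh_def by blast
  show "\<exists>P\<in>RT_polys l. ae_eq K (p + c *\<^sub>R q) P \<and> (\<forall>x\<in>F. P x \<bullet> unit_normal \<Omega> F = g'' F x)"
  proof (intro bexI conjI)
    show "ae_eq K (p + c *\<^sub>R q) (P + c *\<^sub>R Q)" using P Q by (intro ae_eq_add ae_eq_scaleR)
    show "P + c *\<^sub>R Q \<in> RT_polys l" using P Q by (intro subspace_add[OF subspace_RT_polys] subspace_scale[OF subspace_RT_polys])
    show "\<forall>x\<in>F. (P + c *\<^sub>R Q) x \<bullet> unit_normal \<Omega> F = g'' F x" using P Q assms(3) by (simp add: inner_add_left)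
  qed
qed

lemma D0_null: assumes "q \<in> L2 \<Omega>" "ae_eq \<Omega> q 0" shows "q \<in> D0 \<Omega> T l \<Sigma>"
proof -
  have K: "ae_eq K q 0" if "K \<in> T" for K using assms ae_eq_mesh[of q 0] that by blast
  then have "q \<in> RTh \<Omega> T l"
    using ae_zero_imp_Hdiv(1)[OF \<Omega>_open \<Omega>_bounded assms] subspace_0[OF subspace_RT_polys] unfolding RTh_def by blast
  then show ?thesis unfolding Dh_def using K subspace_0[OF subspace_RT_polys] by fastforce
qed

lemma subspace_D0: "subspace (D0 \<Omega> T l \<Sigma>)"
proof (rule subspaceI)
  show 0: "0 \<in> D0 \<Omega> T l \<Sigma>" by (rule D0_null) (auto intro: zero_L2)
  show "u + v \<in> D0 \<Omega> T l \<Sigma>" if "u \<in> D0 \<Omega> T l \<Sigma>" "v \<in> D0 \<Omega> T l \<Sigma>" for u v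
    using Dh_lincomb[OF that, of "\<lambda>F x. 0" 1] by simp
  show "c *\<^sub>R u \<in> D0 \<Omega> T l \<Sigma>" if "u \<in> D0 \<Omega> T l \<Sigma>" for c u
    using Dh_lincomb[OF 0 that, of "\<lambda>F x. 0" c] by simp
qed

lemma D0I:
  assumes "q \<in> Hdiv \<Omega>"
    and "\<And>K. K \<in> T \<Longrightarrow> \<exists>Q\<in>RT_polys l. ae_eq K q Q \<and> (\<forall>F. F facet_of K \<longrightarrow> F \<subseteq> \<Sigma> \<longrightarrow> (\<forall>x\<in>F. Q x \<bullet> unit_normal \<Omega> F = 0))"
  shows "q \<in> D0 \<Omega> T l \<Sigma>"
  unfolding Dh_def RTh_def
proof (intro CollectI conjI ballI allI impI)
  show "q \<in> Hdiv \<Omega>" by fact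
  show "\<exists>Q\<in>RT_polys l. ae_eq K q Q" if "K \<in> T" for K using assms(2)[OF that] by blast
  show "\<exists>Q\<in>RT_polys l. ae_eq K q Q \<and> (\<forall>x\<in>F. Q x \<bullet> unit_normal \<Omega> F = 0)" if "K \<in> T" "F facet_of K \<and> F \<subseteq> \<Sigma>" for K F
    using assms(2)[OF that(1)] that(2) by blast
qed

text \<open>Every facet except the one opposite \<open>v\<close> contains the apex \<open>v\<close>,
  so the cone field is tangential there.\<close>

lemma cone_normal:
  assumes C: "full_simplex C" and K: "convex hull C \<in> T" and v: "v \<in> C"
    and F: "F facet_of convex hull C" "F \<subseteq> frontier \<Omega>" "F \<noteq> convex hull (C - {v})" and x: "x \<in> F"
  shows "(x - v) \<bullet> unit_normal \<Omega> F = 0"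
proof -
  interpret full_simplex C by fact
  obtain u where u: "u \<in> C" "F = convex hull (C - {u})" using facet_simplex[OF C F(1)] by blast
  then have uv: "u \<noteq> v" using F(3) by blast
  obtain c where c: "unit_normal \<Omega> F = c *\<^sub>R bgrad u" using unit_normal_multiple[OF C K u F(2)] by blast
  have "bary u x = 0" using facet_bary[OF u(1)] x u(2) by blast
  moreover have "bary u v = 0" using bary_vertex[OF u(1) v] uv by simp
  ultimately have "bgrad u \<bullet> (x - v) = 0" by (simp add: bary_def algebra_simps)
  then show ?thesis by (simp add: c inner_commute)
qed

lemma bubble_face_normal:
  assumes C: "full_simplex C" and K: "convex hull C \<in> T"
    and F: "F facet_of convex hull C" "F \<subseteq> frontier \<Omega>" and x: "x \<in> F"
  shows "full_simplex.bubble C g x \<bullet> unit_normal \<Omega> F = 0"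
proof -
  interpret full_simplex C by fact
  obtain u where u: "u \<in> C" "F = convex hull (C - {u})" using facet_simplex[OF C F(1)] by blast
  obtain c where c: "unit_normal \<Omega> F = c *\<^sub>R bgrad u" using unit_normal_multiple[OF C K u F(2)] by blast
  show ?thesis
  proof (rule bubble_normal[OF u(1)])
    show "bary u x = 0" using facet_bary[OF u(1)] x u(2) by blast
    show "unit_normal \<Omega> F \<bullet> (v - w) = 0" if "v \<in> C - {u}" "w \<in> C - {u}" for v w
      using that bgrad_diff[OF u(1), of v w] by (auto simp: c)
  qed
qed

text \<open>Extension by zero keeps a weak divergence as soon as integration by parts on the element
  has no boundary term against test functions of \<Omega>. This serves both the bubble fields and
  the cone field at a free boundary facet.\<close>

lemma single_element_field:
  assumes K: "K \<in> T" and cQ: "continuous_on UNIV Q" and cw: "continuous_on UNIV w"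
    and parts: "\<And>\<phi>. \<phi> \<in> test_functions \<Omega> \<Longrightarrow>
      (LINT x|lebesgue_on K. Q x \<bullet> (\<chi> i. partial i \<phi> x)) = - (LINT x|lebesgue_on K. w x * \<phi> x)"
    and Q: "Q \<in> RT_polys l" and normal: "\<And>F x. F facet_of K \<Longrightarrow> F \<subseteq> \<Sigma> \<Longrightarrow> x \<in> F \<Longrightarrow> Q x \<bullet> unit_normal \<Omega> F = 0"
  shows "(\<lambda>x. indicator K x *\<^sub>R Q x) \<in> D0 \<Omega> T l \<Sigma>"
    "ae_eq \<Omega> (weak_div \<Omega> (\<lambda>x. indicator K x *\<^sub>R Q x)) (\<lambda>x. indicator K x * w x)"
proof -
  let ?q = "\<lambda>x. indicator K x *\<^sub>R Q x"
  have wK: "(\<lambda>x. indicator K x * w x) \<in> L2 \<Omega>" using piece_L2[OF K cw] by simp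
  have "is_weak_div \<Omega> ?q (\<lambda>x. indicator K x * w x)"
    unfolding is_weak_div_def
  proof
    fix \<phi> assume \<phi>: "\<phi> \<in> test_functions \<Omega>"
    show "l2_inner \<Omega> ?q (\<lambda>x. \<chi> i. partial i \<phi> x) = - l2_inner \<Omega> (\<lambda>x. indicator K x * w x) \<phi>"
      using l2_inner_piece[OF K cQ gradient_has_derivative(2)[OF \<phi>]] parts[OF \<phi>]
        l2_inner_piece[OF K cw test_function_differentiable(2)[OF \<phi>]] by simp
  qed
  note wd = weak_div_unique[OF \<Omega>_open \<Omega>_bounded piece_L2[OF K cQ] wK this]
  then show "ae_eq \<Omega> (weak_div \<Omega> ?q) (\<lambda>x. indicator K x * w x)" by blast
  show "?q \<in> D0 \<Omega> T l \<Sigma>"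
  proof (rule D0I[OF wd(2)])
    fix K'' assume K'': "K'' \<in> T"
    show "\<exists>Q\<in>RT_polys l. ae_eq K'' ?q Q \<and> (\<forall>F. F facet_of K'' \<longrightarrow> F \<subseteq> \<Sigma> \<longrightarrow> (\<forall>x\<in>F. Q x \<bullet> unit_normal \<Omega> F = 0))"
    proof (cases "K'' = K")
      case True
      then show ?thesis using Q normal ae_eq_indicator[OF K] by blast
    next
      case False
      have "ae_eq K'' ?q 0" by (rule ae_eq_off[OF K K'' False]) simp
      then show ?thesis using subspace_0[OF subspace_RT_polys] by (intro bexI[of _ 0]) auto
    qed
  qed
qed

section \<open>Multipliers orthogonal to all admissible divergences\<close>

lemma b_form_weak_div:
  assumes "q \<in> Hdiv \<Omega>" "ae_eq \<Omega> (weak_div \<Omega> q) w" "w \<in> L2 \<Omega>" "z \<in> L2 \<Omega>"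
  shows "b_form \<Omega> \<mu> q (\<lambda>x. 0) z = l2_inner \<Omega> w z"
  using l2_inner_cong[OF weak_div(1)[OF assms(1)] assms(3,4,2)] by (simp add: b_form_def)

lemma D0_Hdiv: "q \<in> D0 \<Omega> T l \<Sigma> \<Longrightarrow> q \<in> Hdiv \<Omega>"
  by (simp add: Dh_def RTh_def)

lemma fitted_frontier: "fitted_boundary_part \<Omega> T \<Sigma> \<Longrightarrow> \<Sigma> \<subseteq> frontier \<Omega>"
  by (auto simp: fitted_boundary_part_def)

text \<open>The bubble field of the gradient of the local polynomial \<open>P\<close> fits exactly
  into \<open>RT_polys l\<close>. Orthogonality to its divergence becomes, after integration by
  parts, the vanishing integral of \<open>bubble g x \<bullet> g x\<close>, which forces the
  gradient to be zero.\<close>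

lemma multiplier_piecewise_constant:
  assumes fit: "fitted_boundary_part \<Omega> T \<Sigma>" and z: "z \<in> Wh \<Omega> T l"
    and orth: "\<And>q. q \<in> D0 \<Omega> T l \<Sigma> \<Longrightarrow> b_form \<Omega> \<mu> q (\<lambda>x. 0) z = 0" and K: "K \<in> T"
  obtains c where "ae_eq K z (\<lambda>x. c)"
proof -
  have zL2: "z \<in> L2 \<Omega>" using z by (simp add: Xh_def)
  obtain P where P: "P \<in> polys l" "ae_eq K z P" using Xh_piece[OF z K] by blast
  have cP: "continuous_on UNIV P" using polys_continuous[OF P(1)] .
  show ?thesis
  proof (cases l)
    case 0
    then show ?thesis using P polys_0 that by blast
  next
    case (Suc n)
    obtain C where C: "full_simplex C" "K = convex hull C" using T_simplex[OF K] by blast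
    interpret full_simplex C by fact
    from polys_gradient[OF P(1)] obtain D where D': "(\<forall>x. (P has_derivative (\<lambda>h. \<Sum>i\<in>UNIV. h $ i * D i x)) (at x)) \<and> (\<forall>i. D i \<in> polys (l - 1))"
      by (rule exE)
    note D = D'[THEN conjunct1, rule_format] D'[THEN conjunct2, rule_format, unfolded Suc diff_Suc_1]
    \<comment> \<open>Second derivatives of \<open>P\<close> are needed because the bubble of its
      gradient is differentiated once more.\<close>
    have "\<forall>i. \<exists>E. (\<forall>x. (D i has_derivative (\<lambda>h. \<Sum>j\<in>UNIV. h $ j * E j x)) (at x)) \<and> (\<forall>j. E j \<in> polys (n - 1))"
      by (intro allI polys_gradient D)
    then obtain E where E': "\<forall>i. (\<forall>x. (D i has_derivative (\<lambda>h. \<Sum>j\<in>UNIV. h $ j * E i j x)) (at x)) \<and> (\<forall>j. E i j \<in> polys (n - 1))"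
      by (rule choice[THEN exE])
    note E = E'[THEN spec, THEN conjunct1, rule_format] E'[THEN spec, THEN conjunct2, rule_format]
    define g where "g x = (\<chi> i. D i x)" for x
    define g' where "g' x h = (\<chi> i. \<Sum>j\<in>UNIV. h $ j * E i j x)" for x h :: "real^'d"
    have cg: "continuous_on S g" for S
      unfolding g_def[abs_def] by (intro continuous_on_vec_lambda polys_continuous[OF D(2)])
    have Dg: "(g has_derivative g' x) (at x)" for x
      unfolding g_def[abs_def] g'_def by (intro has_derivative_vec_lambda E)
    have cg': "continuous_on UNIV (\<lambda>x. g' x h)" for h
      unfolding g'_def by (intro continuous_on_vec_lambda continuous_intros polys_continuous[OF E(2)])
    have DP: "(P has_derivative (\<lambda>h. g x \<bullet> h)) (at x)" for x
    proof -
      have "(\<lambda>h. g x \<bullet> h) = (\<lambda>h. \<Sum>i\<in>UNIV. h $ i * D i x)" by (simp add: g_def inner_vec_def mult.commute)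
      then show ?thesis using D(1)[of x] by simp
    qed
    have cb: "continuous_on UNIV (bubble g)"
      unfolding bubble_def[abs_def] by (intro continuous_intros continuous_bary cg)
    have RT: "bubble g \<in> RT_polys l" unfolding Suc by (rule bubble_RT) (simp add: g_def D(2))
    let ?q = "\<lambda>x. indicator K x *\<^sub>R bubble g x"
    have normal: "bubble g x \<bullet> unit_normal \<Omega> F = 0" if "F facet_of K" "F \<subseteq> \<Sigma>" "x \<in> F" for F x
      using bubble_face_normal[OF C(1) _ _ _ that(3)] K C(2) that fitted_frontier[OF fit] by blast
    have "(LINT x|lebesgue_on (convex hull C). bubble g x \<bullet> g x) = 0"
    proof (rule bubble_integration_by_parts[OF Dg cg'])
    fix w assume w: "continuous_on UNIV w"
      "\<And>(\<psi> :: real^'d \<Rightarrow> real) (G :: real^'d \<Rightarrow> real^'d). (\<And>x. (\<psi> has_derivative (\<lambda>h. G x \<bullet> h)) (at x)) \<Longrightarrow> continuous_on UNIV G \<Longrightarrow>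
       (LINT x|lebesgue_on (convex hull C). bubble g x \<bullet> G x) = - (LINT x|lebesgue_on (convex hull C). w x * \<psi> x)"
    have parts: "(LINT x|lebesgue_on K. bubble g x \<bullet> (\<chi> i. partial i \<phi> x)) = - (LINT x|lebesgue_on K. w x * \<phi> x)"
      if "\<phi> \<in> test_functions \<Omega>" for \<phi>
      unfolding C(2) by (rule w(2)[OF gradient_has_derivative[OF that]])
    note q = single_element_field[OF K cb w(1) parts RT normal]
    have wK: "(\<lambda>x. indicator K x * w x) \<in> L2 \<Omega>" using piece_L2[OF K w(1)] by simp
    have "0 = b_form \<Omega> \<mu> ?q (\<lambda>x. 0) z" using orth[OF q(1)] by simp
    also have "\<dots> = l2_inner \<Omega> (\<lambda>x. indicator K x * w x) z"
      by (rule b_form_weak_div[OF D0_Hdiv[OF q(1)] q(2) wK zL2])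
    also have "\<dots> = (LINT x|lebesgue_on K. w x * P x)" by (rule l2_inner_piece_ae[OF K w(1) cP zL2 P(2)])
    finally show "(LINT x|lebesgue_on (convex hull C). bubble g x \<bullet> g x) = 0"
      using w(2)[OF DP cg] C(2) by simp
    qed
    then have g0: "g x = 0" if "x \<in> interior K" for x
      using bubble_vanishing_gradient[OF cg] that C(2) by blast
    have "\<exists>c. \<forall>x\<in>interior K. P x = c"
    proof (rule has_derivative_zero_constant)
      show "convex (interior K)" using T_props(1)[OF K] by (rule convex_interior)
      show "(P has_derivative (\<lambda>h. 0)) (at x within interior K)" if "x \<in> interior K" for x
        using has_derivative_at_withinI[OF DP[of x]] g0[OF that] by simp
    qed
    then obtain c where c: "\<And>x. x \<in> interior K \<Longrightarrow> P x = c" by blast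
    \<comment> \<open>Constancy is known in the interior only; the closure of the interior is the
      whole element.\<close>
    have "closed {x. P x = c}" using cP by (intro closed_Collect_eq) auto
    then have "closure (interior K) \<subseteq> {x. P x = c}" using c by (intro closure_minimal) auto
    then have "ae_eq K P (\<lambda>x. c)" unfolding T_props(8)[OF K] ae_eq_lebesgue[OF T_props(5)[OF K]] by (intro AE_I2) blast
    then show ?thesis using that ae_eq_trans[OF P(2)] by blast
  qed
qed

text \<open>The cone fields of the two elements, divided by the volumes and taken with opposite
  signs, have matching flux through the common facet. Their divergences have integrals
  \<open>CARD('d)\<close> and its negative, so testing compares the two constants directly.\<close>

lemma multiplier_adjacent:
  assumes fit: "fitted_boundary_part \<Omega> T \<Sigma>" and z: "z \<in> L2 \<Omega>"
    and orth: "\<And>q. q \<in> D0 \<Omega> T l \<Sigma> \<Longrightarrow> b_form \<Omega> \<mu> q (\<lambda>x. 0) z = 0"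
    and K: "K \<in> T" "K' \<in> T" "adjacent K K'" and c: "ae_eq K z (\<lambda>x. c)" "ae_eq K' z (\<lambda>x. c')"
  shows "c = c'"
proof -
  obtain S v v' where S: "full_simplex (insert v S)" "full_simplex (insert v' S)" "v \<notin> S" "v' \<notin> S"
    "K = convex hull (insert v S)" "K' = convex hull (insert v' S)" "K \<inter> K' = convex hull S"
    by (rule adjacent_simplices[OF K]) (rule that)
  interpret A: full_simplex "insert v S" by fact
  interpret B: full_simplex "insert v' S" by fact
  define m where "m = measure lebesgue K"
  define m' where "m' = measure lebesgue K'"
  have m: "m > 0" "m' > 0" using A.measure_pos B.measure_pos S(5,6) by (simp_all add: m_def m'_def)
  have KK': "K \<noteq> K'" using K(3) by (simp add: adjacent_def)
  let ?d = "real CARD('d)"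
  define Q where "Q x = (1 / m) *\<^sub>R (x - v)" for x
  define Q' where "Q' x = (- 1 / m') *\<^sub>R (x - v')" for x
  define q1 where "q1 x = indicator K x *\<^sub>R Q x" for x
  define q2 where "q2 x = indicator K' x *\<^sub>R Q' x" for x
  define w1 where "w1 x = indicator K x * (?d / m)" for x :: "real^'d"
  define w2 where "w2 x = indicator K' x * (- ?d / m')" for x :: "real^'d"
  have cQ: "continuous_on UNIV Q" "continuous_on UNIV Q'"
    unfolding Q_def[abs_def] Q'_def[abs_def] by (intro continuous_intros)+
  have L2: "q1 \<in> L2 \<Omega>" "q2 \<in> L2 \<Omega>" "w1 \<in> L2 \<Omega>" "w2 \<in> L2 \<Omega>"
    using piece_L2[OF K(1) cQ(1)] piece_L2[OF K(2) cQ(2)]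
      piece_L2[OF K(1), of "\<lambda>x. ?d / m"] piece_L2[OF K(2), of "\<lambda>x. - ?d / m'"]
    by (simp_all add: q1_def[abs_def] q2_def[abs_def] w1_def[abs_def] w2_def[abs_def])
  have wd: "is_weak_div \<Omega> (q1 + q2) (w1 + w2)"
    unfolding is_weak_div_def
  proof
    fix \<phi> assume \<phi>: "\<phi> \<in> test_functions \<Omega>"
    let ?G = "\<lambda>x. \<chi> i. partial i \<phi> x"
    note G = gradient_has_derivative[OF \<phi>]
    note c\<phi> = test_function_differentiable(2)[OF \<phi>]
    have i: "integrable (lebesgue_on K) \<phi>" "integrable (lebesgue_on K) (\<lambda>x. ?G x \<bullet> (x - v))"
      unfolding S(5) by (intro A.integral_K continuous_intros continuous_on_subset[OF c\<phi>] continuous_on_subset[OF G(2)]; simp)+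
    have i': "integrable (lebesgue_on K') \<phi>" "integrable (lebesgue_on K') (\<lambda>x. ?G x \<bullet> (x - v'))"
      unfolding S(6) by (intro B.integral_K continuous_intros continuous_on_subset[OF c\<phi>] continuous_on_subset[OF G(2)]; simp)+
    have flux: "(?d * (LINT x|lebesgue_on K. \<phi> x) + (LINT x|lebesgue_on K. ?G x \<bullet> (x - v))) / m
        = (?d * (LINT x|lebesgue_on K'. \<phi> x) + (LINT x|lebesgue_on K'. ?G x \<bullet> (x - v'))) / m'"
      using two_simplices_flux[OF S(1-4) G] i i' unfolding S(5)[symmetric] S(6)[symmetric] m_def[symmetric] m'_def[symmetric] by simp
    have "l2_inner \<Omega> (q1 + q2) ?G = l2_inner \<Omega> q1 ?G + l2_inner \<Omega> q2 ?G"
      by (rule l2_inner_add[OF L2(1,2) test_function_L2(3)[OF \<phi> \<Omega>_meas]])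
    also have "l2_inner \<Omega> q1 ?G = (LINT x|lebesgue_on K. ?G x \<bullet> (x - v)) / m"
      unfolding q1_def[abs_def] l2_inner_piece[OF K(1) cQ(1) G(2)] by (simp add: Q_def inner_commute)
    also have "l2_inner \<Omega> q2 ?G = - ((LINT x|lebesgue_on K'. ?G x \<bullet> (x - v')) / m')"
      unfolding q2_def[abs_def] l2_inner_piece[OF K(2) cQ(2) G(2)] by (simp add: Q'_def inner_commute)
    finally have 1: "l2_inner \<Omega> (q1 + q2) ?G = (LINT x|lebesgue_on K. ?G x \<bullet> (x - v)) / m + - ((LINT x|lebesgue_on K'. ?G x \<bullet> (x - v')) / m')" .
    have "l2_inner \<Omega> (w1 + w2) \<phi> = l2_inner \<Omega> w1 \<phi> + l2_inner \<Omega> w2 \<phi>"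
      by (rule l2_inner_add[OF L2(3,4) test_function_L2(1)[OF \<phi> \<Omega>_meas]])
    also have "l2_inner \<Omega> w1 \<phi> = ?d / m * (LINT x|lebesgue_on K. \<phi> x)"
      using l2_inner_piece[OF K(1) continuous_on_const c\<phi>, of "?d / m"] by (simp add: w1_def[abs_def])
    also have "l2_inner \<Omega> w2 \<phi> = - ?d / m' * (LINT x|lebesgue_on K'. \<phi> x)"
      using l2_inner_piece[OF K(2) continuous_on_const c\<phi>, of "- ?d / m'"] by (simp add: w2_def[abs_def])
    finally have 2: "l2_inner \<Omega> (w1 + w2) \<phi> = ?d / m * (LINT x|lebesgue_on K. \<phi> x) + - ?d / m' * (LINT x|lebesgue_on K'. \<phi> x)" .
    show "l2_inner \<Omega> (q1 + q2) ?G = - l2_inner \<Omega> (w1 + w2) \<phi>"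
      using flux unfolding 1 2 by (simp add: add_divide_distrib)
  qed
  note q = weak_div_unique[OF \<Omega>_open \<Omega>_bounded L2_add[OF L2(1,2)] L2_add[OF L2(3,4)] wd]
  \<comment> \<open>The common facet is the only one on which these fields have a normal component,
    and it meets \<Omega>, whereas \<Sigma> lies in the frontier.\<close>
  have shared: "\<not> convex hull S \<subseteq> \<Sigma>"
  proof -
    have "convex hull S \<inter> \<Omega> \<noteq> {}" using K(3) S(7) by (simp add: adjacent_def)
    moreover have "frontier \<Omega> \<inter> \<Omega> = {}" using \<Omega>_open by (auto simp: frontier_def interior_open)
    ultimately show ?thesis using fitted_frontier[OF fit] by blast
  qed
  have "q1 + q2 \<in> D0 \<Omega> T l \<Sigma>"
  proof (rule D0I[OF q(2)])
    fix K'' assume K'': "K'' \<in> T"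
    consider "K'' = K" | "K'' = K'" | "K'' \<noteq> K" "K'' \<noteq> K'" by blast
    then show "\<exists>Q\<in>RT_polys l. ae_eq K'' (q1 + q2) Q \<and> (\<forall>F. F facet_of K'' \<longrightarrow> F \<subseteq> \<Sigma> \<longrightarrow> (\<forall>x\<in>F. Q x \<bullet> unit_normal \<Omega> F = 0))"
    proof cases
      case 1
      have "ae_eq K q1 Q" unfolding q1_def[abs_def] by (rule ae_eq_indicator[OF K(1)])
      moreover have "ae_eq K q2 0" by (rule ae_eq_off[OF K(2) K(1) KK']) (simp add: q2_def)
      ultimately have "ae_eq K (q1 + q2) (Q + 0)" by (rule ae_eq_add)
      moreover have "Q x \<bullet> unit_normal \<Omega> F = 0" if "F facet_of K" "F \<subseteq> \<Sigma>" "x \<in> F" for F x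
      proof -
        have "F \<noteq> convex hull (insert v S - {v})" using shared that(2) S(3) by auto
        then show ?thesis
          using cone_normal[OF S(1) _ insertI1 _ _ _ that(3)] K(1) S(5) that fitted_frontier[OF fit] by (simp add: Q_def)
      qed
      moreover have "Q \<in> RT_polys l" unfolding Q_def[abs_def] by (rule RT_polys_affine)
      ultimately show ?thesis using 1 by auto
    next
      case 2
      have "ae_eq K' q2 Q'" unfolding q2_def[abs_def] by (rule ae_eq_indicator[OF K(2)])
      moreover have "ae_eq K' q1 0" by (rule ae_eq_off[OF K(1) K(2)]) (use KK' in \<open>auto simp: q1_def\<close>)
      ultimately have "ae_eq K' (q1 + q2) (0 + Q')" by (intro ae_eq_add)
      moreover have "Q' x \<bullet> unit_normal \<Omega> F = 0" if "F facet_of K'" "F \<subseteq> \<Sigma>" "x \<in> F" for F x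
      proof -
        have "F \<noteq> convex hull (insert v' S - {v'})" using shared that(2) S(4) by auto
        then show ?thesis
          using cone_normal[OF S(2) _ insertI1 _ _ _ that(3)] K(2) S(6) that fitted_frontier[OF fit] by (simp add: Q'_def)
      qed
      moreover have "Q' \<in> RT_polys l" unfolding Q'_def[abs_def] by (rule RT_polys_affine)
      ultimately show ?thesis using 2 by auto
    next
      case 3
      have "ae_eq K'' q1 0" by (rule ae_eq_off[OF K(1) K'' 3(1)]) (simp add: q1_def)
      moreover have "ae_eq K'' q2 0" by (rule ae_eq_off[OF K(2) K'' 3(2)]) (simp add: q2_def)
      ultimately have "ae_eq K'' (q1 + q2) (0 + 0)" by (rule ae_eq_add)
      then show ?thesis using subspace_0[OF subspace_RT_polys] by (intro bexI[of _ 0]) auto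
    qed
  qed
  then have "0 = b_form \<Omega> \<mu> (q1 + q2) (\<lambda>x. 0) z" using orth by simp
  also have "\<dots> = l2_inner \<Omega> (w1 + w2) z" by (rule b_form_weak_div[OF q(2,1) L2_add[OF L2(3,4)] z])
  also have "\<dots> = l2_inner \<Omega> w1 z + l2_inner \<Omega> w2 z" by (rule l2_inner_add[OF L2(3,4) z])
  also have "l2_inner \<Omega> w1 z = ?d * c"
    using l2_inner_piece_ae[OF K(1) continuous_on_const continuous_on_const z c(1), of "?d / m"] m T_props(6)[OF K(1)]
    by (simp add: w1_def[abs_def] m_def measure_restrict_space T_props K)
  also have "l2_inner \<Omega> w2 z = - ?d * c'"
    using l2_inner_piece_ae[OF K(2) continuous_on_const continuous_on_const z c(2), of "- ?d / m'"] m T_props(6)[OF K(2)]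
    by (simp add: w2_def[abs_def] m'_def measure_restrict_space T_props K)
  finally show ?thesis by simp
qed

text \<open>Testing only pairs with zero scalar component removes the \<mu>-term, so the argument
  does not depend on the sign or size of \<mu>.\<close>

theorem divergence_inf_sup:
  assumes fit: "fitted_boundary_part \<Omega> T \<Sigma>" and z: "z \<in> Wh \<Omega> T l"
    and orth: "\<And>q. q \<in> D0 \<Omega> T l \<Sigma> \<Longrightarrow> b_form \<Omega> \<mu> q (\<lambda>x. 0) z = 0"
  shows "ae_eq \<Omega> z 0"
proof -
  have zL2: "z \<in> L2 \<Omega>" using z by (simp add: Xh_def)
  have "\<exists>c. ae_eq K z (\<lambda>x. c)" if "K \<in> T" for K
    using multiplier_piecewise_constant[OF fit z orth that] by blast
  then obtain c where c: "\<And>K. K \<in> T \<Longrightarrow> ae_eq K z (\<lambda>x. c K)" by metis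
  obtain K F where K: "K \<in> T" "F facet_of K" "F \<subseteq> frontier \<Omega>" "\<not> F \<subseteq> \<Sigma>" using free_boundary_face[OF fit] by blast
  \<comment> \<open>The elements that share the constant of the element at the free facet form a set
    closed under adjacency.\<close>
  have "{K' \<in> T. c K' = c K} = T"
  proof (rule mesh_connected)
    fix K1 K2 assume 1: "K1 \<in> {K' \<in> T. c K' = c K}" "K2 \<in> T" "adjacent K1 K2"
    then have "c K1 = c K2" using multiplier_adjacent[OF fit zL2 orth _ 1(2,3) c c[OF 1(2)]] by blast
    then show "K2 \<in> {K' \<in> T. c K' = c K}" using 1 by simp
  qed (use K(1) in auto)
  then have cK: "c K' = c K" if "K' \<in> T" for K' using that by blast
  obtain C where C: "full_simplex C" "K = convex hull C" using T_simplex[OF K(1)] by blast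
  interpret full_simplex C by fact
  obtain v where v: "v \<in> C" "F = convex hull (C - {v})" using facet_simplex[OF C(1)] K(2) C(2) by blast
  have q: "(\<lambda>x. indicator K x *\<^sub>R (1 *\<^sub>R (x - v))) \<in> D0 \<Omega> T l \<Sigma> \<and>
    ae_eq \<Omega> (weak_div \<Omega> (\<lambda>x. indicator K x *\<^sub>R (1 *\<^sub>R (x - v)))) (\<lambda>x. indicator K x * real CARD('d))"
  proof -
    have parts: "(LINT x|lebesgue_on K. (1 *\<^sub>R (x - v)) \<bullet> (\<chi> i. partial i \<phi> x)) = - (LINT x|lebesgue_on K. real CARD('d) * \<phi> x)"
      if \<phi>: "\<phi> \<in> test_functions \<Omega>" for \<phi>
    proof -
      note G = gradient_has_derivative[OF \<phi>]
      note c\<phi> = test_function_differentiable(2)[OF \<phi>]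
      have "(LINT x|lebesgue_on K. real CARD('d) * \<phi> x + (\<chi> i. partial i \<phi> x) \<bullet> (x - v)) = 0"
        unfolding C(2)
      proof (rule integral_cone_field_eq_0[OF v(1) G])
        fix x assume "x \<in> convex hull C" "bary v x = 0"
        then have "x \<in> frontier \<Omega>" using facet_bary[OF v(1)] v(2) K(3) by blast
        then have "x \<notin> \<Omega>" using \<Omega>_open by (simp add: frontier_def interior_open)
        then show "\<phi> x = 0" by (rule test_zero_off[OF \<phi>])
      qed
      moreover have "integrable (lebesgue_on K) (\<lambda>x. real CARD('d) * \<phi> x)" "integrable (lebesgue_on K) (\<lambda>x. (\<chi> i. partial i \<phi> x) \<bullet> (x - v))"
        unfolding C(2) by (intro integral_K continuous_intros continuous_on_subset[OF c\<phi>] continuous_on_subset[OF G(2)]; simp)+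
      ultimately have "(LINT x|lebesgue_on K. real CARD('d) * \<phi> x) + (LINT x|lebesgue_on K. (\<chi> i. partial i \<phi> x) \<bullet> (x - v)) = 0"
        by (simp only: Bochner_Integration.integral_add)
      then show ?thesis by (simp add: inner_commute)
    qed
    have normal: "(1 *\<^sub>R (x - v)) \<bullet> unit_normal \<Omega> F' = 0" if "F' facet_of K" "F' \<subseteq> \<Sigma>" "x \<in> F'" for F' x
    proof -
      \<comment> \<open>The one facet with nonzero flux is not contained in \<Sigma>, so the
        boundary condition does not apply to it.\<close>
      have "F' \<noteq> convex hull (C - {v})" using that(2) K(4) v(2) by blast
      then show ?thesis using cone_normal[OF C(1) _ v(1) _ _ _ that(3)] K(1) C(2) that fitted_frontier[OF fit] by simp
    qed
    have cQ: "continuous_on UNIV (\<lambda>x. 1 *\<^sub>R (x - v))" by (intro continuous_intros)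
    show ?thesis
      using single_element_field[OF K(1) cQ continuous_on_const parts RT_polys_affine normal] by blast
  qed
  let ?q = "\<lambda>x. indicator K x *\<^sub>R (1 *\<^sub>R (x - v))"
  have wK: "(\<lambda>x. indicator K x * real CARD('d)) \<in> L2 \<Omega>" using piece_L2[OF K(1) continuous_on_const, of "real CARD('d)"] by simp
  have "0 = b_form \<Omega> \<mu> ?q (\<lambda>x. 0) z" using orth q by simp
  also have "\<dots> = l2_inner \<Omega> (\<lambda>x. indicator K x * real CARD('d)) z"
    using b_form_weak_div[OF _ _ wK zL2] q D0_Hdiv by blast
  also have "\<dots> = real CARD('d) * c K * measure lebesgue K"
    using l2_inner_piece_ae[OF K(1) continuous_on_const continuous_on_const zL2 c[OF K(1)]] T_props(6)[OF K(1)]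
    by (simp add: measure_restrict_space T_props K)
  finally have "c K = 0" using measure_pos C(2) by simp
  then show ?thesis using c cK unfolding ae_eq_mesh by (simp add: zero_fun_def)
qed

text \<open>The averages of \<open>u\<close> are translation invariant, so the polynomial pieces
  take one common value in the interiors of all elements. By continuity of the piece this value is
  attained on a facet in \<Sigma>, where it is prescribed to be zero.\<close>

theorem zero_gradient_imp_zero:
  assumes fit: "fitted_boundary_part \<Omega> T \<Sigma>" and u: "u \<in> V0 \<Omega> T k \<Sigma>" and zero: "ae_eq \<Omega> (weak_grad \<Omega> u) 0"
  shows "ae_eq \<Omega> u 0"
proof -
  have uL: "u \<in> H1 \<Omega>" "u \<in> Xh \<Omega> T k" "u \<in> L2 \<Omega>" using u by (auto simp: Vh_def Lh_def Xh_def)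
  have z: "l2_inner \<Omega> u (partial i \<phi>) = 0" if \<phi>: "\<phi> \<in> test_functions \<Omega>" for \<phi> i
  proof -
    have "ae_eq \<Omega> (\<lambda>x. weak_grad \<Omega> u x $ i) 0"
      using zero unfolding ae_eq_def by (elim eventually_mono) simp
    moreover have "(\<lambda>x. weak_grad \<Omega> u x $ i) \<in> L2 \<Omega>" using weak_grad(1)[OF uL(1)] by (simp add: L2_components)
    ultimately have "l2_inner \<Omega> (\<lambda>x. weak_grad \<Omega> u x $ i) \<phi> = l2_inner \<Omega> 0 \<phi>"
      using zero_L2 test_function_L2(1)[OF \<phi> \<Omega>_meas] by (intro l2_inner_cong) auto
    then show ?thesis using weak_grad(2)[OF uL(1), of i] \<phi> by (simp add: weak_partial_def l2_inner_def)
  qed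
  obtain \<F> where \<F>: "\<F> \<subseteq> boundary_faces \<Omega> T" "\<Sigma> = \<Union>\<F>" "\<Sigma> \<noteq> {}" using fit by (auto simp: fitted_boundary_part_def)
  then obtain F where F: "F \<in> \<F>" "F \<noteq> {}" by blast
  then obtain K0 where K0: "K0 \<in> T" "F facet_of K0" using \<F>(1) by (auto simp: boundary_faces_def)
  have "F \<subseteq> \<Sigma>" using \<F>(2) F(1) by blast
  then obtain P0 where P0: "P0 \<in> polys k" "ae_eq K0 u P0" "\<forall>x\<in>F. P0 x = 0" using u K0 unfolding Vh_def by blast
  \<comment> \<open>Nothing requires the two elements to be neighbours, or even distinct; the latter
    case gives constancy of a single piece.\<close>
  have same: "P x = P' x'" if "K \<in> T" "K' \<in> T" "x \<in> interior K" "x' \<in> interior K'" "P \<in> polys k" "P' \<in> polys k"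
    "ae_eq K u P" "ae_eq K' u P'" for K K' x x' P P'
  proof (rule zero_weak_grad_pieces_eq[OF \<Omega>_open \<Omega>_bounded \<Omega>_convex uL(3) z])
    show "interior K \<subseteq> \<Omega>" "interior K' \<subseteq> \<Omega>" using T_props(9) that(1,2) by auto
    show "ae_eq (interior K) u P" "ae_eq (interior K') u P'" using interior_of_piece that by blast+
    show "isCont P x" "isCont P' x'"
      using polys_continuous[OF that(5), of UNIV] polys_continuous[OF that(6), of UNIV] by (auto simp: continuous_on_eq_continuous_at)
  qed (use that in auto)
  have limit: "P y = c" if "K \<in> T" "P \<in> polys k" "\<And>x. x \<in> interior K \<Longrightarrow> P x = c" "y \<in> K" for K P c y
  proof -
    have "closed {x. P x = c}" using polys_continuous[OF that(2), of UNIV] by (intro closed_Collect_eq) auto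
    then have "closure (interior K) \<subseteq> {x. P x = c}" using that(3) by (intro closure_minimal) auto
    then show ?thesis using T_props(8)[OF that(1)] that(4) by blast
  qed
  obtain y0 where y0: "y0 \<in> interior K0" using T_props(4)[OF K0(1)] by blast
  obtain y where y: "y \<in> F" using F(2) by blast
  have "P0 y = P0 y0"
    by (rule limit[OF K0(1) P0(1)]) (use same K0 P0 y0 y facet_of_imp_subset[OF K0(2)] in auto)
  then have P00: "P0 y0 = 0" using P0(3) y by simp
  have "ae_eq K u 0" if K: "K \<in> T" for K
  proof -
    obtain P where P: "P \<in> polys k" "ae_eq K u P" using Xh_piece[OF uL(2) K] by blast
    have "P x = 0" if "x \<in> K" for x
      by (rule limit[OF K P(1) _ that]) (use same[OF K K0(1) _ y0 P(1) P0(1) P(2) P0(2)] P00 in simp)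
    then have "ae_eq K P 0" unfolding ae_eq_lebesgue[OF T_props(5)[OF K]] by simp
    then show ?thesis using ae_eq_trans[OF P(2)] by blast
  qed
  then show ?thesis unfolding ae_eq_mesh by blast
qed

end

section \<open>The discrete saddle point problem\<close>

text \<open>Linearity of \<open>G\<close> is required almost everywhere only, because weak gradients
  and divergences are chosen representatives and not linear pointwise.\<close>

lemma psd_form_l2_pullback:
  assumes "subspace E" and G: "\<And>x. x \<in> E \<Longrightarrow> G x \<in> L2 S"
    and add: "\<And>x y. x \<in> E \<Longrightarrow> y \<in> E \<Longrightarrow> ae_eq S (G (x + y)) (G x + G y)"
    and scale: "\<And>c x. x \<in> E \<Longrightarrow> ae_eq S (G (c *\<^sub>R x)) (c *\<^sub>R G x)"
  shows "psd_form E (\<lambda>x y. l2_inner S (G x) (G y))"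
  unfolding psd_form_def
proof (intro conjI ballI allI)
  fix x y z assume *: "x \<in> E" "y \<in> E" "z \<in> E"
  have "l2_inner S (G (x + y)) (G z) = l2_inner S (G x + G y) (G z)"
    using * assms(1) by (intro l2_inner_cong G L2_add add subspace_add)
  then show "l2_inner S (G (x + y)) (G z) = l2_inner S (G x) (G z) + l2_inner S (G y) (G z)"
    using * by (simp add: l2_inner_add G)
next
  fix c x z assume *: "x \<in> E" "z \<in> E"
  have "l2_inner S (G (c *\<^sub>R x)) (G z) = l2_inner S (c *\<^sub>R G x) (G z)"
    using * assms(1) by (intro l2_inner_cong G L2_scale scale subspace_scale)
  then show "l2_inner S (G (c *\<^sub>R x)) (G z) = c * l2_inner S (G x) (G z)"
    by (simp add: l2_inner_scale)
next
  show "l2_inner S (G x) (G y) = l2_inner S (G y) (G x)" for x y by (rule l2_inner_commute)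
  show "0 \<le> l2_inner S (G x) (G x)" for x by (simp add: l2_inner_def)
qed

lemma psd_form_combine:
  assumes "psd_form E s" "psd_form E t" "0 \<le> c" "0 \<le> d"
  shows "psd_form E (\<lambda>x y. c * s x y + d * t x y)"
  unfolding psd_form_def
proof (intro conjI ballI allI)
  fix x y z assume *: "x \<in> E" "y \<in> E" "z \<in> E"
  show "c * s (x + y) z + d * t (x + y) z = c * s x z + d * t x z + (c * s y z + d * t y z)"
    using psd_formD(1)[OF assms(1) *] psd_formD(1)[OF assms(2) *] by (simp add: algebra_simps)
next
  fix r x z assume *: "x \<in> E" "z \<in> E"
  show "c * s (r *\<^sub>R x) z + d * t (r *\<^sub>R x) z = r * (c * s x z + d * t x z)"
    using psd_formD(2)[OF assms(1) *] psd_formD(2)[OF assms(2) *] by (simp add: algebra_simps)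
next
  fix x y assume *: "x \<in> E" "y \<in> E"
  show "c * s x y + d * t x y = c * s y x + d * t y x"
    using psd_formD(3)[OF assms(1) *] psd_formD(3)[OF assms(2) *] by simp
next
  fix x assume *: "x \<in> E"
  show "0 \<le> c * s x x + d * t x x"
    using psd_formD(4)[OF assms(1) * *] psd_formD(4)[OF assms(2) * *] assms(3,4) by simp
qed

lemma psd_form_subset: "psd_form E s \<Longrightarrow> E' \<subseteq> E \<Longrightarrow> psd_form E' s"
  unfolding psd_form_def by blast

lemma sum_fun_apply: "(\<Sum>i\<in>A. f i) x = (\<Sum>i\<in>A. f i x :: _ :: comm_monoid_add)"
  by (induction A rule: infinite_finite_induct) auto

context mesh
begin

text \<open>Makes the weight of the gradient term in \<open>s_form\<close> positive, so that zero
  energy implies a zero gradient.\<close>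

lemma mesh_size_pos: "mesh_size T > 0"
proof -
  obtain K where K: "K \<in> T" using Union_T \<Omega>_nonempty closure_subset by fastforce
  obtain x e where e: "e > 0" "ball x e \<subseteq> K" using T_props(4)[OF K] by (auto simp: mem_interior)
  have "0 < diameter (ball x e)" using e(1) by (simp add: diameter_ball)
  also have "\<dots> \<le> diameter K" using T_props(2)[OF K] e(2) by (intro diameter_subset compact_imp_bounded)
  also have "\<dots> \<le> mesh_size T" using K finite_T by (simp add: mesh_size_def)
  finally show ?thesis .
qed

text \<open>Monomials cut off to single elements span the space up to null functions, since distinct
  elements overlap in null sets.\<close>

lemma finite_dim_Xh:
  "\<exists>B. finite B \<and> (\<forall>v\<in>Xh \<Omega> T k. \<exists>v'\<in>span B. v' \<in> L2 \<Omega> \<and> ae_eq \<Omega> v v')"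
proof -
  define e :: "(real^'d) set \<Rightarrow> ('d \<Rightarrow> nat) \<Rightarrow> real^'d \<Rightarrow> real"
    where "e K \<alpha> = (\<lambda>x. indicator K x * monomial \<alpha> x)" for K \<alpha>
  let ?A = "{\<alpha> :: 'd \<Rightarrow> nat. (\<Sum>i\<in>UNIV. \<alpha> i) \<le> k}"
  let ?B = "(\<lambda>(K, \<alpha>). e K \<alpha>) ` (T \<times> ?A)"
  have "\<exists>v'\<in>span ?B. v' \<in> L2 \<Omega> \<and> ae_eq \<Omega> v v'" if v: "v \<in> Xh \<Omega> T k" for v
  proof -
    have "\<exists>c. ae_eq K v (\<lambda>x. \<Sum>\<alpha>\<in>?A. c \<alpha> * monomial \<alpha> x)" if "K \<in> T" for K
      using Xh_piece[OF v that] by (auto simp: polys_alt)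
    then have "\<forall>K\<in>T. \<exists>c. ae_eq K v (\<lambda>x. \<Sum>\<alpha>\<in>?A. c \<alpha> * monomial \<alpha> x)" by (rule ballI)
    from bchoice[OF this] obtain c where c: "\<forall>K\<in>T. ae_eq K v (\<lambda>x. \<Sum>\<alpha>\<in>?A. c K \<alpha> * monomial \<alpha> x)" by (rule exE)
    let ?v = "\<Sum>K\<in>T. \<Sum>\<alpha>\<in>?A. c K \<alpha> *\<^sub>R e K \<alpha>"
    have v_apply: "?v x = (\<Sum>K\<in>T. indicator K x * (\<Sum>\<alpha>\<in>?A. c K \<alpha> * monomial \<alpha> x))" for x
      by (simp add: sum_fun_apply e_def sum_distrib_left mult_ac)
    show "\<exists>v'\<in>span ?B. v' \<in> L2 \<Omega> \<and> ae_eq \<Omega> v v'"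
    proof (intro bexI[of _ ?v] conjI)
      show "?v \<in> span ?B" by (intro span_sum span_scale span_base) auto
      have "e K \<alpha> \<in> L2 \<Omega>" if "K \<in> T" for K \<alpha>
        using piece_L2[OF that polys_continuous[OF monomial_polys[OF order_refl]], of \<alpha>] by (simp add: e_def)
      then show "?v \<in> L2 \<Omega>" by (intro subspace_sum[OF subspace_L2] subspace_scale[OF subspace_L2])
      show "ae_eq \<Omega> v ?v"
        unfolding ae_eq_mesh
      proof
        fix K assume K: "K \<in> T"
        \<comment> \<open>Off the overlaps only the term of \<open>K\<close> survives in the double
          sum.\<close>
        have "AE x in lebesgue. \<forall>K'\<in>T - {K}. \<not> (x \<in> K \<and> x \<in> K')"
          unfolding AE_finite_all[OF finite_Diff[OF finite_T]] by (intro ballI AE_T_Int) (use K in auto)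
        moreover have "AE x in lebesgue. x \<in> K \<longrightarrow> v x = (\<Sum>\<alpha>\<in>?A. c K \<alpha> * monomial \<alpha> x)"
          using bspec[OF c K] by (simp add: ae_eq_lebesgue T_props(5)[OF K])
        ultimately show "ae_eq K v ?v"
          unfolding ae_eq_lebesgue[OF T_props(5)[OF K]]
        proof eventually_elim
          case (elim x)
          show "x \<in> K \<longrightarrow> v x = ?v x"
          proof
            assume x: "x \<in> K"
            have "?v x = (\<Sum>K'\<in>{K}. indicator K' x * (\<Sum>\<alpha>\<in>?A. c K' \<alpha> * monomial \<alpha> x))"
              unfolding v_apply by (rule sum.mono_neutral_right) (use K finite_T elim(1) x in auto)
            then show "v x = ?v x" using elim(2) x by simp
          qed
        qed
      qed
    qed
  qed
  moreover have "finite ?B" using finite_T by simp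
  ultimately show ?thesis by blast
qed

text \<open>The components are piecewise polynomials of one degree more, which reduces the claim to
  the scalar case.\<close>

lemma finite_dim_RTh:
  "\<exists>B. finite B \<and> (\<forall>q\<in>RTh \<Omega> T l. \<exists>q'\<in>span B. q' \<in> L2 \<Omega> \<and> ae_eq \<Omega> q q')"
proof -
  obtain B where B: "finite B" "\<forall>v\<in>Xh \<Omega> T (Suc l). \<exists>v'\<in>span B. v' \<in> L2 \<Omega> \<and> ae_eq \<Omega> v v'"
    using finite_dim_Xh[of "Suc l"] by (elim exE conjE) (rule that)
  define e :: "'d \<Rightarrow> (real^'d \<Rightarrow> real) \<Rightarrow> real^'d \<Rightarrow> real^'d" where "e i v = (\<lambda>x. v x *\<^sub>R axis i 1)" for i v
  have lin: "linear (e i)" for i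
    by (rule linearI) (simp_all add: e_def fun_eq_iff scaleR_add_left)
  show ?thesis
  proof (intro exI[of _ "\<Union>i\<in>UNIV. e i ` B"] conjI ballI)
    show "finite (\<Union>i\<in>UNIV. e i ` B)" using B(1) by simp
    fix q assume q: "q \<in> RTh \<Omega> T l"
    have qi: "(\<lambda>x. q x $ i) \<in> Xh \<Omega> T (Suc l)" for i
      unfolding Xh_def
    proof (intro CollectI conjI ballI)
      show "(\<lambda>x. q x $ i) \<in> L2 \<Omega>" using q L2_components[of q \<Omega>] by (auto simp: RTh_def Hdiv_def)
      fix K assume "K \<in> T"
      then obtain Q where Q: "Q \<in> RT_polys l" "ae_eq K q Q" using q unfolding RTh_def by blast
      then show "\<exists>P\<in>polys (Suc l). ae_eq K (\<lambda>x. q x $ i) P"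
        using RT_polys_components[OF Q(1), of i] by (intro bexI) (auto simp: ae_eq_def elim!: eventually_mono)
    qed
    have "\<forall>i. \<exists>v. v \<in> span B \<and> v \<in> L2 \<Omega> \<and> ae_eq \<Omega> (\<lambda>x. q x $ i) v"
      using B(2)[rule_format, OF qi] by blast
    then obtain v where v: "\<And>i. v i \<in> span B" "\<And>i. v i \<in> L2 \<Omega>" "\<And>i. ae_eq \<Omega> (\<lambda>x. q x $ i) (v i)"
      unfolding choice_iff by blast
    show "\<exists>q'\<in>span (\<Union>i\<in>UNIV. e i ` B). q' \<in> L2 \<Omega> \<and> ae_eq \<Omega> q q'"
    proof (intro bexI[of _ "\<Sum>i\<in>UNIV. e i (v i)"] conjI)
      have "e i (v i) \<in> span (e i ` B)" for i unfolding linear_span_image[OF lin] by (rule imageI[OF v(1)])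
      then show "(\<Sum>i\<in>UNIV. e i (v i)) \<in> span (\<Union>i\<in>UNIV. e i ` B)"
        by (intro span_sum) (meson UN_upper UNIV_I span_mono subsetD)
      have "e i (v i) \<in> L2 \<Omega>" for i
        unfolding e_def by (rule L2_linear_image[OF bounded_linear_scaleR_left v(2)])
      then show "(\<Sum>i\<in>UNIV. e i (v i)) \<in> L2 \<Omega>" by (intro subspace_sum[OF subspace_L2])
      have "AE x in lebesgue_on \<Omega>. \<forall>i\<in>UNIV. q x $ i = v i x"
        using v(3) unfolding ae_eq_def by (intro AE_finite_allI) auto
      moreover have "(\<Sum>i\<in>UNIV. e i (v i)) x = (\<chi> i. v i x)" for x
        using basis_expansion[of "\<chi> i. v i x"] by (simp add: sum_fun_apply e_def scalar_mult_eq_scaleR)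
      ultimately show "ae_eq \<Omega> q (\<Sum>i\<in>UNIV. e i (v i))"
        unfolding ae_eq_def by (elim eventually_mono) (simp add: vec_eq_iff)
    qed
  qed
qed

end

section \<open>The discrete forms as pullbacks of inner products\<close>

context mesh
begin

definition b_field :: "real \<Rightarrow> (real^'d \<Rightarrow> real) \<times> (real^'d \<Rightarrow> real^'d) \<Rightarrow> real^'d \<Rightarrow> real" where
  "b_field \<mu> x = weak_div \<Omega> (snd x) + \<mu> *\<^sub>R fst x"

definition flux_residual :: "real^'d^'d \<Rightarrow> (real^'d \<Rightarrow> real) \<times> (real^'d \<Rightarrow> real^'d) \<Rightarrow> real^'d \<Rightarrow> real^'d" where
  "flux_residual A x = (\<lambda>y. A *v weak_grad \<Omega> (fst x) y) - snd x"

lemma Lh_H1: "u \<in> Lh \<Omega> T k \<Longrightarrow> u \<in> H1 \<Omega>" and Lh_L2: "u \<in> Lh \<Omega> T k \<Longrightarrow> u \<in> L2 \<Omega>"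
  by (auto simp: Lh_def H1_def)

lemma RTh_Hdiv: "p \<in> RTh \<Omega> T l \<Longrightarrow> p \<in> Hdiv \<Omega>" and RTh_L2: "p \<in> RTh \<Omega> T l \<Longrightarrow> p \<in> L2 \<Omega>"
  by (auto simp: RTh_def Hdiv_def)

lemma subspace_Lh_RTh: "subspace (Lh \<Omega> T k \<times> RTh \<Omega> T l)"
  by (intro subspace_Times subspace_Lh subspace_RTh)

lemma subspace_V0_D0: "subspace (V0 \<Omega> T k \<Sigma> \<times> D0 \<Omega> T l \<Sigma>)"
  by (intro subspace_Times subspace_V0 subspace_D0)

lemma b_field_linear:
  assumes x: "x \<in> Lh \<Omega> T k \<times> RTh \<Omega> T l"
  shows "b_field \<mu> x \<in> L2 \<Omega>" "ae_eq \<Omega> (b_field \<mu> (c *\<^sub>R x)) (c *\<^sub>R b_field \<mu> x)"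
    "y \<in> Lh \<Omega> T k \<times> RTh \<Omega> T l \<Longrightarrow> ae_eq \<Omega> (b_field \<mu> (x + y)) (b_field \<mu> x + b_field \<mu> y)"
proof -
  have p: "snd x \<in> Hdiv \<Omega>" "fst x \<in> L2 \<Omega>" using x RTh_Hdiv Lh_L2 by auto
  show "b_field \<mu> x \<in> L2 \<Omega>"
    unfolding b_field_def by (intro L2_add L2_scale weak_div(1) p)
  show "ae_eq \<Omega> (b_field \<mu> (c *\<^sub>R x)) (c *\<^sub>R b_field \<mu> x)"
    using weak_div_scale(1)[OF \<Omega>_open \<Omega>_bounded p(1), of c] unfolding ae_eq_def
    by (elim eventually_mono) (simp add: b_field_def algebra_simps)
  assume "y \<in> Lh \<Omega> T k \<times> RTh \<Omega> T l"
  then have q: "snd y \<in> Hdiv \<Omega>" using RTh_Hdiv by auto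
  show "ae_eq \<Omega> (b_field \<mu> (x + y)) (b_field \<mu> x + b_field \<mu> y)"
    using weak_div_add(1)[OF \<Omega>_open \<Omega>_bounded p(1) q] unfolding ae_eq_def
    by (elim eventually_mono) (simp add: b_field_def algebra_simps)
qed

lemma flux_residual_linear:
  assumes x: "x \<in> Lh \<Omega> T k \<times> RTh \<Omega> T l"
  shows "flux_residual A x \<in> L2 \<Omega>" "ae_eq \<Omega> (flux_residual A (c *\<^sub>R x)) (c *\<^sub>R flux_residual A x)"
    "y \<in> Lh \<Omega> T k \<times> RTh \<Omega> T l \<Longrightarrow> ae_eq \<Omega> (flux_residual A (x + y)) (flux_residual A x + flux_residual A y)"
proof -
  have p: "fst x \<in> H1 \<Omega>" "snd x \<in> L2 \<Omega>" using x Lh_H1 RTh_L2 by auto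
  show "flux_residual A x \<in> L2 \<Omega>"
    unfolding flux_residual_def
    by (intro subspace_diff[OF subspace_L2] L2_linear_image[OF matrix_vector_mul_bounded_linear] weak_grad(1) p)
  show "ae_eq \<Omega> (flux_residual A (c *\<^sub>R x)) (c *\<^sub>R flux_residual A x)"
    using weak_grad_scale(1)[OF \<Omega>_open \<Omega>_bounded p(1), of c] unfolding ae_eq_def
    by (elim eventually_mono) (simp add: flux_residual_def matrix_vector_mult_scaleR algebra_simps)
  assume "y \<in> Lh \<Omega> T k \<times> RTh \<Omega> T l"
  then have q: "fst y \<in> H1 \<Omega>" using Lh_H1 by auto
  show "ae_eq \<Omega> (flux_residual A (x + y)) (flux_residual A x + flux_residual A y)"
    using weak_grad_add(1)[OF \<Omega>_open \<Omega>_bounded p(1) q] unfolding ae_eq_def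
    by (elim eventually_mono) (simp add: flux_residual_def matrix_vector_right_distrib algebra_simps)
qed

lemma s_form_eq:
  "s_form \<Omega> A \<gamma> h k x y = 1/2 * l2_inner \<Omega> (flux_residual A x) (flux_residual A y)
     + 1/2 * \<gamma> * h ^ (2 * k) * l2_inner \<Omega> (weak_grad \<Omega> (fst x)) (weak_grad \<Omega> (fst y))"
  by (simp add: s_form_def flux_residual_def case_prod_beta fun_diff_def)

lemma b_form_eq: "b_form \<Omega> \<mu> (snd x) (fst x) w = l2_inner \<Omega> (b_field \<mu> x) w"
  by (simp add: b_form_def b_field_def plus_fun_def scaleR_fun_def)

lemma psd_form_s_form:
  assumes "\<gamma> \<ge> 0" shows "psd_form (Lh \<Omega> T k \<times> RTh \<Omega> T l) (s_form \<Omega> A \<gamma> (mesh_size T) n)"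
proof -
  have "psd_form (Lh \<Omega> T k \<times> RTh \<Omega> T l) (\<lambda>x y. 1/2 * l2_inner \<Omega> (flux_residual A x) (flux_residual A y)
     + 1/2 * \<gamma> * mesh_size T ^ (2 * n) * l2_inner \<Omega> (weak_grad \<Omega> (fst x)) (weak_grad \<Omega> (fst y)))"
  proof (intro psd_form_combine psd_form_l2_pullback subspace_Lh_RTh)
    fix x y c assume x: "x \<in> Lh \<Omega> T k \<times> RTh \<Omega> T l"
    then have u: "fst x \<in> H1 \<Omega>" using Lh_H1 by auto
    show "weak_grad \<Omega> (fst x) \<in> L2 \<Omega>" by (rule weak_grad(1)[OF u])
    show "ae_eq \<Omega> (weak_grad \<Omega> (fst (c *\<^sub>R x))) (c *\<^sub>R weak_grad \<Omega> (fst x))"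
      using weak_grad_scale(1)[OF \<Omega>_open \<Omega>_bounded u] by simp
    show "flux_residual A x \<in> L2 \<Omega>" by (rule flux_residual_linear(1)[OF x])
    show "ae_eq \<Omega> (flux_residual A (c *\<^sub>R x)) (c *\<^sub>R flux_residual A x)" by (rule flux_residual_linear(2)[OF x])
    assume y: "y \<in> Lh \<Omega> T k \<times> RTh \<Omega> T l"
    then have v: "fst y \<in> H1 \<Omega>" using Lh_H1 by auto
    show "ae_eq \<Omega> (weak_grad \<Omega> (fst (x + y))) (weak_grad \<Omega> (fst x) + weak_grad \<Omega> (fst y))"
      using weak_grad_add(1)[OF \<Omega>_open \<Omega>_bounded u v] by simp
    show "ae_eq \<Omega> (flux_residual A (x + y)) (flux_residual A x + flux_residual A y)" by (rule flux_residual_linear(3)[OF x y])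
  qed (use assms mesh_size_pos in auto)
  then show ?thesis by (simp only: s_form_eq[abs_def])
qed

text \<open>The sum of the two norms in which convergence is asserted; it vanishes exactly on pairs
  of null functions.\<close>

definition pair_norm :: "(real^'d \<Rightarrow> real) \<times> (real^'d \<Rightarrow> real^'d) \<Rightarrow> real" where
  "pair_norm x = l2_norm \<Omega> (fst x) + l2_norm \<Omega> (snd x)"

lemma V0_D0_subset: "V0 \<Omega> T k \<Sigma> \<times> D0 \<Omega> T l \<Sigma> \<subseteq> Lh \<Omega> T k \<times> RTh \<Omega> T l"
  by (auto simp: Vh_def Dh_def)

lemma l2_norm_nonneg: "0 \<le> l2_norm S f"
  by (simp add: l2_norm_def l2_inner_def)

lemma pair_norm_eq_0:
  assumes "x \<in> Lh \<Omega> T k \<times> RTh \<Omega> T l"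
  shows "pair_norm x = 0 \<longleftrightarrow> ae_eq \<Omega> (fst x) 0 \<and> ae_eq \<Omega> (snd x) 0"
proof -
  have "fst x \<in> L2 \<Omega>" "snd x \<in> L2 \<Omega>" using assms Lh_L2 RTh_L2 by auto
  then have "ae_eq \<Omega> (fst x) 0 \<longleftrightarrow> l2_norm \<Omega> (fst x) = 0" "ae_eq \<Omega> (snd x) 0 \<longleftrightarrow> l2_norm \<Omega> (snd x) = 0"
    by (simp_all add: l2_norm_eq_0)
  then show ?thesis by (simp add: pair_norm_def add_nonneg_eq_0_iff l2_norm_nonneg)
qed

lemma seminorm_on_pair_norm: "seminorm_on (Lh \<Omega> T k \<times> RTh \<Omega> T l) pair_norm"
  unfolding seminorm_on_def
proof (intro conjI ballI allI)
  fix x y c assume x: "x \<in> Lh \<Omega> T k \<times> RTh \<Omega> T l"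
  then have u: "fst x \<in> L2 \<Omega>" "snd x \<in> L2 \<Omega>" using Lh_L2 RTh_L2 by auto
  show "pair_norm (c *\<^sub>R x) = \<bar>c\<bar> * pair_norm x"
    using seminorm_on_scale[OF seminorm_on_l2_norm u(1), of c] seminorm_on_scale[OF seminorm_on_l2_norm u(2), of c]
    by (simp add: pair_norm_def distrib_left)
  assume "y \<in> Lh \<Omega> T k \<times> RTh \<Omega> T l"
  then have v: "fst y \<in> L2 \<Omega>" "snd y \<in> L2 \<Omega>" using Lh_L2 RTh_L2 by auto
  show "pair_norm (x + y) \<le> pair_norm x + pair_norm y"
    using seminorm_on_add[OF seminorm_on_l2_norm u(1) v(1)] seminorm_on_add[OF seminorm_on_l2_norm u(2) v(2)]
    by (simp add: pair_norm_def)
qed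

lemma l2_inner_ae_zero:
  assumes "f \<in> L2 S" "g \<in> L2 S" "ae_eq S f 0" shows "l2_inner S f g = 0"
  using l2_inner_cong[OF assms(1) subspace_0[OF subspace_L2] assms(2,3)] by (simp add: l2_inner_def)

lemma pair_null:
  assumes x: "x \<in> Lh \<Omega> T k \<times> RTh \<Omega> T l" and "pair_norm x = 0"
  shows "ae_eq \<Omega> (weak_grad \<Omega> (fst x)) 0" "ae_eq \<Omega> (flux_residual A x) 0" "ae_eq \<Omega> (b_field \<mu> x) 0"
proof -
  have L: "fst x \<in> L2 \<Omega>" "snd x \<in> L2 \<Omega>" using x Lh_L2 RTh_L2 by auto
  have 0: "ae_eq \<Omega> (fst x) 0" "ae_eq \<Omega> (snd x) 0" using assms(2) pair_norm_eq_0[OF x] by auto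
  show g: "ae_eq \<Omega> (weak_grad \<Omega> (fst x)) 0" using ae_zero_imp_H1[OF \<Omega>_open \<Omega>_bounded L(1) 0(1)] by simp
  show "ae_eq \<Omega> (flux_residual A x) 0"
    using g 0(2) unfolding ae_eq_def by eventually_elim (simp add: flux_residual_def)
  show "ae_eq \<Omega> (b_field \<mu> x) 0"
    using ae_zero_imp_Hdiv(2)[OF \<Omega>_open \<Omega>_bounded L(2) 0(2)] 0(1) unfolding ae_eq_def
    by eventually_elim (simp add: b_field_def)
qed

text \<open>The generators need not satisfy any continuity or boundary condition: the difference to
  the representative is null, and null functions lie in all the spaces.\<close>

lemma finite_dim_pairs:
  "\<exists>B. finite B \<and> (\<forall>x\<in>V0 \<Omega> T k \<Sigma> \<times> D0 \<Omega> T l \<Sigma>. \<forall>w\<in>Wh \<Omega> T m. \<exists>x' w'. (x', w') \<in> span B \<and>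
     x - x' \<in> V0 \<Omega> T k \<Sigma> \<times> D0 \<Omega> T l \<Sigma> \<and> pair_norm (x - x') = 0 \<and>
     w - w' \<in> Wh \<Omega> T m \<and> l2_inner \<Omega> (w - w') (w - w') = 0)"
proof -
  obtain B1 where B1: "finite B1" "\<forall>v\<in>Xh \<Omega> T k. \<exists>v'\<in>span B1. v' \<in> L2 \<Omega> \<and> ae_eq \<Omega> v v'"
    using finite_dim_Xh[of k] by (elim exE conjE) (rule that)
  obtain B2 where B2: "finite B2" "\<forall>q\<in>RTh \<Omega> T l. \<exists>q'\<in>span B2. q' \<in> L2 \<Omega> \<and> ae_eq \<Omega> q q'"
    using finite_dim_RTh[of l] by (elim exE conjE) (rule that)
  obtain B3 where B3: "finite B3" "\<forall>v\<in>Xh \<Omega> T m. \<exists>v'\<in>span B3. v' \<in> L2 \<Omega> \<and> ae_eq \<Omega> v v'"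
    using finite_dim_Xh[of m] by (elim exE conjE) (rule that)
  let ?B = "(\<lambda>v. ((v, 0), 0)) ` B1 \<union> (\<lambda>q. ((0, q), 0)) ` B2 \<union> (\<lambda>w. ((0, 0), w)) ` B3"
  have lin: "linear (\<lambda>v. ((v, 0), 0))" "linear (\<lambda>q. ((0, q), 0))" "linear (\<lambda>w. ((0, 0), w))"
    by (auto intro!: linearI)
  have sub: "span ((\<lambda>v. ((v, 0), 0)) ` B1) \<subseteq> span ?B" "span ((\<lambda>q. ((0, q), 0)) ` B2) \<subseteq> span ?B"
    "span ((\<lambda>w. ((0, 0), w)) ` B3) \<subseteq> span ?B"
    by (intro span_mono; blast)+
  show ?thesis
  proof (intro exI[of _ ?B] conjI ballI)
    show "finite ?B" using B1(1) B2(1) B3(1) by simp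
    fix x w assume x: "x \<in> V0 \<Omega> T k \<Sigma> \<times> D0 \<Omega> T l \<Sigma>" and w: "w \<in> Wh \<Omega> T m"
    have x': "fst x \<in> Xh \<Omega> T k" "snd x \<in> RTh \<Omega> T l" "fst x \<in> L2 \<Omega>" "snd x \<in> L2 \<Omega>" "w \<in> L2 \<Omega>"
      using x w RTh_L2 by (auto simp: Vh_def Dh_def Lh_def Xh_def)
    obtain v' where v: "v' \<in> span B1" "v' \<in> L2 \<Omega>" "ae_eq \<Omega> (fst x) v'" using bspec[OF B1(2) x'(1)] by blast
    obtain q' where q: "q' \<in> span B2" "q' \<in> L2 \<Omega>" "ae_eq \<Omega> (snd x) q'" using bspec[OF B2(2) x'(2)] by blast
    obtain w' where w': "w' \<in> span B3" "w' \<in> L2 \<Omega>" "ae_eq \<Omega> w w'" using bspec[OF B3(2) w] by blast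
    have "((v', 0), 0) + ((0, q'), 0) + ((0, 0), w') \<in> span ?B"
    proof (intro span_add)
      show "((v', 0), 0) \<in> span ?B" using sub(1) imageI[OF v(1), of "\<lambda>v. ((v, 0), 0)"] unfolding linear_span_image[OF lin(1)] by (rule subsetD)
      show "((0, q'), 0) \<in> span ?B" using sub(2) imageI[OF q(1), of "\<lambda>q. ((0, q), 0)"] unfolding linear_span_image[OF lin(2)] by (rule subsetD)
      show "((0, 0), w') \<in> span ?B" using sub(3) imageI[OF w'(1), of "\<lambda>w. ((0, 0), w)"] unfolding linear_span_image[OF lin(3)] by (rule subsetD)
    qed
    then have span: "((v', q'), w') \<in> span ?B" by simp
    have d: "fst x - v' \<in> L2 \<Omega>" "snd x - q' \<in> L2 \<Omega>" "w - w' \<in> L2 \<Omega>"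
      using x' v(2) q(2) w'(2) by (auto intro: subspace_diff[OF subspace_L2])
    have d0: "ae_eq \<Omega> (fst x - v') 0" "ae_eq \<Omega> (snd x - q') 0" "ae_eq \<Omega> (w - w') 0"
      using v(3) q(3) w'(3) by (simp_all add: ae_eq_diff_0)
    have dX: "x - (v', q') \<in> V0 \<Omega> T k \<Sigma> \<times> D0 \<Omega> T l \<Sigma>"
      using V0_null[OF d(1) d0(1)] D0_null[OF d(2) d0(2)] by (simp add: minus_prod_def)
    moreover have "pair_norm (x - (v', q')) = 0"
      using pair_norm_eq_0 subsetD[OF V0_D0_subset dX] d0 by simp
    moreover have "w - w' \<in> Wh \<Omega> T m" by (rule Xh_null[OF d(3) d0(3)])
    moreover have "l2_inner \<Omega> (w - w') (w - w') = 0" using l2_inner_self_eq_0[OF d(3)] d0(3) by simp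
    ultimately show "\<exists>x' w'. (x', w') \<in> span ?B \<and> x - x' \<in> V0 \<Omega> T k \<Sigma> \<times> D0 \<Omega> T l \<Sigma> \<and> pair_norm (x - x') = 0 \<and>
       w - w' \<in> Wh \<Omega> T m \<and> l2_inner \<Omega> (w - w') (w - w') = 0"
      using span by (intro exI[of _ "(v', q')"] exI[of _ w'] conjI)
  qed
qed

text \<open>The multiplier space has the degree \<open>l\<close> of the flux space, as the inf-sup
  argument requires; \<open>zero_gradient_imp_zero\<close> and \<open>divergence_inf_sup\<close>
  supply the two substantial assumptions.\<close>

theorem fe_saddle_point:
  assumes fit: "fitted_boundary_part \<Omega> T \<Sigma>" and "\<gamma> > 0"
  shows "\<exists>B. saddle_point (Lh \<Omega> T k \<times> RTh \<Omega> T l) (V0 \<Omega> T k \<Sigma> \<times> D0 \<Omega> T l \<Sigma>) (Wh \<Omega> T l)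
    (s_form \<Omega> A \<gamma> (mesh_size T) n) (\<lambda>x. b_form \<Omega> \<mu> (snd x) (fst x)) (l2_inner \<Omega>) pair_norm B"
proof -
  obtain B where B: "finite B" "\<forall>x\<in>V0 \<Omega> T k \<Sigma> \<times> D0 \<Omega> T l \<Sigma>. \<forall>w\<in>Wh \<Omega> T l. \<exists>x' w'. (x', w') \<in> span B \<and>
     x - x' \<in> V0 \<Omega> T k \<Sigma> \<times> D0 \<Omega> T l \<Sigma> \<and> pair_norm (x - x') = 0 \<and>
     w - w' \<in> Wh \<Omega> T l \<and> l2_inner \<Omega> (w - w') (w - w') = 0"
    using finite_dim_pairs[of k \<Sigma> l l] by (elim exE conjE) (rule that)
  have W: "w \<in> L2 \<Omega>" if "w \<in> Wh \<Omega> T l" for w using that by (simp add: Xh_def)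
  show ?thesis
  proof (intro exI[of _ B], unfold_locales)
    show "subspace (Lh \<Omega> T k \<times> RTh \<Omega> T l)" by (rule subspace_Lh_RTh)
    show "subspace (V0 \<Omega> T k \<Sigma> \<times> D0 \<Omega> T l \<Sigma>)" by (rule subspace_V0_D0)
    show "V0 \<Omega> T k \<Sigma> \<times> D0 \<Omega> T l \<Sigma> \<subseteq> Lh \<Omega> T k \<times> RTh \<Omega> T l" by (rule V0_D0_subset)
    show "subspace (Wh \<Omega> T l)" by (rule subspace_Xh)
    show "psd_form (Lh \<Omega> T k \<times> RTh \<Omega> T l) (s_form \<Omega> A \<gamma> (mesh_size T) n)"
      using assms(2) by (intro psd_form_s_form) simp
    show "psd_form (Wh \<Omega> T l) (l2_inner \<Omega>)"
      by (rule psd_form_subset[OF psd_form_l2_inner]) (use W in blast)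
    show "seminorm_on (V0 \<Omega> T k \<Sigma> \<times> D0 \<Omega> T l \<Sigma>) pair_norm"
      by (rule seminorm_on_subset[OF seminorm_on_pair_norm V0_D0_subset])
    show "finite B" by (rule B(1))
  next
    fix x y :: "(real^'d \<Rightarrow> real) \<times> (real^'d \<Rightarrow> real^'d)" and v w c
    assume x: "x \<in> Lh \<Omega> T k \<times> RTh \<Omega> T l" and w: "w \<in> Wh \<Omega> T l"
    note bx = b_field_linear[OF x, where \<mu> = \<mu>]
    show "b_form \<Omega> \<mu> (snd (c *\<^sub>R x)) (fst (c *\<^sub>R x)) w = c * b_form \<Omega> \<mu> (snd x) (fst x) w"
      using l2_inner_cong[OF _ L2_scale[OF bx(1)] W[OF w] bx(2)]
        b_field_linear(1)[OF subspace_scale[OF subspace_Lh_RTh x]] by (simp only: b_form_eq l2_inner_scale)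
    show "b_form \<Omega> \<mu> (snd x) (fst x) (c *\<^sub>R w) = c * b_form \<Omega> \<mu> (snd x) (fst x) w"
      unfolding b_form_eq by (simp add: l2_inner_commute[of _ "b_field \<mu> x"] l2_inner_scale)
    show "b_form \<Omega> \<mu> (snd x) (fst x) (v + w) = b_form \<Omega> \<mu> (snd x) (fst x) v + b_form \<Omega> \<mu> (snd x) (fst x) w"
      if "v \<in> Wh \<Omega> T l"
      unfolding b_form_eq l2_inner_commute[of _ "b_field \<mu> x"] by (rule l2_inner_add[OF W[OF that] W[OF w] bx(1)])
    assume y: "y \<in> Lh \<Omega> T k \<times> RTh \<Omega> T l"
    note by' = b_field_linear[OF y, where \<mu> = \<mu>]
    show "b_form \<Omega> \<mu> (snd (x + y)) (fst (x + y)) w = b_form \<Omega> \<mu> (snd x) (fst x) w + b_form \<Omega> \<mu> (snd y) (fst y) w"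
      using l2_inner_cong[OF _ L2_add[OF bx(1) by'(1)] W[OF w] bx(3)[OF y]]
        b_field_linear(1)[OF subspace_add[OF subspace_Lh_RTh x y]] l2_inner_add[OF bx(1) by'(1) W[OF w]]
      by (simp only: b_form_eq)
  next
    fix x w assume x: "x \<in> V0 \<Omega> T k \<Sigma> \<times> D0 \<Omega> T l \<Sigma>" and w: "w \<in> Wh \<Omega> T l"
    show "\<exists>x' w'. (x', w') \<in> span B \<and> x - x' \<in> V0 \<Omega> T k \<Sigma> \<times> D0 \<Omega> T l \<Sigma> \<and> pair_norm (x - x') = 0 \<and>
       w - w' \<in> Wh \<Omega> T l \<and> l2_inner \<Omega> (w - w') (w - w') = 0"
      by (rule B(2)[rule_format, OF x w])
    assume 0: "pair_norm x = 0"
    have xH: "x \<in> Lh \<Omega> T k \<times> RTh \<Omega> T l" using x V0_D0_subset by blast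
    show "b_form \<Omega> \<mu> (snd x) (fst x) w = 0"
      unfolding b_form_eq by (rule l2_inner_ae_zero[OF b_field_linear(1)[OF xH] W[OF w] pair_null(3)[OF xH 0]])
  next
    fix x assume x: "x \<in> V0 \<Omega> T k \<Sigma> \<times> D0 \<Omega> T l \<Sigma>"
    have xH: "x \<in> Lh \<Omega> T k \<times> RTh \<Omega> T l" using x V0_D0_subset by blast
    have "fst x \<in> H1 \<Omega>" using xH Lh_H1 by auto
    then have g: "weak_grad \<Omega> (fst x) \<in> L2 \<Omega>" by (rule weak_grad(1))
    note f = flux_residual_linear(1)[OF xH, where A = A]
    show "s_form \<Omega> A \<gamma> (mesh_size T) n x x = 0" if "pair_norm x = 0"
      unfolding s_form_eq using l2_inner_ae_zero[OF f f pair_null(2)[OF xH that]] l2_inner_ae_zero[OF g g pair_null(1)[OF xH that]] by simp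
    assume s0: "s_form \<Omega> A \<gamma> (mesh_size T) n x x = 0"
    have nn: "0 \<le> l2_inner \<Omega> (flux_residual A x) (flux_residual A x)" "0 \<le> l2_inner \<Omega> (weak_grad \<Omega> (fst x)) (weak_grad \<Omega> (fst x))"
      by (simp_all add: l2_inner_def)
    \<comment> \<open>Both summands of the energy are nonnegative with positive weights, so each
      vanishes separately.\<close>
    then have "l2_inner \<Omega> (flux_residual A x) (flux_residual A x) = 0 \<and> l2_inner \<Omega> (weak_grad \<Omega> (fst x)) (weak_grad \<Omega> (fst x)) = 0"
      using s0 mesh_size_pos assms(2) unfolding s_form_eq by (simp add: add_nonneg_eq_0_iff)
    then have *: "ae_eq \<Omega> (flux_residual A x) 0" "ae_eq \<Omega> (weak_grad \<Omega> (fst x)) 0"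
      using l2_inner_self_eq_0[OF f] l2_inner_self_eq_0[OF g] by auto
    \<comment> \<open>The residual is the flux of the gradient minus \<open>snd x\<close>; with a
      null gradient only \<open>snd x\<close> is left.\<close>
    have "ae_eq \<Omega> (snd x) 0" using * unfolding ae_eq_def by eventually_elim (simp add: flux_residual_def)
    moreover have "ae_eq \<Omega> (fst x) 0" using zero_gradient_imp_zero[OF fit _ *(2)] x by auto
    ultimately show "pair_norm x = 0" using pair_norm_eq_0[OF xH] by simp
  next
    fix w assume w: "w \<in> Wh \<Omega> T l" and orth: "\<And>x. x \<in> V0 \<Omega> T k \<Sigma> \<times> D0 \<Omega> T l \<Sigma> \<Longrightarrow> b_form \<Omega> \<mu> (snd x) (fst x) w = 0"
    have "b_form \<Omega> \<mu> q (\<lambda>x. 0) w = 0" if "q \<in> D0 \<Omega> T l \<Sigma>" for q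
      using orth[of "(0, q)"] that subspace_0[OF subspace_V0] by (simp add: zero_fun_def)
    then have "ae_eq \<Omega> w 0" by (rule divergence_inf_sup[OF fit w])
    then show "l2_inner \<Omega> w w = 0" using l2_inner_self_eq_0[OF W[OF w]] by simp
  qed
qed

end

theorem proposition4p1:
  fixes \<Omega> \<Sigma> :: "(real^'d::finite) set"
    and T :: "(real^'d) set set"
    and A :: "real^'d^'d"
    and \<mu> \<gamma> c\<^sub>1 c\<^sub>2 :: real
    and k l m :: nat
    and f g \<psi> :: "real^'d \<Rightarrow> real"
    and u z :: "nat \<Rightarrow> real^'d \<Rightarrow> real"
    and p :: "nat \<Rightarrow> real^'d \<Rightarrow> real^'d"
  assumes "CARD('d) \<in> {2, 3}"
    and "convex_polytopal_domain \<Omega>"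
    and "conforming_mesh \<Omega> T"
    and "shape_regular c\<^sub>1 T" and "quasi_uniform c\<^sub>2 T"
    and "fitted_boundary_part \<Omega> T \<Sigma>"
    and "transpose A = A" and "\<forall>x. x \<noteq> 0 \<longrightarrow> x \<bullet> (A *v x) > 0"
    and "f \<in> L2 \<Omega>" and "g \<in> H32 \<Omega> \<Sigma>" and "\<psi> \<in> L2_boundary_part \<Omega> T \<Sigma>"
    and "\<gamma> > 0" and "k \<ge> 1" and "k - 1 \<le> l" and "l = m" and "m \<le> k"
    and "z 0 = (\<lambda>x. 0)"
    and "\<forall>\<kappa>. iteration_step \<Omega> T \<Sigma> A \<mu> \<gamma> k l m f g \<psi>
               (z \<kappa>) (u (Suc \<kappa>)) (p (Suc \<kappa>)) (z (Suc \<kappa>))"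
  shows "\<exists>u\<^sub>h p\<^sub>h z\<^sub>h.
           limit_system \<Omega> T \<Sigma> A \<mu> \<gamma> k l m f g \<psi> u\<^sub>h p\<^sub>h z\<^sub>h \<and>
           (\<forall>u' p' z'. limit_system \<Omega> T \<Sigma> A \<mu> \<gamma> k l m f g \<psi> u' p' z' \<longrightarrow>
              ae_eq \<Omega> u' u\<^sub>h \<and> ae_eq \<Omega> p' p\<^sub>h \<and> ae_eq \<Omega> z' z\<^sub>h) \<and>
           (\<lambda>\<kappa>. l2_norm \<Omega> (\<lambda>x. u \<kappa> x - u\<^sub>h x)) \<longlonglongrightarrow> 0 \<and>
           (\<lambda>\<kappa>. l2_norm \<Omega> (\<lambda>x. p \<kappa> x - p\<^sub>h x)) \<longlonglongrightarrow> 0 \<and>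
           (\<lambda>\<kappa>. l2_norm \<Omega> (\<lambda>x. z \<kappa> x - z\<^sub>h x)) \<longlonglongrightarrow> 0"
proof -
  interpret mesh \<Omega> T using assms(2,3) by unfold_locales
  let ?X = "V0 \<Omega> T k \<Sigma> \<times> D0 \<Omega> T l \<Sigma>"
  obtain B where sp: "saddle_point (Lh \<Omega> T k \<times> RTh \<Omega> T l) ?X (Wh \<Omega> T l)
    (s_form \<Omega> A \<gamma> (mesh_size T) k) (\<lambda>x. b_form \<Omega> \<mu> (snd x) (fst x)) (l2_inner \<Omega>) pair_norm B"
    using fe_saddle_point[OF assms(6,12), of k l A k \<mu>] by (rule exE)
  have lm: "m = l" using assms(15) by simp
  have step: "u (Suc n) \<in> Vg \<Omega> T k \<Sigma> g" "p (Suc n) \<in> Dpsi \<Omega> T l \<Sigma> \<psi>" "z (Suc n) \<in> Wh \<Omega> T l"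
    "\<And>v q w. v \<in> V0 \<Omega> T k \<Sigma> \<Longrightarrow> q \<in> D0 \<Omega> T l \<Sigma> \<Longrightarrow> w \<in> Wh \<Omega> T l \<Longrightarrow>
      s_form \<Omega> A \<gamma> (mesh_size T) k (u (Suc n), p (Suc n)) (v, q) + b_form \<Omega> \<mu> q v (z (Suc n)) = 0 \<and>
      b_form \<Omega> \<mu> (p (Suc n)) (u (Suc n)) w - sstar_form \<Omega> (z (Suc n)) w = l2_inner \<Omega> f w - sstar_form \<Omega> (z n) w" for n
    using assms(18)[rule_format, of n] unfolding iteration_step_def lm by blast+
  \<comment> \<open>The shift drops \<open>u 0\<close> and \<open>p 0\<close>, which satisfy no
    equation, and produces the staggered indices of the abstract iteration.\<close>
  define x where "x n = (u (Suc n), p (Suc n))" for n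
  \<comment> \<open>Equal boundary data cancel with the coefficient -1.\<close>
  have diff: "(u' - u'', p' - p'') \<in> ?X"
    if "u' \<in> Vg \<Omega> T k \<Sigma> g" "u'' \<in> Vg \<Omega> T k \<Sigma> g" "p' \<in> Dpsi \<Omega> T l \<Sigma> \<psi>" "p'' \<in> Dpsi \<Omega> T l \<Sigma> \<psi>" for u' u'' p' p''
    using Vh_lincomb[OF that(1,2), of "\<lambda>F x. 0" "-1"] Dh_lincomb[OF that(3,4), of "\<lambda>F x. 0" "-1"] by simp
  have zW: "z n \<in> Wh \<Omega> T l" for n
    using step(3) subspace_0[OF subspace_Xh, of l] assms(17) by (cases n) (simp_all add: zero_fun_def)
  have 0: "0 \<in> V0 \<Omega> T k \<Sigma>" "0 \<in> D0 \<Omega> T l \<Sigma>" "0 \<in> Wh \<Omega> T l"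
    by (rule subspace_0[OF subspace_V0] subspace_0[OF subspace_D0] subspace_0[OF subspace_Xh])+
  have xX: "x n - x 0 \<in> ?X" for n unfolding x_def diff_Pair by (intro diff step)
  have xH: "x n \<in> Lh \<Omega> T k \<times> RTh \<Omega> T l" for n using step(1,2)[of n] by (simp add: x_def Vh_def Dh_def)
  obtain x' z' where x': "x' - x 0 \<in> ?X" and z': "z' \<in> Wh \<Omega> T l"
    and eq1: "\<forall>y\<in>?X. s_form \<Omega> A \<gamma> (mesh_size T) k x' y + b_form \<Omega> \<mu> (snd y) (fst y) z' = 0"
    and eq2: "\<forall>w\<in>Wh \<Omega> T l. b_form \<Omega> \<mu> (snd x') (fst x') w = l2_inner \<Omega> f w"
    and unique: "\<forall>x'' z''. x'' - x 0 \<in> ?X \<longrightarrow> z'' \<in> Wh \<Omega> T l \<longrightarrow>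
        (\<forall>y\<in>?X. s_form \<Omega> A \<gamma> (mesh_size T) k x'' y + b_form \<Omega> \<mu> (snd y) (fst y) z'' = 0) \<longrightarrow>
        (\<forall>w\<in>Wh \<Omega> T l. b_form \<Omega> \<mu> (snd x'') (fst x'') w = l2_inner \<Omega> f w) \<longrightarrow>
        pair_norm (x'' - x') = 0 \<and> l2_inner \<Omega> (z'' - z') (z'' - z') = 0"
    and limx: "(\<lambda>n. pair_norm (x n - x')) \<longlonglongrightarrow> 0"
    and limz: "(\<lambda>n. sqrt (l2_inner \<Omega> (z n - z') (z n - z'))) \<longlonglongrightarrow> 0"
  proof (rule saddle_point.iteration[where x = x and z = z and F = "l2_inner \<Omega> f", OF sp xH xX zW], goal_cases)
    case (1 n y)
    then show ?case using step(4)[OF _ _ 0(3), of "fst y" "snd y" n] by (auto simp: x_def)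
  next
    case (2 n w)
    then show ?case using step(4)[OF 0(1,2), of w n] by (simp add: x_def sstar_form_def)
  next
    case (3 x' z')
    note lim = 3
    show ?case
    proof (rule that[OF 3(2,3) _ _ _ 3(7,8)], goal_cases)
      case 1 show ?case by (intro ballI lim(4))
    next
      case 2 show ?case by (intro ballI lim(5))
    next
      case 3 show ?case by (intro allI impI lim(6)) blast+
    qed
  qed
  obtain u\<^sub>h p\<^sub>h where x'_eq: "x' = (u\<^sub>h, p\<^sub>h)" by (rule prod.exhaust)
  have sol: "u\<^sub>h \<in> Vg \<Omega> T k \<Sigma> g" "p\<^sub>h \<in> Dpsi \<Omega> T l \<Sigma> \<psi>"
  proof -
    have "u\<^sub>h - u 1 \<in> V0 \<Omega> T k \<Sigma>" "p\<^sub>h - p 1 \<in> D0 \<Omega> T l \<Sigma>" using x' by (simp_all add: x'_eq x_def)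
    then show "u\<^sub>h \<in> Vg \<Omega> T k \<Sigma> g" "p\<^sub>h \<in> Dpsi \<Omega> T l \<Sigma> \<psi>"
      using Vh_lincomb[OF step(1)[of 0], of "u\<^sub>h - u 1" "\<lambda>F x. 0" "nodal_interpolant k g" 1]
        Dh_lincomb[OF step(2)[of 0], of "p\<^sub>h - p 1" "\<lambda>F x. 0" "L2_projection l \<psi>" 1] by simp_all
  qed
  have lim: "limit_system \<Omega> T \<Sigma> A \<mu> \<gamma> k l m f g \<psi> u\<^sub>h p\<^sub>h z'"
    unfolding limit_system_def lm
  proof (intro conjI ballI sol z')
    fix v q w assume *: "v \<in> V0 \<Omega> T k \<Sigma>" "q \<in> D0 \<Omega> T l \<Sigma>" "w \<in> Wh \<Omega> T l"
    show "s_form \<Omega> A \<gamma> (mesh_size T) k (u\<^sub>h, p\<^sub>h) (v, q) + b_form \<Omega> \<mu> q v z' = 0"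
      using bspec[OF eq1, of "(v, q)"] * by (simp add: x'_eq)
    show "b_form \<Omega> \<mu> p\<^sub>h u\<^sub>h w = l2_inner \<Omega> f w" using bspec[OF eq2 *(3)] by (simp add: x'_eq)
  qed
  have uniq: "ae_eq \<Omega> u' u\<^sub>h \<and> ae_eq \<Omega> p' p\<^sub>h \<and> ae_eq \<Omega> z'' z'"
    if "limit_system \<Omega> T \<Sigma> A \<mu> \<gamma> k l m f g \<psi> u' p' z''" for u' p' z''
  proof -
    have L: "u' \<in> Vg \<Omega> T k \<Sigma> g" "p' \<in> Dpsi \<Omega> T l \<Sigma> \<psi>" "z'' \<in> Wh \<Omega> T l"
      "\<And>v q w. v \<in> V0 \<Omega> T k \<Sigma> \<Longrightarrow> q \<in> D0 \<Omega> T l \<Sigma> \<Longrightarrow> w \<in> Wh \<Omega> T l \<Longrightarrow>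
        s_form \<Omega> A \<gamma> (mesh_size T) k (u', p') (v, q) + b_form \<Omega> \<mu> q v z'' = 0 \<and> b_form \<Omega> \<mu> p' u' w = l2_inner \<Omega> f w"
      using that unfolding limit_system_def lm by blast+
    have "pair_norm ((u', p') - x') = 0 \<and> l2_inner \<Omega> (z'' - z') (z'' - z') = 0"
    proof (rule unique[rule_format])
      show "(u', p') - x 0 \<in> ?X" unfolding x_def diff_Pair by (intro diff step L)
      show "z'' \<in> Wh \<Omega> T l" by (rule L)
      show "s_form \<Omega> A \<gamma> (mesh_size T) k (u', p') y + b_form \<Omega> \<mu> (snd y) (fst y) z'' = 0" if "y \<in> ?X" for y
        using L(4)[OF _ _ 0(3), of "fst y" "snd y"] that by auto
      show "b_form \<Omega> \<mu> (snd (u', p')) (fst (u', p')) w = l2_inner \<Omega> f w" if "w \<in> Wh \<Omega> T l" for w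
        using L(4)[OF 0(1,2) that] by simp
    qed
    moreover have "(u', p') - x' \<in> Lh \<Omega> T k \<times> RTh \<Omega> T l"
      using subsetD[OF V0_D0_subset diff[OF L(1) sol(1) L(2) sol(2)]] by (simp add: x'_eq)
    moreover have "z'' - z' \<in> L2 \<Omega>"
      using subspace_diff[OF subspace_Xh L(3) z'] by (simp add: Xh_def)
    ultimately show ?thesis
      using pair_norm_eq_0[of "(u', p') - x'"] l2_inner_self_eq_0[of "z'' - z'" \<Omega>] by (simp add: x'_eq ae_eq_diff_0)
  qed
  have pn: "pair_norm (x n - x') = l2_norm \<Omega> (u (Suc n) - u\<^sub>h) + l2_norm \<Omega> (p (Suc n) - p\<^sub>h)" for n
    by (simp add: pair_norm_def x_def x'_eq)
  have "(\<lambda>n. l2_norm \<Omega> (u (Suc n) - u\<^sub>h)) \<longlonglongrightarrow> 0" "(\<lambda>n. l2_norm \<Omega> (p (Suc n) - p\<^sub>h)) \<longlonglongrightarrow> 0"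
    by (rule LIMSEQ_squeeze0[OF limx]; simp add: pn l2_norm_nonneg)+
  \<comment> \<open>The first members, arbitrary for \<open>u\<close> and \<open>p\<close>, do not
    affect the limits.\<close>
  then have "(\<lambda>n. l2_norm \<Omega> (u n - u\<^sub>h)) \<longlonglongrightarrow> 0" "(\<lambda>n. l2_norm \<Omega> (p n - p\<^sub>h)) \<longlonglongrightarrow> 0"
    by (auto dest: LIMSEQ_imp_Suc)
  moreover have "(\<lambda>n. l2_norm \<Omega> (z n - z')) \<longlonglongrightarrow> 0"
    using limz by (simp add: l2_norm_def)
  ultimately show ?thesis using lim uniq unfolding fun_diff_def by blast
qed

end
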